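(* Let $\tilde\epsilon_n = 1+8/\epsilon_n$ and $\varpi_n = \dfrac{q}{\sqrt{\log n}} + \dfrac{pq}{n\epsilon_n} + e^{9\rho_n}\left(1+\dfrac{8}{\epsilon_n}\right)^2$. Suppose $\boldsymbol\theta\in B(\boldsymbol\theta^*,\epsilon_{n1})$ and $\boldsymbol\gamma\in B(\boldsymbol\gamma^*,\epsilon_{n2})$ (so that $|Z_{ij}^T\boldsymbol\gamma+\alpha_i+\beta_j|\le\rho_n$ for all $i\neq j$), and assume $$\tilde\epsilon_n e^{6\rho_n} = o\left(\sqrt{\frac{n}{\log n}}\right),\qquad \varpi_n\lambda_n^2 e^{9\rho_n} = o\left(\frac{n}{\log n}\right),\qquad \tilde\epsilon_n^2e^{9\rho_n}+\varpi_n^2\lambda_n^2\,q\,e^{3\rho_n}\log n=o\left(\frac{n^{1/2}}{\log n}\right).$$ (i) If $e^{\rho_n}\sqrt{\log n}/\epsilon_n=o(1)$, then for any fixed $k\ge1$, as $n\to\infty$, the vector consisting of the first $k$ elements of $\widehat{\boldsymbol\theta}-\boldsymbol\theta^*$ is asymptotically multivariate normal with mean $0$ and covariance matrix given by the upper left $k\times k$ block of $S^*$. (ii) Let $$s_n^2=\mathrm{Var}\left(\sum_{i=1}^n e_i^+-\sum_{i=1}^{n-1}e_i^-\right)=2(2n-1)\frac{e^{-\epsilon_n/2}}{(1-e^{-\epsilon_n/2})^2}.$$ If $s_n/v_{2n,2n}^{1/2}\to c$ for some constant $c$, then for any fixed $k\ge1$, as $n\to\infty$, the vector consisting of the first $k$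 elements of $\widehat{\boldsymbol\theta}-\boldsymbol\theta^*$ is asymptotically $k$-dimensional multivariate normal with mean $0$ and covariance matrix $$\mathrm{diag}\left(\frac1{v_{1,1}},\dots,\frac1{v_{k,k}}\right)+\left(\frac1{v_{2n,2n}}+\frac{s_n^2}{v_{2n,2n}^2}\right)\mathrm I_k\mathrm I_k^T,$$ where $\mathrm I_k$ is the $k$-dimensional column vector with all elements equal to $1$.
   Context: Model. For each $n\ge2$, $A=(a_{ij})_{n\times n}$ is the adjacency matrix of a random directed graph on nodes $1,\dots,n$ without self-loops ($a_{ii}=0$, $a_{ij}\in\{0,1\}$). The edges $a_{ij}$, $i\ne j$, are mutually independent Bernoulli variables with $$P(a_{ij}=1)=\mu(Z_{ij}^T\boldsymbol\gamma^*+\alpha_i^*+\beta_j^* ),\qquad \mu(x)=\frac{e^x}{1+e^x},$$ where $Z_{ij}\in\mathbb R^p$ are given covariate vectors ($p$ fixed), $\boldsymbol\gamma\in\mathbb R^p$, and $\boldsymbol\theta=(\alpha_1,\dots,\alpha_n,\beta_1,\dots,\beta_{n-1})^T$, with the identification convention $\beta_n=0$. True values are denoted by a star. Put $q=\max_{i,j}\|Z_{ij}\|_\infty$, assumed to be a constant. Private statistics. Let $d_i=\sum_{j\ne i}a_{ij}$, $b_j=\sum_{i\ne j}a_{ij}$. For a privacy parameter $\epsilon_n>0$ the released statistics are $\widetilde d_i=d_i+e_i^+$, $\widetilde b_j=b_j+e_j^-$ ($i,j=1,\dots,n$), and $\widetilde{\mathbf y}=\sum_{i\ne j}Z_{ij}a_{ij}+(\eta_1,\dots,\eta_p)^T$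 (sum over all ordered pairs $i\neq j$). All noise variables are independent of each other and of $A$; the $e_i^+,e_j^-$ are discrete Laplace: $P(X=x)=\frac{1-\alpha}{1+\alpha}\alpha^{|x|}$, $x\in\mathbb Z$, with $\alpha=e^{-\epsilon_n/2}$; the $\eta_t$ are continuous Laplace with density $\frac1{2\alpha}e^{-|x|/\alpha}$, $\alpha=pq/\epsilon_n$. Estimators. $(\widehat{\boldsymbol\theta},\widehat{\boldsymbol\gamma})$ (with $\hat\beta_n=0$) is the solution, when it exists, of $$\widetilde d_i=\sum_{j\ne i}\mu(Z_{ij}^T\boldsymbol\gamma+\alpha_i+\beta_j)\ (1\le i\le n),\quad \widetilde b_j=\sum_{i\ne j}\mu(Z_{ij}^T\boldsymbol\gamma+\alpha_i+\beta_j)\ (1\le j\le n-1),\quad \widetilde{\mathbf y}=\sum_{i\neq j}Z_{ij}\,\mu(Z_{ij}^T\boldsymbol\gamma+\alpha_i+\beta_j).$$ Notation. $\|\mathbf x\|_\infty=\max_i|x_i|$; for matrices $\|J\|_\infty=\max_i\sum_j|J_{ij}|$; $B(\mathbf x,\epsilon)=\{\mathbf y:\|\mathbf x-\mathbf y\|_\infty\le\epsilon\}$. $\epsilon_{n1},\epsilon_{n2}$ are small positive numbers and $$\rho_n=\max_{i\ne j}|\alpha_i^*+\beta_j^*|+2\epsilon_{n1}+pq\|\boldsymbol\gamma^*\|_\infty+pq\,\epsilon_{n2}.$$ Let $F=(F_1,\dots,F_{2n-1})^T$ with $F_i(\boldsymbol\theta,\boldsymbol\gamma)=\widetilde d_i-\sum_{j\ne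 i}\mu(Z_{ij}^T\boldsymbol\gamma+\alpha_i+\beta_j)$ for $i\le n$, $F_{n+j}(\boldsymbol\theta,\boldsymbol\gamma)=\widetilde b_j-\sum_{i\ne j}\mu(Z_{ij}^T\boldsymbol\gamma+\alpha_i+\beta_j)$ for $j\le n-1$, and $Q(\boldsymbol\theta,\boldsymbol\gamma)=\widetilde{\mathbf y}-\sum_{i\ne j}Z_{ij}\mu(Z_{ij}^T\boldsymbol\gamma+\alpha_i+\beta_j)$. Define $$H(\boldsymbol\theta,\boldsymbol\gamma)=-\left(\frac{\partial Q}{\partial\boldsymbol\gamma^T}-\frac{\partial Q}{\partial\boldsymbol\theta^T}\left[\frac{\partial F}{\partial\boldsymbol\theta^T}\right]^{-1}\frac{\partial F}{\partial\boldsymbol\gamma^T}\right)(\boldsymbol\theta,\boldsymbol\gamma).$$ Standing assumptions: $H(\boldsymbol\theta,\boldsymbol\gamma)$ is positive definite, and $\lambda_n$ is a number such that $\sup_{\boldsymbol\theta\in B(\boldsymbol\theta^*,\epsilon_{n1})}\|H^{-1}(\boldsymbol\theta,\boldsymbol\gamma^* )\|_\infty\le\lambda_n/n^2$. All quantities may depend on $n$ unless said to be fixed. The matrices $V$ and $S^*$. $V=(v_{i,j})$ is the symmetric $(2n-1)\times(2n-1)$ matrix $V=-\partial F/\partial\boldsymbol\theta^T$ evaluated at $(\boldsymbol\theta^*,\boldsymbol\gamma^* )$. Explicitly, with $\mu'(x)=e^x/(1+e^x)^2$ and $\pi_{ij}^*=Z_{ij}^T\boldsymbol\gamma^*+\alpha_i^*+\beta_j^*$: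 $v_{i,i}=\sum_{j\ne i}\mu'(\pi^*_{ij})$ for $i\le n$; $v_{n+j,n+j}=\sum_{i\ne j}\mu'(\pi^*_{ij})$ for $j\le n-1$; $v_{i,n+j}=v_{n+j,i}=\mu'(\pi^*_{ij})$ for $i\le n$, $j\le n-1$, $i\ne j$; all other entries are $0$. Further $v_{2n,i}=v_{i,2n}:=v_{i,i}-\sum_{j=1,j\ne i}^{2n-1}v_{i,j}$ and $v_{2n,2n}:=\sum_{i=1}^{2n-1}v_{2n,i}$. The matrix $S^*=(s_{i,j})$ is given by $s_{i,j}=\frac{\delta_{i,j}}{v_{i,i}}+\frac1{v_{2n,2n}}$ if $i,j\le n$ or if $i,j\ge n+1$, and $s_{i,j}=-\frac1{v_{2n,2n}}$ otherwise ($1\le i,j\le 2n-1$), where $\delta_{i,j}$ is the Kronecker delta. *)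

theory Defs
  imports "HOL-Probability.Probability" "HOL-Library.Landau_Symbols"
begin

text \<open>
  Nodes are \<open>1, \<dots>, n\<close>.  A parameter vector of length \<open>2 n - 1\<close> is a function \<open>\<theta> :: nat \<Rightarrow> real\<close> of which
  only the values on \<open>{1..2 * n - 1}\<close> matter: \<open>\<alpha>\<^sub>i = \<theta> i\<close> and \<open>\<beta>\<^sub>j = \<theta> (n + j)\<close> for \<open>j < n\<close>.
  Likewise, matrices whose size depends on \<open>n\<close> are functions \<open>nat \<Rightarrow> nat \<Rightarrow> real\<close> restricted to
  \<open>{1..2 * n - 1}\<close>.  Dimensions that do not change with \<open>n\<close> are finite index types.
\<close>

definition logistic :: "real \<Rightarrow> real" where
  "logistic x = exp x / (1 + exp x)"

definition logistic' :: "real \<Rightarrow> real" where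
  "logistic' x = exp x / (1 + exp x)\<^sup>2"

definition beta_par :: "nat \<Rightarrow> (nat \<Rightarrow> real) \<Rightarrow> nat \<Rightarrow> real" where
  "beta_par n \<theta> j = (if j = n then 0 else \<theta> (n + j))"

definition lin_pred ::
    "nat \<Rightarrow> (nat \<Rightarrow> nat \<Rightarrow> real^'p) \<Rightarrow> (nat \<Rightarrow> real) \<Rightarrow> real^'p \<Rightarrow> nat \<Rightarrow> nat \<Rightarrow> real" where
  "lin_pred n Z \<theta> \<gamma> i j = Z i j \<bullet> \<gamma> + \<theta> i + beta_par n \<theta> j"

text \<open>The arguments \<open>d\<close>, \<open>b\<close>, \<open>y\<close> are the (released) out-degrees, in-degrees and covariate statistic.\<close>

definition F_fun :: "nat \<Rightarrow> (nat \<Rightarrow> nat \<Rightarrow> real^'p) \<Rightarrow> (nat \<Rightarrow> real) \<Rightarrow> (nat \<Rightarrow> real)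
    \<Rightarrow> (nat \<Rightarrow> real) \<Rightarrow> real^'p \<Rightarrow> nat \<Rightarrow> real" where
  "F_fun n Z d b \<theta> \<gamma> a =
     (if a \<le> n then d a - (\<Sum>j\<in>{1..n} - {a}. logistic (lin_pred n Z \<theta> \<gamma> a j))
      else b (a - n) - (\<Sum>i\<in>{1..n} - {a - n}. logistic (lin_pred n Z \<theta> \<gamma> i (a - n))))"

definition Q_fun :: "nat \<Rightarrow> (nat \<Rightarrow> nat \<Rightarrow> real^'p) \<Rightarrow> real^'p
    \<Rightarrow> (nat \<Rightarrow> real) \<Rightarrow> real^'p \<Rightarrow> real^'p" where
  "Q_fun n Z y \<theta> \<gamma> =
     y - (\<Sum>i=1..n. \<Sum>j\<in>{1..n} - {i}. logistic (lin_pred n Z \<theta> \<gamma> i j) *\<^sub>R Z i j)"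

definition is_solution :: "nat \<Rightarrow> (nat \<Rightarrow> nat \<Rightarrow> real^'p) \<Rightarrow> (nat \<Rightarrow> real) \<Rightarrow> (nat \<Rightarrow> real)
    \<Rightarrow> real^'p \<Rightarrow> (nat \<Rightarrow> real) \<Rightarrow> real^'p \<Rightarrow> bool" where
  "is_solution n Z d b y \<theta> \<gamma> \<longleftrightarrow>
     (\<forall>a\<in>{1..2 * n - 1}. F_fun n Z d b \<theta> \<gamma> a = 0) \<and> Q_fun n Z y \<theta> \<gamma> = 0"

definition partial_theta :: "((nat \<Rightarrow> real) \<Rightarrow> real) \<Rightarrow> (nat \<Rightarrow> real) \<Rightarrow> nat \<Rightarrow> real" where
  "partial_theta f \<theta> c = deriv (\<lambda>x. f (\<theta>(c := x))) (\<theta> c)"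

definition partial_gamma :: "(real^'p \<Rightarrow> real) \<Rightarrow> real^'p \<Rightarrow> 'p \<Rightarrow> real" where
  "partial_gamma f \<gamma> t = deriv (\<lambda>x. f (\<gamma> + x *\<^sub>R axis t 1)) 0"

text \<open>The inverse of an \<open>m \<times> m\<close> matrix indexed by \<open>{1..m}\<close>; compare \<^const>\<open>matrix_inv\<close>.\<close>

definition fmat_inv :: "nat \<Rightarrow> (nat \<Rightarrow> nat \<Rightarrow> real) \<Rightarrow> nat \<Rightarrow> nat \<Rightarrow> real" where
  "fmat_inv m A = (SOME B. \<forall>i\<in>{1..m}. \<forall>j\<in>{1..m}.
      (\<Sum>l=1..m. A i l * B l j) = (if i = j then 1 else 0) \<and>
      (\<Sum>l=1..m. B i l * A l j) = (if i = j then 1 else 0))"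

definition H_mat :: "nat \<Rightarrow> (nat \<Rightarrow> nat \<Rightarrow> real^'p) \<Rightarrow> (nat \<Rightarrow> real) \<Rightarrow> (nat \<Rightarrow> real) \<Rightarrow> real^'p
    \<Rightarrow> (nat \<Rightarrow> real) \<Rightarrow> real^'p \<Rightarrow> real^'p^'p" where
  "H_mat n Z d b y \<theta> \<gamma> =
     (let F_inv = fmat_inv (2 * n - 1) (\<lambda>a c. partial_theta (\<lambda>u. F_fun n Z d b u \<gamma> a) \<theta> c)
      in \<chi> s t. - (partial_gamma (\<lambda>g. Q_fun n Z y \<theta> g $ s) \<gamma> t
           - (\<Sum>a=1..2 * n - 1. \<Sum>c=1..2 * n - 1.
                partial_theta (\<lambda>u. Q_fun n Z y u \<gamma> $ s) \<theta> a * F_inv a c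
                * partial_gamma (\<lambda>g. F_fun n Z d b \<theta> g c) \<gamma> t)))"

definition pos_def :: "real^'k^'k \<Rightarrow> bool" where
  "pos_def A \<longleftrightarrow> transpose A = A \<and> (\<forall>x. x \<noteq> 0 \<longrightarrow> x \<bullet> (A *v x) > 0)"

definition mat_norm_inf :: "real^'k^'m \<Rightarrow> real" where
  "mat_norm_inf A = Max (range (\<lambda>i. \<Sum>j\<in>UNIV. \<bar>A $ i $ j\<bar>))"

definition theta_ball :: "nat \<Rightarrow> (nat \<Rightarrow> real) \<Rightarrow> real \<Rightarrow> (nat \<Rightarrow> real) set" where
  "theta_ball n \<theta> r = {\<theta>'. \<forall>i\<in>{1..2 * n - 1}. \<bar>\<theta> i - \<theta>' i\<bar> \<le> r}"

definition V_mat ::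
    "nat \<Rightarrow> (nat \<Rightarrow> nat \<Rightarrow> real^'p) \<Rightarrow> (nat \<Rightarrow> real) \<Rightarrow> real^'p \<Rightarrow> nat \<Rightarrow> nat \<Rightarrow> real" where
  "V_mat n Z \<theta> \<gamma> i j =
     (if i = j then
        if i \<le> n then \<Sum>l\<in>{1..n} - {i}. logistic' (lin_pred n Z \<theta> \<gamma> i l)
        else \<Sum>l\<in>{1..n} - {i - n}. logistic' (lin_pred n Z \<theta> \<gamma> l (i - n))
      else if i \<le> n \<and> n < j \<and> i \<noteq> j - n then logistic' (lin_pred n Z \<theta> \<gamma> i (j - n))
      else if n < i \<and> j \<le> n \<and> j \<noteq> i - n then logistic' (lin_pred n Z \<theta> \<gamma> j (i - n))
      else 0)"

text \<open>\<open>V_border\<close> gives the entries \<open>(2 n, i)\<close> of the extended matrix, \<open>V_corner\<close> the entry \<open>(2 n, 2 n)\<close>.\<close>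

definition V_border ::
    "nat \<Rightarrow> (nat \<Rightarrow> nat \<Rightarrow> real^'p) \<Rightarrow> (nat \<Rightarrow> real) \<Rightarrow> real^'p \<Rightarrow> nat \<Rightarrow> real" where
  "V_border n Z \<theta> \<gamma> i =
     V_mat n Z \<theta> \<gamma> i i - (\<Sum>j\<in>{1..2 * n - 1} - {i}. V_mat n Z \<theta> \<gamma> i j)"

definition V_corner ::
    "nat \<Rightarrow> (nat \<Rightarrow> nat \<Rightarrow> real^'p) \<Rightarrow> (nat \<Rightarrow> real) \<Rightarrow> real^'p \<Rightarrow> real" where
  "V_corner n Z \<theta> \<gamma> = (\<Sum>i=1..2 * n - 1. V_border n Z \<theta> \<gamma> i)"

definition S_mat ::
    "nat \<Rightarrow> (nat \<Rightarrow> nat \<Rightarrow> real^'p) \<Rightarrow> (nat \<Rightarrow> real) \<Rightarrow> real^'p \<Rightarrow> nat \<Rightarrow> nat \<Rightarrow> real" where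
  "S_mat n Z \<theta> \<gamma> i j =
     (if (i \<le> n \<and> j \<le> n) \<or> (n + 1 \<le> i \<and> n + 1 \<le> j)
      then (if i = j then 1 / V_mat n Z \<theta> \<gamma> i i else 0) + 1 / V_corner n Z \<theta> \<gamma>
      else - 1 / V_corner n Z \<theta> \<gamma>)"

definition laplace_density :: "real \<Rightarrow> real \<Rightarrow> real" where
  "laplace_density s x = exp (- \<bar>x\<bar> / s) / (2 * s)"

definition discrete_laplace_prob :: "real \<Rightarrow> int \<Rightarrow> real" where
  "discrete_laplace_prob s x = (1 - s) / (1 + s) * s ^ nat \<bar>x\<bar>"

datatype 'p source = Edge nat nat | OutNoise nat | InNoise nat | CovNoise 'p

definition sources :: "nat \<Rightarrow> 'p source set" where
  "sources n = {Edge i j | i j. i \<in> {1..n} \<and> j \<in> {1..n} \<and> i \<noteq> j}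
     \<union> OutNoise ` {1..n} \<union> InNoise ` {1..n} \<union> range CovNoise"

fun source_var :: "(nat \<Rightarrow> nat \<Rightarrow> 'w \<Rightarrow> real) \<Rightarrow> (nat \<Rightarrow> 'w \<Rightarrow> int) \<Rightarrow> (nat \<Rightarrow> 'w \<Rightarrow> int)
    \<Rightarrow> ('p \<Rightarrow> 'w \<Rightarrow> real) \<Rightarrow> 'p source \<Rightarrow> 'w \<Rightarrow> real" where
  "source_var A ep em \<eta> (Edge i j) \<omega> = A i j \<omega>"
| "source_var A ep em \<eta> (OutNoise i) \<omega> = real_of_int (ep i \<omega>)"
| "source_var A ep em \<eta> (InNoise j) \<omega> = real_of_int (em j \<omega>)"
| "source_var A ep em \<eta> (CovNoise t) \<omega> = \<eta> t \<omega>"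

text \<open>
  \<open>\<theta>\<close>, \<open>\<gamma>\<close> are the true parameters and \<open>eps\<close> is the privacy parameter.  The law imposed on \<open>\<eta>\<close>
  is a probability measure only for a positive scale, so the assumptions entail \<open>q > 0\<close>.
\<close>

locale private_network = prob_space M
  for M :: "'w measure" and n :: nat
    and Z :: "nat \<Rightarrow> nat \<Rightarrow> real^'p" and q :: real
    and \<theta> :: "nat \<Rightarrow> real" and \<gamma> :: "real^'p" and eps :: real
    and A :: "nat \<Rightarrow> nat \<Rightarrow> 'w \<Rightarrow> real"
    and ep em :: "nat \<Rightarrow> 'w \<Rightarrow> int" and \<eta> :: "'p \<Rightarrow> 'w \<Rightarrow> real" +
  assumes q_eq: "q = Max {infnorm (Z i j) | i j. i \<in> {1..n} \<and> j \<in> {1..n} \<and> i \<noteq> j}"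
    and eps_pos: "eps > 0"
    and no_loops: "\<And>i \<omega>. i \<in> {1..n} \<Longrightarrow> \<omega> \<in> space M \<Longrightarrow> A i i \<omega> = 0"
    and edge_01: "\<And>i j \<omega>. i \<in> {1..n} \<Longrightarrow> j \<in> {1..n} \<Longrightarrow> \<omega> \<in> space M \<Longrightarrow> A i j \<omega> \<in> {0, 1}"
    and edge_prob: "\<And>i j. i \<in> {1..n} \<Longrightarrow> j \<in> {1..n} \<Longrightarrow> i \<noteq> j \<Longrightarrow>
        prob {\<omega> \<in> space M. A i j \<omega> = 1} = logistic (lin_pred n Z \<theta> \<gamma> i j)"
    and out_noise: "\<And>i x. i \<in> {1..n} \<Longrightarrow>
        prob {\<omega> \<in> space M. ep i \<omega> = x} = discrete_laplace_prob (exp (- eps / 2)) x"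
    and in_noise: "\<And>j x. j \<in> {1..n} \<Longrightarrow>
        prob {\<omega> \<in> space M. em j \<omega> = x} = discrete_laplace_prob (exp (- eps / 2)) x"
    and cov_noise: "\<And>t. distributed M lborel (\<eta> t)
        (\<lambda>x. ennreal (laplace_density (real CARD('p) * q / eps) x))"
    and indep: "indep_vars (\<lambda>_. borel) (source_var A ep em \<eta>) (sources n)"

definition priv_out :: "nat \<Rightarrow> (nat \<Rightarrow> nat \<Rightarrow> 'w \<Rightarrow> real) \<Rightarrow> (nat \<Rightarrow> 'w \<Rightarrow> int)
    \<Rightarrow> 'w \<Rightarrow> nat \<Rightarrow> real" where
  "priv_out n A ep \<omega> i = (\<Sum>j\<in>{1..n} - {i}. A i j \<omega>) + real_of_int (ep i \<omega>)"

definition priv_in :: "nat \<Rightarrow> (nat \<Rightarrow> nat \<Rightarrow> 'w \<Rightarrow> real) \<Rightarrow> (nat \<Rightarrow> 'w \<Rightarrow> int)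
    \<Rightarrow> 'w \<Rightarrow> nat \<Rightarrow> real" where
  "priv_in n A em \<omega> j = (\<Sum>i\<in>{1..n} - {j}. A i j \<omega>) + real_of_int (em j \<omega>)"

definition priv_cov :: "nat \<Rightarrow> (nat \<Rightarrow> nat \<Rightarrow> real^'p) \<Rightarrow> (nat \<Rightarrow> nat \<Rightarrow> 'w \<Rightarrow> real)
    \<Rightarrow> ('p \<Rightarrow> 'w \<Rightarrow> real) \<Rightarrow> 'w \<Rightarrow> real^'p" where
  "priv_cov n Z A \<eta> \<omega> =
     (\<Sum>i=1..n. \<Sum>j\<in>{1..n} - {i}. A i j \<omega> *\<^sub>R Z i j) + (\<chi> t. \<eta> t \<omega>)"

text \<open>The estimator is unconstrained (apart from measurability) where no solution exists.\<close>

definition is_estimator :: "'w measure \<Rightarrow> nat \<Rightarrow> (nat \<Rightarrow> nat \<Rightarrow> real^'p)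
    \<Rightarrow> ('w \<Rightarrow> nat \<Rightarrow> real) \<Rightarrow> ('w \<Rightarrow> nat \<Rightarrow> real) \<Rightarrow> ('w \<Rightarrow> real^'p)
    \<Rightarrow> ('w \<Rightarrow> nat \<Rightarrow> real) \<Rightarrow> ('w \<Rightarrow> real^'p) \<Rightarrow> bool" where
  "is_estimator M n Z d b y \<theta>h \<gamma>h \<longleftrightarrow>
     (\<forall>i\<in>{1..2 * n - 1}. (\<lambda>\<omega>. \<theta>h \<omega> i) \<in> borel_measurable M) \<and>
     \<gamma>h \<in> borel_measurable M \<and>
     (\<forall>\<omega>\<in>space M. (\<exists>\<theta> \<gamma>. is_solution n Z (d \<omega>) (b \<omega>) (y \<omega>) \<theta> \<gamma>) \<longrightarrow>
        is_solution n Z (d \<omega>) (b \<omega>) (y \<omega>) (\<theta>h \<omega>) (\<gamma>h \<omega>))"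

definition rho :: "nat \<Rightarrow> (nat \<Rightarrow> real) \<Rightarrow> real^'p \<Rightarrow> real \<Rightarrow> real \<Rightarrow> real \<Rightarrow> real" where
  "rho n \<theta> \<gamma> q r1 r2 =
     Max {\<bar>\<theta> i + beta_par n \<theta> j\<bar> | i j. i \<in> {1..n} \<and> j \<in> {1..n} \<and> i \<noteq> j} + 2 * r1
     + real CARD('p) * q * infnorm \<gamma> + real CARD('p) * q * r2"

definition eps_tilde :: "real \<Rightarrow> real" where
  "eps_tilde eps = 1 + 8 / eps"

definition varpi :: "nat \<Rightarrow> nat \<Rightarrow> real \<Rightarrow> real \<Rightarrow> real \<Rightarrow> real" where
  "varpi n p q eps \<rho> =
     q / sqrt (ln (real n)) + real p * q / (real n * eps) + exp (9 * \<rho>) * (1 + 8 / eps)\<^sup>2"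

definition noise_sd :: "'w measure \<Rightarrow> nat \<Rightarrow> (nat \<Rightarrow> 'w \<Rightarrow> int) \<Rightarrow> (nat \<Rightarrow> 'w \<Rightarrow> int) \<Rightarrow> real" where
  "noise_sd M n ep em = sqrt (prob_space.variance M
     (\<lambda>\<omega>. (\<Sum>i=1..n. real_of_int (ep i \<omega>)) - (\<Sum>i=1..n - 1. real_of_int (em i \<omega>))))"

definition std_mvn :: "(real^'k) measure" where
  "std_mvn = density lborel (\<lambda>x. ennreal (\<Prod>i\<in>UNIV. std_normal_density (x $ i)))"

definition conv_in_distr ::
    "(nat \<Rightarrow> 'w measure) \<Rightarrow> (nat \<Rightarrow> 'w \<Rightarrow> real^'k) \<Rightarrow> (real^'k) measure \<Rightarrow> bool" where
  "conv_in_distr M X N \<longleftrightarrow>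
     (\<forall>\<^sub>F n in sequentially. X n \<in> borel_measurable (M n)) \<and>
     (\<forall>f :: real^'k \<Rightarrow> real. continuous_on UNIV f \<and> bounded (range f) \<longrightarrow>
        (\<lambda>n. \<integral>\<omega>. f (X n \<omega>) \<partial>M n) \<longlonglongrightarrow> (\<integral>x. f x \<partial>N))"

text \<open>
  With a covariance matrix \<open>\<Sigma> n\<close> that varies with \<open>n\<close>, asymptotic normality means that
  the standardised vector \<open>\<Sigma>\<^sub>n\<^sup>-\<^sup>1\<^sup>/\<^sup>2 (X\<^sub>n - m\<^sub>n)\<close> converges in distribution to \<open>N(0, I)\<close>;
  \<open>R n\<close> is the (unique) positive definite square root of \<open>\<Sigma> n\<close>.
\<close>

definition asymp_normal :: "(nat \<Rightarrow> 'w measure) \<Rightarrow> (nat \<Rightarrow> 'w \<Rightarrow> real^'k)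
    \<Rightarrow> (nat \<Rightarrow> real^'k) \<Rightarrow> (nat \<Rightarrow> real^'k^'k) \<Rightarrow> bool" where
  "asymp_normal M X m \<Sigma> \<longleftrightarrow>
     (\<exists>R. (\<forall>\<^sub>F n in sequentially. pos_def (R n) \<and> R n ** R n = \<Sigma> n) \<and>
          conv_in_distr M (\<lambda>n \<omega>. matrix_inv (R n) *v (X n \<omega> - m n)) std_mvn)"

lemma logistic_deriv: "(logistic has_real_derivative logistic' x) (at x)"
proof -
  have "1 + exp x > 0" by (simp add: add_pos_pos)
  then show ?thesis
    unfolding logistic_def [abs_def] logistic'_def
    by (auto intro!: derivative_eq_intros simp: power2_eq_square field_simps)
qed

text \<open>\<^const>\<open>rho\<close> bounds the linear predictors on the two balls around the true parameters.\<close>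

lemma abs_lin_pred_le_rho:
  fixes Z :: "nat \<Rightarrow> nat \<Rightarrow> real^'p"
  assumes q: "q = Max {infnorm (Z i j) | i j. i \<in> {1..n} \<and> j \<in> {1..n} \<and> i \<noteq> j}"
    and th: "\<theta>' \<in> theta_ball n \<theta> r1" and ga: "infnorm (\<gamma> - \<gamma>') \<le> r2"
    and ij: "i \<in> {1..n}" "j \<in> {1..n}" "i \<noteq> j"
  shows "\<bar>lin_pred n Z \<theta>' \<gamma>' i j\<bar> \<le> rho n \<theta> \<gamma> q r1 r2"
proof -
  have fin: "finite {f i j | i j. i \<in> {1..n} \<and> j \<in> {1..n} \<and> i \<noteq> j}" for f :: "nat \<Rightarrow> nat \<Rightarrow> real"
    by (rule finite_subset[of _ "(\<lambda>(i, j). f i j) ` ({1..n} \<times> {1..n})"]) auto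
  have Zq: "infnorm (Z i j) \<le> q"
    unfolding q by (rule Max_ge[OF fin]) (use ij in blast)
  have mx: "\<bar>\<theta> i + beta_par n \<theta> j\<bar>
      \<le> Max {\<bar>\<theta> i + beta_par n \<theta> j\<bar> | i j. i \<in> {1..n} \<and> j \<in> {1..n} \<and> i \<noteq> j}"
    by (rule Max_ge[OF fin]) (use ij in blast)
  have r1: "\<bar>\<theta> i - \<theta>' i\<bar> \<le> r1"
    using th ij unfolding theta_ball_def by auto
  then have "0 \<le> r1" by linarith
  have "\<bar>beta_par n \<theta> j - beta_par n \<theta>' j\<bar> \<le> r1"
  proof (cases "j = n")
    case False
    then have "n + j \<in> {1..2 * n - 1}" using ij by auto
    then have "\<bar>\<theta> (n + j) - \<theta>' (n + j)\<bar> \<le> r1" using th unfolding theta_ball_def by auto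
    then show ?thesis using False by (simp add: beta_par_def)
  qed (simp add: beta_par_def \<open>0 \<le> r1\<close>)
  then have ab: "\<bar>\<theta>' i + beta_par n \<theta>' j\<bar> \<le> \<bar>\<theta> i + beta_par n \<theta> j\<bar> + 2 * r1"
    using r1 by linarith
  have "infnorm \<gamma>' \<le> infnorm \<gamma> + r2"
    using ga infnorm_triangle[of \<gamma> "\<gamma>' - \<gamma>"] by (simp add: infnorm_sub)
  have comp: "\<bar>x $ t\<bar> \<le> infnorm x" for x :: "real^'p" and t
    by (metis component_le_infnorm_cart)
  have "\<bar>Z i j \<bullet> \<gamma>'\<bar> \<le> (\<Sum>t\<in>UNIV. \<bar>Z i j $ t * \<gamma>' $ t\<bar>)"
    unfolding inner_vec_def by (simp add: sum_abs)
  also have "\<dots> \<le> (\<Sum>t\<in>(UNIV :: 'p set). q * (infnorm \<gamma> + r2))"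
  proof (rule sum_mono)
    fix t
    show "\<bar>Z i j $ t * \<gamma>' $ t\<bar> \<le> q * (infnorm \<gamma> + r2)"
      unfolding abs_mult
      using comp[of "Z i j" t] comp[of \<gamma>' t] Zq \<open>infnorm \<gamma>' \<le> infnorm \<gamma> + r2\<close>
      by (intro mult_mono) (auto intro: order_trans infnorm_pos_le)
  qed
  also have "\<dots> = real CARD('p) * q * infnorm \<gamma> + real CARD('p) * q * r2"
    by (simp add: algebra_simps)
  finally show ?thesis
    using ab mx unfolding lin_pred_def rho_def by linarith
qed

lemma V_mat_eq_Jacobian:
  fixes Z :: "nat \<Rightarrow> nat \<Rightarrow> real^'p"
  assumes "a \<in> {1..2 * n - 1}" "c \<in> {1..2 * n - 1}"
  shows "V_mat n Z \<theta> \<gamma> a c = - partial_theta (\<lambda>u. F_fun n Z d b u \<gamma> a) \<theta> c"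
proof -
  define D where "D i j = (if c = i then 1 else 0) + (if j \<noteq> n \<and> c = n + j then 1 else (0::real))" for i j
  have upd: "lin_pred n Z (\<theta>(c := x)) \<gamma> i j
      = lin_pred n Z \<theta> \<gamma> i j + D i j * (x - \<theta> c)"
    if "i \<in> {1..n}" "j \<in> {1..n}" for i j x
    using that by (auto simp: lin_pred_def beta_par_def D_def)
  have der: "((\<lambda>x. logistic (lin_pred n Z (\<theta>(c := x)) \<gamma> i j)) has_real_derivative
      logistic' (lin_pred n Z \<theta> \<gamma> i j) * D i j) (at (\<theta> c))" if "i \<in> {1..n}" "j \<in> {1..n}" for i j
  proof -
    have "((\<lambda>x. logistic (lin_pred n Z \<theta> \<gamma> i j + D i j * (x - \<theta> c))) has_real_derivative
      logistic' (lin_pred n Z \<theta> \<gamma> i j) * D i j) (at (\<theta> c))"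
      by (rule DERIV_chain2[of logistic]) (auto intro!: derivative_eq_intros logistic_deriv)
    then show ?thesis using upd[OF that] by simp
  qed
  show ?thesis
  proof (cases "a \<le> n")
    case True
    have "((\<lambda>x. F_fun n Z d b (\<theta>(c := x)) \<gamma> a) has_real_derivative
        - (\<Sum>j\<in>{1..n} - {a}. logistic' (lin_pred n Z \<theta> \<gamma> a j) * D a j)) (at (\<theta> c))"
      unfolding F_fun_def using True assms
      by (auto intro!: derivative_eq_intros der simp: sum_negf)
    then have *: "- partial_theta (\<lambda>u. F_fun n Z d b u \<gamma> a) \<theta> c
        = (\<Sum>j\<in>{1..n} - {a}. logistic' (lin_pred n Z \<theta> \<gamma> a j) * D a j)"
      unfolding partial_theta_def by (simp add: DERIV_imp_deriv)
    consider "c = a" | "c \<noteq> a" "c \<le> n" | "c \<noteq> a" "c > n" by linarith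
    then show ?thesis
    proof cases
      case 1
      have "(\<Sum>j\<in>{1..n} - {a}. logistic' (lin_pred n Z \<theta> \<gamma> a j) * D a j)
          = (\<Sum>j\<in>{1..n} - {a}. logistic' (lin_pred n Z \<theta> \<gamma> a j))"
        using 1 True by (intro sum.cong) (auto simp: D_def)
      then show ?thesis using 1 True * by (simp add: V_mat_def)
    next
      case 2
      have "(\<Sum>j\<in>{1..n} - {a}. logistic' (lin_pred n Z \<theta> \<gamma> a j) * D a j) = 0"
        using 2 by (intro sum.neutral) (auto simp: D_def)
      then show ?thesis using 2 True * by (simp add: V_mat_def)
    next
      case 3
      have "(\<Sum>j\<in>{1..n} - {a}. logistic' (lin_pred n Z \<theta> \<gamma> a j) * D a j)
         = (\<Sum>j\<in>{1..n} - {a}. if j = c - n then logistic' (lin_pred n Z \<theta> \<gamma> a j) else 0)"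
        using 3 assms by (intro sum.cong) (auto simp: D_def)
      also have "\<dots> = (if a \<noteq> c - n then logistic' (lin_pred n Z \<theta> \<gamma> a (c - n)) else 0)"
        using 3 assms by (subst sum.delta) auto
      finally show ?thesis using 3 True * by (auto simp: V_mat_def)
    qed
  next
    case False
    then have an: "a - n \<in> {1..n}" "a - n \<noteq> n" using assms by auto
    have "((\<lambda>x. F_fun n Z d b (\<theta>(c := x)) \<gamma> a) has_real_derivative
        - (\<Sum>i\<in>{1..n} - {a - n}. logistic' (lin_pred n Z \<theta> \<gamma> i (a - n)) * D i (a - n))) (at (\<theta> c))"
      unfolding F_fun_def using False an
      by (auto intro!: derivative_eq_intros der simp: sum_negf)
    then have *: "- partial_theta (\<lambda>u. F_fun n Z d b u \<gamma> a) \<theta> c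
        = (\<Sum>i\<in>{1..n} - {a - n}. logistic' (lin_pred n Z \<theta> \<gamma> i (a - n)) * D i (a - n))"
      unfolding partial_theta_def by (simp add: DERIV_imp_deriv)
    consider "c = a" | "c \<noteq> a" "c > n" | "c \<noteq> a" "c \<le> n" by linarith
    then show ?thesis
    proof cases
      case 1
      have "(\<Sum>i\<in>{1..n} - {a - n}. logistic' (lin_pred n Z \<theta> \<gamma> i (a - n)) * D i (a - n))
          = (\<Sum>i\<in>{1..n} - {a - n}. logistic' (lin_pred n Z \<theta> \<gamma> i (a - n)))"
        using 1 False an by (intro sum.cong) (auto simp: D_def)
      then show ?thesis using 1 False * by (simp add: V_mat_def)
    next
      case 2
      have "(\<Sum>i\<in>{1..n} - {a - n}. logistic' (lin_pred n Z \<theta> \<gamma> i (a - n)) * D i (a - n)) = 0"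
        using 2 False an by (intro sum.neutral) (auto simp: D_def)
      then show ?thesis using 2 False * by (simp add: V_mat_def)
    next
      case 3
      have "(\<Sum>i\<in>{1..n} - {a - n}. logistic' (lin_pred n Z \<theta> \<gamma> i (a - n)) * D i (a - n))
         = (\<Sum>i\<in>{1..n} - {a - n}. if i = c then logistic' (lin_pred n Z \<theta> \<gamma> i (a - n)) else 0)"
        using 3 False assms by (intro sum.cong) (auto simp: D_def)
      also have "\<dots> = (if c \<noteq> a - n then logistic' (lin_pred n Z \<theta> \<gamma> c (a - n)) else 0)"
        using 3 assms by (subst sum.delta) auto
      finally show ?thesis using 3 False * by (auto simp: V_mat_def)
    qed
  qed
qed

end

theory Submission
  imports Defs
begin

text \<open>The matrix \<open>V\<close> is a weighted bipartite graph operator; since two rows of the complete bipartite graph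
  share all but two columns, averaging contracts oscillations, and \<open>V\<^sup>-\<^sup>1\<close> has sup norm of order
  \<open>e\<^bsup>2\<rho>\<^esup> / n\<close>. Eliminating the node parameters leaves the system with matrix \<open>H\<close> for the covariate
  effects, so the linearized equations are solvable with explicit bounds. Outside an event of vanishing
  probability, the Newton iteration with frozen Jacobian therefore contracts to a solution close to the true
  parameter. The estimating equations have at most one solution because the logistic function is strictly
  increasing, so this solution is the estimator, and to first order \<open>\<theta>h - \<theta>\<close> is \<open>S\<^sup>*\<close> applied to the score at
  the true parameter.

  A linear form of the leading term is a sum of independent centered edge and noise variables. The noise enters
  through the common coefficient \<open>1 / v\<^bsub>2n,2n\<^esub>\<close> and contributes the variance \<open>s\<^sub>n\<^sup>2 / v\<^bsub>2n,2n\<^esub>\<^sup>2\<close>; in case (i)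
  this is negligible against \<open>1 / v\<^bsub>2n,2n\<^esub>\<close>. A third-moment bound on characteristic functions and Levy's
  continuity theorem, applied to the vector standardized by the square root of its covariance matrix, conclude.\<close>

text \<open>Every estimate is therefore finite-sample and sees the coefficients only through the
  constant value f of the covariance form. The linearization error must beat 1 / sqrt n: all errors
  are collected in (1 + lam) e^(8 \<rho>) ln n / sqrt n, which the third rate condition sends to 0
  because varpi is at least e^(9 \<rho>).

  Freezing the Jacobian means that \<open>H\<close> has to be inverted only at the true parameter,
  where lam bounds its inverse. Uniqueness is essential: the estimator is an arbitrary solution, and
  the nearby solution describes it only if there is no other.

  Both regimes keep e^(-eps/2) below some a0 < 1, which bounds the noise variances and third
  moments: in (i) since eps tends to infinity, in (ii) since the squared ratio of s_n to the root of
  the corner entry is bounded and that entry is at most (n - 1) / 4.\<close>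

section \<open>Finite linear systems\<close>

text \<open>Gaussian elimination by induction on the columns: a pivot row is removed together with
  the column \<open>c\<close>, and injectivity passes to the Schur complement \<open>A'\<close>.
  Rows and columns have separate index sets because the removed row and column need not
  correspond.\<close>

lemma injective_system_solvable:
  fixes A :: "'r \<Rightarrow> 'c \<Rightarrow> real"
  assumes "finite C" "finite R" "card R = card C"
    and "\<And>x. (\<forall>r\<in>R. (\<Sum>c\<in>C. A r c * x c) = 0) \<Longrightarrow> \<forall>c\<in>C. x c = 0"
  shows "\<exists>x. \<forall>r\<in>R. (\<Sum>c\<in>C. A r c * x c) = f r"
  using assms
proof (induction C arbitrary: R A f rule: finite_induct)
  case empty
  then show ?case by simp
next
  case (insert c C R A f)
  \<comment> \<open>If the column \<open>c\<close> vanished, the unit vector at \<open>c\<close>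
    would lie in the kernel.\<close>
  have "\<exists>r\<in>R. A r c \<noteq> 0"
  proof (rule ccontr)
    assume "\<not> ?thesis"
    then have "\<forall>r\<in>R. (\<Sum>d\<in>insert c C. A r d * (if d = c then 1 else 0)) = 0"
      using insert.hyps by (simp add: if_distrib [of "(*) _"] cong: if_cong)
    then have "\<forall>d\<in>insert c C. (if d = c then 1 else 0) = (0::real)" by (rule insert.prems(3))
    then show False by simp
  qed
  then obtain r0 where r0: "r0 \<in> R" "A r0 c \<noteq> 0" by blast
  define A' where "A' r d = A r d - A r c / A r0 c * A r0 d" for r d
  define f' where "f' r = f r - A r c / A r0 c * f r0" for r
  \<comment> \<open>\<open>ext b x\<close> completes \<open>x\<close> by the entry at
    \<open>c\<close> that gives the pivot row the value \<open>b\<close>.\<close>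
  define ext where "ext b x = x(c := (b - (\<Sum>d\<in>C. A r0 d * x d)) / A r0 c)" for b :: real and x
  have ext_sum: "(\<Sum>d\<in>insert c C. A r d * ext b x d)
      = (\<Sum>d\<in>C. A' r d * x d) + A r c / A r0 c * b" for r b x
  proof -
    have "(\<Sum>d\<in>insert c C. A r d * ext b x d)
        = A r c * ((b - (\<Sum>d\<in>C. A r0 d * x d)) / A r0 c) + (\<Sum>d\<in>C. A r d * x d)"
      using insert.hyps by (subst sum.insert) (auto simp: ext_def intro!: sum.cong)
    also have "(\<Sum>d\<in>C. A r d * x d)
        = (\<Sum>d\<in>C. A' r d * x d) + A r c / A r0 c * (\<Sum>d\<in>C. A r0 d * x d)"
      by (simp add: A'_def left_diff_distrib sum_subtractf sum_distrib_left mult.assoc)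
    finally show ?thesis using r0 by (simp add: field_simps)
  qed
  have A'0: "A' r0 d = 0" for d using r0 by (simp add: A'_def)
  have "\<exists>x. \<forall>r\<in>R - {r0}. (\<Sum>d\<in>C. A' r d * x d) = f' r"
  proof (rule insert.IH)
    show "finite (R - {r0})" using insert.prems by simp
    show "card (R - {r0}) = card C" using insert.prems insert.hyps r0 by simp
    fix x assume x: "\<forall>r\<in>R - {r0}. (\<Sum>d\<in>C. A' r d * x d) = 0"
    have "\<forall>r\<in>R. (\<Sum>d\<in>insert c C. A r d * ext 0 x d) = 0"
      unfolding ext_sum using x A'0 by (metis (no_types, lifting) DiffI add.right_neutral
        mult_zero_left mult_zero_right singletonD sum.neutral)
    then have "\<forall>d\<in>insert c C. ext 0 x d = 0" by (rule insert.prems(3))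
    then show "\<forall>d\<in>C. x d = 0" using insert.hyps by (auto simp: ext_def split: if_splits)
  qed
  then obtain x where x: "\<forall>r\<in>R - {r0}. (\<Sum>d\<in>C. A' r d * x d) = f' r" by blast
  have "(\<Sum>d\<in>insert c C. A r d * ext (f r0) x d) = f r" if "r \<in> R" for r
  proof (cases "r = r0")
    case True
    then show ?thesis unfolding ext_sum using A'0 r0 by simp
  next
    case False
    then show ?thesis unfolding ext_sum using x that by (simp add: f'_def)
  qed
  then show ?case by blast
qed

text \<open>\<open>fmat_inv\<close> chooses a two-sided inverse, so nothing follows about it until
  one exists. A right inverse \<open>B\<close> comes from solving for the unit vectors; it is also a
  left inverse because \<open>A (B A - I) = 0\<close> and \<open>A\<close> is injective.\<close>

lemma injective_matrix_inverse:
  fixes A :: "nat \<Rightarrow> nat \<Rightarrow> real"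
  assumes inj: "\<And>x. (\<forall>i\<in>{1..m}. (\<Sum>j=1..m. A i j * x j) = 0) \<Longrightarrow> \<forall>j\<in>{1..m}. x j = 0"
    and "i \<in> {1..m}" "j \<in> {1..m}"
  shows "(\<Sum>l=1..m. A i l * fmat_inv m A l j) = (if i = j then 1 else 0)"
proof -
  let ?I = "\<lambda>i j. if i = j then 1 else (0::real)"
  have "\<exists>x. \<forall>i\<in>{1..m}. (\<Sum>l\<in>{1..m}. A i l * x l) = ?I i j" for j
    by (rule injective_system_solvable) (use inj in auto)
  then obtain X where X: "\<And>j i. i \<in> {1..m} \<Longrightarrow> (\<Sum>l=1..m. A i l * X j l) = ?I i j" by metis
  define B where "B l j = X j l" for l j
  have AB: "(\<Sum>l=1..m. A i l * B l j) = ?I i j" if "i \<in> {1..m}" for i j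
    using X[OF that] by (simp add: B_def)
  have BA: "(\<Sum>l=1..m. B i l * A l j) = ?I i j" if "i \<in> {1..m}" "j \<in> {1..m}" for i j
  proof -
    have "\<forall>r\<in>{1..m}. (\<Sum>i=1..m. A r i * ((\<Sum>l=1..m. B i l * A l j) - ?I i j)) = 0"
    proof
      fix r assume r: "r \<in> {1..m}"
      have "(\<Sum>i=1..m. A r i * (\<Sum>l=1..m. B i l * A l j))
          = (\<Sum>l=1..m. (\<Sum>i=1..m. A r i * B i l) * A l j)"
        unfolding sum_distrib_left sum_distrib_right
        by (subst sum.swap) (simp add: mult.assoc)
      also have "\<dots> = (\<Sum>l=1..m. ?I r l * A l j)"
        using AB[OF r] by simp
      also have "\<dots> = A r j" using r by (simp add: if_distrib [of "\<lambda>x. x * _"] cong: if_cong)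
      finally show "(\<Sum>i=1..m. A r i * ((\<Sum>l=1..m. B i l * A l j) - ?I i j)) = 0"
        using that by (simp add: right_diff_distrib sum_subtractf if_distrib [of "(*) _"] cong: if_cong)
    qed
    then show ?thesis using inj[of "\<lambda>i. (\<Sum>l=1..m. B i l * A l j) - ?I i j"] that by simp
  qed
  have "\<exists>B. \<forall>i\<in>{1..m}. \<forall>j\<in>{1..m}.
      (\<Sum>l=1..m. A i l * B l j) = ?I i j \<and> (\<Sum>l=1..m. B i l * A l j) = ?I i j"
    using AB BA by blast
  from someI_ex[OF this] show ?thesis
    using assms(2,3) unfolding fmat_inv_def by blast
qed

section \<open>Potentials and divergences on the complete bipartite graph\<close>

text \<open>Node \<open>a \<le> n\<close> is the sender \<open>a\<close> and node \<open>n + j\<close> the receiver \<open>j\<close>; the receiver \<open>n\<close>, whose parameter is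
  fixed to 0, is node \<open>2 n\<close>. In these terms \<open>V u = divg (w \<cdot> pot u)\<close> with \<open>w = \<mu>'(\<pi>\<^sup>*)\<close>.\<close>

definition pot :: "nat \<Rightarrow> (nat \<Rightarrow> real) \<Rightarrow> nat \<Rightarrow> nat \<Rightarrow> real" where
  "pot n u i j = u i + beta_par n u j"

definition divg :: "nat \<Rightarrow> (nat \<Rightarrow> nat \<Rightarrow> real) \<Rightarrow> nat \<Rightarrow> real" where
  "divg n f a = (if a \<le> n then \<Sum>j\<in>{1..n} - {a}. f a j else \<Sum>i\<in>{1..n} - {a - n}. f i (a - n))"

definition esum :: "nat \<Rightarrow> (nat \<Rightarrow> nat \<Rightarrow> real) \<Rightarrow> real" where
  "esum n f = (\<Sum>i=1..n. \<Sum>j\<in>{1..n} - {i}. f i j)"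

lemma esum_swap: "(\<Sum>j=1..n. \<Sum>i\<in>{1..n} - {j}. f i j) = esum n f"
proof -
  have *: "(\<Sum>i\<in>{1..n} - {j}. g i) = (\<Sum>i=1..n. if i \<noteq> j then g i else 0)" for g :: "nat \<Rightarrow> real" and j
    by (rule sum.mono_neutral_cong_left) auto
  show ?thesis unfolding esum_def * by (subst sum.swap) (auto intro!: sum.cong)
qed

lemma esum_cong:
  "(\<And>i j. i \<in> {1..n} \<Longrightarrow> j \<in> {1..n} \<Longrightarrow> i \<noteq> j \<Longrightarrow> f i j = g i j) \<Longrightarrow> esum n f = esum n g"
  unfolding esum_def by (intro sum.cong) auto

lemma divg_cong:
  assumes "\<And>i j. i \<in> {1..n} \<Longrightarrow> j \<in> {1..n} \<Longrightarrow> i \<noteq> j \<Longrightarrow> f i j = g i j" "a \<in> {1..2 * n}"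
  shows "divg n f a = divg n g a"
proof (cases "a \<le> n")
  case False
  then have "a - n \<in> {1..n}" using assms(2) by auto
  then show ?thesis unfolding divg_def using assms False by (auto intro!: sum.cong)
qed (use assms in \<open>auto simp: divg_def intro!: sum.cong\<close>)

lemma esum_add: "esum n (\<lambda>i j. f i j + g i j) = esum n f + esum n g"
  by (simp add: esum_def sum.distrib)

lemma esum_diff: "esum n (\<lambda>i j. f i j - g i j) = esum n f - esum n g"
  by (simp add: esum_def sum_subtractf)

lemma esum_cmult: "esum n (\<lambda>i j. c * f i j) = c * esum n f"
  by (simp add: esum_def sum_distrib_left)

lemma esum_sum: "esum n (\<lambda>i j. \<Sum>t\<in>T. f t i j) = (\<Sum>t\<in>T. esum n (f t))"
  unfolding esum_def by (subst sum.swap) (simp add: sum.swap[of _ T])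

lemma divg_add: "divg n (\<lambda>i j. f i j + g i j) a = divg n f a + divg n g a"
  by (simp add: divg_def sum.distrib)

lemma divg_diff: "divg n (\<lambda>i j. f i j - g i j) a = divg n f a - divg n g a"
  by (simp add: divg_def sum_subtractf)

lemma divg_cmult: "divg n (\<lambda>i j. c * f i j) a = c * divg n f a"
  by (simp add: divg_def sum_distrib_left)

lemma divg_sum: "divg n (\<lambda>i j. \<Sum>t\<in>T. f t i j) a = (\<Sum>t\<in>T. divg n (f t) a)"
  by (simp add: divg_def sum.swap[of _ T])

lemma esum_abs_le:
  assumes "\<And>i j. i \<in> {1..n} \<Longrightarrow> j \<in> {1..n} \<Longrightarrow> i \<noteq> j \<Longrightarrow> \<bar>f i j\<bar> \<le> B" "B \<ge> 0"
  shows "\<bar>esum n f\<bar> \<le> (real n)\<^sup>2 * B"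
proof -
  have "\<bar>\<Sum>j\<in>{1..n} - {i}. f i j\<bar> \<le> real n * B" if "i \<in> {1..n}" for i
  proof -
    have "\<bar>\<Sum>j\<in>{1..n} - {i}. f i j\<bar> \<le> (\<Sum>j\<in>{1..n} - {i}. B)"
      using assms that by (intro order.trans[OF sum_abs] sum_mono) auto
    also have "\<dots> \<le> real n * B" using assms(2) by (simp add: mult_right_mono card_Diff_singleton_if)
    finally show ?thesis .
  qed
  then have "\<bar>esum n f\<bar> \<le> (\<Sum>i=1..n. real n * B)"
    unfolding esum_def by (rule order.trans[OF sum_abs sum_mono])
  then show ?thesis by (simp add: power2_eq_square mult_ac)
qed

lemma divg_abs_le:
  assumes "\<And>i j. i \<in> {1..n} \<Longrightarrow> j \<in> {1..n} \<Longrightarrow> i \<noteq> j \<Longrightarrow> \<bar>f i j\<bar> \<le> B" "B \<ge> 0" "a \<in> {1..2 * n}"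
  shows "\<bar>divg n f a\<bar> \<le> real n * B"
proof -
  have c: "(\<Sum>j\<in>{1..n} - {i}. B) \<le> real n * B" for i
    using assms(2) by (simp add: mult_right_mono card_Diff_singleton_if)
  show ?thesis
  proof (cases "a \<le> n")
    case True
    have "\<bar>\<Sum>j\<in>{1..n} - {a}. f a j\<bar> \<le> (\<Sum>j\<in>{1..n} - {a}. B)"
      using assms True by (intro order.trans[OF sum_abs] sum_mono) auto
    then show ?thesis using True c[of a] by (simp add: divg_def)
  next
    case False
    then have an: "a - n \<in> {1..n}" using assms(3) by auto
    have "\<bar>\<Sum>i\<in>{1..n} - {a - n}. f i (a - n)\<bar> \<le> (\<Sum>j\<in>{1..n} - {a - n}. B)"
      using assms False an by (intro order.trans[OF sum_abs] sum_mono) auto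
    then show ?thesis using False c[of "a - n"] by (simp add: divg_def)
  qed
qed

text \<open>The receiver sum runs up to \<open>n\<close> with a zero last term, to match the
  convention that \<open>beta_par n u n\<close> is 0.\<close>

lemma nodes_split_sum:
  fixes g :: "nat \<Rightarrow> real"
  assumes "n \<ge> 1"
  shows "(\<Sum>a=1..2 * n - 1. g a) = (\<Sum>i=1..n. g i) + (\<Sum>j=1..n. if j = n then 0 else g (n + j))"
proof -
  have "{1..2 * n - 1} = {1..n} \<union> (+) n ` {1..n - 1}"
  proof -
    have "x \<in> (+) n ` {1..n - 1}" if "x \<in> {1..2 * n - 1}" "x \<notin> {1..n}" for x
      using that by (intro image_eqI[of _ _ "x - n"]) auto
    moreover have "(+) n ` {1..n - 1} \<subseteq> {1..2 * n - 1}" "{1..n} \<subseteq> {1..2 * n - 1}"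
      using assms by auto
    ultimately show ?thesis by blast
  qed
  then have "(\<Sum>a=1..2 * n - 1. g a) = (\<Sum>a=1..n. g a) + (\<Sum>a\<in>(+) n ` {1..n - 1}. g a)"
    by (simp only:, subst sum.union_disjoint) auto
  also have "(\<Sum>a\<in>(+) n ` {1..n - 1}. g a) = (\<Sum>j=1..n - 1. g (n + j))"
    by (subst sum.reindex) (auto simp: inj_on_def)
  also have "\<dots> = (\<Sum>j=1..n. if j = n then 0 else g (n + j))"
    using assms by (intro sum.mono_neutral_cong_left) auto
  finally show ?thesis .
qed

text \<open>Summation by parts: \<open>divg\<close> is the adjoint of \<open>pot\<close>. Node
  \<open>2 n\<close> does not appear because its potential is 0.\<close>

lemma pot_divg_adjoint:
  assumes "n \<ge> 1"
  shows "(\<Sum>a=1..2 * n - 1. u a * divg n f a) = esum n (\<lambda>i j. f i j * pot n u i j)"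
proof -
  have "(\<Sum>a=1..2 * n - 1. u a * divg n f a)
      = (\<Sum>i=1..n. \<Sum>j\<in>{1..n} - {i}. f i j * u i)
        + (\<Sum>j=1..n. \<Sum>i\<in>{1..n} - {j}. f i j * beta_par n u j)"
    unfolding nodes_split_sum[OF assms]
    by (intro arg_cong2[of _ _ _ _ "(+)"] sum.cong)
      (auto simp: divg_def beta_par_def sum_distrib_left mult.commute)
  also have "(\<Sum>j=1..n. \<Sum>i\<in>{1..n} - {j}. f i j * beta_par n u j)
      = esum n (\<lambda>i j. f i j * beta_par n u j)"
    by (rule esum_swap)
  finally show ?thesis
    by (simp add: esum_def pot_def sum.distrib distrib_left)
qed

text \<open>The divergences over all senders and those over all receivers both count each edge once;
  this determines the one at node \<open>2 n\<close>, for which there is no estimating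
  equation.\<close>

lemma divg_last:
  assumes "n \<ge> 1"
  shows "divg n f (2 * n) = (\<Sum>a=1..2 * n - 1. (if a \<le> n then 1 else - 1) * divg n f a)"
proof -
  have "(\<Sum>a=1..2 * n - 1. (if a \<le> n then 1 else - 1) * divg n f a)
      = esum n (\<lambda>i j. f i j * pot n (\<lambda>a. if a \<le> n then 1 else - 1) i j)"
    by (rule pot_divg_adjoint[OF assms])
  \<comment> \<open>The sign vector has potential 1 - 1 = 0 on every edge except those into receiver
    \<open>n\<close>, whose parameter is 0.\<close>
  also have "\<dots> = esum n (\<lambda>i j. if j = n then f i j else 0)"
    by (intro esum_cong) (auto simp: pot_def beta_par_def)
  also have "\<dots> = (\<Sum>j=1..n. if j = n then \<Sum>i\<in>{1..n} - {j}. f i j else 0)"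
  proof -
    have "(\<Sum>i\<in>{1..n} - {j}. if j = n then f i j else 0)
        = (if j = n then \<Sum>i\<in>{1..n} - {j}. f i j else 0)" for j by (cases "j = n") simp_all
    then show ?thesis unfolding esum_swap[symmetric] by (simp only:)
  qed
  also have "\<dots> = divg n f (2 * n)" using assms by (simp add: divg_def sum.delta)
  finally show ?thesis by simp
qed

text \<open>A row (or column) update averages the opposite side; two averages share all but two nodes, so
  every update shrinks the oscillation by the factor \<open>1 - 2 m\<close>.\<close>

lemma averaging_oscillation:
  fixes w :: "nat \<Rightarrow> nat \<Rightarrow> real"
  assumes n: "n \<ge> 3" and m: "0 < m"
    and w: "\<And>i j. i \<in> {1..n} \<Longrightarrow> j \<in> {1..n} \<Longrightarrow> i \<noteq> j \<Longrightarrow> m \<le> w i j \<and> w i j \<le> 1 / 4"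
    and res: "\<And>i. i \<in> {1..n} \<Longrightarrow> \<bar>\<Sum>j\<in>{1..n} - {i}. w i j * (x i - y j)\<bar> \<le> \<phi>"
    and y: "\<And>j. j \<in> {1..n} \<Longrightarrow> lo \<le> y j \<and> y j \<le> lo + B"
    and i: "i \<in> {1..n}" "i' \<in> {1..n}"
  shows "x i - x i' \<le> (1 - 2 * m) * B + 2 * (\<phi> / (m * real (n - 1)))" (is ?osc)
    and "lo - \<phi> / (m * real (n - 1)) \<le> x i" (is ?low)
    and "x i \<le> lo + B + \<phi> / (m * real (n - 1))" (is ?upp)
proof -
  define e where "e = \<phi> / (m * real (n - 1))"
  define v where "v i = (\<Sum>j\<in>{1..n} - {i}. w i j)" for i
  have B: "B \<ge> 0" using y[OF i(1)] by linarith
  have phi: "\<phi> \<ge> 0" using res[OF i(1)] by linarith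
  have cardn: "card ({1..n} - {i}) = n - 1" if "i \<in> {1..n}" for i using that by simp
  have v_ge: "m * real (n - 1) \<le> v i" and v_le: "v i \<le> real (n - 1) / 4" if "i \<in> {1..n}" for i
  proof -
    have "(\<Sum>j\<in>{1..n} - {i}. m) \<le> v i" unfolding v_def using w that by (intro sum_mono) auto
    then show "m * real (n - 1) \<le> v i" using cardn[OF that] by (simp add: mult.commute)
    have "v i \<le> (\<Sum>j\<in>{1..n} - {i}. 1 / 4)" unfolding v_def using w that by (intro sum_mono) auto
    then show "v i \<le> real (n - 1) / 4" using cardn[OF that] by simp
  qed
  have mn: "m * real (n - 1) > 0" using m n by simp
  have v_pos: "v i > 0" if "i \<in> {1..n}" for i using v_ge[OF that] mn by linarith
  define p where "p i j = w i j / v i" for i j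
  \<comment> \<open>Each weight is at least \<open>m\<close>, and a row sum is at most
    \<open>(n - 1) / 4\<close>.\<close>
  have p_ge: "4 * m / real (n - 1) \<le> p i j" if "i \<in> {1..n}" "j \<in> {1..n}" "i \<noteq> j" for i j
  proof -
    have "4 * m / real (n - 1) = m / (real (n - 1) / 4)" by simp
    also have "\<dots> \<le> w i j / v i"
      using w[OF that] v_le[OF that(1)] v_pos[OF that(1)] m by (intro frac_le) auto
    finally show ?thesis by (simp add: p_def)
  qed
  have p_sum: "(\<Sum>j\<in>{1..n} - {i}. p i j) = 1" if "i \<in> {1..n}" for i
    using v_pos[OF that] by (simp add: p_def v_def sum_divide_distrib[symmetric])
  have near: "\<bar>x i - (\<Sum>j\<in>{1..n} - {i}. p i j * y j)\<bar> \<le> e" if "i \<in> {1..n}" for i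
  proof -
    have "(\<Sum>j\<in>{1..n} - {i}. w i j * (x i - y j)) = v i * (x i - (\<Sum>j\<in>{1..n} - {i}. p i j * y j))"
    proof -
      have "v i * (\<Sum>j\<in>{1..n} - {i}. p i j * y j) = (\<Sum>j\<in>{1..n} - {i}. w i j * y j)"
        unfolding sum_distrib_left using v_pos[OF that] by (intro sum.cong) (auto simp: p_def)
      then show ?thesis
        by (simp add: right_diff_distrib sum_subtractf sum_distrib_right v_def)
    qed
    then have "v i * \<bar>x i - (\<Sum>j\<in>{1..n} - {i}. p i j * y j)\<bar> \<le> \<phi>"
      using res[OF that] v_pos[OF that] by (simp add: abs_mult)
    then have "m * real (n - 1) * \<bar>x i - (\<Sum>j\<in>{1..n} - {i}. p i j * y j)\<bar> \<le> \<phi>"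
      using v_ge[OF that] by (meson abs_ge_zero mult_right_mono order_trans)
    then show ?thesis unfolding e_def pos_le_divide_eq[OF mn] by (subst mult.commute)
  qed
  have p_nonneg: "0 \<le> p i j" if "i \<in> {1..n}" "j \<in> {1..n}" "i \<noteq> j" for i j
    using p_ge[OF that] m by (meson divide_nonneg_nonneg less_imp_le mult_nonneg_nonneg
        of_nat_0_le_iff order_trans zero_le_numeral)
  let ?J = "{1..n} - {i, i'}"
  define D where "D = 4 * m / real (n - 1)"
  have D: "D \<ge> 0" using m by (simp add: D_def)
  \<comment> \<open>The average of row \<open>i\<close> is measured by its deficit from the upper
    end, that of row \<open>i'\<close> by its excess over the lower end. On each common column the
    two gaps add up to \<open>B\<close>, and both rows give this column mass at least
    \<open>D\<close>.\<close>
  have dec: "(\<Sum>j\<in>{1..n} - {i}. p i j * y j) = lo + B - (\<Sum>j\<in>{1..n} - {i}. p i j * (lo + B - y j))"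
    if "i \<in> {1..n}" for i
  proof -
    have "(\<Sum>j\<in>{1..n} - {i}. p i j * (lo + B - y j))
        = (\<Sum>j\<in>{1..n} - {i}. p i j) * (lo + B) - (\<Sum>j\<in>{1..n} - {i}. p i j * y j)"
      by (simp add: right_diff_distrib sum_subtractf sum_distrib_right)
    then show ?thesis using p_sum[OF that] by simp
  qed
  have dec': "(\<Sum>j\<in>{1..n} - {i}. p i j * y j) = lo + (\<Sum>j\<in>{1..n} - {i}. p i j * (y j - lo))"
    if "i \<in> {1..n}" for i
  proof -
    have "(\<Sum>j\<in>{1..n} - {i}. p i j * (y j - lo))
        = (\<Sum>j\<in>{1..n} - {i}. p i j * y j) - (\<Sum>j\<in>{1..n} - {i}. p i j) * lo"
      by (simp add: right_diff_distrib sum_subtractf sum_distrib_right)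
    then show ?thesis using p_sum[OF that] by simp
  qed
  have s1: "D * (\<Sum>j\<in>?J. lo + B - y j) \<le> (\<Sum>j\<in>{1..n} - {i}. p i j * (lo + B - y j))"
    unfolding sum_distrib_left
  proof (rule order.trans[OF sum_mono sum_mono2])
    show "D * (lo + B - y j) \<le> p i j * (lo + B - y j)" if "j \<in> ?J" for j
      using p_ge[of i j] y[of j] that i by (intro mult_right_mono) (auto simp: D_def)
    show "0 \<le> p i j * (lo + B - y j)" if "j \<in> {1..n} - {i} - ?J" for j
      using p_nonneg[of i j] y[of j] that i by (intro mult_nonneg_nonneg) auto
  qed auto
  have s2: "D * (\<Sum>j\<in>?J. y j - lo) \<le> (\<Sum>j\<in>{1..n} - {i'}. p i' j * (y j - lo))"
    unfolding sum_distrib_left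
  proof (rule order.trans[OF sum_mono sum_mono2])
    show "D * (y j - lo) \<le> p i' j * (y j - lo)" if "j \<in> ?J" for j
      using p_ge[of i' j] y[of j] that i by (intro mult_right_mono) (auto simp: D_def)
    show "0 \<le> p i' j * (y j - lo)" if "j \<in> {1..n} - {i'} - ?J" for j
      using p_nonneg[of i' j] y[of j] that i by (intro mult_nonneg_nonneg) auto
  qed auto
  have cJ: "real (card ?J) \<ge> real (n - 2)"
  proof -
    have "card ?J = n - card {i, i'}" using i by (simp add: card_Diff_subset)
    also have "\<dots> \<ge> n - 2" by (cases "i = i'") auto
    finally show ?thesis by simp
  qed
  \<comment> \<open>For \<open>n \<ge> 3\<close> at least half of the \<open>n - 1\<close>
    neighbours are common, so the common mass is at least half of \<open>4 m\<close>.\<close>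
  have "2 * m \<le> D * real (n - 2)"
  proof -
    have "real (n - 1) \<le> 2 * real (n - 2)" using n by (simp add: of_nat_diff)
    then have "2 * m * real (n - 1) \<le> 2 * m * (2 * real (n - 2))"
      using m by (intro mult_left_mono) auto
    then show ?thesis using n by (simp add: D_def field_simps)
  qed
  also have "\<dots> \<le> D * real (card ?J)" using cJ D by (rule mult_left_mono)
  finally have "2 * m * B \<le> D * real (card ?J) * B" using B by (rule mult_right_mono)
  also have "\<dots> = D * (\<Sum>j\<in>?J. lo + B - y j) + D * (\<Sum>j\<in>?J. y j - lo)"
    by (simp add: distrib_left[symmetric] sum.distrib[symmetric] mult.assoc)
  finally have "(\<Sum>j\<in>{1..n} - {i}. p i j * y j) - (\<Sum>j\<in>{1..n} - {i'}. p i' j * y j) \<le> B - 2 * m * B"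
    using s1 s2 dec[OF i(1)] dec'[OF i(2)] by linarith
  then have "x i - x i' \<le> B - 2 * m * B + 2 * e"
    using near[OF i(1)] near[OF i(2)] by linarith
  then show ?osc unfolding e_def by (simp add: left_diff_distrib)
  have "0 \<le> (\<Sum>j\<in>{1..n} - {i}. p i j * (lo + B - y j))"
    using p_nonneg[of i] y i by (intro sum_nonneg mult_nonneg_nonneg) auto
  moreover have "0 \<le> (\<Sum>j\<in>{1..n} - {i}. p i j * (y j - lo))"
    using p_nonneg[of i] y i by (intro sum_nonneg mult_nonneg_nonneg) auto
  ultimately have "lo - e \<le> x i" "x i \<le> lo + B + e"
    using near[OF i(1)] dec[OF i(1)] dec'[OF i(1)] by linarith+
  then show ?low ?upp by (simp_all add: e_def)
qed

text \<open>With receiver values negated, \<open>pot\<close> is a difference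
  \<open>x i - y j\<close>, and small residuals say that rows and columns nearly average each other.
  Each oscillation is at most \<open>1 - 2 m\<close> times the other plus \<open>2 e\<close>, so
  their sum is at most \<open>2 e / m\<close>. The value \<open>y n = 0\<close> turns oscillations
  into absolute bounds, and a last averaging error \<open>e \<le> e / m\<close> makes the constant
  3.\<close>

lemma divg_pot_stability:
  fixes w :: "nat \<Rightarrow> nat \<Rightarrow> real"
  assumes n: "n \<ge> 3" and m: "0 < m"
    and w: "\<And>i j. i \<in> {1..n} \<Longrightarrow> j \<in> {1..n} \<Longrightarrow> i \<noteq> j \<Longrightarrow> m \<le> w i j \<and> w i j \<le> 1 / 4"
    and res: "\<And>a. a \<in> {1..2 * n} \<Longrightarrow> \<bar>divg n (\<lambda>i j. w i j * pot n u i j) a\<bar> \<le> \<phi>"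
    and a: "a \<in> {1..2 * n - 1}"
  shows "\<bar>u a\<bar> \<le> 3 / (m\<^sup>2 * real (n - 1)) * \<phi>"
proof -
  define x where "x i = u i" for i
  define y where "y j = - beta_par n u j" for j
  define e where "e = \<phi> / (m * real (n - 1))"
  have yn: "y n = 0" by (simp add: y_def beta_par_def)
  have pot: "pot n u i j = x i - y j" for i j by (simp add: pot_def x_def y_def)
  have phi: "\<phi> \<ge> 0" using res[of 1] n by auto
  have e0: "e \<ge> 0" using phi m by (simp add: e_def)
  have m4: "m \<le> 1 / 4" using w[of 1 2] n by auto
  have rx: "\<bar>\<Sum>j\<in>{1..n} - {i}. w i j * (x i - y j)\<bar> \<le> \<phi>" if "i \<in> {1..n}" for i
    using res[of i] that by (simp add: divg_def pot)
  have ry: "\<bar>\<Sum>j\<in>{1..n} - {i}. w j i * (y i - x j)\<bar> \<le> \<phi>" if "i \<in> {1..n}" for i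
  proof -
    have "(\<Sum>j\<in>{1..n} - {i}. w j i * (y i - x j)) = - (\<Sum>j\<in>{1..n} - {i}. w j i * (x j - y i))"
      by (simp add: sum_negf[symmetric] algebra_simps)
    then show ?thesis using res[of "n + i"] that by (simp add: divg_def pot)
  qed
  define ly uy lx ux where "ly = Min (y ` {1..n})" and "uy = Max (y ` {1..n})"
    and "lx = Min (x ` {1..n})" and "ux = Max (x ` {1..n})"
  have ne: "{1..n} \<noteq> {}" using n by simp
  have yb: "ly \<le> y j \<and> y j \<le> ly + (uy - ly)" if "j \<in> {1..n}" for j
    using that by (auto simp: ly_def uy_def)
  have xb: "lx \<le> x j \<and> x j \<le> lx + (ux - lx)" if "j \<in> {1..n}" for j
    using that by (auto simp: lx_def ux_def)
  obtain i i' where ii: "i \<in> {1..n}" "i' \<in> {1..n}" "ux = x i" "lx = x i'"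
  proof -
    have "ux \<in> x ` {1..n}" "lx \<in> x ` {1..n}"
      unfolding ux_def lx_def using Max_in[of "x ` {1..n}"] Min_in[of "x ` {1..n}"] ne by blast+
    then show thesis by (elim imageE) (rule that)
  qed
  obtain j j' where jj: "j \<in> {1..n}" "j' \<in> {1..n}" "uy = y j" "ly = y j'"
  proof -
    have "uy \<in> y ` {1..n}" "ly \<in> y ` {1..n}"
      unfolding uy_def ly_def using Max_in[of "y ` {1..n}"] Min_in[of "y ` {1..n}"] ne by blast+
    then show thesis by (elim imageE) (rule that)
  qed
  have w': "m \<le> w j i \<and> w j i \<le> 1 / 4" if "i \<in> {1..n}" "j \<in> {1..n}" "i \<noteq> j" for i j
    using w[of j i] that by auto
  have o1: "ux - lx \<le> (1 - 2 * m) * (uy - ly) + 2 * e"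
    using averaging_oscillation(1)[OF n m w rx yb ii(1,2)] ii by (simp add: e_def)
  have o2: "uy - ly \<le> (1 - 2 * m) * (ux - lx) + 2 * e"
    using averaging_oscillation(1)[where w = "\<lambda>i j. w j i", OF n m w' ry xb jj(1,2)] jj by (simp add: e_def)
  have pos: "ux - lx \<ge> 0" "uy - ly \<ge> 0" using xb[OF ii(1)] yb[OF jj(1)] by auto
  have "uy - ly + (ux - lx) \<le> (1 - 2 * m) * (uy - ly + (ux - lx)) + 4 * e"
    using o1 o2 by (simp add: algebra_simps)
  then have "2 * m * (uy - ly + (ux - lx)) \<le> 4 * e" by (simp add: algebra_simps)
  then have osc: "uy - ly + (ux - lx) \<le> 2 * e / m" using m by (simp add: field_simps)
  have n1: "n \<in> {1..n}" using n by simp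
  have e_le: "e \<le> e / m"
  proof -
    have "e * m \<le> e * 1" using e0 m4 by (intro mult_left_mono) auto
    then show ?thesis using m by (simp add: pos_le_divide_eq)
  qed
  have yabs: "\<bar>y j\<bar> \<le> uy - ly" if "j \<in> {1..n}" for j
    using yb[OF that] yb[OF n1] yn by linarith
  have xabs: "\<bar>x i\<bar> \<le> uy - ly + e" if "i \<in> {1..n}" for i
  proof -
    have "ly - e \<le> x i"
      using averaging_oscillation(2)[OF n m w rx yb that that] by (simp add: e_def)
    moreover have "x i \<le> ly + (uy - ly) + e"
      using averaging_oscillation(3)[OF n m w rx yb that that] by (simp add: e_def)
    ultimately show ?thesis using yb[OF n1] yn by linarith
  qed
  have bd: "uy - ly + e \<le> 3 / (m\<^sup>2 * real (n - 1)) * \<phi>"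
  proof -
    have "uy - ly + e \<le> 3 * (e / m)" using osc e_le pos by linarith
    also have "\<dots> = 3 / (m\<^sup>2 * real (n - 1)) * \<phi>" by (simp add: e_def power2_eq_square)
    finally show ?thesis .
  qed
  show ?thesis
  proof (cases "a \<le> n")
    case True
    then show ?thesis using xabs[of a] a bd by (simp add: x_def)
  next
    case False
    then have "\<bar>u a\<bar> = \<bar>y (a - n)\<bar>" using a by (auto simp: y_def beta_par_def)
    moreover have "\<bar>y (a - n)\<bar> \<le> uy - ly" using a False by (intro yabs) auto
    ultimately have "\<bar>u a\<bar> \<le> uy - ly + e" using e0 by linarith
    then show ?thesis using bd by (rule order_trans)
  qed
qed

section \<open>The Jacobians of the estimating equations\<close>

lemma F_fun_eq_divg:
  "F_fun n Z d b \<theta> \<gamma> a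
    = (if a \<le> n then d a else b (a - n)) - divg n (\<lambda>i j. logistic (lin_pred n Z \<theta> \<gamma> i j)) a"
  by (simp add: F_fun_def divg_def)

lemma Q_fun_eq_esum:
  "Q_fun n Z y \<theta> \<gamma> $ s = y $ s - esum n (\<lambda>i j. logistic (lin_pred n Z \<theta> \<gamma> i j) * Z i j $ s)"
  by (simp add: Q_fun_def esum_def)

lemma lin_pred_eq_pot: "lin_pred n Z \<theta> \<gamma> i j = Z i j \<bullet> \<gamma> + pot n \<theta> i j"
  by (simp add: lin_pred_def pot_def)

lemma V_mat_apply:
  assumes a: "a \<in> {1..2 * n - 1}"
  shows "(\<Sum>c=1..2 * n - 1. V_mat n Z \<theta> \<gamma> a c * u c)
    = divg n (\<lambda>i j. logistic' (lin_pred n Z \<theta> \<gamma> i j) * pot n u i j) a"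
proof -
  let ?w = "\<lambda>i j. logistic' (lin_pred n Z \<theta> \<gamma> i j)"
  have n: "n \<ge> 1" using a by auto
  show ?thesis
  proof (cases "a \<le> n")
    case True
    have "(\<Sum>c=1..n. V_mat n Z \<theta> \<gamma> a c * u c)
        = (\<Sum>c=1..n. if c = a then (\<Sum>j\<in>{1..n} - {a}. ?w a j) * u a else 0)"
      using True by (intro sum.cong) (auto simp: V_mat_def)
    also have "\<dots> = (\<Sum>j\<in>{1..n} - {a}. ?w a j * u a)"
      using True a by (simp add: sum_distrib_right)
    finally have 1: "(\<Sum>c=1..n. V_mat n Z \<theta> \<gamma> a c * u c) = (\<Sum>j\<in>{1..n} - {a}. ?w a j * u a)" .
    have 2: "(\<Sum>j=1..n. if j = n then 0 else V_mat n Z \<theta> \<gamma> a (n + j) * u (n + j))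
        = (\<Sum>j\<in>{1..n} - {a}. ?w a j * beta_par n u j)"
      using True a by (intro sum.mono_neutral_cong_right) (auto simp: V_mat_def beta_par_def)
    show ?thesis unfolding nodes_split_sum[OF n] 1 2
      using True by (simp add: divg_def pot_def distrib_left sum.distrib)
  next
    case False
    then have an: "a - n \<in> {1..n}" "a - n \<noteq> n" using a by auto
    have 1: "(\<Sum>c=1..n. V_mat n Z \<theta> \<gamma> a c * u c) = (\<Sum>i\<in>{1..n} - {a - n}. ?w i (a - n) * u i)"
      using False a by (intro sum.mono_neutral_cong_right) (auto simp: V_mat_def)
    have "(\<Sum>j=1..n. if j = n then 0 else V_mat n Z \<theta> \<gamma> a (n + j) * u (n + j))
        = (\<Sum>j=1..n. if j = a - n then (\<Sum>i\<in>{1..n} - {a - n}. ?w i (a - n)) * u a else 0)"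
      using False a by (intro sum.cong) (auto simp: V_mat_def)
    also have "\<dots> = (\<Sum>i\<in>{1..n} - {a - n}. ?w i (a - n) * beta_par n u (a - n))"
      using an False by (simp add: sum_distrib_right beta_par_def)
    finally have 2: "(\<Sum>j=1..n. if j = n then 0 else V_mat n Z \<theta> \<gamma> a (n + j) * u (n + j))
        = (\<Sum>i\<in>{1..n} - {a - n}. ?w i (a - n) * beta_par n u (a - n))" .
    show ?thesis unfolding nodes_split_sum[OF n] 1 2
      using False by (simp add: divg_def pot_def distrib_left sum.distrib)
  qed
qed

lemma logistic_lin_pred_deriv_gamma:
  fixes Z :: "nat \<Rightarrow> nat \<Rightarrow> real^'p"
  shows "((\<lambda>x. logistic (lin_pred n Z \<theta> (\<gamma> + x *\<^sub>R axis t 1) i j)) has_real_derivative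
     logistic' (lin_pred n Z \<theta> \<gamma> i j) * Z i j $ t) (at 0)"
proof -
  have eq: "lin_pred n Z \<theta> (\<gamma> + x *\<^sub>R axis t 1) i j = lin_pred n Z \<theta> \<gamma> i j + x * Z i j $ t" for x
    by (simp add: lin_pred_def inner_add_right inner_axis)
  show ?thesis unfolding eq
    by (rule DERIV_chain2[of logistic]) (auto intro!: derivative_eq_intros logistic_deriv)
qed

lemma logistic_lin_pred_deriv_theta:
  assumes "i \<in> {1..n}" "j \<in> {1..n}"
  shows "((\<lambda>x. logistic (lin_pred n Z (\<theta>(c := x)) \<gamma> i j)) has_real_derivative
     logistic' (lin_pred n Z \<theta> \<gamma> i j) * pot n (\<lambda>a. if a = c then 1 else 0) i j) (at (\<theta> c))"
proof -
  have eq: "lin_pred n Z (\<theta>(c := x)) \<gamma> i j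
      = lin_pred n Z \<theta> \<gamma> i j + pot n (\<lambda>a. if a = c then 1 else 0) i j * (x - \<theta> c)" for x
    using assms by (auto simp: lin_pred_def pot_def beta_par_def)
  have "((\<lambda>x. logistic (lin_pred n Z \<theta> \<gamma> i j
        + pot n (\<lambda>a. if a = c then 1 else 0) i j * (x - \<theta> c))) has_real_derivative
     logistic' (lin_pred n Z \<theta> \<gamma> i j) * pot n (\<lambda>a. if a = c then 1 else 0) i j) (at (\<theta> c))"
    by (rule DERIV_chain2[of logistic]) (auto intro!: derivative_eq_intros logistic_deriv)
  then show ?thesis by (simp only: eq)
qed

lemma partial_gamma_F_fun:
  fixes Z :: "nat \<Rightarrow> nat \<Rightarrow> real^'p"
  shows "partial_gamma (\<lambda>g. F_fun n Z d b \<theta> g a) \<gamma> t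
    = - divg n (\<lambda>i j. logistic' (lin_pred n Z \<theta> \<gamma> i j) * Z i j $ t) a"
proof -
  have "((\<lambda>x. F_fun n Z d b \<theta> (\<gamma> + x *\<^sub>R axis t 1) a) has_real_derivative
      - divg n (\<lambda>i j. logistic' (lin_pred n Z \<theta> \<gamma> i j) * Z i j $ t) a) (at 0)"
    unfolding F_fun_eq_divg divg_def
    by (cases "a \<le> n")
      (auto intro!: derivative_eq_intros logistic_lin_pred_deriv_gamma)
  then show ?thesis unfolding partial_gamma_def by (rule DERIV_imp_deriv)
qed

lemma partial_gamma_Q_fun:
  fixes Z :: "nat \<Rightarrow> nat \<Rightarrow> real^'p"
  shows "partial_gamma (\<lambda>g. Q_fun n Z y \<theta> g $ s) \<gamma> t
    = - esum n (\<lambda>i j. logistic' (lin_pred n Z \<theta> \<gamma> i j) * Z i j $ t * Z i j $ s)"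
proof -
  have "((\<lambda>x. Q_fun n Z y \<theta> (\<gamma> + x *\<^sub>R axis t 1) $ s) has_real_derivative
      - esum n (\<lambda>i j. logistic' (lin_pred n Z \<theta> \<gamma> i j) * Z i j $ t * Z i j $ s)) (at 0)"
    unfolding Q_fun_eq_esum esum_def
    by (auto intro!: derivative_eq_intros logistic_lin_pred_deriv_gamma)
  then show ?thesis unfolding partial_gamma_def by (rule DERIV_imp_deriv)
qed

lemma partial_theta_Q_fun:
  fixes Z :: "nat \<Rightarrow> nat \<Rightarrow> real^'p"
  assumes c: "c \<in> {1..2 * n - 1}"
  shows "partial_theta (\<lambda>u. Q_fun n Z y u \<gamma> $ s) \<theta> c
    = - divg n (\<lambda>i j. logistic' (lin_pred n Z \<theta> \<gamma> i j) * Z i j $ s) c"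
proof -
  let ?e = "\<lambda>a. if a = c then 1 else (0::real)" and ?w = "\<lambda>i j. logistic' (lin_pred n Z \<theta> \<gamma> i j)"
  have "((\<lambda>x. Q_fun n Z y (\<theta>(c := x)) \<gamma> $ s) has_real_derivative
      - esum n (\<lambda>i j. ?w i j * pot n ?e i j * Z i j $ s)) (at (\<theta> c))"
    unfolding Q_fun_eq_esum esum_def
    by (auto intro!: derivative_eq_intros logistic_lin_pred_deriv_theta)
  then have "partial_theta (\<lambda>u. Q_fun n Z y u \<gamma> $ s) \<theta> c
      = - esum n (\<lambda>i j. ?w i j * pot n ?e i j * Z i j $ s)"
    unfolding partial_theta_def by (rule DERIV_imp_deriv)
  also have "esum n (\<lambda>i j. ?w i j * pot n ?e i j * Z i j $ s)
      = esum n (\<lambda>i j. ?w i j * Z i j $ s * pot n ?e i j)"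
    by (intro esum_cong) simp
  \<comment> \<open>Adjointness with the unit vector at \<open>c\<close> turns the edge sum into the
    divergence at this node.\<close>
  also have "\<dots> = (\<Sum>a=1..2 * n - 1. ?e a * divg n (\<lambda>i j. ?w i j * Z i j $ s) a)"
    using c by (subst pot_divg_adjoint) auto
  also have "\<dots> = divg n (\<lambda>i j. ?w i j * Z i j $ s) c"
    using c by (simp add: if_distrib[of "\<lambda>x. x * _"] cong: if_cong)
  finally show ?thesis .
qed

section \<open>Invertibility of \<open>V\<close> and the explicit form of \<open>H\<close>\<close>

locale weighted_network =
  fixes n :: nat and Z :: "nat \<Rightarrow> nat \<Rightarrow> real^'p" and \<theta> :: "nat \<Rightarrow> real" and \<gamma> :: "real^'p"
    and q m :: real
  assumes n3: "n \<ge> 3" and m_pos: "0 < m"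
    and w_bounds: "\<And>i j. i \<in> {1..n} \<Longrightarrow> j \<in> {1..n} \<Longrightarrow> i \<noteq> j \<Longrightarrow>
      m \<le> logistic' (lin_pred n Z \<theta> \<gamma> i j) \<and> logistic' (lin_pred n Z \<theta> \<gamma> i j) \<le> 1 / 4"
    and Z_bound: "\<And>i j t. i \<in> {1..n} \<Longrightarrow> j \<in> {1..n} \<Longrightarrow> i \<noteq> j \<Longrightarrow> \<bar>Z i j $ t\<bar> \<le> q"
begin

definition w :: "nat \<Rightarrow> nat \<Rightarrow> real" where
  "w i j = logistic' (lin_pred n Z \<theta> \<gamma> i j)"

definition K :: real where "K = 3 / (m\<^sup>2 * real (n - 1))"

lemma w_ge: "i \<in> {1..n} \<Longrightarrow> j \<in> {1..n} \<Longrightarrow> i \<noteq> j \<Longrightarrow> m \<le> w i j"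
  and w_le: "i \<in> {1..n} \<Longrightarrow> j \<in> {1..n} \<Longrightarrow> i \<noteq> j \<Longrightarrow> w i j \<le> 1 / 4"
  using w_bounds by (auto simp: w_def)

lemma q_nonneg: "q \<ge> 0"
  using Z_bound[of 1 2] n3 by force

lemma K_pos: "K > 0" using m_pos n3 by (simp add: K_def)

lemma stability:
  assumes "\<And>a. a \<in> {1..2 * n} \<Longrightarrow> \<bar>divg n (\<lambda>i j. w i j * pot n u i j) a\<bar> \<le> \<phi>"
    and "a \<in> {1..2 * n - 1}"
  shows "\<bar>u a\<bar> \<le> K * \<phi>"
  unfolding K_def
  by (rule divg_pot_stability[of n m w u, OF n3 m_pos _ assms]) (use w_ge w_le in auto)

text \<open>The equations speak of \<open>2 n - 1\<close> nodes while \<open>stability\<close> needs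
  the residual at all \<open>2 n\<close>; \<open>divg_last\<close> fills the gap.\<close>

lemma divg_determines:
  assumes "\<And>a. a \<in> {1..2 * n - 1} \<Longrightarrow> divg n f a = divg n g a" "a \<in> {1..2 * n}"
  shows "divg n f a = divg n g a"
proof (cases "a = 2 * n")
  case True
  have "n \<ge> 1" using n3 by simp
  then show ?thesis unfolding True by (subst (1 2) divg_last) (use assms in \<open>auto intro!: sum.cong\<close>)
qed (use assms in auto)

lemma V_injective:
  assumes "\<And>a. a \<in> {1..2 * n - 1} \<Longrightarrow> divg n (\<lambda>i j. w i j * pot n u i j) a = 0"
    and "a \<in> {1..2 * n - 1}"
  shows "u a = 0"
proof -
  have "divg n (\<lambda>i j. w i j * pot n u i j) a = 0" if "a \<in> {1..2 * n}" for a
    using divg_determines[of "\<lambda>i j. w i j * pot n u i j" "\<lambda>i j. 0" a] assms that by (simp add: divg_def)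
  then show ?thesis using stability[of u 0 a] assms(2) by simp
qed

lemma V_apply:
  "a \<in> {1..2 * n - 1} \<Longrightarrow>
    (\<Sum>c=1..2 * n - 1. V_mat n Z \<theta> \<gamma> a c * u c) = divg n (\<lambda>i j. w i j * pot n u i j) a"
  unfolding w_def by (rule V_mat_apply)

lemma V_solve: "\<exists>u. \<forall>a\<in>{1..2 * n - 1}. divg n (\<lambda>i j. w i j * pot n u i j) a = f a"
proof -
  have "\<exists>u. \<forall>a\<in>{1..2 * n - 1}. (\<Sum>c\<in>{1..2 * n - 1}. V_mat n Z \<theta> \<gamma> a c * u c) = f a"
    by (rule injective_system_solvable)
      (use V_injective in \<open>auto simp: V_apply simp del: One_nat_def\<close>)
  then show ?thesis by (auto simp: V_apply simp del: One_nat_def)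
qed

text \<open>\<open>P t\<close> is the projection of the \<open>t\<close>-th covariate onto the node effects, in the weights \<open>w\<close>.\<close>

lemma H_mat_projection:
  "\<exists>P. (\<forall>t. \<forall>a\<in>{1..2 * n - 1}. divg n (\<lambda>i j. w i j * pot n (P t) i j) a
                 = divg n (\<lambda>i j. w i j * Z i j $ t) a) \<and>
       (\<forall>s t. H_mat n Z d b y \<theta> \<gamma> $ s $ t
          = esum n (\<lambda>i j. w i j * Z i j $ s * (Z i j $ t - pot n (P t) i j)))"
proof -
  let ?N = "2 * n - 1"
  define J where "J = (\<lambda>a c. partial_theta (\<lambda>u. F_fun n Z d b u \<gamma> a) \<theta> c)"
  define B where "B t a = divg n (\<lambda>i j. w i j * Z i j $ t) a" for t a
  \<comment> \<open>\<open>J\<close> is \<open>- V\<close>, hence the sign: \<open>P t\<close> is to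
    solve \<open>V (P t) = B t\<close>.\<close>
  define P where "P t a = - (\<Sum>c=1..?N. fmat_inv ?N J a c * B t c)" for t a
  have J: "J a c = - V_mat n Z \<theta> \<gamma> a c" if "a \<in> {1..?N}" "c \<in> {1..?N}" for a c
    using V_mat_eq_Jacobian[OF that, of Z \<theta> \<gamma> d b] by (simp add: J_def)
  have Jx: "(\<Sum>c=1..?N. J a c * u c) = - divg n (\<lambda>i j. w i j * pot n u i j) a"
    if "a \<in> {1..?N}" for a u
  proof -
    have "(\<Sum>c=1..?N. J a c * u c) = - (\<Sum>c=1..?N. V_mat n Z \<theta> \<gamma> a c * u c)"
      using J[OF that] by (simp add: sum_negf[symmetric])
    then show ?thesis by (simp only: V_apply[OF that])
  qed
  have inv: "(\<Sum>l=1..?N. J a l * fmat_inv ?N J l c) = (if a = c then 1 else 0)"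
    if "a \<in> {1..?N}" "c \<in> {1..?N}" for a c
    by (rule injective_matrix_inverse[OF _ that]) (use Jx V_injective in auto)
  have VP: "divg n (\<lambda>i j. w i j * pot n (P t) i j) a = B t a" if a: "a \<in> {1..?N}" for t a
  proof -
    have "divg n (\<lambda>i j. w i j * pot n (P t) i j) a = - (\<Sum>l=1..?N. J a l * P t l)"
      using Jx[OF a] by simp
    also have "\<dots> = (\<Sum>l=1..?N. \<Sum>c=1..?N. J a l * fmat_inv ?N J l c * B t c)"
      by (simp add: P_def sum_distrib_left sum_negf mult.assoc)
    also have "\<dots> = (\<Sum>c=1..?N. (\<Sum>l=1..?N. J a l * fmat_inv ?N J l c) * B t c)"
      by (subst sum.swap) (simp add: sum_distrib_right)
    also have "\<dots> = (\<Sum>c=1..?N. (if a = c then 1 else 0) * B t c)"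
      using inv[OF a] by simp
    also have "\<dots> = B t a" using a by (simp add: if_distrib[of "\<lambda>x. x * _"] cong: if_cong)
    finally show ?thesis .
  qed
  have "H_mat n Z d b y \<theta> \<gamma> $ s $ t
      = esum n (\<lambda>i j. w i j * Z i j $ s * (Z i j $ t - pot n (P t) i j))" for s t
  proof -
    have "H_mat n Z d b y \<theta> \<gamma> $ s $ t
        = esum n (\<lambda>i j. w i j * Z i j $ t * Z i j $ s)
          + (\<Sum>a=1..?N. \<Sum>c=1..?N. B s a * fmat_inv ?N J a c * B t c)"
      by (simp add: H_mat_def Let_def partial_gamma_Q_fun partial_gamma_F_fun partial_theta_Q_fun
          flip: J_def) (simp add: B_def w_def[abs_def])
    also have "(\<Sum>a=1..?N. \<Sum>c=1..?N. B s a * fmat_inv ?N J a c * B t c)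
        = - (\<Sum>a=1..?N. P t a * B s a)"
      by (simp add: P_def sum_distrib_left sum_distrib_right sum_negf mult_ac)
    \<comment> \<open>Adjointness makes the Schur complement correction an edge sum, which combines
      with the first term to the covariate minus its projection.\<close>
    also have "(\<Sum>a=1..?N. P t a * B s a)
        = esum n (\<lambda>i j. w i j * Z i j $ s * pot n (P t) i j)"
      unfolding B_def using n3 by (subst pot_divg_adjoint) auto
    finally show ?thesis
      by (simp add: right_diff_distrib esum_diff mult_ac)
  qed
  then show ?thesis using VP unfolding B_def by blast
qed

end

section \<open>Solving the estimating equations near the true parameter\<close>

text \<open>Banach's iteration from 0 in the sup distance over \<open>I\<close>. The contraction
  hypothesis quantifies over every bound \<open>e\<close>, so that no supremum over \<open>I\<close>
  has to be formed and values outside \<open>I\<close> stay free.\<close>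

lemma contraction_fixed_point:
  fixes T :: "('i \<Rightarrow> real) \<Rightarrow> 'i \<Rightarrow> real"
  assumes d: "\<delta> \<ge> 0"
    and maps: "\<And>h. (\<forall>i\<in>I. \<bar>h i\<bar> \<le> \<delta>) \<Longrightarrow> \<forall>i\<in>I. \<bar>T h i\<bar> \<le> \<delta>"
    and contr: "\<And>h h' e. (\<forall>i\<in>I. \<bar>h i\<bar> \<le> \<delta>) \<Longrightarrow> (\<forall>i\<in>I. \<bar>h' i\<bar> \<le> \<delta>) \<Longrightarrow>
      (\<forall>i\<in>I. \<bar>h i - h' i\<bar> \<le> e) \<Longrightarrow> \<forall>i\<in>I. \<bar>T h i - T h' i\<bar> \<le> e / 2"
  shows "\<exists>h. (\<forall>i\<in>I. \<bar>h i\<bar> \<le> \<delta>) \<and> (\<forall>i\<in>I. T h i = h i)"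
proof -
  define it where "it k = (T ^^ k) (\<lambda>_. 0)" for k
  have it_Suc: "it (Suc k) = T (it k)" for k by (simp add: it_def)
  have bd: "\<forall>i\<in>I. \<bar>it k i\<bar> \<le> \<delta>" for k
  proof (induction k)
    case 0
    then show ?case using d by (simp add: it_def)
  next
    case (Suc k)
    then show ?case unfolding it_Suc by (rule maps)
  qed
  have shift: "\<forall>i\<in>I. \<bar>it (k + j) i - it k i\<bar> \<le> \<delta> / 2 ^ k" for k j
  proof (induction k)
    case 0
    then show ?case using bd[of j] by (simp add: it_def)
  next
    case (Suc k)
    have "\<forall>i\<in>I. \<bar>T (it (k + j)) i - T (it k) i\<bar> \<le> (\<delta> / 2 ^ k) / 2"
      by (rule contr) (use bd Suc in auto)
    then show ?case by (simp add: it_Suc mult.commute)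
  qed
  have small: "(\<lambda>k. \<delta> / 2 ^ k) \<longlonglongrightarrow> 0"
    by (rule LIMSEQ_divide_realpow_zero) simp
  have cau: "Cauchy (\<lambda>k. it k i)" if i: "i \<in> I" for i
  proof (rule metric_CauchyI)
    fix e :: real assume "e > 0"
    then have "eventually (\<lambda>k. \<delta> / 2 ^ k < e / 2) sequentially"
      using order_tendstoD(2)[OF small, of "e / 2"] by simp
    then obtain k where k: "\<delta> / 2 ^ k < e / 2" by (auto simp: eventually_sequentially)
    have "dist (it a i) (it b i) < e" if "a \<ge> k" "b \<ge> k" for a b
    proof -
      have "\<bar>it a i - it k i\<bar> \<le> \<delta> / 2 ^ k" "\<bar>it b i - it k i\<bar> \<le> \<delta> / 2 ^ k"
        using shift[of k "a - k"] shift[of k "b - k"] that i by auto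
      then show ?thesis using k unfolding dist_real_def by linarith
    qed
    then show "\<exists>M. \<forall>m\<ge>M. \<forall>n\<ge>M. dist (it m i) (it n i) < e" by blast
  qed
  define h where "h i = lim (\<lambda>k. it k i)" for i
  have lim: "(\<lambda>k. it k i) \<longlonglongrightarrow> h i" if "i \<in> I" for i
    using Cauchy_convergent[OF cau[OF that]] by (simp add: h_def convergent_LIMSEQ_iff)
  have h_bd: "\<forall>i\<in>I. \<bar>h i\<bar> \<le> \<delta>"
    using bd by (auto intro!: LIMSEQ_le_const2[OF tendsto_rabs[OF lim]])
  have near: "\<forall>i\<in>I. \<bar>h i - it k i\<bar> \<le> \<delta> / 2 ^ k" for k
  proof
    fix i assume i: "i \<in> I"
    have "(\<lambda>j. \<bar>it (k + j) i - it k i\<bar>) \<longlonglongrightarrow> \<bar>h i - it k i\<bar>"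
      using LIMSEQ_ignore_initial_segment[OF lim[OF i], of k]
      by (intro tendsto_intros) (simp add: add.commute)
    then show "\<bar>h i - it k i\<bar> \<le> \<delta> / 2 ^ k"
      by (rule LIMSEQ_le_const2) (use shift i in blast)
  qed
  have "T h i = h i" if i: "i \<in> I" for i
  proof -
    \<comment> \<open>The contraction between the limit \<open>h\<close> and an iterate exhibits
      \<open>T h\<close> as a limit of the shifted iterates.\<close>
    have half: "\<bar>T h i - it (Suc k) i\<bar> \<le> \<delta> / 2 ^ k / 2" for k
      using contr[OF h_bd bd near] i by (simp add: it_Suc)
    have "\<bar>it (Suc k) i - T h i\<bar> \<le> \<delta> / 2 ^ k" for k
    proof -
      have *: "c / 2 \<le> c" if "0 \<le> c" for c :: real using that by simp
      have "\<delta> / 2 ^ k / 2 \<le> \<delta> / 2 ^ k" by (rule *) (use d in simp)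
      with half[of k] show ?thesis by (subst abs_minus_commute) (rule order_trans)
    qed
    then have "(\<lambda>k. it (Suc k) i - T h i) \<longlonglongrightarrow> 0"
      by (intro Lim_null_comparison[OF _ small] always_eventually) simp
    then have "(\<lambda>k. it (Suc k) i) \<longlonglongrightarrow> T h i" by (rule LIM_zero_cancel)
    then show ?thesis using LIMSEQ_Suc[OF lim[OF i]] by (rule LIMSEQ_unique)
  qed
  then show ?thesis using h_bd by blast
qed

section \<open>Bounds for the logistic function and for its linearization error\<close>

definition logistic_rem :: "real \<Rightarrow> real \<Rightarrow> real" where
  "logistic_rem x h = logistic (x + h) - logistic x - logistic' x * h"

lemma logistic'_eq: "logistic' x = logistic x * (1 - logistic x)"
proof -
  have "1 + exp x \<noteq> 0" by (metis add_pos_pos exp_gt_zero less_irrefl zero_less_one)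
  then show ?thesis by (simp add: logistic'_def logistic_def field_simps power2_eq_square)
qed

lemma logistic_bounds: "0 < logistic x" "logistic x < 1"
proof -
  have "1 + exp x > 0" by (simp add: add_pos_pos)
  then show "0 < logistic x" "logistic x < 1" by (simp_all add: logistic_def)
qed

lemma logistic'_pos: "0 < logistic' x"
  using logistic_bounds[of x] by (simp add: logistic'_eq)

lemma logistic'_le: "logistic' x \<le> 1 / 4"
proof -
  have "0 \<le> (logistic x - 1 / 2)\<^sup>2" by simp
  then show ?thesis by (simp add: logistic'_eq power2_eq_square algebra_simps)
qed

text \<open>The derivative is even, and for \<open>y \<ge> 0\<close> its denominator is controlled
  by \<open>1 + exp y \<le> 2 * exp y\<close>.\<close>

lemma logistic'_ge: "exp (- \<bar>x\<bar>) / 4 \<le> logistic' x"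
proof -
  have *: "exp (- y) / 4 \<le> exp y / (1 + exp y)\<^sup>2" if "y \<ge> 0" for y :: real
  proof -
    have "1 + exp y \<le> 2 * exp y" using that by simp
    then have "(1 + exp y)\<^sup>2 \<le> (2 * exp y)\<^sup>2" by (intro power_mono) (auto simp: add_nonneg_nonneg)
    then have "exp (- y) * (1 + exp y)\<^sup>2 \<le> exp (- y) * (2 * exp y)\<^sup>2" by (intro mult_left_mono) auto
    also have "\<dots> = exp y * 4" by (simp add: exp_minus power2_eq_square)
    finally have "exp (- y) * (1 + exp y)\<^sup>2 \<le> exp y * 4" .
    moreover have "(1 + exp y)\<^sup>2 > 0" by (intro zero_less_power add_pos_pos) auto
    ultimately show ?thesis by (simp add: pos_le_divide_eq)
  qed
  have even: "logistic' (- x) = logistic' x"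
  proof -
    have "1 + exp x > 0" "1 + exp (-x) > 0" by (simp_all add: add_pos_pos)
    then show ?thesis
      by (simp add: logistic'_def exp_minus divide_simps power2_eq_square) (simp add: algebra_simps)
  qed
  show ?thesis
  proof (cases "x \<ge> 0")
    case True
    then show ?thesis using *[of x] by (simp add: logistic'_def)
  next
    case False
    then have "exp (- \<bar>x\<bar>) / 4 \<le> logistic' (- x)" using *[of "- x"] by (simp add: logistic'_def)
    then show ?thesis by (simp only: even)
  qed
qed

lemma logistic_strict_mono: "x < y \<Longrightarrow> logistic x < logistic y"
  by (rule DERIV_pos_imp_increasing[of x y logistic]) (use logistic_deriv logistic'_pos in blast)+

lemma logistic'_deriv: "(logistic' has_real_derivative logistic' x * (1 - 2 * logistic x)) (at x)"
proof -
  have "(\<lambda>x. logistic x * (1 - logistic x)) = logistic'" by (simp add: fun_eq_iff logistic'_eq)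
  moreover have "((\<lambda>x. logistic x * (1 - logistic x)) has_real_derivative
      logistic' x * (1 - 2 * logistic x)) (at x)"
    by (auto intro!: derivative_eq_intros logistic_deriv simp: algebra_simps)
  ultimately show ?thesis by (simp only:)
qed

lemma logistic'_lipschitz: "\<bar>logistic' x - logistic' y\<bar> \<le> \<bar>x - y\<bar>"
proof -
  have "norm (logistic' x - logistic' y) \<le> 1 * norm (x - y)"
  proof (rule field_differentiable_bound[of UNIV])
    show "(logistic' has_field_derivative logistic' z * (1 - 2 * logistic z)) (at z within UNIV)" for z
      using logistic'_deriv by simp
    show "norm (logistic' z * (1 - 2 * logistic z)) \<le> 1" for z
    proof -
      have "\<bar>logistic' z\<bar> \<le> 1" using logistic'_pos[of z] logistic'_le[of z] by simp
      moreover have "\<bar>1 - 2 * logistic z\<bar> \<le> 1" using logistic_bounds[of z] by (simp add: abs_if)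
      ultimately show ?thesis by (simp add: abs_mult mult_le_one)
    qed
  qed auto
  then show ?thesis by simp
qed

text \<open>In the increment, the remainder has derivative
  \<open>logistic' (x + z) - logistic' x\<close>, which is at most \<open>\<delta>\<close> on the
  interval. This small Lipschitz constant is what makes an iteration with frozen Jacobian
  contract.\<close>

lemma logistic_rem_lipschitz:
  assumes "\<bar>h\<bar> \<le> \<delta>" "\<bar>h'\<bar> \<le> \<delta>"
  shows "\<bar>logistic_rem x h - logistic_rem x h'\<bar> \<le> \<delta> * \<bar>h - h'\<bar>"
proof -
  have "norm (logistic_rem x h - logistic_rem x h') \<le> \<delta> * norm (h - h')"
  proof (rule field_differentiable_bound[of "{- \<delta>..\<delta>}"])
    fix z assume z: "z \<in> {- \<delta>..\<delta>}"
    have "((\<lambda>h. logistic (x + h)) has_real_derivative logistic' (x + z) * 1) (at z)"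
      by (rule DERIV_chain2[of logistic]) (auto intro!: derivative_eq_intros logistic_deriv)
    then have "((\<lambda>h. logistic_rem x h) has_real_derivative logistic' (x + z) - logistic' x) (at z)"
      unfolding logistic_rem_def by (auto intro!: derivative_eq_intros)
    then show "((\<lambda>h. logistic_rem x h) has_field_derivative logistic' (x + z) - logistic' x)
        (at z within {- \<delta>..\<delta>})"
      by (rule has_field_derivative_at_within)
    show "norm (logistic' (x + z) - logistic' x) \<le> \<delta>"
      using logistic'_lipschitz[of "x + z" x] z by auto
  qed (use assms in auto)
  then show ?thesis by simp
qed

lemma logistic_rem_bound:
  assumes "\<bar>h\<bar> \<le> \<delta>"
  shows "\<bar>logistic_rem x h\<bar> \<le> \<delta>\<^sup>2"
proof -
  have "\<bar>logistic_rem x h - logistic_rem x 0\<bar> \<le> \<delta> * \<bar>h - 0\<bar>"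
    by (rule logistic_rem_lipschitz) (use assms in auto)
  also have "\<dots> \<le> \<delta> * \<delta>" using assms by (intro mult_left_mono) auto
  finally show ?thesis by (simp add: logistic_rem_def power2_eq_square)
qed

lemma matrix_inv_mult:
  assumes "invertible (A :: real^'n^'n)"
  shows "matrix_inv A ** A = mat 1" "A ** matrix_inv A = mat 1"
proof -
  have "A ** matrix_inv A = mat 1 \<and> matrix_inv A ** A = mat 1"
    unfolding matrix_inv_def by (rule someI_ex) (use assms in \<open>simp add: invertible_def\<close>)
  then show "matrix_inv A ** A = mat 1" "A ** matrix_inv A = mat 1" by auto
qed

section \<open>Elimination of the node parameters from the linearized equations\<close>

locale projected_network = weighted_network n Z \<theta> \<gamma> q m
  for n :: nat and Z :: "nat \<Rightarrow> nat \<Rightarrow> real^'p" and \<theta> :: "nat \<Rightarrow> real" and \<gamma> :: "real^'p"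
    and q m :: real +
  fixes P :: "'p \<Rightarrow> nat \<Rightarrow> real" and Hm :: "real^'p^'p" and lam :: real
  assumes VP: "\<And>t a. a \<in> {1..2 * n - 1} \<Longrightarrow>
      divg n (\<lambda>i j. w i j * pot n (P t) i j) a = divg n (\<lambda>i j. w i j * Z i j $ t) a"
    and Hm_eq: "\<And>s t. Hm $ s $ t = esum n (\<lambda>i j. w i j * Z i j $ s * (Z i j $ t - pot n (P t) i j))"
    and Hm_pos: "pos_def Hm"
    and Hm_inv: "mat_norm_inf (matrix_inv Hm) \<le> lam / (real n)\<^sup>2"
begin

text \<open>The change of the linear predictor on an edge when the parameters move by
  \<open>u\<close> and \<open>x\<close>.\<close>

definition lift :: "(nat \<Rightarrow> real) \<Rightarrow> real^'p \<Rightarrow> nat \<Rightarrow> nat \<Rightarrow> real" where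
  "lift u x i j = pot n u i j + Z i j \<bullet> x"

text \<open>The bound that \<open>stability\<close> gives for the projections: at each node the
  weighted covariates have divergence at most \<open>n q / 4\<close>.\<close>

definition Pb :: real where "Pb = K * (real n * (q / 4))"

text \<open>Bound for a covariate minus its projection; the factor 2 is that of
  \<open>pot_bound\<close>.\<close>

definition \<kappa> :: real where "\<kappa> = q + 2 * Pb"

lemma n_pos: "real n > 0" and n1: "n \<ge> 1" using n3 by auto

lemma Pb_nonneg: "Pb \<ge> 0" and kappa_nonneg: "\<kappa> \<ge> 0"
  using K_pos q_nonneg by (auto simp: Pb_def \<kappa>_def)

lemma lam_nonneg: "lam \<ge> 0"
proof -
  have "0 \<le> (\<Sum>j\<in>UNIV. \<bar>matrix_inv Hm $ i $ j\<bar>)" for i by (simp add: sum_nonneg)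
  also have "(\<Sum>j\<in>UNIV. \<bar>matrix_inv Hm $ i $ j\<bar>) \<le> mat_norm_inf (matrix_inv Hm)" for i
    unfolding mat_norm_inf_def by (rule Max_ge) auto
  finally have "0 \<le> lam / (real n)\<^sup>2" using Hm_inv by linarith
  then show ?thesis using n_pos by (simp add: zero_le_divide_iff)
qed

lemma pot_bound:
  assumes "\<And>a. a \<in> {1..2 * n - 1} \<Longrightarrow> \<bar>u a\<bar> \<le> B" "i \<in> {1..n}" "j \<in> {1..n}"
  shows "\<bar>pot n u i j\<bar> \<le> 2 * B"
proof -
  have 1: "\<bar>u i\<bar> \<le> B" using assms by auto
  then have "\<bar>beta_par n u j\<bar> \<le> B"
    using assms(1)[of "n + j"] assms(3) by (auto simp: beta_par_def)
  then show ?thesis using 1 by (simp add: pot_def)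
qed

lemma P_bound:
  assumes "a \<in> {1..2 * n - 1}"
  shows "\<bar>P t a\<bar> \<le> Pb"
  unfolding Pb_def
proof (rule stability[OF _ assms])
  fix a assume a: "a \<in> {1..2 * n}"
  have "\<bar>divg n (\<lambda>i j. w i j * Z i j $ t) a\<bar> \<le> real n * (q / 4)"
  proof (rule divg_abs_le[OF _ _ a])
    fix i j assume ij: "i \<in> {1..n}" "j \<in> {1..n}" "i \<noteq> j"
    have "\<bar>w i j * Z i j $ t\<bar> \<le> (1 / 4) * q"
      unfolding abs_mult using w_le[OF ij] w_ge[OF ij] m_pos Z_bound[OF ij] by (intro mult_mono) auto
    then show "\<bar>w i j * Z i j $ t\<bar> \<le> q / 4" by simp
  qed (use q_nonneg in simp)
  then show "\<bar>divg n (\<lambda>i j. w i j * pot n (P t) i j) a\<bar> \<le> real n * (q / 4)"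
    using divg_determines[OF VP a] by simp
qed

lemma residual_covariate_bound:
  assumes "i \<in> {1..n}" "j \<in> {1..n}" "i \<noteq> j"
  shows "\<bar>Z i j $ s - pot n (P s) i j\<bar> \<le> \<kappa>"
proof -
  have "\<bar>pot n (P s) i j\<bar> \<le> 2 * Pb" by (rule pot_bound[OF P_bound assms(1,2)])
  then show ?thesis using Z_bound[OF assms, of s] unfolding \<kappa>_def by linarith
qed

lemma Z_inner_bound:
  assumes "i \<in> {1..n}" "j \<in> {1..n}" "i \<noteq> j" "\<And>t. \<bar>x $ t\<bar> \<le> \<xi>"
  shows "\<bar>Z i j \<bullet> x\<bar> \<le> real CARD('p) * q * \<xi>"
proof -
  have "\<bar>Z i j \<bullet> x\<bar> \<le> (\<Sum>t\<in>UNIV. \<bar>Z i j $ t * x $ t\<bar>)"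
    unfolding inner_vec_def by (simp add: sum_abs)
  also have "\<dots> \<le> (\<Sum>t\<in>(UNIV :: 'p set). q * \<xi>)"
    unfolding abs_mult using Z_bound[OF assms(1-3)] assms(4) q_nonneg by (intro sum_mono mult_mono) auto
  finally show ?thesis by simp
qed

text \<open>\<open>VP\<close> are the normal equations of a weighted least squares projection; here
  they are tested against an arbitrary node effect \<open>u\<close>.\<close>

lemma residual_orthogonal:
  "esum n (\<lambda>i j. w i j * (Z i j $ s - pot n (P s) i j) * pot n u i j) = 0"
proof -
  have "esum n (\<lambda>i j. w i j * (Z i j $ s - pot n (P s) i j) * pot n u i j)
      = (\<Sum>a=1..2 * n - 1. u a * divg n (\<lambda>i j. w i j * (Z i j $ s - pot n (P s) i j)) a)"
    by (simp only: pot_divg_adjoint[OF n1])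
  also have "\<dots> = 0"
    by (intro sum.neutral) (auto simp: right_diff_distrib divg_diff VP simp del: One_nat_def)
  finally show ?thesis .
qed

text \<open>Subtracting the node equations, paired with \<open>P s\<close>, from the covariate
  equation pairs the increment with the residual covariate. Orthogonality removes \<open>u\<close>,
  and what remains is \<open>Hm\<close> applied to \<open>x\<close>.\<close>

lemma reduced_system:
  assumes f: "\<And>a. a \<in> {1..2 * n - 1} \<Longrightarrow> divg n (\<lambda>i j. w i j * lift u x i j) a = f a"
    and G: "\<And>s. esum n (\<lambda>i j. w i j * lift u x i j * Z i j $ s) = G s"
  shows "(Hm *v x) $ s = G s - (\<Sum>a=1..2 * n - 1. P s a * f a)"
proof -
  let ?R = "\<lambda>s i j. Z i j $ s - pot n (P s) i j"
  have "(\<Sum>a=1..2 * n - 1. P s a * f a)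
      = (\<Sum>a=1..2 * n - 1. P s a * divg n (\<lambda>i j. w i j * lift u x i j) a)"
    using f by simp
  also have "\<dots> = esum n (\<lambda>i j. w i j * lift u x i j * pot n (P s) i j)"
    by (rule pot_divg_adjoint[OF n1])
  finally have "G s - (\<Sum>a=1..2 * n - 1. P s a * f a)
      = esum n (\<lambda>i j. w i j * lift u x i j * ?R s i j)"
    by (simp add: right_diff_distrib esum_diff G)
  also have "\<dots> = esum n (\<lambda>i j. w i j * ?R s i j * pot n u i j
      + (\<Sum>t\<in>UNIV. x $ t * (w i j * Z i j $ t * ?R s i j)))"
    by (intro esum_cong) (simp add: lift_def inner_vec_def algebra_simps sum_distrib_left
        sum_distrib_right sum_subtractf)
  also have "\<dots> = (\<Sum>t\<in>UNIV. x $ t * Hm $ t $ s)"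
    by (simp add: esum_add residual_orthogonal esum_sum esum_cmult Hm_eq)
  also have "\<dots> = (Hm *v x) $ s"
  proof -
    have "Hm $ t $ s = Hm $ s $ t" for t
    proof -
      have "transpose Hm $ s $ t = Hm $ s $ t" using Hm_pos by (simp add: pos_def_def)
      then show ?thesis by (simp add: transpose_def)
    qed
    then show ?thesis by (simp add: matrix_vector_mult_def mult.commute)
  qed
  finally show ?thesis by simp
qed

lemma Hm_invertible: "invertible Hm"
proof -
  have "x = 0" if "Hm *v x = 0" for x
    using Hm_pos that by (auto simp: pos_def_def)
  then show ?thesis
    by (simp add: invertible_left_inverse matrix_left_invertible_ker)
qed

lemma Hm_solution_bound:
  assumes "\<And>s. \<bar>(Hm *v x) $ s\<bar> \<le> \<Gamma>"
  shows "\<bar>x $ t\<bar> \<le> lam / (real n)\<^sup>2 * \<Gamma>"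
proof -
  let ?B = "matrix_inv Hm"
  have "x = ?B *v (Hm *v x)"
    using Hm_invertible by (simp add: matrix_vector_mul_assoc matrix_inv_mult)
  then have "\<bar>x $ t\<bar> = \<bar>(?B *v (Hm *v x)) $ t\<bar>" by (rule arg_cong)
  also have "\<dots> = \<bar>\<Sum>j\<in>UNIV. ?B $ t $ j * (Hm *v x) $ j\<bar>"
    by (subst matrix_vector_mult_def) simp
  also have "\<dots> \<le> (\<Sum>j\<in>UNIV. \<bar>?B $ t $ j\<bar> * \<Gamma>)"
    by (rule order.trans[OF sum_abs sum_mono]) (simp add: abs_mult assms mult_left_mono)
  also have "\<dots> = (\<Sum>j\<in>UNIV. \<bar>?B $ t $ j\<bar>) * \<Gamma>" by (simp add: sum_distrib_right)
  also have "\<dots> \<le> lam / (real n)\<^sup>2 * \<Gamma>"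
  proof (rule mult_right_mono)
    have "(\<Sum>j\<in>UNIV. \<bar>?B $ t $ j\<bar>) \<le> mat_norm_inf ?B"
      unfolding mat_norm_inf_def by (rule Max_ge) auto
    then show "(\<Sum>j\<in>UNIV. \<bar>?B $ t $ j\<bar>) \<le> lam / (real n)\<^sup>2" using Hm_inv by linarith
    show "0 \<le> \<Gamma>" using assms[of undefined] by linarith
  qed
  finally show ?thesis .
qed

lemma linear_x_bound:
  assumes "\<And>a. a \<in> {1..2 * n - 1} \<Longrightarrow> divg n (\<lambda>i j. w i j * lift u x i j) a = f a"
    and "\<And>s. esum n (\<lambda>i j. w i j * lift u x i j * Z i j $ s) = G s"
    and "\<And>s. \<bar>G s - (\<Sum>a=1..2 * n - 1. P s a * f a)\<bar> \<le> \<Gamma>"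
  shows "\<bar>x $ t\<bar> \<le> lam / (real n)\<^sup>2 * \<Gamma>"
  by (rule Hm_solution_bound) (use reduced_system[OF assms(1,2)] assms(3) in simp)

text \<open>Once \<open>x\<close> is bounded, its contribution \<open>Z i j \<bullet> x\<close> can
  be moved to the data of the node equations, and the stability of \<open>V\<close> bounds
  \<open>u\<close>.\<close>

lemma linear_u_bound:
  assumes f: "\<And>a. a \<in> {1..2 * n} \<Longrightarrow> \<bar>divg n (\<lambda>i j. w i j * lift u x i j) a\<bar> \<le> \<phi>"
    and x: "\<And>t. \<bar>x $ t\<bar> \<le> \<xi>" and a: "a \<in> {1..2 * n - 1}"
  shows "\<bar>u a\<bar> \<le> K * (\<phi> + real n * (real CARD('p) * q * \<xi> / 4))"
proof (rule stability[OF _ a])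
  fix a assume a: "a \<in> {1..2 * n}"
  have xi: "\<xi> \<ge> 0" using x[of undefined] by linarith
  have "\<bar>divg n (\<lambda>i j. w i j * (Z i j \<bullet> x)) a\<bar> \<le> real n * (real CARD('p) * q * \<xi> / 4)"
  proof (rule divg_abs_le[OF _ _ a])
    fix i j assume ij: "i \<in> {1..n}" "j \<in> {1..n}" "i \<noteq> j"
    have "\<bar>w i j * (Z i j \<bullet> x)\<bar> \<le> (1 / 4) * (real CARD('p) * q * \<xi>)"
      unfolding abs_mult using w_le[OF ij] w_ge[OF ij] m_pos Z_inner_bound[OF ij x]
      by (intro mult_mono) auto
    then show "\<bar>w i j * (Z i j \<bullet> x)\<bar> \<le> real CARD('p) * q * \<xi> / 4" by simp
  qed (use q_nonneg xi in simp)
  moreover have "divg n (\<lambda>i j. w i j * lift u x i j) a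
      = divg n (\<lambda>i j. w i j * pot n u i j) a + divg n (\<lambda>i j. w i j * (Z i j \<bullet> x)) a"
    by (simp add: lift_def distrib_left divg_add)
  ultimately show "\<bar>divg n (\<lambda>i j. w i j * pot n u i j) a\<bar>
      \<le> \<phi> + real n * (real CARD('p) * q * \<xi> / 4)"
    using f[OF a] by linarith
qed

lemma linear_solve:
  "\<exists>u x. (\<forall>a\<in>{1..2 * n - 1}. divg n (\<lambda>i j. w i j * lift u x i j) a = f a) \<and>
     (\<forall>s. esum n (\<lambda>i j. w i j * lift u x i j * Z i j $ s) = G s)"
proof -
  obtain y where y: "\<And>a. a \<in> {1..2 * n - 1} \<Longrightarrow> divg n (\<lambda>i j. w i j * pot n y i j) a = f a"
    using V_solve by blast
  define x where "x = matrix_inv Hm *v (\<chi> s. G s - (\<Sum>a=1..2 * n - 1. P s a * f a))"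
  \<comment> \<open>The projected effect of \<open>x\<close> is subtracted from \<open>y\<close>.
    Then the increment is \<open>pot n y\<close> plus a combination of residual covariates, and the
    weighted residuals have divergence 0.\<close>
  define u where "u a = y a - (\<Sum>t\<in>UNIV. x $ t * P t a)" for a
  have Hx: "(Hm *v x) $ s = G s - (\<Sum>a=1..2 * n - 1. P s a * f a)" for s
    using Hm_invertible by (simp add: x_def matrix_vector_mul_assoc matrix_inv_mult)
  have lift: "lift u x i j = pot n y i j + (\<Sum>t\<in>UNIV. x $ t * (Z i j $ t - pot n (P t) i j))" for i j
    by (simp add: lift_def u_def[abs_def] pot_def beta_par_def inner_vec_def algebra_simps
        sum_subtractf sum.distrib)
  have 1: "divg n (\<lambda>i j. w i j * lift u x i j) a = f a" if a: "a \<in> {1..2 * n - 1}" for a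
  proof -
    have "divg n (\<lambda>i j. w i j * lift u x i j) a
        = divg n (\<lambda>i j. w i j * pot n y i j
            + (\<Sum>t\<in>UNIV. x $ t * (w i j * Z i j $ t - w i j * pot n (P t) i j))) a"
      unfolding lift by (simp add: algebra_simps sum_distrib_left)
    also have "\<dots> = f a"
      using VP[OF a] y[OF a] by (simp add: divg_add divg_sum divg_cmult divg_diff)
    finally show ?thesis .
  qed
  have 2: "esum n (\<lambda>i j. w i j * lift u x i j * Z i j $ s) = G s" for s
  proof -
    have "esum n (\<lambda>i j. w i j * lift u x i j * Z i j $ s)
      = (Hm *v x) $ s + (\<Sum>a=1..2 * n - 1. P s a * f a)"
      using reduced_system[OF 1 refl, where s = s] by simp
    then show ?thesis using Hx[of s] by simp
  qed
  show ?thesis using 1 2 by blast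
qed

text \<open>Sup norm, over edges, of the map that sends an edge function \<open>r\<close> to the
  increment solving the linear equations with data \<open>divg n r\<close> and the
  \<open>Z\<close>-weighted sums of \<open>r\<close>; see \<open>linear_edge_bound\<close>. The
  first summand comes from the node parameters, the second from the covariate effects.\<close>

definition \<Lambda> :: real where
  "\<Lambda> = 2 * K * real n * (1 + real CARD('p) * q * lam * \<kappa> / 4) + real CARD('p) * q * lam * \<kappa>"

text \<open>Adjointness moves \<open>P s\<close> to the edges, so data generated by an edge function
  meet only residual covariates, each at most \<open>\<kappa>\<close>.\<close>

lemma edge_data_bound:
  assumes "\<And>i j. i \<in> {1..n} \<Longrightarrow> j \<in> {1..n} \<Longrightarrow> i \<noteq> j \<Longrightarrow> \<bar>r i j\<bar> \<le> e" "e \<ge> 0"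
  shows "\<bar>esum n (\<lambda>i j. r i j * Z i j $ s) - (\<Sum>a=1..2 * n - 1. P s a * divg n r a)\<bar>
    \<le> (real n)\<^sup>2 * (e * \<kappa>)"
proof -
  have "esum n (\<lambda>i j. r i j * Z i j $ s) - (\<Sum>a=1..2 * n - 1. P s a * divg n r a)
      = esum n (\<lambda>i j. r i j * (Z i j $ s - pot n (P s) i j))"
    by (simp add: pot_divg_adjoint[OF n1] right_diff_distrib esum_diff del: One_nat_def)
  also have "\<bar>\<dots>\<bar> \<le> (real n)\<^sup>2 * (e * \<kappa>)"
    using assms residual_covariate_bound kappa_nonneg
    by (intro esum_abs_le) (auto simp: abs_mult intro!: mult_mono)
  finally show ?thesis .
qed

lemma lift_bound:
  assumes u: "\<And>a. a \<in> {1..2 * n - 1} \<Longrightarrow> \<bar>u a\<bar> \<le> B" and x: "\<And>t. \<bar>x $ t\<bar> \<le> \<xi>"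
    and ij: "i \<in> {1..n}" "j \<in> {1..n}" "i \<noteq> j"
  shows "\<bar>lift u x i j\<bar> \<le> 2 * B + real CARD('p) * q * \<xi>"
proof -
  have "\<bar>pot n u i j\<bar> \<le> 2 * B" by (rule pot_bound[OF u ij(1,2)])
  moreover have "\<bar>Z i j \<bullet> x\<bar> \<le> real CARD('p) * q * \<xi>" by (rule Z_inner_bound[OF ij x])
  ultimately show ?thesis unfolding lift_def by linarith
qed

lemma linear_edge_bound:
  assumes eq1: "\<And>a. a \<in> {1..2 * n - 1} \<Longrightarrow> divg n (\<lambda>i j. w i j * lift u x i j) a = divg n r a"
    and eq2: "\<And>s. esum n (\<lambda>i j. w i j * lift u x i j * Z i j $ s) = esum n (\<lambda>i j. r i j * Z i j $ s)"
    and r: "\<And>i j. i \<in> {1..n} \<Longrightarrow> j \<in> {1..n} \<Longrightarrow> i \<noteq> j \<Longrightarrow> \<bar>r i j\<bar> \<le> e"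
    and ij: "i \<in> {1..n}" "j \<in> {1..n}" "i \<noteq> j"
  shows "\<bar>lift u x i j\<bar> \<le> \<Lambda> * e"
proof -
  have e: "e \<ge> 0" using r[OF ij] by linarith
  have x: "\<bar>x $ t\<bar> \<le> lam * \<kappa> * e" for t
  proof -
    have "\<bar>x $ t\<bar> \<le> lam / (real n)\<^sup>2 * ((real n)\<^sup>2 * (e * \<kappa>))"
      by (rule linear_x_bound[OF eq1 eq2]) (use edge_data_bound[OF r e] in simp_all)
    then show ?thesis using n_pos by (simp add: mult_ac)
  qed
  have "\<bar>u a\<bar> \<le> K * (real n * e + real n * (real CARD('p) * q * (lam * \<kappa> * e) / 4))"
    if "a \<in> {1..2 * n - 1}" for a
  proof (rule linear_u_bound[OF _ x that])
    fix a assume "a \<in> {1..2 * n}"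
    then show "\<bar>divg n (\<lambda>i j. w i j * lift u x i j) a\<bar> \<le> real n * e"
      using divg_determines[OF eq1] divg_abs_le[OF r e] by simp
  qed
  from lift_bound[OF this x ij] show ?thesis by (simp add: \<Lambda>_def algebra_simps)
qed

section \<open>The nonlinear equations: existence, uniqueness and first-order expansion\<close>

definition lp :: "nat \<Rightarrow> nat \<Rightarrow> real" where "lp i j = lin_pred n Z \<theta> \<gamma> i j"

text \<open>The estimating equations recentered at the true parameter: \<open>u\<close> and
  \<open>x\<close> are deviations from it, and \<open>g\<close>, \<open>G\<close> stand for the
  values of \<open>F_fun\<close> and \<open>Q_fun\<close> there; see
  \<open>solution_iff_solves\<close>.\<close>

definition solves :: "(nat \<Rightarrow> real) \<Rightarrow> ('p \<Rightarrow> real) \<Rightarrow> (nat \<Rightarrow> real) \<Rightarrow> real^'p \<Rightarrow> bool" where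
  "solves g G u x \<longleftrightarrow>
    (\<forall>a\<in>{1..2 * n - 1}. divg n (\<lambda>i j. logistic (lp i j + lift u x i j) - logistic (lp i j)) a = g a) \<and>
    (\<forall>s. esum n (\<lambda>i j. (logistic (lp i j + lift u x i j) - logistic (lp i j)) * Z i j $ s) = G s)"

lemma increment_eq: "logistic (lp i j + h) - logistic (lp i j) = w i j * h + logistic_rem (lp i j) h"
  by (simp add: logistic_rem_def w_def lp_def)

lemma lift_diff: "lift u x i j - lift u' x' i j = lift (\<lambda>a. u a - u' a) (x - x') i j"
  by (simp add: lift_def pot_def beta_par_def inner_diff_right)

text \<open>The fixed point is taken in the edge increments \<open>h i j\<close>: one step of the Newton iteration with the
  Jacobian frozen at the true parameter halves their sup distance.\<close>

lemma nonlinear_solvable: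
  assumes eq1: "\<And>a. a \<in> {1..2 * n - 1} \<Longrightarrow> divg n (\<lambda>i j. w i j * lift u0 x0 i j) a = g a"
    and eq2: "\<And>s. esum n (\<lambda>i j. w i j * lift u0 x0 i j * Z i j $ s) = G s"
    and small: "\<And>i j. i \<in> {1..n} \<Longrightarrow> j \<in> {1..n} \<Longrightarrow> i \<noteq> j \<Longrightarrow> \<bar>lift u0 x0 i j\<bar> \<le> \<delta> / 2"
    and contr: "\<Lambda> * \<delta> \<le> 1 / 2"
  shows "\<exists>u x. solves g G u x \<and>
    (\<forall>i\<in>{1..n}. \<forall>j\<in>{1..n}. i \<noteq> j \<longrightarrow> \<bar>lift u x i j\<bar> \<le> \<delta>)"
proof -
  define I where "I = {(i, j). i \<in> {1..n} \<and> j \<in> {1..n} \<and> i \<noteq> j}"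
  have d: "\<delta> \<ge> 0" using small[of 1 2] n3 by force
  define r where "r h i j = logistic_rem (lp i j) (h (i, j))" for h i j
  \<comment> \<open>One iteration step: linear equations with the second-order remainder of
    \<open>h\<close> moved to the right-hand side. Choice makes the solution a function of
    \<open>h\<close>.\<close>
  have "\<forall>h. \<exists>p. (\<forall>a\<in>{1..2 * n - 1}.
        divg n (\<lambda>i j. w i j * lift (fst p) (snd p) i j) a = g a - divg n (r h) a) \<and>
     (\<forall>s. esum n (\<lambda>i j. w i j * lift (fst p) (snd p) i j * Z i j $ s)
        = G s - esum n (\<lambda>i j. r h i j * Z i j $ s))"
    using linear_solve by simp
  from choice[OF this] obtain p where p: "\<forall>h. (\<forall>a\<in>{1..2 * n - 1}.
        divg n (\<lambda>i j. w i j * lift (fst (p h)) (snd (p h)) i j) a = g a - divg n (r h) a) \<and>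
     (\<forall>s. esum n (\<lambda>i j. w i j * lift (fst (p h)) (snd (p h)) i j * Z i j $ s)
        = G s - esum n (\<lambda>i j. r h i j * Z i j $ s))" by blast
  define U X where "U h = fst (p h)" and "X h = snd (p h)" for h
  have U: "divg n (\<lambda>i j. w i j * lift (U h) (X h) i j) a = g a - divg n (r h) a"
    if "a \<in> {1..2 * n - 1}" for h a
    using p that by (simp add: U_def X_def)
  have X: "esum n (\<lambda>i j. w i j * lift (U h) (X h) i j * Z i j $ s)
      = G s - esum n (\<lambda>i j. r h i j * Z i j $ s)" for h s
    using p by (simp add: U_def X_def)
  define T where "T h = (\<lambda>(i, j). lift (U h) (X h) i j)" for h
  have "\<exists>h. (\<forall>e\<in>I. \<bar>h e\<bar> \<le> \<delta>) \<and> (\<forall>e\<in>I. T h e = h e)"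
  proof (rule contraction_fixed_point[OF d])
    fix h assume h: "\<forall>e\<in>I. \<bar>h e\<bar> \<le> \<delta>"
    show "\<forall>e\<in>I. \<bar>T h e\<bar> \<le> \<delta>"
    proof
      fix e assume "e \<in> I"
      then obtain i j where e: "e = (i, j)" and ij: "i \<in> {1..n}" "j \<in> {1..n}" "i \<noteq> j"
        by (auto simp: I_def)
      \<comment> \<open>The new iterate differs from the pure linear step \<open>u0\<close>,
        \<open>x0\<close> by the response to the remainder, which is at most
        \<open>\<Lambda> * \<delta>^2\<close> and so uses only the other half of the radius.\<close>
      have "\<bar>lift (\<lambda>a. u0 a - U h a) (x0 - X h) i j\<bar> \<le> \<Lambda> * \<delta>\<^sup>2"
      proof (rule linear_edge_bound[where r = "r h", OF _ _ _ ij])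
        show "divg n (\<lambda>i j. w i j * lift (\<lambda>a. u0 a - U h a) (x0 - X h) i j) a = divg n (r h) a"
          if "a \<in> {1..2 * n - 1}" for a
          using eq1[OF that] U[OF that, of h]
          by (simp add: lift_diff[symmetric] right_diff_distrib divg_diff)
        show "esum n (\<lambda>i j. w i j * lift (\<lambda>a. u0 a - U h a) (x0 - X h) i j * Z i j $ s)
            = esum n (\<lambda>i j. r h i j * Z i j $ s)" for s
          using eq2[of s] X[of h s]
          by (simp add: lift_diff[symmetric] right_diff_distrib left_diff_distrib esum_diff)
        show "\<bar>r h i j\<bar> \<le> \<delta>\<^sup>2" if "i \<in> {1..n}" "j \<in> {1..n}" "i \<noteq> j" for i j
          unfolding r_def by (rule logistic_rem_bound) (use h that in \<open>auto simp: I_def\<close>)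
      qed
      also have "\<Lambda> * \<delta>\<^sup>2 \<le> \<delta> / 2"
        using mult_right_mono[OF contr d] by (simp add: power2_eq_square mult_ac)
      finally have "\<bar>lift u0 x0 i j - T h e\<bar> \<le> \<delta> / 2"
        by (simp add: e T_def lift_diff)
      then show "\<bar>T h e\<bar> \<le> \<delta>" using small[OF ij] by linarith
    qed
  next
    fix h h' c
    assume h: "\<forall>e\<in>I. \<bar>h e\<bar> \<le> \<delta>" and h': "\<forall>e\<in>I. \<bar>h' e\<bar> \<le> \<delta>" and c: "\<forall>e\<in>I. \<bar>h e - h' e\<bar> \<le> c"
    show "\<forall>e\<in>I. \<bar>T h e - T h' e\<bar> \<le> c / 2"
    proof
      fix e assume eI: "e \<in> I"
      then obtain i j where e: "e = (i, j)" and ij: "i \<in> {1..n}" "j \<in> {1..n}" "i \<noteq> j"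
        by (auto simp: I_def)
      have c0: "c \<ge> 0" using c eI by force
      \<comment> \<open>The remainder enters the right-hand side with a minus sign; hence the primed
        solution comes first.\<close>
      have "\<bar>lift (\<lambda>a. U h' a - U h a) (X h' - X h) i j\<bar> \<le> \<Lambda> * (\<delta> * c)"
      proof (rule linear_edge_bound[where r = "\<lambda>i j. r h i j - r h' i j", OF _ _ _ ij])
        show "divg n (\<lambda>i j. w i j * lift (\<lambda>a. U h' a - U h a) (X h' - X h) i j) a
            = divg n (\<lambda>i j. r h i j - r h' i j) a" if "a \<in> {1..2 * n - 1}" for a
          using U[OF that, of h'] U[OF that, of h]
          by (simp add: lift_diff[symmetric] right_diff_distrib divg_diff)
        show "esum n (\<lambda>i j. w i j * lift (\<lambda>a. U h' a - U h a) (X h' - X h) i j * Z i j $ s)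
            = esum n (\<lambda>i j. (r h i j - r h' i j) * Z i j $ s)" for s
          using X[of h' s] X[of h s]
          by (simp add: lift_diff[symmetric] right_diff_distrib left_diff_distrib esum_diff)
        show "\<bar>r h i j - r h' i j\<bar> \<le> \<delta> * c" if "i \<in> {1..n}" "j \<in> {1..n}" "i \<noteq> j" for i j
        proof -
          have "\<bar>r h i j - r h' i j\<bar> \<le> \<delta> * \<bar>h (i, j) - h' (i, j)\<bar>"
            unfolding r_def by (rule logistic_rem_lipschitz) (use h h' that in \<open>auto simp: I_def\<close>)
          also have "\<dots> \<le> \<delta> * c" using c that d by (intro mult_left_mono) (auto simp: I_def)
          finally show ?thesis .
        qed
      qed
      also have "\<Lambda> * (\<delta> * c) \<le> c / 2"
        using mult_right_mono[OF contr c0] by (simp add: mult_ac)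
      finally show "\<bar>T h e - T h' e\<bar> \<le> c / 2"
        by (simp add: e T_def lift_diff[symmetric] abs_minus_commute)
    qed
  qed
  then obtain h where h: "\<And>e. e \<in> I \<Longrightarrow> \<bar>h e\<bar> \<le> \<delta>" "\<And>e. e \<in> I \<Longrightarrow> T h e = h e" by blast
  have hl: "lift (U h) (X h) i j = h (i, j)" if "i \<in> {1..n}" "j \<in> {1..n}" "i \<noteq> j" for i j
    using h(2)[of "(i, j)"] that by (auto simp: I_def T_def)
  have inc: "logistic (lp i j + lift (U h) (X h) i j) - logistic (lp i j)
      = w i j * lift (U h) (X h) i j + r h i j" if "i \<in> {1..n}" "j \<in> {1..n}" "i \<noteq> j" for i j
    unfolding increment_eq r_def hl[OF that] ..
  have "solves g G (U h) (X h)"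
    unfolding solves_def
  proof (intro conjI ballI allI)
    fix a assume a: "a \<in> {1..2 * n - 1}"
    have "divg n (\<lambda>i j. logistic (lp i j + lift (U h) (X h) i j) - logistic (lp i j)) a
        = divg n (\<lambda>i j. w i j * lift (U h) (X h) i j + r h i j) a"
      by (rule divg_cong[OF inc]) (use a in auto)
    then show "divg n (\<lambda>i j. logistic (lp i j + lift (U h) (X h) i j) - logistic (lp i j)) a = g a"
      using U[OF a, of h] by (simp add: divg_add)
  next
    fix s
    have "esum n (\<lambda>i j. (logistic (lp i j + lift (U h) (X h) i j) - logistic (lp i j)) * Z i j $ s)
        = esum n (\<lambda>i j. w i j * lift (U h) (X h) i j * Z i j $ s + r h i j * Z i j $ s)"
      by (rule esum_cong) (subst inc, assumption+, rule distrib_right)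
    then show "esum n (\<lambda>i j. (logistic (lp i j + lift (U h) (X h) i j) - logistic (lp i j)) * Z i j $ s)
        = G s"
      using X[of h s] by (simp add: esum_add)
  qed
  moreover have "\<forall>i\<in>{1..n}. \<forall>j\<in>{1..n}. i \<noteq> j \<longrightarrow> \<bar>lift (U h) (X h) i j\<bar> \<le> \<delta>"
    using h(1) hl by (auto simp: I_def)
  ultimately show ?thesis by blast
qed

text \<open>\<open>D\<close> has divergence 0 and is orthogonal to all covariates, while the
  difference \<open>L\<close> of the linear predictors is a combination of potentials and
  covariates; hence their pairing vanishes. Monotonicity makes each term nonnegative, and strict
  monotonicity gives \<open>L = 0\<close> on every edge. Invertibility of \<open>Hm\<close> and of
  \<open>V\<close> then identifies the parameters themselves.\<close>

lemma nonlinear_unique: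
  assumes s1: "solves g G u x" and s2: "solves g G u' x'"
  shows "x = x'" "a \<in> {1..2 * n - 1} \<Longrightarrow> u a = u' a"
proof -
  define A where "A u x i j = logistic (lp i j + lift u x i j) - logistic (lp i j)" for u x i j
  define D where "D i j = A u x i j - A u' x' i j" for i j
  define L where "L i j = lift u x i j - lift u' x' i j" for i j
  have AS: "divg n (A v z) a = g a" "esum n (\<lambda>i j. A v z i j * Z i j $ s) = G s"
    if "solves g G v z" "a \<in> {1..2 * n - 1}" for v z a s
    using that by (auto simp only: solves_def A_def[abs_def])
  have AS: "\<And>a. a \<in> {1..2 * n - 1} \<Longrightarrow> divg n (A u x) a = g a"
    "\<And>a. a \<in> {1..2 * n - 1} \<Longrightarrow> divg n (A u' x') a = g a"
    "\<And>s. esum n (\<lambda>i j. A u x i j * Z i j $ s) = G s"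
    "\<And>s. esum n (\<lambda>i j. A u' x' i j * Z i j $ s) = G s"
    using AS[OF s1] AS[OF s2] AS(2)[OF s1, of 1] AS(2)[OF s2, of 1] n3 by auto
  have D1: "divg n D a = 0" if "a \<in> {1..2 * n - 1}" for a
  proof -
    have "divg n D a = divg n (A u x) a - divg n (A u' x') a"
      unfolding D_def[abs_def] by (rule divg_diff)
    also have "\<dots> = g a - g a"
      using that by (simp only: AS)
    finally show ?thesis by simp
  qed
  have D2: "esum n (\<lambda>i j. D i j * Z i j $ s) = 0" for s
  proof -
    have "esum n (\<lambda>i j. D i j * Z i j $ s)
        = esum n (\<lambda>i j. A u x i j * Z i j $ s) - esum n (\<lambda>i j. A u' x' i j * Z i j $ s)"
      unfolding D_def left_diff_distrib by (rule esum_diff)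
    also have "\<dots> = G s - G s"
      by (simp only: AS)
    finally show ?thesis by simp
  qed
  have L: "L i j = lift (\<lambda>a. u a - u' a) (x - x') i j" for i j by (simp add: L_def lift_diff)
  have "esum n (\<lambda>i j. D i j * L i j)
      = esum n (\<lambda>i j. D i j * pot n (\<lambda>a. u a - u' a) i j
          + (\<Sum>s\<in>UNIV. (x - x') $ s * (D i j * Z i j $ s)))"
    unfolding L lift_def inner_vec_def
    by (intro esum_cong) (simp add: sum_distrib_left distrib_left mult_ac)
  also have "\<dots> = 0"
    by (simp add: esum_add esum_sum esum_cmult D2 pot_divg_adjoint[OF n1, symmetric] D1 del: One_nat_def)
  finally have zero: "esum n (\<lambda>i j. D i j * L i j) = 0" .
  have sign: "0 \<le> D i j * L i j" "D i j * L i j = 0 \<Longrightarrow> L i j = 0" for i j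
  proof -
    have D: "D i j = logistic (lp i j + lift u x i j) - logistic (lp i j + lift u' x' i j)"
      by (simp add: D_def A_def)
    have "L i j > 0 \<Longrightarrow> D i j > 0" "L i j < 0 \<Longrightarrow> D i j < 0"
      unfolding D L_def by (auto intro: logistic_strict_mono)
    then show "0 \<le> D i j * L i j" "D i j * L i j = 0 \<Longrightarrow> L i j = 0"
      by (metis less_eq_real_def linorder_neqE_linordered_idom mult_neg_neg mult_pos_pos mult_zero_right)
        (use \<open>L i j > 0 \<Longrightarrow> D i j > 0\<close> \<open>L i j < 0 \<Longrightarrow> D i j < 0\<close> in \<open>metis
          linorder_neqE_linordered_idom mult_eq_0_iff less_irrefl\<close>)
  qed
  have L0: "L i j = 0" if ij: "i \<in> {1..n}" "j \<in> {1..n}" "i \<noteq> j" for i j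
  proof (rule sign(2))
    have "\<forall>i\<in>{1..n}. (\<Sum>j\<in>{1..n} - {i}. D i j * L i j) = 0"
      using zero unfolding esum_def
      by (subst (asm) sum_nonneg_eq_0_iff) (auto intro!: sum_nonneg sign)
    then have "(\<Sum>j\<in>{1..n} - {i}. D i j * L i j) = 0" using ij by blast
    then have "\<forall>j\<in>{1..n} - {i}. D i j * L i j = 0"
      by (subst (asm) sum_nonneg_eq_0_iff) (auto intro!: sign)
    then show "D i j * L i j = 0" using ij by blast
  qed
  have lin1: "divg n (\<lambda>i j. w i j * lift (\<lambda>a. u a - u' a) (x - x') i j) a = 0"
    if "a \<in> {1..2 * n - 1}" for a
  proof -
    have "divg n (\<lambda>i j. w i j * L i j) a = divg n (\<lambda>i j. 0) a"
      by (rule divg_cong) (use L0 that in auto)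
    then show ?thesis by (simp add: L divg_def)
  qed
  have lin2: "esum n (\<lambda>i j. w i j * lift (\<lambda>a. u a - u' a) (x - x') i j * Z i j $ s) = 0" for s
  proof -
    have "esum n (\<lambda>i j. w i j * L i j * Z i j $ s) = esum n (\<lambda>i j. 0)"
      by (rule esum_cong) (use L0 in auto)
    then show ?thesis by (simp add: L esum_def)
  qed
  have "\<bar>(x - x') $ t\<bar> \<le> lam / (real n)\<^sup>2 * 0" for t
    by (rule linear_x_bound[OF lin1 lin2]) auto
  then have "(x - x') $ t = 0" for t by simp
  then show xx: "x = x'" by (simp add: vec_eq_iff)
  show "u a = u' a" if a: "a \<in> {1..2 * n - 1}"
    using V_injective[of "\<lambda>a. u a - u' a", OF _ a] lin1 xx by (simp add: lift_def)
qed

text \<open>Size of the first Newton step. The signed sum of the data is their implicit value at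
  node \<open>2 n\<close> by \<open>divg_last\<close>, and \<open>linear_u_bound\<close> asks for a
  bound there as well.\<close>

lemma linear_step_bound:
  assumes eq1: "\<And>a. a \<in> {1..2 * n - 1} \<Longrightarrow> divg n (\<lambda>i j. w i j * lift u x i j) a = g a"
    and eq2: "\<And>s. esum n (\<lambda>i j. w i j * lift u x i j * Z i j $ s) = G s"
    and g: "\<And>a. a \<in> {1..2 * n - 1} \<Longrightarrow> \<bar>g a\<bar> \<le> \<phi>"
    and gl: "\<bar>\<Sum>a=1..2 * n - 1. (if a \<le> n then 1 else - 1) * g a\<bar> \<le> \<phi>"
    and G: "\<And>s. \<bar>G s - (\<Sum>a=1..2 * n - 1. P s a * g a)\<bar> \<le> \<Gamma>"
    and ij: "i \<in> {1..n}" "j \<in> {1..n}" "i \<noteq> j"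
  shows "\<bar>lift u x i j\<bar> \<le> 2 * (K * (\<phi> + real n * (real CARD('p) * q * (lam / (real n)\<^sup>2 * \<Gamma>) / 4)))
    + real CARD('p) * q * (lam / (real n)\<^sup>2 * \<Gamma>)"
proof -
  have x: "\<bar>x $ t\<bar> \<le> lam / (real n)\<^sup>2 * \<Gamma>" for t
    by (rule linear_x_bound[OF eq1 eq2 G]) auto
  have f: "\<bar>divg n (\<lambda>i j. w i j * lift u x i j) a\<bar> \<le> \<phi>" if a: "a \<in> {1..2 * n}" for a
  proof (cases "a = 2 * n")
    case True
    have "divg n (\<lambda>i j. w i j * lift u x i j) a = (\<Sum>a=1..2 * n - 1. (if a \<le> n then 1 else - 1) * g a)"
      unfolding True divg_last[OF n1] by (intro sum.cong refl) (simp add: eq1)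
    then show ?thesis using gl by simp
  qed (use eq1 g a in auto)
  show ?thesis
    by (rule lift_bound[OF linear_u_bound[OF f x] x ij])
qed

text \<open>\<open>y\<close> is the response of the node parameters to \<open>g\<close> alone. Its
  distance from \<open>u\<close> has two sources, the second-order remainder and the covariate
  effect \<open>x\<close>; both are treated as additional data of the node equations.\<close>

lemma expansion:
  assumes sol: "solves g G u x"
    and small: "\<And>i j. i \<in> {1..n} \<Longrightarrow> j \<in> {1..n} \<Longrightarrow> i \<noteq> j \<Longrightarrow> \<bar>lift u x i j\<bar> \<le> \<delta>"
    and y: "\<And>a. a \<in> {1..2 * n - 1} \<Longrightarrow> divg n (\<lambda>i j. w i j * pot n y i j) a = g a"
    and G: "\<And>s. \<bar>G s - (\<Sum>a=1..2 * n - 1. P s a * g a)\<bar> \<le> \<Gamma>"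
    and a: "a \<in> {1..2 * n - 1}"
  shows "\<bar>u a - y a\<bar> \<le> K * (real n * \<delta>\<^sup>2
    + real n * (real CARD('p) * q * (lam / (real n)\<^sup>2 * (\<Gamma> + (real n)\<^sup>2 * (\<delta>\<^sup>2 * \<kappa>))) / 4))"
proof -
  define r where "r i j = logistic_rem (lp i j) (lift u x i j)" for i j
  have r: "\<bar>r i j\<bar> \<le> \<delta>\<^sup>2" if "i \<in> {1..n}" "j \<in> {1..n}" "i \<noteq> j" for i j
    unfolding r_def by (rule logistic_rem_bound[OF small[OF that]])
  have e1: "divg n (\<lambda>i j. w i j * lift u x i j) a = g a - divg n r a" if "a \<in> {1..2 * n - 1}" for a
  proof -
    have "divg n (\<lambda>i j. w i j * lift u x i j + r i j) a = g a"
      using sol that unfolding solves_def increment_eq r_def by blast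
    then show ?thesis by (simp add: divg_add)
  qed
  have e2: "esum n (\<lambda>i j. w i j * lift u x i j * Z i j $ s) = G s - esum n (\<lambda>i j. r i j * Z i j $ s)" for s
  proof -
    have "esum n (\<lambda>i j. (w i j * lift u x i j + r i j) * Z i j $ s) = G s"
      using sol by (simp add: solves_def increment_eq r_def)
    then show ?thesis by (simp add: distrib_right esum_add)
  qed
  have x: "\<bar>x $ t\<bar> \<le> lam / (real n)\<^sup>2 * (\<Gamma> + (real n)\<^sup>2 * (\<delta>\<^sup>2 * \<kappa>))" for t
  proof (rule linear_x_bound[OF e1 e2])
    fix s
    have "G s - esum n (\<lambda>i j. r i j * Z i j $ s) - (\<Sum>a=1..2 * n - 1. P s a * (g a - divg n r a))
       = (G s - (\<Sum>a=1..2 * n - 1. P s a * g a))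
        - (esum n (\<lambda>i j. r i j * Z i j $ s) - (\<Sum>a=1..2 * n - 1. P s a * divg n r a))"
      by (simp add: right_diff_distrib sum_subtractf)
    moreover have "\<bar>esum n (\<lambda>i j. r i j * Z i j $ s) - (\<Sum>a=1..2 * n - 1. P s a * divg n r a)\<bar>
        \<le> (real n)\<^sup>2 * (\<delta>\<^sup>2 * \<kappa>)"
      by (rule edge_data_bound[OF r]) auto
    ultimately show "\<bar>G s - esum n (\<lambda>i j. r i j * Z i j $ s)
        - (\<Sum>a=1..2 * n - 1. P s a * (g a - divg n r a))\<bar> \<le> \<Gamma> + (real n)\<^sup>2 * (\<delta>\<^sup>2 * \<kappa>)"
      using G[of s] by linarith
  qed auto
  have f: "\<bar>divg n (\<lambda>i j. w i j * lift (\<lambda>a. u a - y a) x i j) a\<bar> \<le> real n * \<delta>\<^sup>2" if "a \<in> {1..2 * n}" for a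
  proof -
    have "divg n (\<lambda>i j. w i j * lift (\<lambda>a. u a - y a) x i j) a = divg n (\<lambda>i j. - 1 * r i j) a"
    proof (rule divg_determines[OF _ that])
      fix a assume a: "a \<in> {1..2 * n - 1}"
      have "divg n (\<lambda>i j. w i j * lift (\<lambda>a. u a - y a) x i j) a
          = divg n (\<lambda>i j. w i j * lift u x i j - w i j * pot n y i j) a"
      proof -
        have "lift (\<lambda>a. u a - y a) x i j = lift u x i j - pot n y i j" for i j
          by (simp add: lift_def pot_def beta_par_def)
        then show ?thesis by (simp add: right_diff_distrib)
      qed
      then show "divg n (\<lambda>i j. w i j * lift (\<lambda>a. u a - y a) x i j) a = divg n (\<lambda>i j. - 1 * r i j) a"
        unfolding divg_cmult by (simp add: divg_diff e1[OF a] y[OF a])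
    qed
    moreover have "\<bar>divg n r a\<bar> \<le> real n * \<delta>\<^sup>2"
      by (rule divg_abs_le[OF r _ that]) auto
    ultimately show ?thesis unfolding divg_cmult by simp
  qed
  show ?thesis by (rule linear_u_bound[OF f x a])
qed

end

section \<open>The approximate inverse of V\<close>

context weighted_network
begin

definition vd :: "nat \<Rightarrow> real" where "vd i = V_mat n Z \<theta> \<gamma> i i"

definition vc :: real where "vc = V_corner n Z \<theta> \<gamma>"

lemma vd_eq: "i \<in> {1..n} \<Longrightarrow> vd i = (\<Sum>j\<in>{1..n} - {i}. w i j)"
  by (simp add: vd_def V_mat_def w_def)

text \<open>Nonzero off-diagonal entries of \<open>V\<close> join a sender to a receiver, so
  \<open>V_border\<close> is \<open>V\<close> applied to the sign vector, up to sign. By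
  \<open>divg_last\<close> its sum is a divergence at node \<open>2 n\<close>, where the sign vector
  has potential 1 on every incoming edge.\<close>

lemma vc_eq: "vc = (\<Sum>l\<in>{1..n} - {n}. w l n)"
proof -
  define sg where "sg a = (if a \<le> n then 1 else - 1 :: real)" for a
  have n1: "n \<ge> 1" using n3 by simp
  have border: "V_border n Z \<theta> \<gamma> a = sg a * divg n (\<lambda>i j. w i j * pot n sg i j) a"
    if a: "a \<in> {1..2 * n - 1}" for a
  proof -
    have "(\<Sum>c=1..2 * n - 1. V_mat n Z \<theta> \<gamma> a c * sg c)
        = V_mat n Z \<theta> \<gamma> a a * sg a + (\<Sum>c\<in>{1..2 * n - 1} - {a}. V_mat n Z \<theta> \<gamma> a c * sg c)"
      using a by (simp add: sum.remove)
    also have "(\<Sum>c\<in>{1..2 * n - 1} - {a}. V_mat n Z \<theta> \<gamma> a c * sg c)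
        = (\<Sum>c\<in>{1..2 * n - 1} - {a}. - sg a * V_mat n Z \<theta> \<gamma> a c)"
      by (intro sum.cong refl) (auto simp: V_mat_def sg_def)
    also have "\<dots> = - sg a * (\<Sum>c\<in>{1..2 * n - 1} - {a}. V_mat n Z \<theta> \<gamma> a c)"
      by (simp add: sum_distrib_left)
    finally have "divg n (\<lambda>i j. w i j * pot n sg i j) a
        = sg a * (V_mat n Z \<theta> \<gamma> a a - (\<Sum>c\<in>{1..2 * n - 1} - {a}. V_mat n Z \<theta> \<gamma> a c))"
      unfolding V_apply[OF a] by (simp add: algebra_simps)
    moreover have "sg a * sg a = 1" by (simp add: sg_def)
    ultimately show ?thesis
      unfolding V_border_def by (simp add: mult.assoc[symmetric])
  qed
  have "vc = (\<Sum>a=1..2 * n - 1. sg a * divg n (\<lambda>i j. w i j * pot n sg i j) a)"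
    unfolding vc_def V_corner_def by (intro sum.cong refl border) auto
  also have "\<dots> = divg n (\<lambda>i j. w i j * pot n sg i j) (2 * n)"
    unfolding divg_last[OF n1] sg_def ..
  also have "\<dots> = (\<Sum>l\<in>{1..n} - {n}. w l n)"
    using n1 by (auto simp: divg_def pot_def beta_par_def sg_def intro!: sum.cong)
  finally show ?thesis .
qed

lemma w_sum_bounds:
  assumes "i \<in> {1..n}"
  shows "m * real (n - 1) \<le> (\<Sum>j\<in>{1..n} - {i}. w i j)" "(\<Sum>j\<in>{1..n} - {i}. w i j) \<le> real (n - 1) / 4"
    "m * real (n - 1) \<le> (\<Sum>j\<in>{1..n} - {i}. w j i)" "(\<Sum>j\<in>{1..n} - {i}. w j i) \<le> real (n - 1) / 4"
proof -
  have c: "(\<Sum>j\<in>{1..n} - {i}. b) = real (n - 1) * b" for b :: real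
    using assms by simp
  have "(\<Sum>j\<in>{1..n} - {i}. m) \<le> (\<Sum>j\<in>{1..n} - {i}. w i j)"
    "(\<Sum>j\<in>{1..n} - {i}. m) \<le> (\<Sum>j\<in>{1..n} - {i}. w j i)"
    using assms by (intro sum_mono w_ge; force)+
  moreover have "(\<Sum>j\<in>{1..n} - {i}. w i j) \<le> (\<Sum>j\<in>{1..n} - {i}. 1 / 4)"
    "(\<Sum>j\<in>{1..n} - {i}. w j i) \<le> (\<Sum>j\<in>{1..n} - {i}. 1 / 4)"
    using assms by (intro sum_mono w_le; force)+
  ultimately show "m * real (n - 1) \<le> (\<Sum>j\<in>{1..n} - {i}. w i j)"
    "(\<Sum>j\<in>{1..n} - {i}. w i j) \<le> real (n - 1) / 4"
    "m * real (n - 1) \<le> (\<Sum>j\<in>{1..n} - {i}. w j i)"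
    "(\<Sum>j\<in>{1..n} - {i}. w j i) \<le> real (n - 1) / 4"
    unfolding c by (simp_all add: mult.commute)
qed

lemma mn_pos: "0 < m * real (n - 1)" using m_pos n3 by simp

lemma vd_bounds:
  assumes "i \<in> {1..n}"
  shows "m * real (n - 1) \<le> vd i" "vd i \<le> real (n - 1) / 4" "vd i > 0"
  using w_sum_bounds[OF assms] vd_eq[OF assms] mn_pos by linarith+

lemma vc_bounds: "m * real (n - 1) \<le> vc" "vc \<le> real (n - 1) / 4" "vc > 0"
  using w_sum_bounds[of n] vc_eq mn_pos n3 by (auto simp del: One_nat_def)

text \<open>The \<open>i\<close>-th column of \<open>S\<^sup>*\<close>, for \<open>i \<le> n\<close>.\<close>

definition Scol :: "nat \<Rightarrow> nat \<Rightarrow> real" where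
  "Scol i a = (if a \<le> n then (if a = i then 1 / vd i else 0) + 1 / vc else - 1 / vc)"

text \<open>This explains the shape of \<open>S\<close>: the potential lives on the row of sender
  \<open>i\<close> and on the column of receiver \<open>n\<close>, and after multiplication by the
  weights each of the two carries total mass 1.\<close>

lemma pot_Scol:
  assumes "l \<in> {1..n}" "j \<in> {1..n}"
  shows "pot n (Scol i) l j = (if l = i then 1 / vd i else 0) + (if j = n then 1 / vc else 0)"
  using assms by (auto simp: pot_def beta_par_def Scol_def)

text \<open>The exact column \<open>Y\<close> of the inverse has divergence 1 at node
  \<open>i\<close>, hence also 1 at node \<open>2 n\<close>, and 0 elsewhere. \<open>Scol i\<close>
  has the same divergences up to the contribution of a single edge at each node, which is at most
  \<open>(1 / 4) / (m (n - 1))\<close>. Stability converts this residual into an entrywise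
  bound.\<close>

lemma V_inverse_column_approx:
  assumes i: "i \<in> {1..n}"
  shows "\<exists>Y. (\<forall>a\<in>{1..2 * n - 1}. divg n (\<lambda>i j. w i j * pot n Y i j) a = (if a = i then 1 else 0)) \<and>
    (\<forall>a\<in>{1..2 * n - 1}. \<bar>Y a - Scol i a\<bar> \<le> K * (1 / (4 * (m * real (n - 1)))))"
proof -
  have n1: "n \<ge> 1" using n3 by simp
  obtain Y where Y: "\<And>a. a \<in> {1..2 * n - 1} \<Longrightarrow>
      divg n (\<lambda>i j. w i j * pot n Y i j) a = (if a = i then 1 else 0)"
    using V_solve[of "\<lambda>a. if a = i then 1 else 0"] by blast
  have Yl: "divg n (\<lambda>i j. w i j * pot n Y i j) (2 * n) = 1"
  proof -
    have "divg n (\<lambda>i j. w i j * pot n Y i j) (2 * n)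
        = (\<Sum>a=1..2 * n - 1. (if a \<le> n then 1 else - 1) * (if a = i then 1 else 0))"
      unfolding divg_last[OF n1] by (intro sum.cong refl) (simp add: Y)
    also have "\<dots> = (\<Sum>a=1..2 * n - 1. if a = i then 1 else 0)"
      by (intro sum.cong refl) (use i in auto)
    also have "\<dots> = 1"
    proof -
      have "i \<in> {1..2 * n - 1}" using i unfolding atLeastAtMost_iff by linarith
      then show ?thesis by simp
    qed
    finally show ?thesis .
  qed
  have ratio: "\<bar>w k l / v\<bar> \<le> 1 / (4 * (m * real (n - 1)))"
    if "k \<in> {1..n}" "l \<in> {1..n}" "k \<noteq> l" "m * real (n - 1) \<le> v" for k l v
  proof -
    have a: "w k l / v \<le> (1 / 4) / (m * real (n - 1))"
      by (rule frac_le[OF _ w_le[OF that(1-3)] mn_pos that(4)]) simp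
    have b: "w k l / v \<ge> 0"
      using w_ge[OF that(1-3)] m_pos mn_pos that(4) by (intro divide_nonneg_nonneg) linarith+
    show ?thesis unfolding abs_of_nonneg[OF b] using a by simp
  qed
  have zero: "0 \<le> 1 / (4 * (m * real (n - 1)))"
    by (rule divide_nonneg_pos) (use mn_pos in linarith)+
  have res: "\<bar>divg n (\<lambda>k l. w k l * pot n (\<lambda>a. Y a - Scol i a) k l) a\<bar> \<le> 1 / (4 * (m * real (n - 1)))"
    if a: "a \<in> {1..2 * n}" for a
  proof -
    have "divg n (\<lambda>k l. w k l * pot n (\<lambda>a. Y a - Scol i a) k l) a
        = divg n (\<lambda>k l. w k l * pot n Y k l - w k l * pot n (Scol i) k l) a"
    proof -
      have "pot n (\<lambda>a. Y a - Scol i a) k l = pot n Y k l - pot n (Scol i) k l" for k l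
        by (simp add: pot_def beta_par_def)
      then show ?thesis by (simp add: right_diff_distrib)
    qed
    also have "\<dots> = divg n (\<lambda>k l. w k l * pot n Y k l) a - divg n (\<lambda>k l. w k l * pot n (Scol i) k l) a"
      by (rule divg_diff)
    finally have eq: "divg n (\<lambda>k l. w k l * pot n (\<lambda>a. Y a - Scol i a) k l) a
        = divg n (\<lambda>k l. w k l * pot n Y k l) a - divg n (\<lambda>k l. w k l * pot n (Scol i) k l) a" .
    show ?thesis
    proof (cases "a \<le> n")
      case True
      have "divg n (\<lambda>k l. w k l * pot n (Scol i) k l) a
          = (\<Sum>l\<in>{1..n} - {a}. w a l * pot n (Scol i) a l)"
        using True by (simp add: divg_def)
      also have "\<dots> = (\<Sum>l\<in>{1..n} - {a}. w a l * (if a = i then 1 / vd i else 0) + (if l = n then w a l / vc else 0))"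
        by (rule sum.cong[OF refl]) (use True a in \<open>auto simp: pot_Scol distrib_left\<close>)
      also have "\<dots> = (\<Sum>l\<in>{1..n} - {a}. w a l) * (if a = i then 1 / vd i else 0)
          + (if a = n then 0 else w a n / vc)"
        using True n1 by (simp add: sum.distrib sum_distrib_right)
      also have "(\<Sum>l\<in>{1..n} - {a}. w a l) * (if a = i then 1 / vd i else 0) = (if a = i then 1 else 0)"
        using vd_eq[OF i] vd_bounds(3)[OF i] by auto
      finally have "divg n (\<lambda>k l. w k l * pot n Y k l) a - divg n (\<lambda>k l. w k l * pot n (Scol i) k l) a
          = - (if a = n then 0 else w a n / vc)"
        using Y[of a] True a by auto
      then show ?thesis unfolding eq using ratio[of a n vc] vc_bounds True a n1 zero by auto
    next
      case False
      then have an: "a - n \<in> {1..n}" using a by auto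
      have "divg n (\<lambda>k l. w k l * pot n (Scol i) k l) a
          = (\<Sum>k\<in>{1..n} - {a - n}. w k (a - n) * pot n (Scol i) k (a - n))"
        using False by (simp add: divg_def)
      also have "\<dots> = (\<Sum>k\<in>{1..n} - {a - n}. (if k = i then w k (a - n) / vd i else 0)
              + w k (a - n) * (if a - n = n then 1 / vc else 0))"
        by (rule sum.cong[OF refl]) (use an in \<open>auto simp: pot_Scol distrib_left\<close>)
      also have "\<dots> = (if a - n = i then 0 else w i (a - n) / vd i)
          + (\<Sum>k\<in>{1..n} - {a - n}. w k (a - n)) * (if a - n = n then 1 / vc else 0)"
        using i by (simp add: sum.distrib sum_distrib_right)
      also have "(\<Sum>k\<in>{1..n} - {a - n}. w k (a - n)) * (if a - n = n then 1 / vc else 0)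
          = (if a = 2 * n then 1 else 0)"
      proof (cases "a - n = n")
        case True
        then show ?thesis using vc_eq vc_bounds(3) False by auto
      qed auto
      finally have S: "divg n (\<lambda>k l. w k l * pot n (Scol i) k l) a
          = (if a - n = i then 0 else w i (a - n) / vd i) + (if a = 2 * n then 1 else 0)" .
      have "divg n (\<lambda>k l. w k l * pot n Y k l) a = (if a = 2 * n then 1 else 0)"
        using Y[of a] Yl a False i by auto
      then have "divg n (\<lambda>k l. w k l * pot n Y k l) a - divg n (\<lambda>k l. w k l * pot n (Scol i) k l) a
          = - (if a - n = i then 0 else w i (a - n) / vd i)" using S by simp
      then show ?thesis unfolding eq using ratio[of i "a - n" "vd i"] vd_bounds[OF i] i an zero by auto
    qed
  qed
  show ?thesis using Y stability[OF res] by blast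
qed

text \<open>Symmetry of \<open>V\<close>: an entry of the solution is the data paired with the
  corresponding column of the inverse, and \<open>Y\<close> is that column.\<close>

lemma V_dual:
  assumes "i \<in> {1..n}"
    and Y: "\<And>a. a \<in> {1..2 * n - 1} \<Longrightarrow> divg n (\<lambda>i j. w i j * pot n Y i j) a = (if a = i then 1 else 0)"
    and y: "\<And>a. a \<in> {1..2 * n - 1} \<Longrightarrow> divg n (\<lambda>i j. w i j * pot n y i j) a = g a"
  shows "y i = (\<Sum>a=1..2 * n - 1. Y a * g a)"
proof -
  have n1: "n \<ge> 1" using n3 by simp
  have "y i = (\<Sum>a=1..2 * n - 1. y a * (if a = i then 1 else 0))"
  proof -
    have "i \<in> {1..2 * n - 1}" using assms(1) unfolding atLeastAtMost_iff by linarith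
    then show ?thesis by (simp add: if_distrib[of "(*) _"] cong: if_cong)
  qed
  also have "\<dots> = (\<Sum>a=1..2 * n - 1. y a * divg n (\<lambda>i j. w i j * pot n Y i j) a)"
    using Y by (intro sum.cong) auto
  also have "\<dots> = esum n (\<lambda>i j. w i j * pot n Y i j * pot n y i j)"
    by (rule pot_divg_adjoint[OF n1])
  also have "\<dots> = esum n (\<lambda>i j. w i j * pot n y i j * pot n Y i j)"
    by (intro esum_cong) simp
  also have "\<dots> = (\<Sum>a=1..2 * n - 1. Y a * divg n (\<lambda>i j. w i j * pot n y i j) a)"
    by (rule pot_divg_adjoint[OF n1, symmetric])
  also have "\<dots> = (\<Sum>a=1..2 * n - 1. Y a * g a)"
    using y by (intro sum.cong) auto
  finally show ?thesis .
qed

end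

section \<open>Sums of independent centered variables\<close>

lemma (in prob_space) indep_centered_sum:
  fixes X :: "'i \<Rightarrow> 'a \<Rightarrow> real"
  assumes "finite I" "indep_vars (\<lambda>_. borel) X I"
    and "\<And>i. i \<in> I \<Longrightarrow> integrable M (\<lambda>\<omega>. (X i \<omega>)\<^sup>2)" "\<And>i. i \<in> I \<Longrightarrow> expectation (X i) = 0"
  shows "integrable M (\<lambda>\<omega>. (\<Sum>i\<in>I. X i \<omega>)\<^sup>2) \<and> expectation (\<lambda>\<omega>. \<Sum>i\<in>I. X i \<omega>) = 0
    \<and> expectation (\<lambda>\<omega>. (\<Sum>i\<in>I. X i \<omega>)\<^sup>2) = (\<Sum>i\<in>I. expectation (\<lambda>\<omega>. (X i \<omega>)\<^sup>2))"
  using assms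
proof (induction I rule: finite_induct)
  case (insert i I)
  let ?S = "\<lambda>\<omega>. \<Sum>i\<in>I. X i \<omega>"
  have indep: "indep_vars (\<lambda>_. borel) X I"
    using insert.prems(1) by (rule indep_vars_subset) auto
  have [measurable]: "random_variable borel (X j)" if "j \<in> insert i I" for j
    using insert.prems(1) that by (auto simp: indep_vars_def)
  have [measurable]: "random_variable borel ?S" by (auto intro!: borel_measurable_sum)
  have IH: "integrable M (\<lambda>\<omega>. (?S \<omega>)\<^sup>2)" "expectation ?S = 0"
    "expectation (\<lambda>\<omega>. (?S \<omega>)\<^sup>2) = (\<Sum>i\<in>I. expectation (\<lambda>\<omega>. (X i \<omega>)\<^sup>2))"
    using insert.IH[OF indep] insert.prems(2,3) by auto
  have Xi: "integrable M (\<lambda>\<omega>. (X i \<omega>)\<^sup>2)" "expectation (X i) = 0" using insert.prems by auto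
  have int: "integrable M (X i)" "integrable M ?S"
    using Xi(1) IH(1) by (auto intro: square_integrable_imp_integrable)
  have iv: "indep_var borel (X i) borel ?S"
    using insert.hyps insert.prems(1) by (intro indep_vars_sum) auto
  have prod: "integrable M (\<lambda>\<omega>. X i \<omega> * ?S \<omega>)" "expectation (\<lambda>\<omega>. X i \<omega> * ?S \<omega>) = 0"
    using indep_var_integrable[OF iv int] indep_var_lebesgue_integral[OF iv int] Xi(2) by auto
  have sq: "(\<Sum>i\<in>insert i I. X i \<omega>)\<^sup>2 = (X i \<omega>)\<^sup>2 + (?S \<omega>)\<^sup>2 + 2 * (X i \<omega> * ?S \<omega>)" for \<omega>
    using insert.hyps by (simp add: power2_sum)
  show ?case
    unfolding sq using insert.hyps Xi IH int prod by simp
qed simp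

lemma (in prob_space) second_moment_tail:
  assumes "random_variable borel f" "integrable M (\<lambda>\<omega>. (f \<omega>)\<^sup>2)" "expectation f = 0"
    and "expectation (\<lambda>\<omega>. (f \<omega>)\<^sup>2) \<le> v" "0 < a"
  shows "prob {\<omega> \<in> space M. a \<le> \<bar>f \<omega>\<bar>} \<le> v / a\<^sup>2"
proof -
  have "prob {\<omega> \<in> space M. a \<le> \<bar>f \<omega> - expectation f\<bar>} \<le> variance f / a\<^sup>2"
    by (rule Chebyshev_inequality) (use assms in auto)
  also have "\<dots> \<le> v / a\<^sup>2" using assms by (intro divide_right_mono) auto
  finally show ?thesis using assms(3) by simp
qed

lemma exp_minus_half_taylor:
  assumes "0 \<le> (s :: real)"
  shows "\<bar>1 - s / 2 - exp (- s / 2)\<bar> \<le> s\<^sup>2 / 8"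
proof -
  have le: "1 - s / 2 \<le> exp (- s / 2)" using exp_ge_add_one_self[of "- s / 2"] by simp
  define f where "f x = 1 - x + x\<^sup>2 / 2 - exp (- x)" for x :: real
  have "f 0 \<le> f (s / 2)"
  proof (rule DERIV_nonneg_imp_nondecreasing[of 0 "s / 2" f])
    show "0 \<le> s / 2" using assms by simp
    fix x :: real
    have "(f has_real_derivative - 1 + x + exp (- x)) (at x)"
      unfolding f_def by (auto intro!: derivative_eq_intros)
    moreover have "0 \<le> - 1 + x + exp (- x)" using exp_ge_add_one_self[of "- x"] by simp
    ultimately show "\<exists>y. (f has_real_derivative y) (at x) \<and> 0 \<le> y" by blast
  qed
  then have "exp (- s / 2) \<le> 1 - s / 2 + s\<^sup>2 / 8" by (simp add: f_def power_divide)
  then show ?thesis using le by (simp add: abs_le_iff)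
qed

text \<open>A Lyapunov bound with explicit error, since both the summands and their coefficients
  will vary with the network. Each factor is compared with that of a centered normal variable of the
  same variance, at the cost of a third moment and \<open>(v i)^2\<close>; as all factors have
  modulus at most 1, these errors add up.\<close>

lemma (in prob_space) char_indep_sum_bound:
  fixes X :: "'i \<Rightarrow> 'a \<Rightarrow> real"
  assumes fin: "finite I" and indep: "indep_vars (\<lambda>_. borel) X I"
    and cube: "\<And>i. i \<in> I \<Longrightarrow> integrable M (\<lambda>\<omega>. \<bar>X i \<omega>\<bar> ^ 3)"
    and sq: "\<And>i. i \<in> I \<Longrightarrow> integrable M (\<lambda>\<omega>. (X i \<omega>)\<^sup>2)"
    and mean: "\<And>i. i \<in> I \<Longrightarrow> expectation (X i) = 0"
    and var: "\<And>i. i \<in> I \<Longrightarrow> expectation (\<lambda>\<omega>. (X i \<omega>)\<^sup>2) = v i"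
  shows "cmod (expectation (\<lambda>\<omega>. iexp (\<Sum>i\<in>I. X i \<omega>)) - complex_of_real (exp (- (\<Sum>i\<in>I. v i) / 2)))
    \<le> (\<Sum>i\<in>I. expectation (\<lambda>\<omega>. \<bar>X i \<omega>\<bar> ^ 3) + (v i)\<^sup>2)"
proof -
  have rv [measurable]: "random_variable borel (X i)" if "i \<in> I" for i
    using indep that by (auto simp: indep_vars_def)
  have [measurable]: "random_variable borel (\<lambda>\<omega>. \<Sum>i\<in>I. X i \<omega>)" by (intro borel_measurable_sum rv)
  have v0: "v i \<ge> 0" if "i \<in> I" for i using var[OF that] by (metis integral_nonneg_AE AE_I2 zero_le_power2)
  define \<phi> where "\<phi> i = char (distr M borel (X i)) 1" for i
  have "expectation (\<lambda>\<omega>. iexp (\<Sum>i\<in>I. X i \<omega>)) = char (distr M borel (\<lambda>\<omega>. \<Sum>i\<in>I. X i \<omega>)) 1"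
    unfolding char_def by (subst integral_distr) auto
  also have "\<dots> = (\<Prod>i\<in>I. \<phi> i)" unfolding \<phi>_def by (rule char_distr_sum[OF indep])
  finally have 1: "expectation (\<lambda>\<omega>. iexp (\<Sum>i\<in>I. X i \<omega>)) = (\<Prod>i\<in>I. \<phi> i)" .
  have 2: "complex_of_real (exp (- (\<Sum>i\<in>I. v i) / 2)) = (\<Prod>i\<in>I. complex_of_real (exp (- v i / 2)))"
    using fin by (simp add: sum_divide_distrib sum_negf[symmetric] exp_sum)
  have "cmod (\<phi> i - complex_of_real (exp (- v i / 2))) \<le> expectation (\<lambda>\<omega>. \<bar>X i \<omega>\<bar> ^ 3) + (v i)\<^sup>2"
    if i: "i \<in> I" for i
  proof -
    have int: "integrable M (X i)" using sq[OF i] rv[OF i] by (rule square_integrable_imp_integrable[rotated])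
    have "variance (X i) = v i" using mean[OF i] var[OF i] by simp
    then have "cmod (\<phi> i - (1 - 1\<^sup>2 * v i / 2))
        \<le> 1\<^sup>2 / 6 * expectation (\<lambda>\<omega>. min (6 * (X i \<omega>)\<^sup>2) (\<bar>1\<bar> * \<bar>X i \<omega>\<bar> ^ 3))"
      unfolding \<phi>_def by (intro char_approx3') (use rv[OF i] int sq[OF i] mean[OF i] in auto)
    also have "\<dots> \<le> 1\<^sup>2 / 6 * expectation (\<lambda>\<omega>. \<bar>X i \<omega>\<bar> ^ 3)"
    proof (intro mult_left_mono integral_mono)
      show "integrable M (\<lambda>\<omega>. min (6 * (X i \<omega>)\<^sup>2) (\<bar>1\<bar> * \<bar>X i \<omega>\<bar> ^ 3))"
        using sq[OF i] cube[OF i] by (intro integrable_min) auto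
    qed (use cube[OF i] in auto)
    also have "\<dots> \<le> expectation (\<lambda>\<omega>. \<bar>X i \<omega>\<bar> ^ 3)"
    proof -
      have "expectation (\<lambda>\<omega>. \<bar>X i \<omega>\<bar> ^ 3) \<ge> 0" by (rule integral_nonneg_AE) simp
      then show ?thesis by simp
    qed
    finally have a: "cmod (\<phi> i - complex_of_real (1 - v i / 2)) \<le> expectation (\<lambda>\<omega>. \<bar>X i \<omega>\<bar> ^ 3)"
      by simp
    have "cmod (complex_of_real (1 - v i / 2) - complex_of_real (exp (- v i / 2)))
        = \<bar>1 - v i / 2 - exp (- v i / 2)\<bar>"
      by (metis norm_of_real of_real_diff real_norm_def)
    also have "\<dots> \<le> (v i)\<^sup>2" using exp_minus_half_taylor[OF v0[OF i]] by (rule order_trans) simp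
    finally have b: "cmod (complex_of_real (1 - v i / 2) - complex_of_real (exp (- v i / 2))) \<le> (v i)\<^sup>2" .
    have "cmod (\<phi> i - complex_of_real (exp (- v i / 2)))
      \<le> cmod (\<phi> i - complex_of_real (1 - v i / 2))
        + cmod (complex_of_real (1 - v i / 2) - complex_of_real (exp (- v i / 2)))"
      by (metis diff_add_cancel add_diff_eq norm_triangle_ineq)
    then show ?thesis using a b by linarith
  qed
  moreover have "cmod ((\<Prod>i\<in>I. \<phi> i) - (\<Prod>i\<in>I. complex_of_real (exp (- v i / 2))))
      \<le> (\<Sum>i\<in>I. cmod (\<phi> i - complex_of_real (exp (- v i / 2))))"
  proof (rule norm_prod_diff)
    fix i assume i: "i \<in> I"
    interpret D: real_distribution "distr M borel (X i)"
      using rv[OF i] by (rule real_distribution_distr)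
    show "norm (\<phi> i) \<le> 1" unfolding \<phi>_def by (rule D.cmod_char_le_1)
    show "norm (complex_of_real (exp (- v i / 2))) \<le> 1" using v0[OF i] by simp
  qed
  ultimately show ?thesis
    unfolding 1 2 by (meson order_trans sum_mono)
qed

section \<open>Discrete Laplace noise\<close>

text \<open>With \<open>b\<close> the fourth root of \<open>a\<close>, three of the four factors
  \<open>b ^ k\<close> absorb \<open>k ^ 3\<close> and the last one leaves a geometric
  series.\<close>

lemma summable_cube_power:
  assumes "0 \<le> a" "a < (1::real)"
  shows "summable (\<lambda>k. real k ^ 3 * a ^ k)"
proof -
  define b where "b = root 4 a"
  have b: "0 \<le> b" "b < 1" "b ^ 4 = a" using assms by (auto simp: b_def)
  have "(\<lambda>k. real k * b ^ k) \<longlonglongrightarrow> 0"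
    using powser_times_n_limit_0[of b] b by simp
  then obtain C where C: "\<And>k. norm (real k * b ^ k) \<le> C"
    using convergent_imp_Bseq[of "\<lambda>k. real k * b ^ k"] by (auto simp: convergent_def Bseq_def)
  show ?thesis
  proof (rule summable_comparison_test'[where g = "\<lambda>k. C ^ 3 * b ^ k" and N = 0])
    show "summable (\<lambda>k. C ^ 3 * b ^ k)" using b by (intro summable_mult summable_geometric) simp
    fix k :: nat
    have "real k ^ 3 * a ^ k = (real k * b ^ k) ^ 3 * b ^ k"
      by (simp add: b(3)[symmetric] power_mult_distrib flip: power_mult power_add)
    also have "\<dots> \<le> C ^ 3 * b ^ k"
      using C[of k] b by (intro mult_right_mono power_mono) (auto simp: abs_mult)
    finally show "norm (real k ^ 3 * a ^ k) \<le> C ^ 3 * b ^ k" using assms by simp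
  qed
qed

text \<open>Shifting the index gives a linear equation for each series: \<open>S1\<close> in terms
  of the geometric series, then \<open>S2\<close> in terms of \<open>S1\<close>.\<close>

lemma power_series_moments:
  assumes a: "0 \<le> a" "a < (1::real)"
  shows "summable (\<lambda>k. real k * a ^ k)" "summable (\<lambda>k. (real k)\<^sup>2 * a ^ k)"
    and "(\<Sum>k. (real k)\<^sup>2 * a ^ k) = a * (1 + a) / (1 - a) ^ 3"
proof -
  have s3: "summable (\<lambda>k. real k ^ 3 * a ^ k)" by (rule summable_cube_power[OF a])
  have le: "real k \<le> real k ^ 3" "(real k)\<^sup>2 \<le> real k ^ 3" for k
    by (cases k; simp add: self_le_power power_increasing)+
  show s1: "summable (\<lambda>k. real k * a ^ k)"
    by (rule summable_comparison_test'[OF s3, of 0]) (use a le in \<open>auto intro: mult_right_mono\<close>)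
  show s2: "summable (\<lambda>k. (real k)\<^sup>2 * a ^ k)"
    by (rule summable_comparison_test'[OF s3, of 0]) (use a le in \<open>auto intro: mult_right_mono\<close>)
  have s0: "summable (\<lambda>k. a ^ k)" using a by (intro summable_geometric) simp
  define S1 S2 where "S1 = (\<Sum>k. real k * a ^ k)" and "S2 = (\<Sum>k. (real k)\<^sup>2 * a ^ k)"
  have S0: "(\<Sum>k. a ^ k) = 1 / (1 - a)" using a by (intro suminf_geometric) simp
  have "S1 = (\<Sum>k. real (Suc k) * a ^ Suc k)"
    unfolding S1_def using suminf_split_head[OF s1] by simp
  also have "\<dots> = (\<Sum>k. a * (real k * a ^ k) + a * a ^ k)"
    by (intro suminf_cong) (simp add: algebra_simps)
  also have "\<dots> = a * S1 + a * (1 / (1 - a))"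
    using s0 s1 by (simp add: suminf_add[symmetric] suminf_mult summable_mult S1_def S0)
  finally have S1: "S1 * (1 - a) = a / (1 - a)" by (simp add: algebra_simps)
  have "S2 = (\<Sum>k. (real (Suc k))\<^sup>2 * a ^ Suc k)"
    unfolding S2_def using suminf_split_head[OF s2] by simp
  also have "\<dots> = (\<Sum>k. a * ((real k)\<^sup>2 * a ^ k) + (2 * a * (real k * a ^ k) + a * a ^ k))"
    by (intro suminf_cong) (simp add: algebra_simps power2_eq_square)
  also have "\<dots> = a * S2 + (2 * a * S1 + a * (1 / (1 - a)))"
    using s0 s1 s2 by (simp add: suminf_add[symmetric] suminf_mult summable_mult summable_add S1_def S2_def S0)
  finally have S2: "S2 * (1 - a) = 2 * a * S1 + a / (1 - a)" by (simp add: algebra_simps)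
  have "1 - a \<noteq> 0" using a by simp
  have "S2 * (1 - a) ^ 3 = (S2 * (1 - a)) * (1 - a)\<^sup>2" by (simp add: power2_eq_square power3_eq_cube)
  also have "\<dots> = 2 * a * (S1 * (1 - a)) * (1 - a) + a * (1 - a)"
    unfolding S2 using \<open>1 - a \<noteq> 0\<close> by (simp add: power2_eq_square distrib_right)
  also have "\<dots> = a * (1 + a)"
  proof -
    have c: "a / (1 - a) * (1 - a) = a" using \<open>1 - a \<noteq> 0\<close> by simp
    show ?thesis unfolding S1 mult.assoc c by (simp add: algebra_simps)
  qed
  finally have "S2 = a * (1 + a) / (1 - a) ^ 3" using \<open>1 - a \<noteq> 0\<close> by (simp add: eq_divide_eq)
  then show "(\<Sum>k. (real k)\<^sup>2 * a ^ k) = a * (1 + a) / (1 - a) ^ 3" by (simp add: S2_def)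
qed

locale discrete_laplace_var = prob_space M for M :: "'a measure" +
  fixes e :: "'a \<Rightarrow> int" and a :: real
  assumes rv: "random_variable borel (\<lambda>\<omega>. real_of_int (e \<omega>))" and a: "0 < a" "a < 1"
    and law: "\<And>x. prob {\<omega> \<in> space M. e \<omega> = x} = discrete_laplace_prob a x"
begin

text \<open>The model makes the noise measurable only as a real-valued source; countability of the
  integers brings this back to \<open>e\<close> itself.\<close>

lemma meas: "e \<in> measurable M (count_space UNIV)"
proof -
  have "e -` {x} \<inter> space M \<in> sets M" for x
  proof -
    have "e -` {x} \<inter> space M = {\<omega> \<in> space M. real_of_int (e \<omega>) = real_of_int x}" by auto
    moreover have "{\<omega> \<in> space M. real_of_int (e \<omega>) = real_of_int x} \<in> sets M"
      using rv by measurable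
    ultimately show ?thesis by (simp only:)
  qed
  then show ?thesis by (simp add: measurable_count_space_eq2_countable)
qed

text \<open>An even function of the noise depends on \<open>\<bar>e \<omega>\<bar>\<close> only,
  whose law gives each \<open>k > 0\<close> twice the one-sided mass. Doubling the whole series
  counts 0 twice; hence \<open>g 0\<close> is subtracted.\<close>

lemma abs_moment:
  assumes g: "summable (\<lambda>k. \<bar>g k\<bar> * a ^ k)"
  shows "integrable M (\<lambda>\<omega>. g (nat \<bar>e \<omega>\<bar>))"
    and "expectation (\<lambda>\<omega>. g (nat \<bar>e \<omega>\<bar>)) = (1 - a) / (1 + a) * (2 * (\<Sum>k. g k * a ^ k) - g 0)"
proof -
  note [measurable] = meas
  let ?N = "\<lambda>\<omega>. nat \<bar>e \<omega>\<bar>"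
  have N [measurable]: "?N \<in> measurable M (count_space UNIV)" by measurable
  define p where "p k = (1 - a) / (1 + a) * (if k = 0 then 1 else 2) * a ^ k" for k :: nat
  have p0: "p k \<ge> 0" for k using a by (simp add: p_def)
  have prob_N: "prob {\<omega> \<in> space M. ?N \<omega> = k} = p k" for k
  proof (cases "k = 0")
    case True
    have "{\<omega> \<in> space M. ?N \<omega> = k} = {\<omega> \<in> space M. e \<omega> = 0}" using True by auto
    then show ?thesis using law[of 0] True by (simp add: p_def discrete_laplace_prob_def)
  next
    case False
    have "{\<omega> \<in> space M. ?N \<omega> = k}
        = {\<omega> \<in> space M. e \<omega> = int k} \<union> {\<omega> \<in> space M. e \<omega> = - int k}" using False by auto
    also have "prob \<dots> = prob {\<omega> \<in> space M. e \<omega> = int k} + prob {\<omega> \<in> space M. e \<omega> = - int k}"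
      using False by (intro finite_measure_Union) auto
    finally show ?thesis using False by (simp add: law p_def discrete_laplace_prob_def)
  qed
  have D: "distr M (count_space UNIV) ?N = density (count_space UNIV) (\<lambda>k. ennreal (p k))"
  proof (rule measure_eqI_countable[where A = UNIV])
    fix k :: nat
    have "emeasure (distr M (count_space UNIV) ?N) {k} = emeasure M {\<omega> \<in> space M. ?N \<omega> = k}"
      by (subst emeasure_distr) (auto intro!: arg_cong2[where f = emeasure])
    then show "emeasure (distr M (count_space UNIV) ?N) {k}
        = emeasure (density (count_space UNIV) (\<lambda>k. ennreal (p k))) {k}"
      by (simp add: emeasure_eq_measure prob_N emeasure_density nn_integral_indicator_singleton)
  qed auto
  have sp: "summable (\<lambda>k. norm (p k *\<^sub>R g k))"
  proof (rule summable_comparison_test'[where g = "\<lambda>k. 2 * (1 - a) / (1 + a) * (\<bar>g k\<bar> * a ^ k)" and N = 0])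
    show "summable (\<lambda>k. 2 * (1 - a) / (1 + a) * (\<bar>g k\<bar> * a ^ k))" by (rule summable_mult[OF g])
    fix k :: nat
    have "p k \<le> 2 * (1 - a) / (1 + a) * a ^ k"
      using a by (simp add: p_def divide_right_mono mult_right_mono)
    then have "p k * \<bar>g k\<bar> \<le> 2 * (1 - a) / (1 + a) * a ^ k * \<bar>g k\<bar>" by (rule mult_right_mono) simp
    then show "norm (norm (p k *\<^sub>R g k)) \<le> 2 * (1 - a) / (1 + a) * (\<bar>g k\<bar> * a ^ k)"
      using p0[of k] by (simp add: abs_mult mult_ac)
  qed
  have ic: "integrable (count_space UNIV) (\<lambda>k. p k *\<^sub>R g k)"
    unfolding integrable_count_space_nat_iff by (rule sp)
  have "integrable (distr M (count_space UNIV) ?N) g"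
    unfolding D by (subst integrable_density) (use p0 ic in auto)
  then show "integrable M (\<lambda>\<omega>. g (?N \<omega>))" by (subst (asm) integrable_distr_eq) auto
  have "expectation (\<lambda>\<omega>. g (?N \<omega>)) = integral\<^sup>L (distr M (count_space UNIV) ?N) g"
    by (subst integral_distr) auto
  also have "\<dots> = (\<Sum>k. p k *\<^sub>R g k)"
    unfolding D using p0 ic by (subst integral_density) (auto simp: integral_count_space_nat)
  also have "\<dots> = (1 - a) / (1 + a) * (2 * (\<Sum>k. g k * a ^ k) - g 0)"
  proof -
    have sg: "summable (\<lambda>k. g k * a ^ k)"
      by (rule summable_norm_cancel) (use g a in \<open>simp add: abs_mult\<close>)
    have "(\<lambda>k. (1 - a) / (1 + a) * (2 * (g k * a ^ k) - (if k = 0 then g 0 else 0)))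
        sums ((1 - a) / (1 + a) * (2 * (\<Sum>k. g k * a ^ k) - g 0))"
      by (intro sums_mult sums_diff summable_sums sg sums_single)
    moreover have "(1 - a) / (1 + a) * (2 * (g k * a ^ k) - (if k = 0 then g 0 else 0)) = p k *\<^sub>R g k" for k
      by (cases "k = 0") (simp_all add: p_def)
    ultimately show ?thesis by (simp add: sums_iff)
  qed
  finally show "expectation (\<lambda>\<omega>. g (?N \<omega>)) = (1 - a) / (1 + a) * (2 * (\<Sum>k. g k * a ^ k) - g 0)" .
qed

lemma square: "integrable M (\<lambda>\<omega>. (real_of_int (e \<omega>))\<^sup>2)"
  "expectation (\<lambda>\<omega>. (real_of_int (e \<omega>))\<^sup>2) = 2 * a / (1 - a)\<^sup>2"
proof -
  have eq: "(real (nat \<bar>x\<bar>))\<^sup>2 = (real_of_int x)\<^sup>2" for x by simp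
  have s: "summable (\<lambda>k. \<bar>(real k)\<^sup>2\<bar> * a ^ k)" using power_series_moments(2)[of a] a by simp
  show "integrable M (\<lambda>\<omega>. (real_of_int (e \<omega>))\<^sup>2)" using abs_moment(1)[OF s] by (simp only: eq)
  have "expectation (\<lambda>\<omega>. (real_of_int (e \<omega>))\<^sup>2)
      = (1 - a) / (1 + a) * (2 * (a * (1 + a) / (1 - a) ^ 3))"
    using abs_moment(2)[OF s] power_series_moments(3)[of a] a by (simp add: eq)
  also have "\<dots> = 2 * a / (1 - a)\<^sup>2"
    using a by (simp add: divide_simps power2_eq_square power3_eq_cube)
  finally show "expectation (\<lambda>\<omega>. (real_of_int (e \<omega>))\<^sup>2) = 2 * a / (1 - a)\<^sup>2" .
qed

text \<open>A bound by a fixed \<open>a0\<close>, uniform in \<open>a \<le> a0\<close>, keeps the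
  third moments bounded along the sequence of networks.\<close>

lemma cube:
  assumes "a \<le> a0" "a0 < 1"
  shows "integrable M (\<lambda>\<omega>. \<bar>real_of_int (e \<omega>)\<bar> ^ 3)"
    "expectation (\<lambda>\<omega>. \<bar>real_of_int (e \<omega>)\<bar> ^ 3) \<le> 2 * (\<Sum>k. real k ^ 3 * a0 ^ k)"
proof -
  have eq: "(real (nat \<bar>x\<bar>)) ^ 3 = \<bar>real_of_int x\<bar> ^ 3" for x by simp
  have sa: "summable (\<lambda>k. real k ^ 3 * a ^ k)" using summable_cube_power[of a] a by simp
  then have s: "summable (\<lambda>k. \<bar>real k ^ 3\<bar> * a ^ k)" by simp
  show "integrable M (\<lambda>\<omega>. \<bar>real_of_int (e \<omega>)\<bar> ^ 3)" using abs_moment(1)[OF s] by (simp only: eq)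
  have "expectation (\<lambda>\<omega>. \<bar>real_of_int (e \<omega>)\<bar> ^ 3) = (1 - a) / (1 + a) * (2 * (\<Sum>k. real k ^ 3 * a ^ k))"
    using abs_moment(2)[OF s] by (simp add: eq)
  also have "\<dots> \<le> 1 * (2 * (\<Sum>k. real k ^ 3 * a ^ k))"
    using a sa by (intro mult_right_mono) (auto intro!: suminf_nonneg)
  also have "(\<Sum>k. real k ^ 3 * a ^ k) \<le> (\<Sum>k. real k ^ 3 * a0 ^ k)"
    using a assms sa summable_cube_power[of a0]
    by (intro suminf_le) (auto intro!: mult_left_mono power_mono)
  finally show "expectation (\<lambda>\<omega>. \<bar>real_of_int (e \<omega>)\<bar> ^ 3) \<le> 2 * (\<Sum>k. real k ^ 3 * a0 ^ k)" by simp
qed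

text \<open>The identity is not even, so \<open>abs_moment\<close> does not cover it; instead
  \<open>e\<close> and \<open>- e\<close> have the same law.\<close>

lemma mean: "expectation (\<lambda>\<omega>. real_of_int (e \<omega>)) = 0"
proof -
  note [measurable] = meas
  have eq: "distr M (count_space UNIV) e = distr M (count_space UNIV) (\<lambda>\<omega>. - e \<omega>)"
  proof (rule measure_eqI_countable[where A = UNIV])
    fix k :: int
    have "emeasure (distr M (count_space UNIV) e) {k} = prob {\<omega> \<in> space M. e \<omega> = k}"
      by (subst emeasure_distr) (auto simp: emeasure_eq_measure intro!: arg_cong[where f = prob])
    moreover have "emeasure (distr M (count_space UNIV) (\<lambda>\<omega>. - e \<omega>)) {k} = prob {\<omega> \<in> space M. e \<omega> = - k}"
      by (subst emeasure_distr) (auto simp: emeasure_eq_measure intro!: arg_cong[where f = prob])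
    ultimately show "emeasure (distr M (count_space UNIV) e) {k}
        = emeasure (distr M (count_space UNIV) (\<lambda>\<omega>. - e \<omega>)) {k}"
      by (simp add: law discrete_laplace_prob_def)
  qed auto
  have "expectation (\<lambda>\<omega>. real_of_int (e \<omega>))
      = integral\<^sup>L (distr M (count_space UNIV) e) real_of_int"
    by (subst integral_distr) auto
  also have "\<dots> = expectation (\<lambda>\<omega>. real_of_int (- e \<omega>))"
    unfolding eq by (subst integral_distr) auto
  finally show ?thesis by simp
qed

end

section \<open>The score and its tails\<close>

fun center :: "(nat \<Rightarrow> nat \<Rightarrow> real) \<Rightarrow> 'p source \<Rightarrow> real" where
  "center f (Edge i j) = f i j"
| "center f _ = 0"

text \<open>The noise entry \<open>v\<close> is a parameter because the same pattern also carries
  the third-moment bounds of \<open>csrc_cube\<close>.\<close>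

fun source_variance :: "(nat \<Rightarrow> nat \<Rightarrow> real) \<Rightarrow> real \<Rightarrow> 'p source \<Rightarrow> real" where
  "source_variance f v (Edge i j) = f i j"
| "source_variance f v (OutNoise i) = v"
| "source_variance f v (InNoise j) = v"
| "source_variance f v (CovNoise t) = 0"

text \<open>Coefficient with which a source enters the pairing of the node vector \<open>y\<close>
  with the score; see \<open>score_functional\<close>. The in-noise of node \<open>n\<close> gets 0
  through \<open>beta_par\<close>, since its equation is dropped for identification.\<close>

fun node_coef :: "nat \<Rightarrow> (nat \<Rightarrow> real) \<Rightarrow> 'p source \<Rightarrow> real" where
  "node_coef n y (Edge i j) = pot n y i j"
| "node_coef n y (OutNoise i) = y i"
| "node_coef n y (InNoise j) = beta_par n y j"
| "node_coef n y (CovNoise t) = 0"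

text \<open>The continuous noise is left out: it appears only in the covariate equations, where the
  tail bound \<open>cov_noise_tail\<close> suffices.\<close>

definition node_sources :: "nat \<Rightarrow> 'p source set" where
  "node_sources n = (\<lambda>(i, j). Edge i j) ` (SIGMA i:{1..n}. {1..n} - {i})
     \<union> OutNoise ` {1..n} \<union> InNoise ` {1..n}"

lemma finite_node_sources: "finite (node_sources n)"
  by (simp add: node_sources_def)

lemma node_sources_subset: "node_sources n \<subseteq> sources n"
  by (auto simp: node_sources_def sources_def)

lemma node_sources_cases:
  assumes "s \<in> node_sources n"
  obtains i j where "s = Edge i j" "i \<in> {1..n}" "j \<in> {1..n}" "i \<noteq> j"
  | i where "s = OutNoise i" "i \<in> {1..n}"
  | j where "s = InNoise j" "j \<in> {1..n}"
  using assms by (fastforce simp: node_sources_def)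

lemma sum_node_sources:
  "(\<Sum>s\<in>node_sources n. f s)
    = esum n (\<lambda>i j. f (Edge i j)) + (\<Sum>i=1..n. f (OutNoise i)) + (\<Sum>j=1..n. f (InNoise j))"
proof -
  have "(\<Sum>s\<in>(\<lambda>(i, j). Edge i j) ` (SIGMA i:{1..n}. {1..n} - {i}). f s) = esum n (\<lambda>i j. f (Edge i j))"
    by (subst sum.reindex) (auto simp: inj_on_def esum_def sum.Sigma split_beta)
  moreover have "(\<Sum>s\<in>OutNoise ` {1..n}. f s) = (\<Sum>i=1..n. f (OutNoise i))"
    by (subst sum.reindex) (auto simp: inj_on_def)
  moreover have "(\<Sum>s\<in>InNoise ` {1..n}. f s) = (\<Sum>i=1..n. f (InNoise i))"
    by (subst sum.reindex) (auto simp: inj_on_def)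
  ultimately show ?thesis
    unfolding node_sources_def by (subst sum.union_disjoint; auto)+
qed

context private_network
begin

definition mu :: "nat \<Rightarrow> nat \<Rightarrow> real" where "mu i j = logistic (lin_pred n Z \<theta> \<gamma> i j)"

definition wt :: "nat \<Rightarrow> nat \<Rightarrow> real" where "wt i j = logistic' (lin_pred n Z \<theta> \<gamma> i j)"

definition al :: real where "al = exp (- eps / 2)"

definition tau2 :: real where "tau2 = 2 * al / (1 - al)\<^sup>2"

definition csrc :: "'p source \<Rightarrow> 'w \<Rightarrow> real" where
  "csrc s \<omega> = source_var A ep em \<eta> s \<omega> - center mu s"

definition LF :: "('p source \<Rightarrow> real) \<Rightarrow> 'w \<Rightarrow> real" where
  "LF c \<omega> = (\<Sum>s\<in>node_sources n. c s * csrc s \<omega>)"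

lemma al: "0 < al" "al < 1" using eps_pos by (auto simp: al_def)

lemma tau2_nonneg: "tau2 \<ge> 0" using al by (simp add: tau2_def)

lemma rv_source: "s \<in> sources n \<Longrightarrow> random_variable borel (source_var A ep em \<eta> s)"
  using indep by (auto simp: indep_vars_def)

lemma source_var_eta:
  "source_var A ep em \<eta> (Edge i j) = A i j"
  "source_var A ep em \<eta> (OutNoise i) = (\<lambda>\<omega>. real_of_int (ep i \<omega>))"
  "source_var A ep em \<eta> (InNoise j) = (\<lambda>\<omega>. real_of_int (em j \<omega>))"
  by (simp_all add: fun_eq_iff)

lemma indep_csrc: "indep_vars (\<lambda>_. borel) csrc (node_sources n)"
proof -
  have "indep_vars (\<lambda>_. borel) (\<lambda>s \<omega>. (\<lambda>x. x - center mu s) (source_var A ep em \<eta> s \<omega>)) (node_sources n)"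
    by (rule indep_vars_compose2[OF indep_vars_subset[OF indep node_sources_subset]]) measurable
  then show ?thesis by (simp add: csrc_def[abs_def])
qed

lemma indep_weighted_csrc: "indep_vars (\<lambda>_. borel) (\<lambda>s \<omega>. c s * csrc s \<omega>) (node_sources n)"
  using indep_vars_compose2[OF indep_csrc, of "\<lambda>s x. c s * x" "\<lambda>_. borel"] by simp

lemma rv_csrc: "s \<in> node_sources n \<Longrightarrow> random_variable borel (csrc s)"
  using indep_csrc by (auto simp: indep_vars_def)

lemma rv_LF: "random_variable borel (LF c)"
  unfolding LF_def by (intro borel_measurable_sum borel_measurable_times rv_csrc) auto

lemma discrete_laplace_noise:
  assumes "i \<in> {1..n}"
  shows "discrete_laplace_var M (ep i) al" "discrete_laplace_var M (em i) al"
proof -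
  have "random_variable borel (\<lambda>\<omega>. real_of_int (ep i \<omega>))" "random_variable borel (\<lambda>\<omega>. real_of_int (em i \<omega>))"
    using rv_source[of "OutNoise i"] rv_source[of "InNoise i"] assms
    by (auto simp: sources_def source_var_eta)
  then show "discrete_laplace_var M (ep i) al" "discrete_laplace_var M (em i) al"
    using al out_noise[OF assms] in_noise[OF assms] by unfold_locales (auto simp: al_def)
qed

lemma csrc_noise: "csrc (OutNoise i) \<omega> = real_of_int (ep i \<omega>)" "csrc (InNoise i) \<omega> = real_of_int (em i \<omega>)"
  by (simp_all add: csrc_def)

lemma csrc_edge: "csrc (Edge i j) \<omega> = A i j \<omega> - mu i j" by (simp add: csrc_def)

lemma csrc_edge_bounds:
  assumes "i \<in> {1..n}" "j \<in> {1..n}" "\<omega> \<in> space M"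
  shows "csrc (Edge i j) \<omega> \<in> {- mu i j..1 - mu i j}" "\<bar>csrc (Edge i j) \<omega>\<bar> \<le> 1"
  using edge_01[OF assms] logistic_bounds[of "lin_pred n Z \<theta> \<gamma> i j"]
  by (auto simp: csrc_edge mu_def)

lemma edge_moments:
  assumes ij: "i \<in> {1..n}" "j \<in> {1..n}" "i \<noteq> j"
  shows "expectation (csrc (Edge i j)) = 0" "integrable M (\<lambda>\<omega>. (csrc (Edge i j) \<omega>)\<^sup>2)"
    "expectation (\<lambda>\<omega>. (csrc (Edge i j) \<omega>)\<^sup>2) = wt i j"
    "integrable M (\<lambda>\<omega>. \<bar>csrc (Edge i j) \<omega>\<bar> ^ 3)"
    "expectation (\<lambda>\<omega>. \<bar>csrc (Edge i j) \<omega>\<bar> ^ 3) \<le> wt i j"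
proof -
  have mem: "Edge i j \<in> node_sources n" using ij by (auto simp: node_sources_def)
  have [measurable]: "random_variable borel (csrc (Edge i j))" using rv_csrc[OF mem] .
  have [measurable]: "random_variable borel (A i j)"
    using rv_source[of "Edge i j"] subsetD[OF node_sources_subset mem] by (simp add: source_var_eta)
  have bd: "\<bar>csrc (Edge i j) \<omega>\<bar> \<le> 1" if "\<omega> \<in> space M" for \<omega>
    using csrc_edge_bounds(2)[OF ij(1,2) that] .
  have A_int: "integrable M (A i j)"
    by (rule integrable_const_bound[where B = 1]) 
      (use edge_01[OF ij(1,2)] in \<open>auto intro!: AE_I2 simp: abs_le_iff, fastforce+\<close>)
  have "expectation (A i j) = expectation (indicator {\<omega> \<in> space M. A i j \<omega> = 1})"
    by (rule Bochner_Integration.integral_cong) (use edge_01[OF ij(1,2)] in \<open>auto simp: indicator_def\<close>)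
  also have "\<dots> = mu i j"
    using edge_prob[OF ij] by (simp add: mu_def Int_absorb2[of _ "space M"] Collect_conj_eq)
  finally have EA: "expectation (A i j) = mu i j" .
  show E0: "expectation (csrc (Edge i j)) = 0"
    unfolding csrc_edge[abs_def] using A_int EA by (simp add: prob_space)
  show "integrable M (\<lambda>\<omega>. (csrc (Edge i j) \<omega>)\<^sup>2)"
    by (rule integrable_const_bound[where B = 1]) (use bd in \<open>auto intro!: AE_I2 simp: abs_square_le_1\<close>)
  then have i2: "integrable M (\<lambda>\<omega>. (csrc (Edge i j) \<omega>)\<^sup>2)" .
  have "(csrc (Edge i j) \<omega>)\<^sup>2 = A i j \<omega> * (1 - 2 * mu i j) + (mu i j)\<^sup>2" if "\<omega> \<in> space M" for \<omega>
    using edge_01[OF ij(1,2) that] by (auto simp: csrc_edge power2_eq_square algebra_simps)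
  then have "expectation (\<lambda>\<omega>. (csrc (Edge i j) \<omega>)\<^sup>2)
      = expectation (\<lambda>\<omega>. A i j \<omega> * (1 - 2 * mu i j) + (mu i j)\<^sup>2)"
    by (intro Bochner_Integration.integral_cong) auto
  also have "\<dots> = wt i j"
    using A_int EA by (simp add: prob_space wt_def logistic'_eq mu_def power2_eq_square algebra_simps)
  finally show E2: "expectation (\<lambda>\<omega>. (csrc (Edge i j) \<omega>)\<^sup>2) = wt i j" .
  have i3: "integrable M (\<lambda>\<omega>. \<bar>csrc (Edge i j) \<omega>\<bar> ^ 3)"
    by (rule integrable_const_bound[where B = 1]) (use bd in \<open>auto intro!: AE_I2 simp: power_le_one\<close>)
  then show "integrable M (\<lambda>\<omega>. \<bar>csrc (Edge i j) \<omega>\<bar> ^ 3)" .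
  have "expectation (\<lambda>\<omega>. \<bar>csrc (Edge i j) \<omega>\<bar> ^ 3) \<le> expectation (\<lambda>\<omega>. (csrc (Edge i j) \<omega>)\<^sup>2)"
  proof (rule integral_mono[OF i3 i2])
    fix \<omega> assume "\<omega> \<in> space M"
    then have "\<bar>csrc (Edge i j) \<omega>\<bar> ^ 3 \<le> \<bar>csrc (Edge i j) \<omega>\<bar> ^ 2"
      by (intro power_decreasing) (use bd in auto)
    then show "\<bar>csrc (Edge i j) \<omega>\<bar> ^ 3 \<le> (csrc (Edge i j) \<omega>)\<^sup>2" by simp
  qed
  then show "expectation (\<lambda>\<omega>. \<bar>csrc (Edge i j) \<omega>\<bar> ^ 3) \<le> wt i j" using E2 by simp
qed

lemma csrc_moments:
  assumes s: "s \<in> node_sources n"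
  shows "expectation (csrc s) = 0" "integrable M (\<lambda>\<omega>. (csrc s \<omega>)\<^sup>2)"
    "expectation (\<lambda>\<omega>. (csrc s \<omega>)\<^sup>2) = source_variance wt tau2 s"
proof -
  have "expectation (csrc s) = 0 \<and> integrable M (\<lambda>\<omega>. (csrc s \<omega>)\<^sup>2)
      \<and> expectation (\<lambda>\<omega>. (csrc s \<omega>)\<^sup>2) = source_variance wt tau2 s"
    using s
  proof (cases rule: node_sources_cases)
    case (1 i j)
    then show ?thesis using edge_moments[of i j] by simp
  next
    case (2 i)
    interpret e: discrete_laplace_var M "ep i" al using 2 by (intro discrete_laplace_noise)
    show ?thesis using e.mean e.square 2 by (simp add: csrc_noise[abs_def] tau2_def)
  next
    case (3 i)
    interpret e: discrete_laplace_var M "em i" al using 3 by (intro discrete_laplace_noise)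
    show ?thesis using e.mean e.square 3 by (simp add: csrc_noise[abs_def] tau2_def)
  qed
  then show "expectation (csrc s) = 0" "integrable M (\<lambda>\<omega>. (csrc s \<omega>)\<^sup>2)"
    "expectation (\<lambda>\<omega>. (csrc s \<omega>)\<^sup>2) = source_variance wt tau2 s" by auto
qed

lemma csrc_cube:
  assumes s: "s \<in> node_sources n" and a0: "al \<le> a0" "a0 < 1"
  shows "integrable M (\<lambda>\<omega>. \<bar>csrc s \<omega>\<bar> ^ 3)"
    "expectation (\<lambda>\<omega>. \<bar>csrc s \<omega>\<bar> ^ 3) \<le> source_variance wt (2 * (\<Sum>k. real k ^ 3 * a0 ^ k)) s"
proof -
  have "integrable M (\<lambda>\<omega>. \<bar>csrc s \<omega>\<bar> ^ 3) \<and>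
    expectation (\<lambda>\<omega>. \<bar>csrc s \<omega>\<bar> ^ 3) \<le> source_variance wt (2 * (\<Sum>k. real k ^ 3 * a0 ^ k)) s"
    using s
  proof (cases rule: node_sources_cases)
    case (1 i j)
    then show ?thesis using edge_moments(4,5)[of i j] by simp
  next
    case (2 i)
    interpret e: discrete_laplace_var M "ep i" al using 2 by (intro discrete_laplace_noise)
    show ?thesis using e.cube[OF a0] 2 by (simp add: csrc_noise)
  next
    case (3 i)
    interpret e: discrete_laplace_var M "em i" al using 3 by (intro discrete_laplace_noise)
    show ?thesis using e.cube[OF a0] 3 by (simp add: csrc_noise)
  qed
  then show "integrable M (\<lambda>\<omega>. \<bar>csrc s \<omega>\<bar> ^ 3)"
    "expectation (\<lambda>\<omega>. \<bar>csrc s \<omega>\<bar> ^ 3) \<le> source_variance wt (2 * (\<Sum>k. real k ^ 3 * a0 ^ k)) s" by auto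
qed

lemma LF_moments:
  "integrable M (\<lambda>\<omega>. (LF c \<omega>)\<^sup>2)" "expectation (LF c) = 0"
  "expectation (\<lambda>\<omega>. (LF c \<omega>)\<^sup>2) = (\<Sum>s\<in>node_sources n. (c s)\<^sup>2 * source_variance wt tau2 s)"
proof -
  have m: "integrable M (\<lambda>\<omega>. (c s * csrc s \<omega>)\<^sup>2)" "expectation (\<lambda>\<omega>. c s * csrc s \<omega>) = 0"
    "expectation (\<lambda>\<omega>. (c s * csrc s \<omega>)\<^sup>2) = (c s)\<^sup>2 * source_variance wt tau2 s"
    if "s \<in> node_sources n" for s
    using csrc_moments[OF that] by (auto simp: power_mult_distrib)
  have "integrable M (\<lambda>\<omega>. (\<Sum>s\<in>node_sources n. c s * csrc s \<omega>)\<^sup>2)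
    \<and> expectation (\<lambda>\<omega>. \<Sum>s\<in>node_sources n. c s * csrc s \<omega>) = 0
    \<and> expectation (\<lambda>\<omega>. (\<Sum>s\<in>node_sources n. c s * csrc s \<omega>)\<^sup>2)
      = (\<Sum>s\<in>node_sources n. expectation (\<lambda>\<omega>. (c s * csrc s \<omega>)\<^sup>2))"
    by (rule indep_centered_sum[OF finite_node_sources indep_weighted_csrc]) (use m in auto)
  then show "integrable M (\<lambda>\<omega>. (LF c \<omega>)\<^sup>2)" "expectation (LF c) = 0"
    "expectation (\<lambda>\<omega>. (LF c \<omega>)\<^sup>2) = (\<Sum>s\<in>node_sources n. (c s)\<^sup>2 * source_variance wt tau2 s)"
    using m(3) by (auto simp: LF_def[abs_def])
qed

lemma LF_tail:
  assumes "(\<Sum>s\<in>node_sources n. (c s)\<^sup>2 * source_variance wt tau2 s) \<le> v" "0 < a"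
  shows "prob {\<omega> \<in> space M. a \<le> \<bar>LF c \<omega>\<bar>} \<le> v / a\<^sup>2"
  by (rule second_moment_tail[OF rv_LF LF_moments(1,2)]) (use assms LF_moments(3) in auto)

lemma LF_variance_bound:
  assumes e: "\<And>i j. i \<in> {1..n} \<Longrightarrow> j \<in> {1..n} \<Longrightarrow> i \<noteq> j \<Longrightarrow> \<bar>c (Edge i j)\<bar> \<le> B"
    and o: "\<And>i. i \<in> {1..n} \<Longrightarrow> \<bar>c (OutNoise i)\<bar> \<le> D" "\<And>i. i \<in> {1..n} \<Longrightarrow> \<bar>c (InNoise i)\<bar> \<le> D"
    and "0 \<le> B" "0 \<le> D"
  shows "(\<Sum>s\<in>node_sources n. (c s)\<^sup>2 * source_variance wt tau2 s)
    \<le> (real n)\<^sup>2 * (B\<^sup>2 / 4) + 2 * real n * D\<^sup>2 * tau2"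
proof -
  have sq: "x\<^sup>2 \<le> b\<^sup>2" if "\<bar>x\<bar> \<le> b" for x b :: real
    using that by (metis abs_ge_zero power2_abs power_mono)
  have "\<bar>esum n (\<lambda>i j. (c (Edge i j))\<^sup>2 * wt i j)\<bar> \<le> (real n)\<^sup>2 * (B\<^sup>2 / 4)"
  proof (rule esum_abs_le)
    fix i j assume "i \<in> {1..n}" "j \<in> {1..n}" "i \<noteq> j"
    then have "(c (Edge i j))\<^sup>2 * wt i j \<le> B\<^sup>2 * (1 / 4)"
      using logistic'_pos logistic'_le by (intro mult_mono sq e) (auto simp: wt_def less_imp_le)
    then show "\<bar>(c (Edge i j))\<^sup>2 * wt i j\<bar> \<le> B\<^sup>2 / 4"
      using logistic'_pos by (simp add: abs_mult wt_def abs_of_pos)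
  qed simp
  moreover have "(\<Sum>i=1..n. (c (OutNoise i))\<^sup>2 * tau2) \<le> (\<Sum>i=1..n. D\<^sup>2 * tau2)"
    using tau2_nonneg by (intro sum_mono mult_right_mono sq o) auto
  moreover have "(\<Sum>i=1..n. (c (InNoise i))\<^sup>2 * tau2) \<le> (\<Sum>i=1..n. D\<^sup>2 * tau2)"
    using tau2_nonneg by (intro sum_mono mult_right_mono sq o) auto
  ultimately show ?thesis unfolding sum_node_sources by (simp add: mult_ac)
qed

section \<open>The score as a function of the independent sources, and its tails\<close>

definition xi :: "nat \<Rightarrow> nat \<Rightarrow> 'w \<Rightarrow> real" where "xi i j \<omega> = csrc (Edge i j) \<omega>"

definition score :: "nat \<Rightarrow> 'w \<Rightarrow> real" where
  "score a \<omega> = F_fun n Z (priv_out n A ep \<omega>) (priv_in n A em \<omega>) \<theta> \<gamma> a"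

lemma score_eq:
  "score a \<omega> = divg n (\<lambda>i j. xi i j \<omega>) a
    + (if a \<le> n then csrc (OutNoise a) \<omega> else csrc (InNoise (a - n)) \<omega>)"
  by (simp add: score_def F_fun_eq_divg priv_out_def priv_in_def divg_def xi_def csrc_edge csrc_noise
      mu_def sum_subtractf)

text \<open>The coordinates of the score share edges and are dependent; summation by parts rewrites
  any combination of them as a sum over independent sources.\<close>

lemma score_functional:
  assumes "n \<ge> 1"
  shows "(\<Sum>a=1..2 * n - 1. u a * score a \<omega>) = LF (node_coef n u) \<omega>"
proof -
  have "(\<Sum>a=1..2 * n - 1. u a * score a \<omega>) = (\<Sum>a=1..2 * n - 1. u a * divg n (\<lambda>i j. xi i j \<omega>) a)
      + (\<Sum>a=1..2 * n - 1. u a * (if a \<le> n then csrc (OutNoise a) \<omega> else csrc (InNoise (a - n)) \<omega>))"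
    by (simp add: score_eq distrib_left sum.distrib)
  also have "(\<Sum>a=1..2 * n - 1. u a * divg n (\<lambda>i j. xi i j \<omega>) a) = esum n (\<lambda>i j. xi i j \<omega> * pot n u i j)"
    by (rule pot_divg_adjoint[OF assms])
  also have "(\<Sum>a=1..2 * n - 1. u a * (if a \<le> n then csrc (OutNoise a) \<omega> else csrc (InNoise (a - n)) \<omega>))
      = (\<Sum>i=1..n. u i * csrc (OutNoise i) \<omega>) + (\<Sum>j=1..n. beta_par n u j * csrc (InNoise j) \<omega>)"
    unfolding nodes_split_sum[OF assms]
    by (intro arg_cong2[of _ _ _ _ "(+)"] sum.cong) (auto simp: beta_par_def)
  finally show ?thesis
    unfolding LF_def sum_node_sources by (simp add: xi_def mult.commute)
qed

lemma covariate_score: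
  "Q_fun n Z (priv_cov n Z A \<eta> \<omega>) \<theta> \<gamma> $ t = esum n (\<lambda>i j. xi i j \<omega> * Z i j $ t) + \<eta> t \<omega>"
  by (simp add: Q_fun_eq_esum priv_cov_def xi_def csrc_edge mu_def esum_def left_diff_distrib
      sum_subtractf)

lemma edge_sum_tail:
  assumes J: "J \<subseteq> {1..n} \<times> {1..n}" "\<And>i. (i, i) \<notin> J" and N: "card J > 0" and T: "T \<ge> 0"
  shows "prob {\<omega> \<in> space M. T \<le> \<bar>\<Sum>(i, j)\<in>J. xi i j \<omega>\<bar>} \<le> 2 * exp (- 2 * T\<^sup>2 / real (card J))"
proof -
  let ?I = "(\<lambda>(i, j). Edge i j) ` J"
  have inj: "inj_on (\<lambda>(i, j). Edge i j) J" by (auto simp: inj_on_def)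
  have fin: "finite ?I" using N by (simp add: card_gt_0_iff)
  have sub: "?I \<subseteq> node_sources n" using J by (auto simp: node_sources_def)
  define lo where "lo s = - center mu s" for s :: "'p source"
  define hi where "hi s = 1 - center mu s" for s :: "'p source"
  interpret H: Hoeffding_ineq M ?I csrc lo hi "\<Sum>s\<in>?I. expectation (csrc s)"
  proof unfold_locales
    show "indep_vars (\<lambda>_. borel) csrc ?I" by (rule indep_vars_subset[OF indep_csrc sub])
    show "AE \<omega> in M. csrc s \<omega> \<in> {lo s..hi s}" if "s \<in> ?I" for s
      using that J csrc_edge_bounds(1) by (auto intro!: AE_I2 simp: lo_def hi_def)
  qed (use fin in auto)
  have m0: "(\<Sum>s\<in>?I. expectation (csrc s)) = 0"
    using sub csrc_moments(1) by (intro sum.neutral) auto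
  have c: "(\<Sum>s\<in>?I. (hi s - lo s)\<^sup>2) = real (card J)"
    by (simp add: lo_def hi_def card_image[OF inj])
  have "prob {\<omega> \<in> space M. T \<le> \<bar>(\<Sum>s\<in>?I. csrc s \<omega>) - (\<Sum>s\<in>?I. expectation (csrc s))\<bar>}
      \<le> 2 * exp (- 2 * T\<^sup>2 / (\<Sum>s\<in>?I. (hi s - lo s)\<^sup>2))"
    by (rule H.Hoeffding_ineq_abs_ge[OF T]) (use N c in simp)
  moreover have "(\<Sum>s\<in>?I. csrc s \<omega>) = (\<Sum>(i, j)\<in>J. xi i j \<omega>)" for \<omega>
    unfolding sum.reindex[OF inj] by (simp add: xi_def split_beta comp_def)
  ultimately show ?thesis unfolding m0 c by simp
qed

text \<open>The bound is wanted at all \<open>2 n\<close> nodes at once. At this threshold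
  Chebyshev's inequality would give only order \<open>1 / ln n\<close> per node, too much for the
  union; Hoeffding's gives \<open>2 / n^2\<close> and a union of \<open>4 / n\<close>.\<close>

lemma divg_xi_tail:
  assumes a: "a \<in> {1..2 * n}" and n: "n \<ge> 2"
  shows "prob {\<omega> \<in> space M. sqrt (real n * ln (real n)) \<le> \<bar>divg n (\<lambda>i j. xi i j \<omega>) a\<bar>} \<le> 2 / (real n)\<^sup>2"
proof -
  define J where "J = (if a \<le> n then {a} \<times> ({1..n} - {a}) else ({1..n} - {a - n}) \<times> {a - n})"
  have an: "a \<le> n \<Longrightarrow> a \<in> {1..n}" "\<not> a \<le> n \<Longrightarrow> a - n \<in> {1..n}" using a by auto
  have J: "J \<subseteq> {1..n} \<times> {1..n}" "\<And>i. (i, i) \<notin> J" using an by (auto simp: J_def)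
  have cJ: "card J = n - 1" using an by (auto simp: J_def card_cartesian_product)
  have sum: "divg n (\<lambda>i j. xi i j \<omega>) a = (\<Sum>(i, j)\<in>J. xi i j \<omega>)" for \<omega>
    by (simp add: divg_def J_def sum.cartesian_product[symmetric])
  let ?T = "sqrt (real n * ln (real n))"
  have T2: "?T\<^sup>2 = real n * ln (real n)" using n by simp
  have "prob {\<omega> \<in> space M. ?T \<le> \<bar>\<Sum>(i, j)\<in>J. xi i j \<omega>\<bar>} \<le> 2 * exp (- 2 * ?T\<^sup>2 / real (card J))"
    by (rule edge_sum_tail[OF J]) (use cJ n in auto)
  also have "\<dots> \<le> 2 * exp (- 2 * ln (real n))"
  proof -
    have "2 * ln (real n) * (real n - 1) \<le> 2 * ln (real n) * real n"
      using n by (intro mult_left_mono) auto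
    then have "2 * ln (real n) \<le> 2 * (real n * ln (real n)) / real (n - 1)"
      using n by (simp add: pos_le_divide_eq of_nat_diff mult_ac)
    then show ?thesis unfolding T2 cJ by simp
  qed
  also have "exp (- 2 * ln (real n)) = 1 / (real n)\<^sup>2"
  proof -
    have "exp (- 2 * ln (real n)) = exp (- (ln (real n) + ln (real n)))" by simp
    also have "\<dots> = 1 / (real n)\<^sup>2"
      using n by (simp only: exp_minus exp_add exp_ln) (simp add: power2_eq_square divide_inverse)
    finally show ?thesis .
  qed
  finally show ?thesis unfolding sum by simp
qed

lemma noise_tail:
  assumes "i \<in> {1..n}" "T > 0"
  shows "prob {\<omega> \<in> space M. T \<le> \<bar>csrc (OutNoise i) \<omega>\<bar>} \<le> tau2 / T\<^sup>2"
    "prob {\<omega> \<in> space M. T \<le> \<bar>csrc (InNoise i) \<omega>\<bar>} \<le> tau2 / T\<^sup>2"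
proof -
  have mem: "OutNoise i \<in> node_sources n" "InNoise i \<in> node_sources n"
    using assms by (auto simp: node_sources_def)
  note * = second_moment_tail[OF rv_csrc csrc_moments(2) csrc_moments(1) eq_refl[OF csrc_moments(3)] assms(2)]
  show "prob {\<omega> \<in> space M. T \<le> \<bar>csrc (OutNoise i) \<omega>\<bar>} \<le> tau2 / T\<^sup>2"
    "prob {\<omega> \<in> space M. T \<le> \<bar>csrc (InNoise i) \<omega>\<bar>} \<le> tau2 / T\<^sup>2"
    using *[of "OutNoise i"] *[of "InNoise i"] mem by simp_all
qed

lemma q_nonneg: "n \<ge> 2 \<Longrightarrow> q \<ge> 0"
proof -
  assume n: "n \<ge> 2"
  let ?S = "{infnorm (Z i j) | i j. i \<in> {1..n} \<and> j \<in> {1..n} \<and> i \<noteq> j}"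
  have fin: "finite ?S"
    by (rule finite_subset[of _ "(\<lambda>(i, j). infnorm (Z i j)) ` ({1..n} \<times> {1..n})"]) auto
  have "infnorm (Z 1 2) \<in> ?S" using n by force
  then have "infnorm (Z 1 2) \<le> q" unfolding q_eq using fin by (intro Max_ge)
  then show "q \<ge> 0" using infnorm_pos_le order_trans by blast
qed

lemma Z_component_bound:
  assumes "i \<in> {1..n}" "j \<in> {1..n}" "i \<noteq> j"
  shows "\<bar>Z i j $ t\<bar> \<le> q"
proof -
  let ?S = "{infnorm (Z i j) | i j. i \<in> {1..n} \<and> j \<in> {1..n} \<and> i \<noteq> j}"
  have fin: "finite ?S"
    by (rule finite_subset[of _ "(\<lambda>(i, j). infnorm (Z i j)) ` ({1..n} \<times> {1..n})"]) auto
  have "infnorm (Z i j) \<in> ?S" using assms by blast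
  then have "infnorm (Z i j) \<le> q" unfolding q_eq using fin by (intro Max_ge)
  then show ?thesis using component_le_infnorm_cart[of "Z i j" t] by linarith
qed

lemma cov_noise_emeasure:
  assumes "S \<in> sets borel"
  shows "emeasure M (\<eta> t -` S \<inter> space M)
    = (\<integral>\<^sup>+x. ennreal (laplace_density (real CARD('p) * q / eps) x) * indicator S x \<partial>lborel)"
  using distributed_emeasure[OF cov_noise, of S t] assms by simp

text \<open>For \<open>q = 0\<close> the Laplace scale is 0, and by the convention on division by 0
  the density vanishes identically, so it cannot have total mass 1.\<close>

lemma q_pos:
  assumes "n \<ge> 2"
  shows "q > 0"
proof (rule ccontr)
  assume "\<not> q > 0"
  then have "q = 0" using q_nonneg[OF assms] by simp
  then have "emeasure M (\<eta> undefined -` UNIV \<inter> space M) = 0"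
    by (subst cov_noise_emeasure) (auto simp: laplace_density_def)
  then show False by (simp add: emeasure_space_1)
qed

lemma cov_noise_tail:
  assumes n: "n \<ge> 2" and x: "x > 0"
  shows "prob {\<omega> \<in> space M. x < \<bar>\<eta> t \<omega>\<bar>} \<le> real CARD('p) * q / (eps * x)"
proof -
  define b where "b = real CARD('p) * q / eps"
  have b: "b > 0" using q_pos[OF n] eps_pos by (simp add: b_def)
  have [measurable]: "random_variable borel (\<eta> t)"
    using cov_noise[of t] by (simp add: distributed_def)
  have dens: "prob (\<eta> t -` S \<inter> space M) = v"
    if "S \<in> sets borel" "(\<integral>\<^sup>+x. ennreal (laplace_density b x) * indicator S x \<partial>lborel) = ennreal v" "v \<ge> 0" for S v
    using cov_noise_emeasure[OF that(1), of t] that by (simp add: b_def[symmetric] emeasure_eq_measure)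
  have e1: "exp (- x / b) \<le> 1" using x b by simp
  \<comment> \<open>The absolute value is resolved by integrating over the two halves separately;
    they overlap in the null event that \<open>\<eta> t\<close> is 0.\<close>
  have R: "prob (\<eta> t -` {0..x} \<inter> space M) = (1 - exp (- x / b)) / 2"
  proof (rule dens)
    have "(\<integral>\<^sup>+y. ennreal (laplace_density b y) * indicator {0..x} y \<partial>lborel)
        = (\<integral>\<^sup>+y. ennreal (exp (- y / b) / (2 * b)) * indicator {0..x} y \<partial>lborel)"
      by (intro nn_integral_cong) (auto simp: laplace_density_def indicator_def)
    also have "\<dots> = ennreal (- exp (- x / b) / 2 - (- exp (- 0 / b) / 2))"
      using b x by (intro nn_integral_FTC_Icc) (auto intro!: derivative_eq_intros)
    finally show "(\<integral>\<^sup>+y. ennreal (laplace_density b y) * indicator {0..x} y \<partial>lborel)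
        = ennreal ((1 - exp (- x / b)) / 2)" by (simp add: diff_divide_distrib)
  qed (use e1 in auto)
  have L: "prob (\<eta> t -` {-x..0} \<inter> space M) = (1 - exp (- x / b)) / 2"
  proof (rule dens)
    have "(\<integral>\<^sup>+y. ennreal (laplace_density b y) * indicator {-x..0} y \<partial>lborel)
        = (\<integral>\<^sup>+y. ennreal (exp (y / b) / (2 * b)) * indicator {-x..0} y \<partial>lborel)"
      by (intro nn_integral_cong) (auto simp: laplace_density_def indicator_def)
    also have "\<dots> = ennreal (exp (0 / b) / 2 - exp (- x / b) / 2)"
      using b x by (intro nn_integral_FTC_Icc) (auto intro!: derivative_eq_intros)
    finally show "(\<integral>\<^sup>+y. ennreal (laplace_density b y) * indicator {-x..0} y \<partial>lborel)
        = ennreal ((1 - exp (- x / b)) / 2)" by (simp add: diff_divide_distrib)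
  qed (use e1 in auto)
  have Z: "prob (\<eta> t -` {0} \<inter> space M) = 0"
  proof (rule dens)
    have "(\<integral>\<^sup>+y. ennreal (laplace_density b y) * indicator {0} y \<partial>lborel) = 0"
      by (subst nn_integral_indicator_singleton) auto
    then show "(\<integral>\<^sup>+y. ennreal (laplace_density b y) * indicator {0} y \<partial>lborel) = ennreal 0" by simp
  qed auto
  let ?L = "\<eta> t -` {-x..0} \<inter> space M" and ?R = "\<eta> t -` {0..x} \<inter> space M"
  have m: "?L \<in> events" "?R \<in> events" by measurable
  have "prob (?L \<union> ?R) = prob ?L + prob ?R - prob (?L \<inter> ?R)"
    using m by (simp add: measure_Un3 fmeasurable_eq_sets)
  also have "?L \<inter> ?R = \<eta> t -` {0} \<inter> space M" using x by auto
  finally have LR: "prob (?L \<union> ?R) = 1 - exp (- x / b)" using L R Z by simp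
  have "{\<omega> \<in> space M. x < \<bar>\<eta> t \<omega>\<bar>} = space M - (?L \<union> ?R)" using x by auto
  then have "prob {\<omega> \<in> space M. x < \<bar>\<eta> t \<omega>\<bar>} = exp (- x / b)"
    using m LR by (simp add: prob_compl)
  \<comment> \<open>This weak form of the exponential tail is enough at \<open>x = n\<close> when
    \<open>eps\<close> is bounded below.\<close>
  also have "\<dots> \<le> b / x"
  proof -
    have "x / b \<le> exp (x / b)" using exp_ge_add_one_self[of "x / b"] by linarith
    then have "inverse (exp (x / b)) \<le> inverse (x / b)" using x b by (intro le_imp_inverse_le) auto
    then show ?thesis by (simp add: exp_minus)
  qed
  also have "b / x = real CARD('p) * q / (eps * x)" by (simp add: b_def)
  finally show ?thesis .
qed

lemma noise_sd_square:
  assumes n: "n \<ge> 1"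
  shows "(noise_sd M n ep em)\<^sup>2 = (2 * real n - 1) * tau2"
proof -
  \<comment> \<open>The sum of the in-noise stops at \<open>n - 1\<close>, hence the coefficient 0
    at \<open>j = n\<close>; there remain \<open>2 n - 1\<close> independent terms of variance
    \<open>tau2\<close>.\<close>
  define c where "c s = (case s of OutNoise i \<Rightarrow> 1 | InNoise j \<Rightarrow> if j = n then 0 else - 1 | _ \<Rightarrow> (0::real))"
    for s :: "'p source"
  have LFc: "LF c \<omega> = (\<Sum>i=1..n. real_of_int (ep i \<omega>)) - (\<Sum>i=1..n - 1. real_of_int (em i \<omega>))" for \<omega>
  proof -
    have "(\<Sum>j=1..n. (if j = n then 0 else - 1) * real_of_int (em j \<omega>)) = - (\<Sum>i=1..n - 1. real_of_int (em i \<omega>))"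
      unfolding sum_negf[symmetric] using n by (intro sum.mono_neutral_cong_right) auto
    then show ?thesis
      unfolding LF_def sum_node_sources by (simp add: c_def csrc_noise esum_def)
  qed
  have "variance (LF c) = (\<Sum>s\<in>node_sources n. (c s)\<^sup>2 * source_variance wt tau2 s)"
    using LF_moments(2,3)[of c] by simp
  also have "\<dots> = real n * tau2 + (\<Sum>j=1..n. if j = n then 0 else tau2)"
    unfolding sum_node_sources by (simp add: c_def esum_def if_distrib[of "\<lambda>x. x\<^sup>2 * _"] cong: if_cong)
  also have "(\<Sum>j=1..n. if j = n then 0 else tau2) = (\<Sum>j=1..n - 1. tau2)"
    using n by (intro sum.mono_neutral_cong_right) auto
  also have "real n * tau2 + (\<Sum>j=1..n - 1. tau2) = (2 * real n - 1) * tau2"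
    using n by (simp add: of_nat_diff algebra_simps)
  finally have v: "variance (LF c) = (2 * real n - 1) * tau2" .
  have "0 \<le> variance (LF c)" by (rule variance_positive)
  then show ?thesis unfolding noise_sd_def LFc[symmetric] using v by simp
qed

end

section \<open>Linearization of the estimator\<close>

lemma (in finite_measure) measure_UN_le:
  assumes "finite I" "\<And>i. i \<in> I \<Longrightarrow> E i \<in> sets M" "\<And>i. i \<in> I \<Longrightarrow> measure M (E i) \<le> b"
  shows "measure M (\<Union>i\<in>I. E i) \<le> real (card I) * b"
proof -
  have "measure M (\<Union>i\<in>I. E i) \<le> (\<Sum>i\<in>I. measure M (E i))"
    using assms(1,2) by (intro finite_measure_subadditive_finite) auto
  also have "\<dots> \<le> (\<Sum>i\<in>I. b)" by (intro sum_mono assms(3))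
  finally show ?thesis by simp
qed

lemma solution_iff_solves:
  assumes "projected_network n Z \<theta> \<gamma> q m P Hm lam"
  shows "is_solution n Z d b y \<theta>' \<gamma>' \<longleftrightarrow>
    projected_network.solves n Z \<theta> \<gamma> (F_fun n Z d b \<theta> \<gamma>) (\<lambda>t. Q_fun n Z y \<theta> \<gamma> $ t)
      (\<lambda>a. \<theta>' a - \<theta> a) (\<gamma>' - \<gamma>)"
proof -
  interpret projected_network n Z \<theta> \<gamma> q m P Hm lam by fact
  have lp: "lin_pred n Z \<theta>' \<gamma>' i j = lp i j + lift (\<lambda>a. \<theta>' a - \<theta> a) (\<gamma>' - \<gamma>) i j" for i j
    by (simp add: lp_def lift_def lin_pred_eq_pot pot_def beta_par_def inner_diff_right)
  have F: "F_fun n Z d b \<theta>' \<gamma>' a = 0 \<longleftrightarrow>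
      divg n (\<lambda>i j. logistic (lp i j + lift (\<lambda>a. \<theta>' a - \<theta> a) (\<gamma>' - \<gamma>) i j) - logistic (lp i j)) a
        = F_fun n Z d b \<theta> \<gamma> a" for a
    unfolding F_fun_eq_divg lp divg_diff by (auto simp: lp_def)
  have Q: "Q_fun n Z y \<theta>' \<gamma>' $ t = 0 \<longleftrightarrow>
      esum n (\<lambda>i j. (logistic (lp i j + lift (\<lambda>a. \<theta>' a - \<theta> a) (\<gamma>' - \<gamma>) i j) - logistic (lp i j)) * Z i j $ t)
        = Q_fun n Z y \<theta> \<gamma> $ t" for t
    unfolding Q_fun_eq_esum lp left_diff_distrib esum_diff by (auto simp: lp_def)
  show ?thesis
    unfolding is_solution_def solves_def vec_eq_iff F zero_index Q by simp
qed

text \<open>Reduction of the first \<open>k\<close> coordinates to a linear form in the sources,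
  outside an event of small probability. The data \<open>d0\<close>, \<open>b0\<close>,
  \<open>y0\<close> are arbitrary because differentiation removes them from \<open>H_mat\<close>.
  The constants enter as equations so that their sizes can be compared later by real arithmetic, in
  \<open>rate_bounds\<close>, apart from the probability.\<close>

lemma (in private_network) estimator_localization:
  fixes k :: nat and m lam :: real
  assumes n3: "n \<ge> 3" and m: "0 < m"
    and wt_ge: "\<And>i j. i \<in> {1..n} \<Longrightarrow> j \<in> {1..n} \<Longrightarrow> i \<noteq> j \<Longrightarrow> m \<le> wt i j"
    and Hpos: "pos_def (H_mat n Z d0 b0 y0 \<theta> \<gamma>)"
    and Hinv: "mat_norm_inf (matrix_inv (H_mat n Z d0 b0 y0 \<theta> \<gamma>)) \<le> lam / (real n)\<^sup>2"
    and est: "is_estimator M n Z (priv_out n A ep) (priv_in n A em) (priv_cov n Z A \<eta>) \<theta>h \<gamma>h"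
    and k: "k \<le> n"
    and K: "K = 3 / (m\<^sup>2 * real (n - 1))"
    and \<kappa>: "\<kappa> = q + 2 * (K * (real n * (q / 4)))"
    and \<Lambda>: "\<Lambda> = 2 * K * real n * (1 + real CARD('p) * q * lam * \<kappa> / 4) + real CARD('p) * q * lam * \<kappa>"
    and T: "T = sqrt (real n * ln (real n))"
    and \<Gamma>: "\<Gamma> = real n * \<kappa> * sqrt (ln (real n)) + real n"
    and \<delta>: "\<delta> = 2 * (2 * (K * (2 * T + real n * (real CARD('p) * q * (lam / (real n)\<^sup>2 * \<Gamma>) / 4)))
        + real CARD('p) * q * (lam / (real n)\<^sup>2 * \<Gamma>))"
    and contr: "\<Lambda> * \<delta> \<le> 1 / 2"
    and Db: "Db = K * (1 / (4 * (m * real (n - 1))))"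
  shows "\<exists>B\<in>events.
    prob B \<le> 4 / real n + (real CARD('p) + real k + 4) * (1 + 2 * tau2) / ln (real n)
      + real CARD('p) * (real CARD('p) * q / (eps * real n)) \<and>
    (\<forall>\<omega>\<in>space M - B. \<forall>i\<in>{1..k}.
      \<bar>\<theta>h \<omega> i - \<theta> i - LF (node_coef n (weighted_network.Scol n Z \<theta> \<gamma> i)) \<omega>\<bar>
        \<le> K * (real n * \<delta>\<^sup>2 + real n * (real CARD('p) * q
              * (lam / (real n)\<^sup>2 * (\<Gamma> + (real n)\<^sup>2 * (\<delta>\<^sup>2 * \<kappa>))) / 4))
          + real n * Db * sqrt (ln (real n)))"
proof -
  have n1: "n \<ge> 1" and n2: "n \<ge> 2" using n3 by auto
  interpret W: weighted_network n Z \<theta> \<gamma> q m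
    using n3 m wt_ge Z_component_bound logistic'_le by unfold_locales (auto simp: wt_def)
  have Ww: "W.w = wt" by (simp add: fun_eq_iff W.w_def wt_def)
  obtain P where VP: "\<forall>t. \<forall>a\<in>{1..2 * n - 1}. divg n (\<lambda>i j. W.w i j * pot n (P t) i j) a
                 = divg n (\<lambda>i j. W.w i j * Z i j $ t) a"
    and HP: "\<forall>s t. H_mat n Z d0 b0 y0 \<theta> \<gamma> $ s $ t
          = esum n (\<lambda>i j. W.w i j * Z i j $ s * (Z i j $ t - pot n (P t) i j))"
    using W.H_mat_projection[of d0 b0 y0] by blast
  interpret N: projected_network n Z \<theta> \<gamma> q m P "H_mat n Z d0 b0 y0 \<theta> \<gamma>" lam
    by unfold_locales (use VP HP Hpos Hinv in auto)
  have K_eq: "W.K = K" by (simp add: W.K_def K)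
  have Pb_eq: "N.Pb = K * (real n * (q / 4))" by (simp add: N.Pb_def K_eq)
  have \<kappa>_eq: "N.\<kappa> = \<kappa>" by (simp add: N.\<kappa>_def \<kappa> Pb_eq)
  have \<Lambda>_eq: "N.\<Lambda> = \<Lambda>" by (simp add: N.\<Lambda>_def \<Lambda> K_eq \<kappa>_eq)
  have q: "q > 0" by (rule q_pos[OF n2])
  have Kp: "K > 0" using W.K_pos by (simp add: K_eq)
  have \<kappa>p: "\<kappa> > 0" using q Kp n1 by (simp add: \<kappa> add_pos_nonneg)
  have lnp: "ln (real n) > 0" using n2 by simp
  have Tp: "T > 0" and T2: "T\<^sup>2 = real n * ln (real n)" using n2 lnp by (auto simp: T)
  have Dbp: "Db > 0"
    unfolding Db using Kp m n3 by (intro mult_pos_pos divide_pos_pos) auto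
  have "\<forall>i\<in>{1..n}. \<exists>Y. (\<forall>a\<in>{1..2 * n - 1}. divg n (\<lambda>i j. W.w i j * pot n Y i j) a = (if a = i then 1 else 0)) \<and>
    (\<forall>a\<in>{1..2 * n - 1}. \<bar>Y a - W.Scol i a\<bar> \<le> Db)"
    using W.V_inverse_column_approx unfolding K_eq Db by blast
  from bchoice[OF this] obtain Y where
    Y: "\<And>i a. i \<in> {1..n} \<Longrightarrow> a \<in> {1..2 * n - 1} \<Longrightarrow>
        divg n (\<lambda>k l. W.w k l * pot n (Y i) k l) a = (if a = i then 1 else 0)"
    and Yd: "\<And>i a. i \<in> {1..n} \<Longrightarrow> a \<in> {1..2 * n - 1} \<Longrightarrow> \<bar>Y i a - W.Scol i a\<bar> \<le> Db"
    by blast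
  \<comment> \<open>Noise part of the signed score sum, that is, of the implicit residual at node
    \<open>2 n\<close>.\<close>
  define c3 :: "'p source \<Rightarrow> real" where
    "c3 s = (case s of OutNoise i \<Rightarrow> 1 | InNoise j \<Rightarrow> if j = n then 0 else - 1 | _ \<Rightarrow> (0::real))" for s
  \<comment> \<open>Coefficients of the edges and of the discrete noise in the covariate score after
    elimination of the node parameters.\<close>
  define c4 :: "'p \<Rightarrow> 'p source \<Rightarrow> real" where
    "c4 t s = (case s of Edge i j \<Rightarrow> Z i j $ t | _ \<Rightarrow> (0::real)) - node_coef n (P t) s" for t s
  define c6 where "c6 i = (\<lambda>a. Y i a - W.Scol i a)" for i
  \<comment> \<open>The bad events. \<open>E1\<close>, \<open>E2\<close>, \<open>E2'\<close> and
    \<open>E3\<close> control the score at all \<open>2 n\<close> nodes, the last of them implicit;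
    \<open>E4\<close> and \<open>E5\<close> control the reduced covariate score; \<open>E6\<close>
    controls the error of replacing a column of the inverse of \<open>V\<close> by
    \<open>Scol\<close>.\<close>
  define E1 where "E1 a = {\<omega> \<in> space M. T \<le> \<bar>divg n (\<lambda>i j. xi i j \<omega>) a\<bar>}" for a
  define E2 where "E2 i = {\<omega> \<in> space M. T \<le> \<bar>csrc (OutNoise i) \<omega>\<bar>}" for i
  define E2' where "E2' i = {\<omega> \<in> space M. T \<le> \<bar>csrc (InNoise i) \<omega>\<bar>}" for i
  define E3 where "E3 = {\<omega> \<in> space M. T \<le> \<bar>LF c3 \<omega>\<bar>}"
  define E4 where "E4 t = {\<omega> \<in> space M. real n * \<kappa> * sqrt (ln (real n)) \<le> \<bar>LF (c4 t) \<omega>\<bar>}" for t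
  define E5 where "E5 t = {\<omega> \<in> space M. real n < \<bar>\<eta> t \<omega>\<bar>}" for t
  define E6 where "E6 i = {\<omega> \<in> space M. real n * Db * sqrt (ln (real n)) \<le> \<bar>LF (node_coef n (c6 i)) \<omega>\<bar>}" for i
  have rv_xi [measurable]: "random_variable borel (\<lambda>\<omega>. xi i j \<omega>)"
    if "i \<in> {1..n}" "j \<in> {1..n}" "i \<noteq> j" for i j
    unfolding xi_def using that by (intro rv_csrc) (auto simp: node_sources_def)
  have [measurable]: "random_variable borel (\<lambda>\<omega>. divg n (\<lambda>i j. xi i j \<omega>) a)" if "a \<in> {1..2 * n}" for a
  proof (cases "a \<le> n")
    case True
    then show ?thesis unfolding divg_def using that
      by (auto intro!: borel_measurable_sum rv_xi)
  next
    case False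
    then have "a - n \<in> {1..n}" using that by auto
    then show ?thesis unfolding divg_def using False
      by (auto intro!: borel_measurable_sum rv_xi)
  qed
  note [measurable] = rv_LF
  have [measurable]: "random_variable borel (\<eta> t)" for t
    using cov_noise[of t] by (simp add: distributed_def)
  have rv_noise: "random_variable borel (csrc (OutNoise i))" "random_variable borel (csrc (InNoise i))"
    if "i \<in> {1..n}" for i using that by (auto intro!: rv_csrc simp: node_sources_def)
  have ev: "a \<in> {1..2 * n} \<Longrightarrow> E1 a \<in> events" "i \<in> {1..n} \<Longrightarrow> E2 i \<in> events" "i \<in> {1..n} \<Longrightarrow> E2' i \<in> events"
    "E3 \<in> events" "E4 t \<in> events" "E5 t \<in> events" "E6 i \<in> events" for a i t
    unfolding E1_def E2_def E2'_def E3_def E4_def E5_def E6_def using rv_noise[of i] by measurable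
  have tau: "tau2 \<ge> 0" by (rule tau2_nonneg)
  have nsq: "real n \<le> (real n)\<^sup>2" using n1 by (simp add: power2_eq_square)
  have p1: "prob (\<Union>a\<in>{1..2 * n}. E1 a) \<le> 4 / real n"
  proof -
    have "prob (\<Union>a\<in>{1..2 * n}. E1 a) \<le> real (card {1..2 * n}) * (2 / (real n)\<^sup>2)"
      using ev(1) divg_xi_tail[OF _ n2] by (intro measure_UN_le) (auto simp: E1_def T)
    also have "\<dots> = 4 / real n" using n1 by (simp add: power2_eq_square)
    finally show ?thesis .
  qed
  have p2: "prob (\<Union>i\<in>{1..n}. E2 i) \<le> tau2 / ln (real n)" "prob (\<Union>i\<in>{1..n}. E2' i) \<le> tau2 / ln (real n)"
  proof -
    \<comment> \<open>For the noise Chebyshev's inequality survives the union: there are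
      \<open>n\<close> events, each of probability at most \<open>tau2 / (n ln n)\<close>.\<close>
    have eq: "real (card {1..n}) * (tau2 / T\<^sup>2) = tau2 / ln (real n)" using n1 by (simp add: T2)
    show "prob (\<Union>i\<in>{1..n}. E2 i) \<le> tau2 / ln (real n)" unfolding eq[symmetric]
      by (rule measure_UN_le) (use ev(2) noise_tail(1)[OF _ Tp] in \<open>auto simp: E2_def\<close>)
    show "prob (\<Union>i\<in>{1..n}. E2' i) \<le> tau2 / ln (real n)" unfolding eq[symmetric]
      by (rule measure_UN_le) (use ev(3) noise_tail(2)[OF _ Tp] in \<open>auto simp: E2'_def\<close>)
  qed
  have p3: "prob E3 \<le> 2 * tau2 / ln (real n)"
  proof -
    have "(\<Sum>s\<in>node_sources n. (c3 s)\<^sup>2 * source_variance wt tau2 s)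
        \<le> (real n)\<^sup>2 * (0\<^sup>2 / 4) + 2 * real n * 1\<^sup>2 * tau2"
      by (rule LF_variance_bound) (auto simp: c3_def)
    then have "prob E3 \<le> (2 * real n * tau2) / T\<^sup>2"
      unfolding E3_def by (intro LF_tail Tp) simp
    also have "\<dots> = 2 * tau2 / ln (real n)" using n1 by (simp add: T2)
    finally show ?thesis .
  qed
  have p4: "prob (\<Union>t. E4 t) \<le> real CARD('p) * ((1 + 2 * tau2) / ln (real n))"
  proof (rule measure_UN_le)
    fix t
    have Pt: "\<bar>P t a\<bar> \<le> \<kappa>" if "a \<in> {1..2 * n - 1}" for a
    proof -
      have "0 \<le> K * (real n * (q / 4))" using Kp q by simp
      then show ?thesis using N.P_bound[OF that, of t] q unfolding Pb_eq \<kappa> by linarith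
    qed
    have bt: "\<bar>beta_par n (P t) i\<bar> \<le> \<kappa>" if "i \<in> {1..n}" for i
    proof (cases "i = n")
      case False
      then have "n + i \<in> {1..2 * n - 1}" using that by auto
      then show ?thesis using Pt False by (simp add: beta_par_def)
    qed (use \<kappa>p in \<open>simp add: beta_par_def\<close>)
    have "(\<Sum>s\<in>node_sources n. (c4 t s)\<^sup>2 * source_variance wt tau2 s)
        \<le> (real n)\<^sup>2 * (\<kappa>\<^sup>2 / 4) + 2 * real n * \<kappa>\<^sup>2 * tau2"
    proof (rule LF_variance_bound)
      show "\<bar>c4 t (Edge i j)\<bar> \<le> \<kappa>" if "i \<in> {1..n}" "j \<in> {1..n}" "i \<noteq> j" for i j
        using N.residual_covariate_bound[OF that, of t] by (simp add: c4_def \<kappa>_eq)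
      show "\<bar>c4 t (OutNoise i)\<bar> \<le> \<kappa>" if "i \<in> {1..n}" for i
        using Pt[of i] that by (auto simp: c4_def)
      show "\<bar>c4 t (InNoise i)\<bar> \<le> \<kappa>" if "i \<in> {1..n}" for i
        using bt[OF that] by (simp add: c4_def)
    qed (use \<kappa>p in auto)
    also have "\<dots> \<le> (real n)\<^sup>2 * \<kappa>\<^sup>2 * (1 + 2 * tau2)"
    proof -
      have "real n * (\<kappa>\<^sup>2 * tau2) \<le> (real n)\<^sup>2 * (\<kappa>\<^sup>2 * tau2)"
        using nsq tau by (intro mult_right_mono) auto
      moreover have "0 \<le> (real n)\<^sup>2 * \<kappa>\<^sup>2" by simp
      moreover have "(real n)\<^sup>2 * (\<kappa>\<^sup>2 / 4) + 2 * real n * \<kappa>\<^sup>2 * tau2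
          = ((real n)\<^sup>2 * \<kappa>\<^sup>2) / 4 + 2 * (real n * (\<kappa>\<^sup>2 * tau2))" by simp
      moreover have "(real n)\<^sup>2 * \<kappa>\<^sup>2 * (1 + 2 * tau2)
          = (real n)\<^sup>2 * \<kappa>\<^sup>2 + 2 * ((real n)\<^sup>2 * (\<kappa>\<^sup>2 * tau2))" by (simp add: algebra_simps)
      ultimately show ?thesis by linarith
    qed
    finally have "prob (E4 t) \<le> (real n)\<^sup>2 * \<kappa>\<^sup>2 * (1 + 2 * tau2) / (real n * \<kappa> * sqrt (ln (real n)))\<^sup>2"
      unfolding E4_def using n1 \<kappa>p lnp by (intro LF_tail) auto
    also have "\<dots> = (1 + 2 * tau2) / ln (real n)"
      using n1 \<kappa>p lnp by (simp add: power_mult_distrib)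
    finally show "prob (E4 t) \<le> (1 + 2 * tau2) / ln (real n)" .
  qed (use ev in auto)
  have p5: "prob (\<Union>t. E5 t) \<le> real CARD('p) * (real CARD('p) * q / (eps * real n))"
    by (rule measure_UN_le) (use ev cov_noise_tail[OF n2] n1 in \<open>auto simp: E5_def\<close>)
  have p6: "prob (\<Union>i\<in>{1..k}. E6 i) \<le> real k * ((1 + 2 * tau2) / ln (real n))"
  proof -
    have "prob (\<Union>i\<in>{1..k}. E6 i) \<le> real (card {1..k}) * ((1 + 2 * tau2) / ln (real n))"
    proof (rule measure_UN_le)
      fix i assume "i \<in> {1..k}"
      then have i: "i \<in> {1..n}" using k by auto
      have cb: "\<bar>c6 i a\<bar> \<le> Db" if "a \<in> {1..2 * n - 1}" for a using Yd[OF i that] by (simp add: c6_def)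
      have "(\<Sum>s\<in>node_sources n. (node_coef n (c6 i) s)\<^sup>2 * source_variance wt tau2 s)
          \<le> (real n)\<^sup>2 * ((2 * Db)\<^sup>2 / 4) + 2 * real n * Db\<^sup>2 * tau2"
      proof (rule LF_variance_bound)
        show "\<bar>node_coef n (c6 i) (Edge a b)\<bar> \<le> 2 * Db" if "a \<in> {1..n}" "b \<in> {1..n}" "a \<noteq> b" for a b
          using N.pot_bound[OF cb that(1,2)] by simp
        show "\<bar>node_coef n (c6 i) (OutNoise a)\<bar> \<le> Db" if "a \<in> {1..n}" for a
          using cb[of a] that by auto
        show "\<bar>node_coef n (c6 i) (InNoise a)\<bar> \<le> Db" if "a \<in> {1..n}" for a
        proof (cases "a = n")
          case False
          then have "n + a \<in> {1..2 * n - 1}" using that by auto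
          then show ?thesis using cb False by (simp add: beta_par_def)
        qed (use Dbp in \<open>simp add: beta_par_def\<close>)
      qed (use Dbp in auto)
      also have "\<dots> \<le> (real n)\<^sup>2 * Db\<^sup>2 * (1 + 2 * tau2)"
      proof -
        have "real n * (Db\<^sup>2 * tau2) \<le> (real n)\<^sup>2 * (Db\<^sup>2 * tau2)"
          using nsq tau by (intro mult_right_mono) auto
        then show ?thesis by (simp add: algebra_simps power_mult_distrib)
      qed
      finally have "prob (E6 i) \<le> (real n)\<^sup>2 * Db\<^sup>2 * (1 + 2 * tau2) / (real n * Db * sqrt (ln (real n)))\<^sup>2"
        unfolding E6_def using n1 Dbp lnp by (intro LF_tail) auto
      also have "\<dots> = (1 + 2 * tau2) / ln (real n)"
        using n1 Dbp lnp by (simp add: power_mult_distrib)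
      finally show "prob (E6 i) \<le> (1 + 2 * tau2) / ln (real n)" .
    qed (use ev in auto)
    then show ?thesis by simp
  qed
  define B where "B = (\<Union>a\<in>{1..2 * n}. E1 a) \<union> ((\<Union>i\<in>{1..n}. E2 i) \<union> ((\<Union>i\<in>{1..n}. E2' i) \<union>
    (E3 \<union> ((\<Union>t. E4 t) \<union> ((\<Union>t. E5 t) \<union> (\<Union>i\<in>{1..k}. E6 i))))))"
  have evU: "(\<Union>a\<in>{1..2 * n}. E1 a) \<in> events" "(\<Union>i\<in>{1..n}. E2 i) \<in> events" "(\<Union>i\<in>{1..n}. E2' i) \<in> events"
    "(\<Union>t. E4 t) \<in> events" "(\<Union>t. E5 t) \<in> events" "(\<Union>i\<in>{1..k}. E6 i) \<in> events"
    using ev by (auto intro!: sets.finite_UN)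
  have B_ev: "B \<in> events" unfolding B_def using evU ev by (intro sets.Un) auto
  have un: "prob (S1 \<union> S2) \<le> x + z" if "S1 \<in> events" "S2 \<in> events" "prob S1 \<le> x" "prob S2 \<le> z" for S1 S2 x z
    using measure_Un_le[OF that(1,2)] that(3,4) by linarith
  have "prob B \<le> 4 / real n + (tau2 / ln (real n) + (tau2 / ln (real n) + (2 * tau2 / ln (real n)
      + (real CARD('p) * ((1 + 2 * tau2) / ln (real n)) + (real CARD('p) * (real CARD('p) * q / (eps * real n))
      + real k * ((1 + 2 * tau2) / ln (real n)))))))"
    unfolding B_def by (intro un p1 p2 p3 p4 p5 p6 sets.Un evU ev)
  also have "\<dots> = 4 / real n + (real CARD('p) + real k) * (1 + 2 * tau2) / ln (real n)
      + 4 * tau2 / ln (real n) + real CARD('p) * (real CARD('p) * q / (eps * real n))"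
    by (simp add: add_divide_distrib ring_distribs)
  also have "\<dots> \<le> 4 / real n + (real CARD('p) + real k + 4) * (1 + 2 * tau2) / ln (real n)
      + real CARD('p) * (real CARD('p) * q / (eps * real n))"
  proof -
    have "4 * tau2 / ln (real n) \<le> 4 * (1 + 2 * tau2) / ln (real n)"
      using tau lnp by (intro divide_right_mono) auto
    then show ?thesis by (simp add: add_divide_distrib ring_distribs)
  qed
  finally have pB: "prob B \<le> 4 / real n + (real CARD('p) + real k + 4) * (1 + 2 * tau2) / ln (real n)
      + real CARD('p) * (real CARD('p) * q / (eps * real n))" .
  have main: "\<bar>\<theta>h \<omega> i - \<theta> i - LF (node_coef n (W.Scol i)) \<omega>\<bar>
        \<le> K * (real n * \<delta>\<^sup>2 + real n * (real CARD('p) * q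
              * (lam / (real n)\<^sup>2 * (\<Gamma> + (real n)\<^sup>2 * (\<delta>\<^sup>2 * \<kappa>))) / 4))
          + real n * Db * sqrt (ln (real n))"
    if \<omega>: "\<omega> \<in> space M - B" and ik: "i \<in> {1..k}" for \<omega> i
  proof -
    have \<omega>M: "\<omega> \<in> space M" using \<omega> by simp
    have i: "i \<in> {1..n}" using ik k by auto
    have i': "i \<in> {1..2 * n - 1}" using i n1 by auto
    have g1: "\<bar>divg n (\<lambda>i j. xi i j \<omega>) a\<bar> \<le> T" if "a \<in> {1..2 * n}" for a
      using \<omega> that by (auto simp: B_def E1_def not_le less_imp_le)
    have g2: "\<bar>csrc (OutNoise i) \<omega>\<bar> \<le> T" "\<bar>csrc (InNoise i) \<omega>\<bar> \<le> T" if "i \<in> {1..n}" for i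
      using \<omega> that by (auto simp: B_def E2_def E2'_def not_le less_imp_le)
    have g3: "\<bar>LF c3 \<omega>\<bar> \<le> T" using \<omega> by (auto simp: B_def E3_def)
    have g4: "\<bar>LF (c4 t) \<omega>\<bar> \<le> real n * \<kappa> * sqrt (ln (real n))" for t
      using \<omega> by (auto simp: B_def E4_def not_le less_imp_le)
    have g5: "\<bar>\<eta> t \<omega>\<bar> \<le> real n" for t using \<omega> by (auto simp: B_def E5_def not_less)
    have g6: "\<bar>LF (node_coef n (c6 i)) \<omega>\<bar> \<le> real n * Db * sqrt (ln (real n))"
      using \<omega> ik by (auto simp: B_def E6_def not_le less_imp_le)
    let ?g = "\<lambda>a. score a \<omega>" and ?G = "\<lambda>t. Q_fun n Z (priv_cov n Z A \<eta> \<omega>) \<theta> \<gamma> $ t"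
    have sg: "\<bar>?g a\<bar> \<le> 2 * T" if "a \<in> {1..2 * n - 1}" for a
    proof -
      have "\<bar>if a \<le> n then csrc (OutNoise a) \<omega> else csrc (InNoise (a - n)) \<omega>\<bar> \<le> T"
      proof (cases "a \<le> n")
        case False
        then have "a - n \<in> {1..n}" using that by auto
        then show ?thesis using g2(2) False by simp
      qed (use g2(1)[of a] that in auto)
      moreover have "\<bar>divg n (\<lambda>i j. xi i j \<omega>) a\<bar> \<le> T" using g1[of a] that by auto
      ultimately show ?thesis unfolding score_eq by linarith
    qed
    have sl: "\<bar>\<Sum>a=1..2 * n - 1. (if a \<le> n then 1 else - 1) * ?g a\<bar> \<le> 2 * T"
    proof -
      let ?sg = "\<lambda>a. if a \<le> n then 1 else (- 1 :: real)"
      have "(\<Sum>a=1..2 * n - 1. ?sg a * ?g a) = (\<Sum>a=1..2 * n - 1. ?sg a * divg n (\<lambda>i j. xi i j \<omega>) a)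
         + (\<Sum>a=1..2 * n - 1. ?sg a * (if a \<le> n then csrc (OutNoise a) \<omega> else csrc (InNoise (a - n)) \<omega>))"
        unfolding score_eq distrib_left sum.distrib ..
      also have "(\<Sum>a=1..2 * n - 1. ?sg a * divg n (\<lambda>i j. xi i j \<omega>) a) = divg n (\<lambda>i j. xi i j \<omega>) (2 * n)"
        by (rule divg_last[OF n1, symmetric])
      also have "(\<Sum>a=1..2 * n - 1. ?sg a * (if a \<le> n then csrc (OutNoise a) \<omega> else csrc (InNoise (a - n)) \<omega>))
          = LF c3 \<omega>"
        unfolding nodes_split_sum[OF n1] LF_def sum_node_sources
        by (auto simp: c3_def esum_def intro!: arg_cong2[of _ _ _ _ "(+)"] sum.cong)
      finally show ?thesis using g1[of "2 * n"] g3 n1 by auto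
    qed
    have sG: "\<bar>?G t - (\<Sum>a=1..2 * n - 1. P t a * ?g a)\<bar> \<le> \<Gamma>" for t
    proof -
      have "?G t - (\<Sum>a=1..2 * n - 1. P t a * ?g a) = LF (c4 t) \<omega> + \<eta> t \<omega>"
        unfolding score_functional[OF n1] covariate_score LF_def sum_node_sources
        by (simp add: c4_def xi_def left_diff_distrib esum_diff sum_negf mult.commute)
      then show ?thesis using g4[of t] g5[of t] by (simp add: \<Gamma>)
    qed
    obtain u0 x0 where
      l1: "\<And>a. a \<in> {1..2 * n - 1} \<Longrightarrow> divg n (\<lambda>i j. W.w i j * N.lift u0 x0 i j) a = ?g a" and
      l2: "\<And>s. esum n (\<lambda>i j. W.w i j * N.lift u0 x0 i j * Z i j $ s) = ?G s"
      using N.linear_solve[of ?g ?G] by blast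
    \<comment> \<open>The factor 2 in \<open>\<delta>\<close> reserves half of the radius for the
      linear step; the other half is for the remainder.\<close>
    have small0: "\<bar>N.lift u0 x0 a b\<bar> \<le> \<delta> / 2" if "a \<in> {1..n}" "b \<in> {1..n}" "a \<noteq> b" for a b
      using N.linear_step_bound[OF l1 l2 sg sl sG that] by (simp add: K_eq \<delta>)
    obtain u x where sol: "N.solves ?g ?G u x"
      and small: "\<And>a b. a \<in> {1..n} \<Longrightarrow> b \<in> {1..n} \<Longrightarrow> a \<noteq> b \<Longrightarrow> \<bar>N.lift u x a b\<bar> \<le> \<delta>"
      using N.nonlinear_solvable[OF l1 l2 small0] contr unfolding \<Lambda>_eq by blast
    have g_eq: "?g = F_fun n Z (priv_out n A ep \<omega>) (priv_in n A em \<omega>) \<theta> \<gamma>"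
      by (simp add: fun_eq_iff score_def)
    note iff = solution_iff_solves[OF N.projected_network_axioms,
      of "priv_out n A ep \<omega>" "priv_in n A em \<omega>" "priv_cov n Z A \<eta> \<omega>", folded g_eq]
    have "is_solution n Z (priv_out n A ep \<omega>) (priv_in n A em \<omega>) (priv_cov n Z A \<eta> \<omega>)
        (\<lambda>a. \<theta> a + u a) (\<gamma> + x)"
      unfolding iff using sol by simp
    then have "is_solution n Z (priv_out n A ep \<omega>) (priv_in n A em \<omega>) (priv_cov n Z A \<eta> \<omega>) (\<theta>h \<omega>) (\<gamma>h \<omega>)"
      using est \<omega>M unfolding is_estimator_def by blast
    then have "N.solves ?g ?G (\<lambda>a. \<theta>h \<omega> a - \<theta> a) (\<gamma>h \<omega> - \<gamma>)" unfolding iff .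
    from N.nonlinear_unique(2)[OF this sol i'] have u_eq: "\<theta>h \<omega> i - \<theta> i = u i" .
    obtain yy where yy: "\<And>a. a \<in> {1..2 * n - 1} \<Longrightarrow> divg n (\<lambda>i j. W.w i j * pot n yy i j) a = ?g a"
      using W.V_solve[of ?g] by blast
    have ex: "\<bar>u i - yy i\<bar> \<le> K * (real n * \<delta>\<^sup>2 + real n * (real CARD('p) * q
              * (lam / (real n)\<^sup>2 * (\<Gamma> + (real n)\<^sup>2 * (\<delta>\<^sup>2 * \<kappa>))) / 4))"
      using N.expansion[OF sol small yy sG i'] by (simp add: K_eq \<kappa>_eq)
    have "yy i = (\<Sum>a=1..2 * n - 1. Y i a * ?g a)"
      by (rule W.V_dual[OF i Y[OF i] yy])
    also have "\<dots> = (\<Sum>a=1..2 * n - 1. W.Scol i a * ?g a) + (\<Sum>a=1..2 * n - 1. c6 i a * ?g a)"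
      by (simp add: c6_def left_diff_distrib sum_subtractf)
    also have "\<dots> = LF (node_coef n (W.Scol i)) \<omega> + LF (node_coef n (c6 i)) \<omega>"
      by (simp only: score_functional[OF n1])
    finally show ?thesis using ex g6 u_eq by linarith
  qed
  show ?thesis using B_ev pB main by blast
qed

section \<open>Characteristic functions of linear forms of the estimator\<close>

lemma iexp_lipschitz: "cmod (iexp x - iexp y) \<le> \<bar>x - y\<bar>"
proof -
  have "iexp x - iexp y = iexp y * (iexp (x - y) - 1)"
    by (simp add: right_diff_distrib exp_add[symmetric] algebra_simps)
  then have "cmod (iexp x - iexp y) = cmod (iexp (x - y) - 1)" by (simp add: norm_mult)
  also have "\<dots> \<le> \<bar>x - y\<bar>" using iexp_approx1[of "x - y" 0] by simp
  finally show ?thesis .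
qed

lemma (in prob_space) iexp_expectation_diff:
  assumes [measurable]: "random_variable borel U" "random_variable borel V" and B: "B \<in> events"
    and e: "0 \<le> e" "\<And>\<omega>. \<omega> \<in> space M - B \<Longrightarrow> \<bar>U \<omega> - V \<omega>\<bar> \<le> e"
  shows "cmod (expectation (\<lambda>\<omega>. iexp (U \<omega>)) - expectation (\<lambda>\<omega>. iexp (V \<omega>))) \<le> 2 * prob B + e"
proof -
  have i: "integrable M (\<lambda>\<omega>. iexp (U \<omega>))" "integrable M (\<lambda>\<omega>. iexp (V \<omega>))"
    by (auto intro!: integrable_iexp)
  have iB: "integrable M (indicator B :: _ \<Rightarrow> real)"
    by (rule integrable_const_bound[where B = 1]) (use B in \<open>auto simp: indicator_def\<close>)
  have "expectation (\<lambda>\<omega>. iexp (U \<omega>)) - expectation (\<lambda>\<omega>. iexp (V \<omega>))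
      = expectation (\<lambda>\<omega>. iexp (U \<omega>) - iexp (V \<omega>))"
    using i by simp
  also have "cmod \<dots> \<le> expectation (\<lambda>\<omega>. cmod (iexp (U \<omega>) - iexp (V \<omega>)))"
    by (rule integral_norm_bound)
  also have "\<dots> \<le> expectation (\<lambda>\<omega>. 2 * indicator B \<omega> + e)"
  proof (rule integral_mono)
    fix \<omega> assume \<omega>: "\<omega> \<in> space M"
    show "cmod (iexp (U \<omega>) - iexp (V \<omega>)) \<le> 2 * indicator B \<omega> + e"
    proof (cases "\<omega> \<in> B")
      case True
      have "cmod (iexp (U \<omega>) - iexp (V \<omega>)) \<le> cmod (iexp (U \<omega>)) + cmod (iexp (V \<omega>))"
        by (rule norm_triangle_ineq4)
      then show ?thesis using True e(1) by simp
    next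
      case False
      then show ?thesis using iexp_lipschitz[of "U \<omega>" "V \<omega>"] e(2)[of \<omega>] \<omega> by simp
    qed
  next
    show "integrable M (\<lambda>\<omega>. cmod (iexp (U \<omega>) - iexp (V \<omega>)))" using i by simp
    show "integrable M (\<lambda>\<omega>. 2 * indicator B \<omega> + e)" using iB by simp
  qed
  also have "\<dots> = 2 * prob B + e" using iB B by (simp add: prob_space)
  finally show ?thesis .
qed

text \<open>There are about \<open>n^2\<close> edges and \<open>\<beta>\<close> will be of order
  \<open>1 / sqrt n\<close> up to powers of e^\<rho>, so bounding every edge coefficient by
  \<open>\<beta>\<close> would leave \<open>n^2 * \<beta>^3\<close>, which diverges. Only the
  surplus powers are bounded by \<open>\<beta>\<close>; the rest is kept as the variance of the edge
  part. The \<open>2 n\<close> noise terms can afford the crude bound.\<close>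

lemma (in private_network) LF_char_bound:
  fixes c :: "'p source \<Rightarrow> real"
  assumes a0: "al \<le> a0" "a0 < 1" and C3: "C3 = 2 * (\<Sum>k. real k ^ 3 * a0 ^ k)"
    and \<beta>: "\<And>s. s \<in> node_sources n \<Longrightarrow> \<bar>c s\<bar> \<le> \<beta>" "\<beta> \<ge> 0"
  shows "cmod (expectation (\<lambda>\<omega>. iexp (LF c \<omega>))
      - complex_of_real (exp (- (\<Sum>s\<in>node_sources n. (c s)\<^sup>2 * source_variance wt tau2 s) / 2)))
    \<le> (\<beta> + \<beta>\<^sup>2) * esum n (\<lambda>i j. wt i j * (c (Edge i j))\<^sup>2) + 2 * real n * \<beta> ^ 3 * C3
      + 2 * real n * \<beta> ^ 4 * tau2\<^sup>2"
proof -
  let ?v = "\<lambda>s. (c s)\<^sup>2 * source_variance wt tau2 s"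
  have a0pos: "0 \<le> a0" using al a0 by simp
  have C3p: "C3 \<ge> 0"
    unfolding C3 using summable_cube_power[OF a0pos a0(2)] a0pos by (auto intro!: suminf_nonneg)
  have cube: "integrable M (\<lambda>\<omega>. \<bar>c s * csrc s \<omega>\<bar> ^ 3)"
    "expectation (\<lambda>\<omega>. \<bar>c s * csrc s \<omega>\<bar> ^ 3) \<le> \<bar>c s\<bar> ^ 3 * source_variance wt C3 s"
    if "s \<in> node_sources n" for s
    using csrc_cube[OF that a0] by (auto simp: abs_mult power_mult_distrib C3 intro!: mult_left_mono)
  have "cmod (expectation (\<lambda>\<omega>. iexp (LF c \<omega>)) - complex_of_real (exp (- (\<Sum>s\<in>node_sources n. ?v s) / 2)))
      \<le> (\<Sum>s\<in>node_sources n. expectation (\<lambda>\<omega>. \<bar>c s * csrc s \<omega>\<bar> ^ 3) + (?v s)\<^sup>2)"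
    unfolding LF_def
  proof (rule char_indep_sum_bound[OF finite_node_sources indep_weighted_csrc])
    show "integrable M (\<lambda>\<omega>. (c s * csrc s \<omega>)\<^sup>2)" "expectation (\<lambda>\<omega>. c s * csrc s \<omega>) = 0"
      "expectation (\<lambda>\<omega>. (c s * csrc s \<omega>)\<^sup>2) = ?v s" if "s \<in> node_sources n" for s
      using csrc_moments[OF that] by (auto simp: power_mult_distrib)
  qed (use cube in auto)
  also have "\<dots> \<le> (\<Sum>s\<in>node_sources n. \<bar>c s\<bar> ^ 3 * source_variance wt C3 s + (?v s)\<^sup>2)"
    using cube by (intro sum_mono add_mono) auto
  also have "\<dots> = esum n (\<lambda>i j. \<bar>c (Edge i j)\<bar> ^ 3 * wt i j + ((c (Edge i j))\<^sup>2 * wt i j)\<^sup>2)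
      + (\<Sum>i=1..n. \<bar>c (OutNoise i)\<bar> ^ 3 * C3 + ((c (OutNoise i))\<^sup>2 * tau2)\<^sup>2)
      + (\<Sum>i=1..n. \<bar>c (InNoise i)\<bar> ^ 3 * C3 + ((c (InNoise i))\<^sup>2 * tau2)\<^sup>2)"
    unfolding sum_node_sources by simp
  also have "\<dots> \<le> (\<beta> + \<beta>\<^sup>2) * esum n (\<lambda>i j. wt i j * (c (Edge i j))\<^sup>2)
      + real n * (\<beta> ^ 3 * C3 + (\<beta>\<^sup>2 * tau2)\<^sup>2) + real n * (\<beta> ^ 3 * C3 + (\<beta>\<^sup>2 * tau2)\<^sup>2)"
  proof (intro add_mono)
    show "esum n (\<lambda>i j. \<bar>c (Edge i j)\<bar> ^ 3 * wt i j + ((c (Edge i j))\<^sup>2 * wt i j)\<^sup>2)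
        \<le> (\<beta> + \<beta>\<^sup>2) * esum n (\<lambda>i j. wt i j * (c (Edge i j))\<^sup>2)"
      unfolding esum_cmult[symmetric] unfolding esum_def
    proof (intro sum_mono)
      fix i j assume ij: "i \<in> {1..n}" "j \<in> {1..n} - {i}"
      then have "Edge i j \<in> node_sources n" by (auto simp: node_sources_def)
      then have cb: "\<bar>c (Edge i j)\<bar> \<le> \<beta>" by (rule \<beta>)
      let ?c = "c (Edge i j)" and ?w = "wt i j"
      have w: "0 \<le> ?w" "?w \<le> 1"
        using logistic'_pos[of "lin_pred n Z \<theta> \<gamma> i j"] logistic'_le[of "lin_pred n Z \<theta> \<gamma> i j"]
        by (auto simp: wt_def)
      have "\<bar>?c\<bar> * (?w * ?c\<^sup>2) \<le> \<beta> * (?w * ?c\<^sup>2)" using cb w by (intro mult_right_mono) auto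
      moreover have "(?c\<^sup>2 * ?w) * (?w * ?c\<^sup>2) \<le> \<beta>\<^sup>2 * (?w * ?c\<^sup>2)"
      proof (rule mult_right_mono)
        have "?c\<^sup>2 * ?w \<le> ?c\<^sup>2 * 1" using w by (intro mult_left_mono) auto
        also have "\<dots> \<le> \<beta>\<^sup>2" using cb power_mono[of "\<bar>?c\<bar>" \<beta> 2] by simp
        finally show "?c\<^sup>2 * ?w \<le> \<beta>\<^sup>2" .
      qed (use w in auto)
      moreover have "\<bar>?c\<bar> ^ 3 * ?w = \<bar>?c\<bar> * (?w * ?c\<^sup>2)"
        by (simp add: power3_eq_cube power2_eq_square)
      moreover have "(?c\<^sup>2 * ?w)\<^sup>2 = (?c\<^sup>2 * ?w) * (?w * ?c\<^sup>2)"
        by (simp add: power2_eq_square)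
      ultimately show "\<bar>?c\<bar> ^ 3 * ?w + (?c\<^sup>2 * ?w)\<^sup>2 \<le> (\<beta> + \<beta>\<^sup>2) * (?w * ?c\<^sup>2)"
        unfolding distrib_right by linarith
    qed
  next
    have b: "\<bar>x\<bar> ^ 3 * C3 + (x\<^sup>2 * tau2)\<^sup>2 \<le> \<beta> ^ 3 * C3 + (\<beta>\<^sup>2 * tau2)\<^sup>2" if "\<bar>x\<bar> \<le> \<beta>" for x
    proof (rule add_mono)
      show "\<bar>x\<bar> ^ 3 * C3 \<le> \<beta> ^ 3 * C3" using that C3p by (intro mult_right_mono power_mono) auto
      have "x\<^sup>2 \<le> \<beta>\<^sup>2" using that power_mono[of "\<bar>x\<bar>" \<beta> 2] by simp
      then have "x\<^sup>2 * tau2 \<le> \<beta>\<^sup>2 * tau2" using tau2_nonneg by (rule mult_right_mono)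
      then show "(x\<^sup>2 * tau2)\<^sup>2 \<le> (\<beta>\<^sup>2 * tau2)\<^sup>2" using tau2_nonneg by (intro power_mono) auto
    qed
    have "(\<Sum>i=1..n. \<bar>c (OutNoise i)\<bar> ^ 3 * C3 + ((c (OutNoise i))\<^sup>2 * tau2)\<^sup>2)
        \<le> (\<Sum>i=1..n. \<beta> ^ 3 * C3 + (\<beta>\<^sup>2 * tau2)\<^sup>2)"
      by (intro sum_mono b \<beta>) (auto simp: node_sources_def)
    then show "(\<Sum>i=1..n. \<bar>c (OutNoise i)\<bar> ^ 3 * C3 + ((c (OutNoise i))\<^sup>2 * tau2)\<^sup>2)
        \<le> real n * (\<beta> ^ 3 * C3 + (\<beta>\<^sup>2 * tau2)\<^sup>2)" by simp
    have "(\<Sum>i=1..n. \<bar>c (InNoise i)\<bar> ^ 3 * C3 + ((c (InNoise i))\<^sup>2 * tau2)\<^sup>2)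
        \<le> (\<Sum>i=1..n. \<beta> ^ 3 * C3 + (\<beta>\<^sup>2 * tau2)\<^sup>2)"
      by (intro sum_mono b \<beta>) (auto simp: node_sources_def)
    then show "(\<Sum>i=1..n. \<bar>c (InNoise i)\<bar> ^ 3 * C3 + ((c (InNoise i))\<^sup>2 * tau2)\<^sup>2)
        \<le> real n * (\<beta> ^ 3 * C3 + (\<beta>\<^sup>2 * tau2)\<^sup>2)" by simp
  qed
  also have "\<dots> = (\<beta> + \<beta>\<^sup>2) * esum n (\<lambda>i j. wt i j * (c (Edge i j))\<^sup>2) + 2 * real n * \<beta> ^ 3 * C3
      + 2 * real n * \<beta> ^ 4 * tau2\<^sup>2"
    by (simp add: power_mult_distrib algebra_simps flip: power_mult)
  finally show ?thesis .
qed

text \<open>The weights \<open>c\<close> may grow with the network, so all coefficients are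
  controlled through \<open>f\<close>. As \<open>1 / vc \<le> t\<close>, the form dominates each
  \<open>(c \<iota>)^2 / vd (idx \<iota>)\<close> and also \<open>C^2 / vc\<close>, where
  \<open>C\<close> is the sum of the weights; dividing once more by \<open>vd\<close> or
  \<open>vc\<close> shows that the building blocks of the combined column are at most
  \<open>\<beta>\<close>. The exact variance \<open>\<sigma>\<close> of the combination differs from
  \<open>f\<close> by the mismatch between \<open>t\<close> and the true variance of the common
  part, and by cross terms of order \<open>\<beta>^2\<close>.\<close>

lemma (in private_network) combination_char_bound:
  fixes idx :: "'k::finite \<Rightarrow> nat" and c :: "'k \<Rightarrow> real"
  assumes n3: "n \<ge> 3" and m: "0 < m"
    and wt_ge: "\<And>i j. i \<in> {1..n} \<Longrightarrow> j \<in> {1..n} \<Longrightarrow> i \<noteq> j \<Longrightarrow> m \<le> wt i j"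
    and idx: "inj idx" "\<And>\<iota>. idx \<iota> \<in> {1..n}"
    and a0: "al \<le> a0" "a0 < 1" and C3: "C3 = 2 * (\<Sum>k. real k ^ 3 * a0 ^ k)"
    and vd: "\<And>i. vd i = V_mat n Z \<theta> \<gamma> i i" and vc: "vc = V_corner n Z \<theta> \<gamma>"
    and t: "1 / vc \<le> t"
    and form: "(\<Sum>\<iota>\<in>UNIV. (c \<iota>)\<^sup>2 / vd (idx \<iota>)) + t * (\<Sum>\<iota>\<in>UNIV. c \<iota>)\<^sup>2 = f"
    and \<beta>: "\<beta> = sqrt (f / (m * real (n - 1)))"
  shows "cmod (expectation (\<lambda>\<omega>. iexp (\<Sum>\<iota>\<in>UNIV. c \<iota> * LF (node_coef n (weighted_network.Scol n Z \<theta> \<gamma> (idx \<iota>))) \<omega>))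
      - complex_of_real (exp (- f / 2)))
    \<le> (2 * \<beta> + 4 * \<beta>\<^sup>2) * (f + real CARD('k) * \<beta>\<^sup>2) + 16 * real n * \<beta> ^ 3 * C3
      + 32 * real n * \<beta> ^ 4 * tau2\<^sup>2
      + f * \<bar>(1 / vc + (2 * real n - 1) * tau2 / vc\<^sup>2) / t - 1\<bar> + real CARD('k) * \<beta>\<^sup>2 * (1 + 3 * tau2)"
    and "\<And>\<iota>. \<bar>c \<iota>\<bar> \<le> sqrt (f * real n)"
proof -
  have n1: "n \<ge> 1" using n3 by simp
  interpret W: weighted_network n Z \<theta> \<gamma> q m
    using n3 m wt_ge Z_component_bound logistic'_le by unfold_locales (auto simp: wt_def)
  have Ww: "W.w = wt" by (simp add: fun_eq_iff W.w_def wt_def)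
  have vdW: "W.vd i = vd i" for i by (simp add: W.vd_def vd)
  have vcW: "W.vc = vc" by (simp add: W.vc_def vc)
  note vd_b = W.vd_bounds[unfolded vdW] and vc_b = W.vc_bounds[unfolded vcW]
  define C where "C = (\<Sum>\<iota>\<in>UNIV. c \<iota>)"
  \<comment> \<open>The combined column of \<open>S\<close> is \<open>a\<close>, supported on the
    selected senders, plus \<open>D\<close> on every sender and \<open>- D\<close> on every receiver
    other than \<open>n\<close>.\<close>
  define D where "D = C / vc"
  define a where "a l = (\<Sum>\<iota>\<in>UNIV. if l = idx \<iota> then c \<iota> / vd (idx \<iota>) else 0)" for l
  define y where "y = (\<lambda>x. \<Sum>\<iota>\<in>UNIV. c \<iota> * W.Scol (idx \<iota>) x)"
  have a_idx: "a (idx \<iota>) = c \<iota> / vd (idx \<iota>)" for \<iota>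
    using idx(1) by (simp add: a_def inj_eq)
  have a_out: "a l = 0" if "l \<notin> range idx" for l using that by (auto simp: a_def intro!: sum.neutral)
  have a_sum: "(\<Sum>l=1..n. a l * h l) = (\<Sum>\<iota>\<in>UNIV. c \<iota> / vd (idx \<iota>) * h (idx \<iota>))" for h
  proof -
    have "(\<Sum>l=1..n. a l * h l) = (\<Sum>l\<in>range idx. a l * h l)"
      using idx(2) a_out by (intro sum.mono_neutral_right) auto
    then show ?thesis using idx(1) by (simp add: sum.reindex a_idx)
  qed
  have vdp: "vd (idx \<iota>) > 0" for \<iota> using vd_b(3)[OF idx(2)] .
  have f_parts: "(c \<iota>)\<^sup>2 / vd (idx \<iota>) \<le> f" "t * C\<^sup>2 \<le> f" for \<iota>
  proof -
    have tp: "t > 0" using t vc_b(3) by (smt (verit) divide_pos_pos zero_less_one)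
    have "(c \<iota>)\<^sup>2 / vd (idx \<iota>) \<le> (\<Sum>\<iota>\<in>UNIV. (c \<iota>)\<^sup>2 / vd (idx \<iota>))"
      using vdp by (intro member_le_sum) (auto simp: less_imp_le)
    moreover have "0 \<le> t * C\<^sup>2" using tp by simp
    ultimately show "(c \<iota>)\<^sup>2 / vd (idx \<iota>) \<le> f" using form unfolding C_def by linarith
    have "0 \<le> (\<Sum>\<iota>\<in>UNIV. (c \<iota>)\<^sup>2 / vd (idx \<iota>))" using vdp by (intro sum_nonneg) (auto simp: less_imp_le)
    then show "t * C\<^sup>2 \<le> f" using form unfolding C_def by linarith
  qed
  have tp: "t > 0" using t vc_b(3) by (smt (verit) divide_pos_pos zero_less_one)
  have f0: "f \<ge> 0" using f_parts(2) tp by (meson mult_nonneg_nonneg less_imp_le order_trans zero_le_power2)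
  have mn: "m * real (n - 1) > 0" by (rule W.mn_pos)
  have fm: "0 \<le> f / (m * real (n - 1))" by (rule divide_nonneg_pos[OF f0 mn])
  have \<beta>0: "\<beta> \<ge> 0" and \<beta>2: "\<beta>\<^sup>2 = f / (m * real (n - 1))"
    unfolding \<beta> by (rule real_sqrt_ge_zero[OF fm], rule real_sqrt_pow2[OF fm])
  have abs_le: "\<bar>x\<bar> \<le> \<beta>" if "x\<^sup>2 \<le> f / v" "m * real (n - 1) \<le> v" for x v
  proof -
    have "0 < v" using that(2) mn by linarith
    then have "f / v \<le> f / (m * real (n - 1))"
      using divide_left_mono[OF that(2) f0] mn by (simp only: mult_pos_pos)
    then have "x\<^sup>2 \<le> \<beta>\<^sup>2" unfolding \<beta>2 by (rule order_trans[OF that(1)])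
    then show ?thesis using \<beta>0 abs_le_square_iff[of x \<beta>] by simp
  qed
  have D_b: "\<bar>D\<bar> \<le> \<beta>"
  proof (rule abs_le)
    have "1 / vc * C\<^sup>2 \<le> t * C\<^sup>2" using t by (intro mult_right_mono) auto
    then have "C\<^sup>2 / vc \<le> f" using f_parts(2) by simp
    then have "C\<^sup>2 / vc / vc \<le> f / vc" using vc_b(3) by (intro divide_right_mono) auto
    then show "D\<^sup>2 \<le> f / vc" by (simp add: D_def power_divide power2_eq_square)
    show "m * real (n - 1) \<le> vc" by (rule vc_b(1))
  qed
  have a_b: "\<bar>a l\<bar> \<le> \<beta>" for l
  proof (cases "l \<in> range idx")
    case True
    then obtain \<iota> where \<iota>: "l = idx \<iota>" by auto
    have "(c \<iota>)\<^sup>2 / vd (idx \<iota>) / vd (idx \<iota>) \<le> f / vd (idx \<iota>)"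
      using f_parts(1)[of \<iota>] vdp[of \<iota>] by (intro divide_right_mono) auto
    then show ?thesis unfolding \<iota> a_idx
      by (intro abs_le[OF _ vd_b(1)[OF idx(2)[of \<iota>]]]) (simp add: power_divide power2_eq_square)
  qed (use a_out \<beta>0 in simp)
  show cb: "\<bar>c \<iota>\<bar> \<le> sqrt (f * real n)" for \<iota>
  proof (rule real_le_rsqrt)
    have "(c \<iota>)\<^sup>2 \<le> f * vd (idx \<iota>)" using f_parts(1)[of \<iota>] vdp[of \<iota>] by (simp add: pos_divide_le_eq)
    also have "\<dots> \<le> f * real n" using vd_b(2)[OF idx(2)[of \<iota>]] f0 n1 by (intro mult_left_mono) (auto simp: of_nat_diff)
    finally show "\<bar>c \<iota>\<bar>\<^sup>2 \<le> f * real n" by simp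
  qed
  have y_row: "y i = a i + D" if "i \<le> n" for i
  proof -
    have "c \<iota> * W.Scol (idx \<iota>) i = (if i = idx \<iota> then c \<iota> / vd (idx \<iota>) else 0) + c \<iota> / vc" for \<iota>
      using that by (simp add: W.Scol_def vdW vcW distrib_left)
    then show ?thesis by (simp add: y_def a_def D_def C_def sum.distrib sum_divide_distrib)
  qed
  have y_col: "y (n + j) = - D" if "1 \<le> j" for j
    using that by (simp add: y_def W.Scol_def D_def C_def vcW sum_negf sum_divide_distrib)
  have y_pot: "pot n y l j = a l + (if j = n then D else 0)" if "l \<in> {1..n}" "j \<in> {1..n}" for l j
    using that by (simp add: pot_def beta_par_def y_row y_col)
  have y_beta: "beta_par n y j = (if j = n then 0 else - D)" if "j \<in> {1..n}" for j
    using that by (simp add: beta_par_def y_col)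
  have LFy: "(\<Sum>\<iota>\<in>UNIV. c \<iota> * LF (node_coef n (W.Scol (idx \<iota>))) \<omega>) = LF (node_coef n y) \<omega>" for \<omega>
  proof -
    have "(\<Sum>\<iota>\<in>UNIV. c \<iota> * LF (node_coef n (W.Scol (idx \<iota>))) \<omega>)
        = (\<Sum>\<iota>\<in>UNIV. \<Sum>x=1..2 * n - 1. c \<iota> * (W.Scol (idx \<iota>) x * score x \<omega>))"
      by (simp only: score_functional[OF n1, symmetric] sum_distrib_left)
    also have "\<dots> = (\<Sum>x=1..2 * n - 1. y x * score x \<omega>)"
      by (subst sum.swap) (simp add: y_def sum_distrib_right mult.assoc)
    finally show ?thesis by (simp only: score_functional[OF n1])
  qed
  define vE where "vE = esum n (\<lambda>i j. wt i j * (node_coef n y (Edge i j :: 'p source))\<^sup>2)"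
  define \<sigma> where "\<sigma> = (\<Sum>s\<in>node_sources n. (node_coef n y (s :: 'p source))\<^sup>2 * source_variance wt tau2 s)"
  have coef_b: "\<bar>node_coef n y s\<bar> \<le> 2 * \<beta>" if "s \<in> node_sources n" for s :: "'p source"
    using that
  proof (cases rule: node_sources_cases)
    case (1 i j)
    then show ?thesis using a_b[of i] D_b \<beta>0 by (cases "j = n") (auto simp: y_pot)
  next
    case (2 i)
    then show ?thesis using a_b[of i] D_b \<beta>0 by (simp add: y_row)
  next
    case (3 j)
    then show ?thesis using D_b \<beta>0 by (simp add: y_beta)
  qed
  let ?R1 = "(\<Sum>l=1..n. a l * (if l = n then 0 else wt l n))"
  \<comment> \<open>\<open>?R1\<close> is the overlap: the edges from a selected sender to receiver
    \<open>n\<close> carry both \<open>a\<close> and \<open>D\<close>.\<close>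
  have vE_eq: "vE = (\<Sum>\<iota>\<in>UNIV. (c \<iota>)\<^sup>2 / vd (idx \<iota>)) + C\<^sup>2 / vc + 2 * D * ?R1"
  proof -
    have "vE = esum n (\<lambda>i j. a i * (a i * wt i j) + (if j = n then D\<^sup>2 * wt i n + 2 * D * (a i * wt i n) else 0))"
      unfolding vE_def by (intro esum_cong) (auto simp: y_pot power2_eq_square algebra_simps)
    also have "\<dots> = (\<Sum>i=1..n. a i * (a i * vd i)) +
        (\<Sum>i=1..n. if i = n then 0 else D\<^sup>2 * wt i n + 2 * D * (a i * wt i n))"
    proof -
      have "(\<Sum>j\<in>{1..n} - {i}. a i * (a i * wt i j) + (if j = n then D\<^sup>2 * wt i n + 2 * D * (a i * wt i n) else 0))
          = a i * (a i * vd i) + (if i = n then 0 else D\<^sup>2 * wt i n + 2 * D * (a i * wt i n))"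
        if "i \<in> {1..n}" for i
        using that n1 W.vd_eq[OF that] by (simp add: sum.distrib sum_distrib_left vdW Ww)
      then show ?thesis unfolding esum_def by (simp add: sum.distrib)
    qed
    also have "(\<Sum>i=1..n. a i * (a i * vd i)) = (\<Sum>\<iota>\<in>UNIV. (c \<iota>)\<^sup>2 / vd (idx \<iota>))"
    proof -
      have "vd (idx \<iota>) \<noteq> 0" for \<iota> using vdp[of \<iota>] by simp
      then show ?thesis unfolding a_sum a_idx by (simp add: power2_eq_square)
    qed
    also have "(\<Sum>i=1..n. if i = n then 0 else D\<^sup>2 * wt i n + 2 * D * (a i * wt i n))
        = (\<Sum>i\<in>{1..n} - {n}. D\<^sup>2 * wt i n) + 2 * D * ?R1"
    proof -
      have "(\<Sum>i=1..n. if i = n then 0 else D\<^sup>2 * wt i n + 2 * D * (a i * wt i n))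
          = (\<Sum>i=1..n. if i = n then 0 else D\<^sup>2 * wt i n) + (\<Sum>i=1..n. 2 * D * (a i * (if i = n then 0 else wt i n)))"
        unfolding sum.distrib[symmetric] by (intro sum.cong) auto
      also have "(\<Sum>i=1..n. if i = n then 0 else D\<^sup>2 * wt i n) = (\<Sum>i\<in>{1..n} - {n}. D\<^sup>2 * wt i n)"
        by (intro sum.mono_neutral_cong_right) auto
      finally show ?thesis by (simp add: sum_distrib_left)
    qed
    also have "(\<Sum>i\<in>{1..n} - {n}. D\<^sup>2 * wt i n) = C\<^sup>2 / vc"
    proof -
      have "(\<Sum>i\<in>{1..n} - {n}. D\<^sup>2 * wt i n) = D\<^sup>2 * vc"
        using W.vc_eq by (simp add: sum_distrib_left vcW Ww)
      then show ?thesis using vc_b(3) by (simp add: D_def power2_eq_square)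
    qed
    finally show ?thesis by simp
  qed
  have R1: "\<bar>2 * D * ?R1\<bar> \<le> real CARD('k) * \<beta>\<^sup>2"
  proof -
    have "\<bar>?R1\<bar> \<le> (\<Sum>\<iota>\<in>(UNIV :: 'k set). \<beta> * (1 / 2))"
      unfolding a_sum
    proof (rule order.trans[OF sum_abs sum_mono])
      fix \<iota> :: 'k
      have "\<bar>c \<iota> / vd (idx \<iota>)\<bar> \<le> \<beta>" using a_b[of "idx \<iota>"] by (simp add: a_idx)
      moreover have "\<bar>if idx \<iota> = n then 0 else wt (idx \<iota>) n\<bar> \<le> 1 / 2"
        using logistic'_pos[of "lin_pred n Z \<theta> \<gamma> (idx \<iota>) n"] logistic'_le[of "lin_pred n Z \<theta> \<gamma> (idx \<iota>) n"]
        by (simp add: wt_def)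
      ultimately show "\<bar>c \<iota> / vd (idx \<iota>) * (if idx \<iota> = n then 0 else wt (idx \<iota>) n)\<bar> \<le> \<beta> * (1 / 2)"
        unfolding abs_mult using \<beta>0 by (intro mult_mono) auto
    qed
    then have "\<bar>D\<bar> * \<bar>?R1\<bar> \<le> \<beta> * (real CARD('k) * (\<beta> * (1 / 2)))"
      using D_b \<beta>0 by (intro mult_mono) auto
    then show ?thesis by (simp add: abs_mult power2_eq_square mult_ac)
  qed
  let ?R2 = "\<Sum>i=1..n. a i * (a i + 2 * D)"
  have R2: "\<bar>?R2\<bar> \<le> real CARD('k) * (3 * \<beta>\<^sup>2)"
  proof -
    have "\<bar>?R2\<bar> \<le> (\<Sum>\<iota>\<in>(UNIV :: 'k set). \<beta> * (3 * \<beta>))"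
      unfolding a_sum
    proof (rule order.trans[OF sum_abs sum_mono])
      fix \<iota> :: 'k
      have "\<bar>c \<iota> / vd (idx \<iota>)\<bar> \<le> \<beta>" using a_b[of "idx \<iota>"] by (simp add: a_idx)
      moreover have "\<bar>a (idx \<iota>) + 2 * D\<bar> \<le> 3 * \<beta>" using a_b[of "idx \<iota>"] D_b by linarith
      ultimately show "\<bar>c \<iota> / vd (idx \<iota>) * (a (idx \<iota>) + 2 * D)\<bar> \<le> \<beta> * (3 * \<beta>)"
        unfolding abs_mult using \<beta>0 by (intro mult_mono) auto
    qed
    then show ?thesis by (simp add: power2_eq_square)
  qed
  \<comment> \<open>The \<open>2 n - 1\<close> noise variables carry the common coefficient
    \<open>D\<close> up to sign; \<open>?R2\<close> collects what the selected senders add to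
    it.\<close>
  have \<sigma>_eq: "\<sigma> = vE + (2 * real n - 1) * tau2 * D\<^sup>2 + tau2 * ?R2"
  proof -
    have "\<sigma> = vE + (\<Sum>i=1..n. (a i + D)\<^sup>2 * tau2) + (\<Sum>j=1..n. (if j = n then 0 else - D)\<^sup>2 * tau2)"
      unfolding \<sigma>_def sum_node_sources vE_def by (simp add: y_row y_beta mult.commute)
    also have "(\<Sum>i=1..n. (a i + D)\<^sup>2 * tau2) = real n * (D\<^sup>2 * tau2) + tau2 * ?R2"
    proof -
      have "(a i + D)\<^sup>2 * tau2 = D\<^sup>2 * tau2 + tau2 * (a i * (a i + 2 * D))" for i
        by (simp add: power2_eq_square algebra_simps)
      then show ?thesis by (simp only: sum.distrib sum_distrib_left[symmetric]) simp
    qed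
    also have "(\<Sum>j=1..n. (if j = n then 0 else - D)\<^sup>2 * tau2) = (\<Sum>j=1..n - 1. D\<^sup>2 * tau2)"
      using n1 by (intro sum.mono_neutral_cong_right) auto
    also have "\<dots> = (real n - 1) * (D\<^sup>2 * tau2)" using n1 by (simp add: of_nat_diff)
    finally show ?thesis by (simp add: algebra_simps)
  qed
  have vE_le: "vE \<le> f + real CARD('k) * \<beta>\<^sup>2"
  proof -
    have "C\<^sup>2 / vc \<le> t * C\<^sup>2" using mult_right_mono[OF t, of "C\<^sup>2"] by simp
    then show ?thesis using R1 form vE_eq unfolding C_def by linarith
  qed
  have \<sigma>_near: "\<bar>\<sigma> - f\<bar> \<le> f * \<bar>(1 / vc + (2 * real n - 1) * tau2 / vc\<^sup>2) / t - 1\<bar>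
      + real CARD('k) * \<beta>\<^sup>2 * (1 + 3 * tau2)"
  proof -
    let ?S = "1 / vc + (2 * real n - 1) * tau2 / vc\<^sup>2"
    have tri: "\<bar>x + (y + z)\<bar> \<le> p + (q + r)" if "\<bar>x\<bar> \<le> p" "\<bar>y\<bar> \<le> q" "\<bar>z\<bar> \<le> r" for x y z p q r :: real
      using that by linarith
    \<comment> \<open>The diagonal parts cancel exactly. What is left is the mismatch in the
      coefficient of \<open>C^2\<close> and the overlaps with the selected senders.\<close>
    have eq: "\<sigma> - f = C\<^sup>2 * (?S - t) + (2 * D * ?R1 + tau2 * ?R2)"
    proof -
      have "C\<^sup>2 * (?S - t) = C\<^sup>2 / vc + (2 * real n - 1) * tau2 * D\<^sup>2 - t * C\<^sup>2"
      proof -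
        have "C\<^sup>2 * ((2 * real n - 1) * tau2 / vc\<^sup>2) = (2 * real n - 1) * tau2 * D\<^sup>2"
          by (simp add: D_def power_divide)
        then show ?thesis unfolding right_diff_distrib[of "C\<^sup>2"] distrib_left by simp
      qed
      then show ?thesis unfolding \<sigma>_eq vE_eq form[symmetric] C_def[symmetric] by linarith
    qed
    have p1: "\<bar>C\<^sup>2 * (?S - t)\<bar> \<le> f * \<bar>?S / t - 1\<bar>"
    proof -
      have "\<bar>C\<^sup>2 * (?S - t)\<bar> = (t * C\<^sup>2) * \<bar>?S / t - 1\<bar>"
      proof -
        have "?S - t = t * (?S / t - 1)" using tp by (simp add: right_diff_distrib)
        then show ?thesis using tp by (simp only: abs_mult) (simp add: mult_ac)
      qed
      also have "\<dots> \<le> f * \<bar>?S / t - 1\<bar>" using f_parts(2) by (intro mult_right_mono) auto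
      finally show ?thesis .
    qed
    have p2: "\<bar>tau2 * ?R2\<bar> \<le> tau2 * (real CARD('k) * (3 * \<beta>\<^sup>2))"
      unfolding abs_mult using tau2_nonneg R2 by (simp add: mult_left_mono)
    have "\<bar>\<sigma> - f\<bar> \<le> f * \<bar>?S / t - 1\<bar> + (real CARD('k) * \<beta>\<^sup>2 + tau2 * (real CARD('k) * (3 * \<beta>\<^sup>2)))"
      unfolding eq by (rule tri[OF p1 R1 p2])
    then show ?thesis by (simp add: algebra_simps)
  qed
  have \<sigma>0: "\<sigma> \<ge> 0"
  proof -
    have "0 \<le> expectation (\<lambda>\<omega>. (LF (node_coef n y) \<omega>)\<^sup>2)" by (rule integral_nonneg_AE) simp
    then show ?thesis by (simp only: LF_moments(3) \<sigma>_def)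
  qed
  have exp_lip: "\<bar>exp (- \<sigma> / 2) - exp (- f / 2)\<bar> \<le> \<bar>\<sigma> - f\<bar>"
  proof -
    have "norm (exp (- \<sigma> / 2) - exp (- f / 2)) \<le> 1 * norm (\<sigma> - f)"
    proof (rule field_differentiable_bound[of "{0..}" "\<lambda>x. exp (- x / 2)" "\<lambda>x. - exp (- x / 2) / 2"])
      show "((\<lambda>x. exp (- x / 2)) has_field_derivative - exp (- x / 2) / 2) (at x within {0..})" for x :: real
        by (auto intro!: derivative_eq_intros)
      show "norm (- exp (- x / 2) / 2) \<le> 1" if "x \<in> {0..}" for x :: real
        using that by (simp add: order.trans[of _ "1 :: real"])
    qed (use \<sigma>0 f0 in auto)
    then show ?thesis by simp
  qed
  have "cmod (expectation (\<lambda>\<omega>. iexp (LF (node_coef n y) \<omega>)) - complex_of_real (exp (- \<sigma> / 2)))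
      \<le> (2 * \<beta> + (2 * \<beta>)\<^sup>2) * vE + 2 * real n * (2 * \<beta>) ^ 3 * C3 + 2 * real n * (2 * \<beta>) ^ 4 * tau2\<^sup>2"
    unfolding \<sigma>_def vE_def by (rule LF_char_bound[OF a0 C3 coef_b]) (use \<beta>0 in auto)
  also have "\<dots> \<le> (2 * \<beta> + (2 * \<beta>)\<^sup>2) * (f + real CARD('k) * \<beta>\<^sup>2) + 2 * real n * (2 * \<beta>) ^ 3 * C3
      + 2 * real n * (2 * \<beta>) ^ 4 * tau2\<^sup>2"
    using vE_le \<beta>0 by (intro add_right_mono mult_left_mono) auto
  also have "\<dots> = (2 * \<beta> + 4 * \<beta>\<^sup>2) * (f + real CARD('k) * \<beta>\<^sup>2) + 16 * real n * \<beta> ^ 3 * C3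
      + 32 * real n * \<beta> ^ 4 * tau2\<^sup>2"
    by (simp add: power_mult_distrib)
  finally have 1: "cmod (expectation (\<lambda>\<omega>. iexp (LF (node_coef n y) \<omega>)) - complex_of_real (exp (- \<sigma> / 2)))
      \<le> (2 * \<beta> + 4 * \<beta>\<^sup>2) * (f + real CARD('k) * \<beta>\<^sup>2) + 16 * real n * \<beta> ^ 3 * C3
      + 32 * real n * \<beta> ^ 4 * tau2\<^sup>2" .
  have 2: "cmod (complex_of_real (exp (- \<sigma> / 2)) - complex_of_real (exp (- f / 2))) \<le> \<bar>\<sigma> - f\<bar>"
    unfolding of_real_diff[symmetric] norm_of_real by (rule exp_lip)
  have "cmod (expectation (\<lambda>\<omega>. iexp (LF (node_coef n y) \<omega>)) - complex_of_real (exp (- f / 2)))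
      \<le> cmod (expectation (\<lambda>\<omega>. iexp (LF (node_coef n y) \<omega>)) - complex_of_real (exp (- \<sigma> / 2)))
        + cmod (complex_of_real (exp (- \<sigma> / 2)) - complex_of_real (exp (- f / 2)))"
    using norm_triangle_ineq[of "expectation (\<lambda>\<omega>. iexp (LF (node_coef n y) \<omega>)) - complex_of_real (exp (- \<sigma> / 2))"
        "complex_of_real (exp (- \<sigma> / 2)) - complex_of_real (exp (- f / 2))"] by simp
  then show "cmod (expectation (\<lambda>\<omega>. iexp (\<Sum>\<iota>\<in>UNIV. c \<iota> * LF (node_coef n (W.Scol (idx \<iota>))) \<omega>))
      - complex_of_real (exp (- f / 2)))
    \<le> (2 * \<beta> + 4 * \<beta>\<^sup>2) * (f + real CARD('k) * \<beta>\<^sup>2) + 16 * real n * \<beta> ^ 3 * C3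
      + 32 * real n * \<beta> ^ 4 * tau2\<^sup>2
      + f * \<bar>(1 / vc + (2 * real n - 1) * tau2 / vc\<^sup>2) / t - 1\<bar> + real CARD('k) * \<beta>\<^sup>2 * (1 + 3 * tau2)"
    unfolding LFy using 1 2 \<sigma>_near by linarith
qed

text \<open>Bookkeeping with \<open>E = e^\<rho>\<close> and \<open>L = 1 + lam\<close>, up to
  constants depending on p and q: \<open>K\<close> is \<open>E^2 / N\<close>,
  \<open>\<kappa>\<close> is \<open>E^2\<close>, \<open>\<Lambda>\<close> is \<open>L E^4\<close>,
  and \<open>\<delta>\<close> is \<open>E^2 sqrt (ln N / N)\<close>. The exponent 8 in
  \<open>B\<close> is dictated by the product \<open>K N * lam * \<kappa> * \<delta>^2\<close>, the
  response of the node parameters to the remainder in the covariate equations.\<close>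

lemma rate_bounds:
  fixes N E lam q p :: real
  assumes N: "N \<ge> 3" and E: "E \<ge> 1" and lam: "lam \<ge> 0" and q: "q > 0" and p: "p \<ge> 0"
    and l1: "ln N \<ge> 1"
    and K: "K = 3 / ((1 / (4 * E))\<^sup>2 * (N - 1))"
    and \<kappa>: "\<kappa> = q + 2 * (K * (N * (q / 4)))"
    and \<Lambda>: "\<Lambda> = 2 * K * N * (1 + p * q * lam * \<kappa> / 4) + p * q * lam * \<kappa>"
    and T: "T = sqrt (N * ln N)"
    and \<Gamma>: "\<Gamma> = N * \<kappa> * sqrt (ln N) + N"
    and \<delta>: "\<delta> = 2 * (2 * (K * (2 * T + N * (p * q * (lam / N\<^sup>2 * \<Gamma>) / 4))) + p * q * (lam / N\<^sup>2 * \<Gamma>))"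
    and Db: "Db = K * (1 / (4 * (1 / (4 * E) * (N - 1))))"
    and err: "err = K * (N * \<delta>\<^sup>2 + N * (p * q * (lam / N\<^sup>2 * (\<Gamma> + N\<^sup>2 * (\<delta>\<^sup>2 * \<kappa>))) / 4))
        + N * Db * sqrt (ln N)"
    and B: "B = (1 + lam) * E ^ 8 * ln N / sqrt N" and B1: "B \<le> 1"
    and C1: "C1 = 192 + 2401 * p * q\<^sup>2" and C2: "C2 = 768 + 98 * p * q * (49 * q + 1)"
    and C3: "C3 = 288 * C2\<^sup>2 + 24 * p * q * (49 * q + 1 + 49 * q * C2\<^sup>2) + 192"
  shows "\<Lambda> * \<delta> \<le> C1 * C2 * B" "sqrt N * err \<le> C3 * B"
proof -
  define l r S L where "l = ln N" and "r = sqrt l" and "S = sqrt N" and "L = 1 + lam"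
  have l: "l \<ge> 1" using l1 by (simp add: l_def)
  have r: "r \<ge> 1" "r * r = l" using l by (auto simp: r_def)
  have r_le: "r \<le> l" using r by (metis mult_right_mono mult_1 order_trans zero_le_one)
  have S: "S \<ge> 1" "S * S = N" using N by (auto simp: S_def)
  have S0: "S > 0" using S by simp
  have L: "L \<ge> 1" "lam \<le> L" using lam by (auto simp: L_def)
  have N0: "N > 0" using N by simp
  have TS: "T = S * r" by (simp add: T S_def r_def l_def real_sqrt_mult)
  have Bl: "B = L * E ^ 8 * l / S" by (simp add: B L_def l_def S_def)
  have Ep: "E ^ a \<le> E ^ b" if "a \<le> b" for a b using E that by (rule power_increasing[rotated])
  have E0: "E > 0" using E by simp
  \<comment> \<open>Here \<open>3 / m^2\<close> equals \<open>48 E^2\<close>, and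
    \<open>N - 1 \<ge> N / 2\<close> doubles the constant.\<close>
  have KN: "K * N \<le> 96 * E\<^sup>2" and K0: "K \<ge> 0" and KN1: "K \<le> 96 * E\<^sup>2 / N"
  proof -
    have Keq: "K = 48 * E\<^sup>2 / (N - 1)" using E0 N by (simp add: K field_simps power2_eq_square)
    have "48 * E\<^sup>2 * N \<le> 96 * E\<^sup>2 * (N - 1)"
      using N mult_left_mono[of "48 * N" "96 * (N - 1)" "E\<^sup>2"] by (simp add: algebra_simps)
    then show KN: "K * N \<le> 96 * E\<^sup>2" unfolding Keq using N by (simp add: pos_divide_le_eq)
    show "K \<ge> 0" unfolding Keq using N by simp
    show "K \<le> 96 * E\<^sup>2 / N" using KN N0 by (simp add: pos_le_divide_eq)
  qed
  have E2: "E\<^sup>2 \<ge> 1" using E by (simp add: one_le_power)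
  have \<kappa>_le: "\<kappa> \<le> 49 * q * E\<^sup>2" and \<kappa>0: "\<kappa> \<ge> 0"
  proof -
    have "\<kappa> = q * 1 + (K * N) * (q / 2)" by (simp add: \<kappa>)
    also have "\<dots> \<le> q * E\<^sup>2 + (96 * E\<^sup>2) * (q / 2)"
      using KN E2 q by (intro add_mono mult_left_mono mult_right_mono) auto
    finally show "\<kappa> \<le> 49 * q * E\<^sup>2" by simp
    show "\<kappa> \<ge> 0" using K0 N0 q by (simp add: \<kappa>)
  qed
  have \<kappa>lam: "lam * \<kappa> \<le> L * (49 * q * E\<^sup>2)" using L lam \<kappa>_le \<kappa>0 by (intro mult_mono) auto
  have \<Lambda>_le: "\<Lambda> \<le> C1 * (L * E ^ 4)" and \<Lambda>0: "\<Lambda> \<ge> 0"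
  proof -
    have LE: "E\<^sup>2 \<le> L * E ^ 4" "L * E\<^sup>2 \<le> L * E ^ 4"
    proof -
      show a: "L * E\<^sup>2 \<le> L * E ^ 4" using L Ep[of 2 4] by (intro mult_left_mono) auto
      have "1 * E\<^sup>2 \<le> L * E\<^sup>2" using L by (intro mult_right_mono) auto
      then show "E\<^sup>2 \<le> L * E ^ 4" using a by linarith
    qed
    have "\<Lambda> = 2 * (K * N) * (1 + p * q / 4 * (lam * \<kappa>)) + p * q * (lam * \<kappa>)"
      by (simp add: \<Lambda> algebra_simps)
    also have "\<dots> \<le> 2 * (96 * E\<^sup>2) * (1 + p * q / 4 * (L * (49 * q * E\<^sup>2))) + p * q * (L * (49 * q * E\<^sup>2))"
    proof (rule add_mono[OF mult_mono])
      show "2 * (K * N) \<le> 2 * (96 * E\<^sup>2)" using KN by simp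
      have "p * q / 4 * (lam * \<kappa>) \<le> p * q / 4 * (L * (49 * q * E\<^sup>2))"
        using \<kappa>lam p q by (intro mult_left_mono) auto
      then show "1 + p * q / 4 * (lam * \<kappa>) \<le> 1 + p * q / 4 * (L * (49 * q * E\<^sup>2))" by simp
      show "0 \<le> 2 * (96 * E\<^sup>2)" by simp
      show "0 \<le> 1 + p * q / 4 * (lam * \<kappa>)" using p q lam \<kappa>0 by simp
      show "p * q * (lam * \<kappa>) \<le> p * q * (L * (49 * q * E\<^sup>2))"
        using \<kappa>lam p q by (intro mult_left_mono) auto
    qed
    \<comment> \<open>\<open>2352 = 2 * 96 * 49 / 4\<close>; together with 49 this is the constant
      2401 in \<open>C1\<close>.\<close>
    also have "\<dots> = 192 * E\<^sup>2 + 2352 * p * q\<^sup>2 * (L * E ^ 4) + 49 * p * q\<^sup>2 * (L * E\<^sup>2)"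
      by (simp add: algebra_simps power2_eq_square power4_eq_xxxx)
    also have "\<dots> \<le> 192 * (L * E ^ 4) + 2352 * p * q\<^sup>2 * (L * E ^ 4) + 49 * p * q\<^sup>2 * (L * E ^ 4)"
      using p by (intro add_mono order_refl mult_left_mono[OF LE(1)] mult_left_mono[OF LE(2)]) auto
    also have "\<dots> = C1 * (L * E ^ 4)" by (simp add: C1 algebra_simps)
    finally show "\<Lambda> \<le> C1 * (L * E ^ 4)" .
    show "\<Lambda> \<ge> 0" using K0 N0 p q lam \<kappa>0 by (simp add: \<Lambda>)
  qed
  define q1 where "q1 = 49 * q + 1"
  have q1: "q1 > 0" using q by (simp add: q1_def)
  define \<xi> where "\<xi> = lam / N\<^sup>2 * \<Gamma>"
  have \<xi>_le: "\<xi> \<le> q1 * (L * E\<^sup>2) * r / N" and \<xi>0: "\<xi> \<ge> 0"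
  proof -
    have one: "1 * 1 \<le> E\<^sup>2 * r" using E2 r by (intro mult_mono) auto
    have "\<Gamma> \<le> N * (49 * q * E\<^sup>2) * r + N * (E\<^sup>2 * r)"
    proof -
      have "\<Gamma> = N * \<kappa> * r + N * 1" by (simp add: \<Gamma> r_def l_def)
      moreover have "N * \<kappa> * r \<le> N * (49 * q * E\<^sup>2) * r"
        using \<kappa>_le N0 r by (intro mult_right_mono mult_left_mono) auto
      moreover have "N * 1 \<le> N * (E\<^sup>2 * r)" using N0 one by (intro mult_left_mono) auto
      ultimately show ?thesis by linarith
    qed
    also have "\<dots> = N * (q1 * E\<^sup>2 * r)" by (simp add: q1_def algebra_simps)
    finally have G: "\<Gamma> \<le> N * (q1 * E\<^sup>2 * r)" .
    have G0: "\<Gamma> \<ge> 0"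
      unfolding \<Gamma> using N N0 \<kappa>0 l1 by (intro add_nonneg_nonneg mult_nonneg_nonneg) auto
    have "\<xi> \<le> L / N\<^sup>2 * (N * (q1 * E\<^sup>2 * r))"
      unfolding \<xi>_def using G G0 L N0 by (intro mult_mono divide_right_mono) auto
    also have "\<dots> = q1 * (L * E\<^sup>2) * r / N" using N0 by (simp add: power2_eq_square)
    finally show "\<xi> \<le> q1 * (L * E\<^sup>2) * r / N" .
    show "\<xi> \<ge> 0" unfolding \<xi>_def using lam G0 by simp
  qed
  \<comment> \<open>Here \<open>B \<le> 1\<close> enters. It absorbs the factor \<open>L E^2\<close>
    of the covariate step into half a power of \<open>N\<close>, so that the bound for
    \<open>\<delta>\<close> is free of lam.\<close>
  have LES: "L * E\<^sup>2 / S \<le> 1"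
  proof -
    have "L * E\<^sup>2 * 1 \<le> L * E ^ 8 * l" using L l Ep[of 2 8] E0 by (intro mult_mono) auto
    then have "L * E\<^sup>2 / S \<le> B" unfolding Bl using S0 by (intro divide_right_mono) auto
    then show ?thesis using B1 by linarith
  qed
  have \<xi>_le': "\<xi> \<le> q1 * (r / S)"
  proof -
    have "\<xi> \<le> (L * E\<^sup>2 / S) * (q1 * (r / S))"
      using \<xi>_le S0 by (simp add: S(2)[symmetric] mult_ac)
    also have "\<dots> \<le> 1 * (q1 * (r / S))" using LES q1 r S0 by (intro mult_right_mono) auto
    finally show ?thesis by simp
  qed
  have TN: "T / N = r / S" using S0 by (simp add: TS S(2)[symmetric])
  have \<delta>_le: "\<delta> \<le> C2 * (E\<^sup>2 * (r / S))" and \<delta>0: "\<delta> \<ge> 0"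
  proof -
    have rS: "0 \<le> r / S" using r S0 by simp
    have "\<delta> = 8 * ((K * N) * (T / N)) + (K * N) * (p * q * \<xi>) + 2 * (p * q * \<xi>)"
      unfolding \<delta> \<xi>_def[symmetric] using N0 by (simp add: algebra_simps)
    also have "\<dots> \<le> 8 * ((96 * E\<^sup>2) * (r / S)) + (96 * E\<^sup>2) * (p * q * (q1 * (r / S)))
        + 2 * (p * q * (q1 * (E\<^sup>2 * (r / S))))"
    proof (intro add_mono)
      show "8 * ((K * N) * (T / N)) \<le> 8 * ((96 * E\<^sup>2) * (r / S))"
        unfolding TN using KN rS by (intro mult_left_mono mult_right_mono) auto
      show "(K * N) * (p * q * \<xi>) \<le> (96 * E\<^sup>2) * (p * q * (q1 * (r / S)))"
      proof (rule mult_mono[OF KN])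
        show "p * q * \<xi> \<le> p * q * (q1 * (r / S))" using p q \<xi>_le' by (intro mult_left_mono) auto
      qed (use p q \<xi>0 in auto)
      have "q1 * (1 * (r / S)) \<le> q1 * (E\<^sup>2 * (r / S))"
        using q1 E2 rS by (intro mult_left_mono mult_right_mono) auto
      then have "\<xi> \<le> q1 * (E\<^sup>2 * (r / S))" using \<xi>_le' by simp
      then show "2 * (p * q * \<xi>) \<le> 2 * (p * q * (q1 * (E\<^sup>2 * (r / S))))"
        using p q by (intro mult_left_mono) auto
    qed
    also have "\<dots> = C2 * (E\<^sup>2 * (r / S))" by (simp add: C2 q1_def algebra_simps)
    finally show "\<delta> \<le> C2 * (E\<^sup>2 * (r / S))" .
    show "\<delta> \<ge> 0" unfolding \<delta> \<xi>_def[symmetric] TS using K0 S0 r N0 p q \<xi>0 by simp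
  qed
  have C10: "C1 \<ge> 0" and C20: "C2 \<ge> 0" using p q by (auto simp: C1 C2)
  have "\<Lambda> * \<delta> \<le> (C1 * (L * E ^ 4)) * (C2 * (E\<^sup>2 * (r / S)))"
    using \<Lambda>_le \<delta>_le \<Lambda>0 \<delta>0 C10 L E0 by (intro mult_mono) auto
  also have "\<dots> = C1 * C2 * (L * E ^ 6 * r / S)"
    by (simp add: mult_ac flip: power_add)
  also have "\<dots> \<le> C1 * C2 * B"
  proof -
    have "L * E ^ 6 * r \<le> L * E ^ 8 * l" using L r_le Ep[of 6 8] E0 r by (intro mult_mono) auto
    then show ?thesis unfolding Bl using C10 C20 S0 by (intro mult_left_mono divide_right_mono) auto
  qed
  finally show "\<Lambda> * \<delta> \<le> C1 * C2 * B" .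
  have \<delta>2: "\<delta>\<^sup>2 \<le> C2\<^sup>2 * (E ^ 4 * (l / N))"
  proof -
    have "\<delta>\<^sup>2 \<le> (C2 * (E\<^sup>2 * (r / S)))\<^sup>2" using \<delta>_le \<delta>0 by (intro power_mono) auto
    also have "\<dots> = C2\<^sup>2 * (E ^ 4 * (l / N))"
      using r(2) S(2) by (simp add: power2_eq_square power4_eq_xxxx)
    finally show ?thesis .
  qed
  \<comment> \<open>\<open>?X\<close> is \<open>B / S\<close>, the common yardstick for the three
    parts of the error.\<close>
  let ?X = "L * E ^ 8 * l / N"
  have X: "E ^ 6 * l / N \<le> ?X" "L * E ^ 4 * r / N \<le> ?X" "L * E ^ 8 * l / N \<le> ?X" "E ^ 3 * r / N \<le> ?X"
  proof -
    have "1 * E ^ 8 \<le> L * E ^ 8" using L E0 by (intro mult_right_mono) auto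
    then have e: "E ^ 6 \<le> L * E ^ 8" "E ^ 3 \<le> L * E ^ 8" using Ep[of 6 8] Ep[of 3 8] by simp_all
    have "L * E ^ 4 \<le> L * E ^ 8" using L Ep[of 4 8] by (intro mult_left_mono) auto
    then have "E ^ 6 * l \<le> L * E ^ 8 * l" "L * E ^ 4 * r \<le> L * E ^ 8 * l" "E ^ 3 * r \<le> L * E ^ 8 * l"
      using mult_mono[OF e(1) order_refl[of l]] mult_mono[OF _ r_le] mult_mono[OF e(2) r_le] E0 L l r by auto
    then show "E ^ 6 * l / N \<le> ?X" "L * E ^ 4 * r / N \<le> ?X" "L * E ^ 8 * l / N \<le> ?X" "E ^ 3 * r / N \<le> ?X"
      using N0 by (auto intro!: divide_right_mono)
  qed
  have t1: "K * N * \<delta>\<^sup>2 \<le> 96 * C2\<^sup>2 * ?X"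
  proof -
    have "K * N * \<delta>\<^sup>2 \<le> (96 * E\<^sup>2) * (C2\<^sup>2 * (E ^ 4 * (l / N)))"
      by (rule mult_mono[OF KN \<delta>2]) auto
    also have "\<dots> = 96 * C2\<^sup>2 * (E ^ 6 * l / N)" by (simp add: mult_ac flip: power_add)
    also have "\<dots> \<le> 96 * C2\<^sup>2 * ?X" using X(1) by (intro mult_left_mono) auto
    finally show ?thesis .
  qed
  have t2: "K * N * (p * q * (lam / N\<^sup>2 * (\<Gamma> + N\<^sup>2 * (\<delta>\<^sup>2 * \<kappa>))) / 4) \<le> 24 * p * q * (q1 + 49 * q * C2\<^sup>2) * ?X"
  proof -
    have "lam / N\<^sup>2 * (\<Gamma> + N\<^sup>2 * (\<delta>\<^sup>2 * \<kappa>)) = \<xi> + \<delta>\<^sup>2 * (lam * \<kappa>)"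
      using N0 by (simp add: \<xi>_def distrib_left)
    also have "\<dots> \<le> q1 * (L * E\<^sup>2) * r / N + (C2\<^sup>2 * (E ^ 4 * (l / N))) * (L * (49 * q * E\<^sup>2))"
      by (rule add_mono[OF \<xi>_le mult_mono[OF \<delta>2 \<kappa>lam]]) (use lam \<kappa>0 l N0 in auto)
    finally have in_le: "lam / N\<^sup>2 * (\<Gamma> + N\<^sup>2 * (\<delta>\<^sup>2 * \<kappa>))
        \<le> q1 * (L * E\<^sup>2) * r / N + (C2\<^sup>2 * (E ^ 4 * (l / N))) * (L * (49 * q * E\<^sup>2))" .
    have in0: "0 \<le> q1 * (L * E\<^sup>2) * r / N + (C2\<^sup>2 * (E ^ 4 * (l / N))) * (L * (49 * q * E\<^sup>2))"
      using q1 L r N0 l q E0 by (intro add_nonneg_nonneg mult_nonneg_nonneg divide_nonneg_nonneg) auto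
    have "K * N * (p * q * (lam / N\<^sup>2 * (\<Gamma> + N\<^sup>2 * (\<delta>\<^sup>2 * \<kappa>))) / 4)
        = (K * N) * (p * q / 4 * (lam / N\<^sup>2 * (\<Gamma> + N\<^sup>2 * (\<delta>\<^sup>2 * \<kappa>))))" by simp
    also have "\<dots> \<le> (K * N) * (p * q / 4 * (q1 * (L * E\<^sup>2) * r / N + (C2\<^sup>2 * (E ^ 4 * (l / N))) * (L * (49 * q * E\<^sup>2))))"
      using in_le K0 N0 p q by (intro mult_left_mono) auto
    also have "\<dots> \<le> (96 * E\<^sup>2) * (p * q / 4 * (q1 * (L * E\<^sup>2) * r / N + (C2\<^sup>2 * (E ^ 4 * (l / N))) * (L * (49 * q * E\<^sup>2))))"
      by (rule mult_right_mono[OF KN]) (use in0 p q in \<open>intro mult_nonneg_nonneg[OF _ in0], simp\<close>)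
    also have "\<dots> = 24 * p * q * (q1 * (L * E ^ 4 * r / N) + 49 * q * C2\<^sup>2 * (L * E ^ 8 * l / N))"
      by (simp add: algebra_simps power2_eq_square power4_eq_xxxx eval_nat_numeral add_divide_distrib)
    also have "\<dots> \<le> 24 * p * q * (q1 * ?X + 49 * q * C2\<^sup>2 * ?X)"
      using X(2) q1 p q by (intro mult_left_mono add_mono) auto
    also have "\<dots> = 24 * p * q * (q1 + 49 * q * C2\<^sup>2) * ?X" by (simp add: algebra_simps)
    finally show ?thesis .
  qed
  have t3: "N * Db * sqrt (ln N) \<le> 192 * ?X"
  proof -
    have "4 * (1 / (4 * E) * (N - 1)) = (N - 1) / E" using E0 by (simp add: field_simps)
    then have "Db = K * (E / (N - 1))" unfolding Db by (simp only:) simp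
    also have "\<dots> \<le> (96 * E\<^sup>2 / N) * (E / (N / 2))"
      using KN1 K0 E0 N by (intro mult_mono divide_left_mono) auto
    also have "\<dots> = 192 * (E ^ 3 / N) / N" using N0 by (simp add: eval_nat_numeral)
    finally have "N * Db \<le> 192 * (E ^ 3 / N)" using N0 by (simp add: pos_le_divide_eq mult_ac)
    then have "N * Db * r \<le> 192 * (E ^ 3 / N) * r" using r by (intro mult_right_mono) auto
    also have "\<dots> = 192 * (E ^ 3 * r / N)" by simp
    also have "\<dots> \<le> 192 * ?X" using X(4) by (intro mult_left_mono) auto
    finally show ?thesis by (simp add: r_def l_def)
  qed
  have X0: "?X \<ge> 0" using L E0 l N0 by simp
  have "err = K * N * \<delta>\<^sup>2 + K * N * (p * q * (lam / N\<^sup>2 * (\<Gamma> + N\<^sup>2 * (\<delta>\<^sup>2 * \<kappa>))) / 4) + N * Db * sqrt (ln N)"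
    by (simp only: err distrib_left mult.assoc)
  also have "\<dots> \<le> 96 * C2\<^sup>2 * ?X + 24 * p * q * (q1 + 49 * q * C2\<^sup>2) * ?X + 192 * ?X"
    using t1 t2 t3 by linarith
  also have "\<dots> \<le> C3 * ?X"
  proof -
    have "96 * C2\<^sup>2 + 24 * p * q * (q1 + 49 * q * C2\<^sup>2) + 192 \<le> C3" by (simp add: C3 q1_def)
    from mult_right_mono[OF this X0] show ?thesis by (simp only: distrib_right)
  qed
  finally have "S * err \<le> S * (C3 * ?X)" using S0 by (intro mult_left_mono) auto
  also have "\<dots> = C3 * B" unfolding Bl using S0 by (simp add: S(2)[symmetric])
  finally show "sqrt N * err \<le> C3 * B" by (simp add: S_def)
qed

text \<open>A coefficient can be as large as \<open>sqrt (f n)\<close>, so the localization error is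
  multiplied by this factor; that is why \<open>rate_bounds\<close> estimates
  \<open>sqrt N * err\<close>. The resulting bound involves the coefficients only through
  \<open>f\<close>, and hence tends to 0 along weights that vary with the network.\<close>

lemma (in private_network) char_rate:
  fixes idx :: "'k::finite \<Rightarrow> nat" and c :: "'k \<Rightarrow> real" and E lam :: real
  assumes n3: "n \<ge> 3" and E: "E \<ge> 1"
    and wt_ge: "\<And>i j. i \<in> {1..n} \<Longrightarrow> j \<in> {1..n} \<Longrightarrow> i \<noteq> j \<Longrightarrow> 1 / (4 * E) \<le> wt i j"
    and Hpos: "pos_def (H_mat n Z d0 b0 y0 \<theta> \<gamma>)"
    and Hinv: "mat_norm_inf (matrix_inv (H_mat n Z d0 b0 y0 \<theta> \<gamma>)) \<le> lam / (real n)\<^sup>2"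
    and est: "is_estimator M n Z (priv_out n A ep) (priv_in n A em) (priv_cov n Z A \<eta>) \<theta>h \<gamma>h"
    and idx: "bij_betw idx UNIV {1..CARD('k)}" and k: "CARD('k) \<le> n"
    and a0: "al \<le> a0" "a0 < 1" and e0: "0 < e0" "e0 \<le> eps"
    and t: "1 / V_corner n Z \<theta> \<gamma> \<le> t"
    and form: "(\<Sum>\<iota>\<in>UNIV. (c \<iota>)\<^sup>2 / V_mat n Z \<theta> \<gamma> (idx \<iota>) (idx \<iota>)) + t * (\<Sum>\<iota>\<in>UNIV. c \<iota>)\<^sup>2 = f"
    and B: "B = (1 + lam) * E ^ 8 * ln (real n) / sqrt (real n)" and B1: "B \<le> 1"
    and C1: "C1 = 192 + 2401 * real CARD('p) * q\<^sup>2"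
    and C2: "C2 = 768 + 98 * real CARD('p) * q * (49 * q + 1)"
    and C3: "C3 = 288 * C2\<^sup>2 + 24 * real CARD('p) * q * (49 * q + 1 + 49 * q * C2\<^sup>2) + 192"
    and B2: "C1 * C2 * B \<le> 1 / 2"
    and \<tau>: "\<tau> = 2 / (1 - a0)\<^sup>2" and Cc: "Cc = 2 * (\<Sum>k. real k ^ 3 * a0 ^ k)"
  shows "cmod (expectation (\<lambda>\<omega>. iexp (\<Sum>\<iota>\<in>UNIV. c \<iota> * (\<theta>h \<omega> (idx \<iota>) - \<theta> (idx \<iota>))))
      - complex_of_real (exp (- f / 2)))
    \<le> 2 * (4 / real n + (real CARD('p) + real CARD('k) + 4) * (1 + 2 * \<tau>) / ln (real n)
        + real CARD('p) * (real CARD('p) * q / (e0 * real n)))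
      + (real CARD('k) * sqrt f * C3 + (2 * sqrt (8 * f) + 32 * f) * (f + 8 * real CARD('k) * f)
        + 128 * f * sqrt (8 * f) * Cc + 2048 * f\<^sup>2 * \<tau>\<^sup>2 + 8 * real CARD('k) * f * (1 + 3 * \<tau>)) * B
      + f * \<bar>(1 / V_corner n Z \<theta> \<gamma> + (2 * real n - 1) * tau2 / (V_corner n Z \<theta> \<gamma>)\<^sup>2) / t - 1\<bar>"
proof -
  have n2: "n \<ge> 2" and n1: "n \<ge> 1" using n3 by auto
  have N3: "real n \<ge> 3" using n3 by simp
  have E0: "E > 0" using E by simp
  have q: "q > 0" by (rule q_pos[OF n2])
  have l1: "ln (real n) \<ge> 1"
  proof -
    have "exp 1 \<le> (3 :: real)" by (rule exp_le)
    then have "exp 1 \<le> real n" using N3 by linarith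
    then show ?thesis using N3 by (simp add: ln_ge_iff)
  qed
  have lam0: "lam \<ge> 0"
  proof -
    let ?A = "matrix_inv (H_mat n Z d0 b0 y0 \<theta> \<gamma>)"
    have "0 \<le> (\<Sum>j\<in>UNIV. \<bar>?A $ undefined $ j\<bar>)" by (simp add: sum_nonneg)
    also have "\<dots> \<le> mat_norm_inf ?A" unfolding mat_norm_inf_def by (rule Max_ge) auto
    finally have "0 \<le> lam / (real n)\<^sup>2" using Hinv by linarith
    then show ?thesis using n1 by (simp add: zero_le_divide_iff)
  qed
  define m where "m = 1 / (4 * E)"
  have m: "m > 0" using E0 by (simp add: m_def)
  define K where "K = 3 / (m\<^sup>2 * real (n - 1))"
  define \<kappa> where "\<kappa> = q + 2 * (K * (real n * (q / 4)))"
  define \<Lambda> where "\<Lambda> = 2 * K * real n * (1 + real CARD('p) * q * lam * \<kappa> / 4) + real CARD('p) * q * lam * \<kappa>"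
  define T where "T = sqrt (real n * ln (real n))"
  define \<Gamma> where "\<Gamma> = real n * \<kappa> * sqrt (ln (real n)) + real n"
  define \<delta> where "\<delta> = 2 * (2 * (K * (2 * T + real n * (real CARD('p) * q * (lam / (real n)\<^sup>2 * \<Gamma>) / 4)))
        + real CARD('p) * q * (lam / (real n)\<^sup>2 * \<Gamma>))"
  define Db where "Db = K * (1 / (4 * (m * real (n - 1))))"
  define err where "err = K * (real n * \<delta>\<^sup>2 + real n * (real CARD('p) * q
              * (lam / (real n)\<^sup>2 * (\<Gamma> + (real n)\<^sup>2 * (\<delta>\<^sup>2 * \<kappa>))) / 4))
          + real n * Db * sqrt (ln (real n))"
  have nm1: "real (n - 1) = real n - 1" using n1 by (simp add: of_nat_diff)
  have rb: "\<Lambda> * \<delta> \<le> C1 * C2 * B" "sqrt (real n) * err \<le> C3 * B"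
    using rate_bounds[OF N3 E lam0 q _ l1 K_def[unfolded m_def nm1] \<kappa>_def \<Lambda>_def T_def \<Gamma>_def \<delta>_def
        Db_def[unfolded m_def nm1] err_def B B1 C1 C2 C3] by auto
  have contr: "\<Lambda> * \<delta> \<le> 1 / 2" using rb(1) B2 by linarith
  let ?S = "\<lambda>\<iota>. LF (node_coef n (weighted_network.Scol n Z \<theta> \<gamma> (idx \<iota>)))"
  obtain Bad where Bad: "Bad \<in> events"
    and pBad: "prob Bad \<le> 4 / real n + (real CARD('p) + real CARD('k) + 4) * (1 + 2 * tau2) / ln (real n)
      + real CARD('p) * (real CARD('p) * q / (eps * real n))"
    and loc: "\<And>\<omega> i. \<omega> \<in> space M - Bad \<Longrightarrow> i \<in> {1..CARD('k)} \<Longrightarrow>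
      \<bar>\<theta>h \<omega> i - \<theta> i - LF (node_coef n (weighted_network.Scol n Z \<theta> \<gamma> i)) \<omega>\<bar> \<le> err"
    using estimator_localization[OF n3 m wt_ge[folded m_def] Hpos Hinv est k K_def \<kappa>_def \<Lambda>_def T_def \<Gamma>_def
        \<delta>_def contr Db_def] unfolding err_def by blast
  have idx_in: "idx \<iota> \<in> {1..CARD('k)}" for \<iota> using idx by (auto simp: bij_betw_def)
  have idx_n: "idx \<iota> \<in> {1..n}" for \<iota> using idx_in[of \<iota>] k by auto
  have idx_inj: "inj idx" using idx by (simp add: bij_betw_def)
  have idx_N: "idx \<iota> \<in> {1..2 * n - 1}" for \<iota> using idx_n[of \<iota>] n1 by auto
  define \<beta> where "\<beta> = sqrt (f / (m * real (n - 1)))"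
  note comb = combination_char_bound[OF n3 m wt_ge[folded m_def] idx_inj idx_n a0 Cc refl refl t form \<beta>_def]
  let ?ratio = "\<bar>(1 / V_corner n Z \<theta> \<gamma> + (2 * real n - 1) * tau2 / (V_corner n Z \<theta> \<gamma>)\<^sup>2) / t - 1\<bar>"
  have clt: "cmod (expectation (\<lambda>\<omega>. iexp (\<Sum>\<iota>\<in>UNIV. c \<iota> * ?S \<iota> \<omega>)) - complex_of_real (exp (- f / 2)))
    \<le> (2 * \<beta> + 4 * \<beta>\<^sup>2) * (f + real CARD('k) * \<beta>\<^sup>2) + 16 * real n * \<beta> ^ 3 * Cc
      + 32 * real n * \<beta> ^ 4 * tau2\<^sup>2 + f * ?ratio + real CARD('k) * \<beta>\<^sup>2 * (1 + 3 * tau2)"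
    by (rule comb(1))
  have cb: "\<bar>c \<iota>\<bar> \<le> sqrt (f * real n)" for \<iota> by (rule comb(2))
  have f0: "f \<ge> 0"
  proof -
    have "0 \<le> sqrt (f * real n)" using cb[of undefined] by linarith
    then show ?thesis using n1 by (simp add: zero_le_mult_iff)
  qed
  have err0: "err \<ge> 0"
  proof -
    have K0: "K > 0" unfolding K_def using m n3 by simp
    have \<kappa>0: "\<kappa> \<ge> 0" unfolding \<kappa>_def using q K0 by simp
    have \<Gamma>0: "\<Gamma> \<ge> 0" unfolding \<Gamma>_def using \<kappa>0 l1 by (intro add_nonneg_nonneg mult_nonneg_nonneg) auto
    have Db0: "Db \<ge> 0" unfolding Db_def using K0 m by simp
    show ?thesis unfolding err_def
      using K0 \<kappa>0 \<Gamma>0 Db0 q lam0 l1 by (intro add_nonneg_nonneg mult_nonneg_nonneg divide_nonneg_nonneg) auto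
  qed
  have rv\<theta>: "random_variable borel (\<lambda>\<omega>. \<theta>h \<omega> (idx \<iota>))" for \<iota>
    using est idx_N by (auto simp: is_estimator_def)
  have loc_err: "cmod (expectation (\<lambda>\<omega>. iexp (\<Sum>\<iota>\<in>UNIV. c \<iota> * (\<theta>h \<omega> (idx \<iota>) - \<theta> (idx \<iota>))))
      - expectation (\<lambda>\<omega>. iexp (\<Sum>\<iota>\<in>UNIV. c \<iota> * ?S \<iota> \<omega>)))
      \<le> 2 * prob Bad + real CARD('k) * (sqrt (f * real n) * err)"
  proof (rule iexp_expectation_diff[OF _ _ Bad])
    show "random_variable borel (\<lambda>\<omega>. \<Sum>\<iota>\<in>UNIV. c \<iota> * (\<theta>h \<omega> (idx \<iota>) - \<theta> (idx \<iota>)))"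
      by (intro borel_measurable_sum borel_measurable_times borel_measurable_diff rv\<theta>) auto
    show "random_variable borel (\<lambda>\<omega>. \<Sum>\<iota>\<in>UNIV. c \<iota> * ?S \<iota> \<omega>)"
      by (intro borel_measurable_sum borel_measurable_times rv_LF) auto
    show "0 \<le> real CARD('k) * (sqrt (f * real n) * err)" using err0 f0 by simp
    fix \<omega> assume \<omega>: "\<omega> \<in> space M - Bad"
    have "\<bar>(\<Sum>\<iota>\<in>UNIV. c \<iota> * (\<theta>h \<omega> (idx \<iota>) - \<theta> (idx \<iota>))) - (\<Sum>\<iota>\<in>UNIV. c \<iota> * ?S \<iota> \<omega>)\<bar>
        = \<bar>\<Sum>\<iota>\<in>UNIV. c \<iota> * (\<theta>h \<omega> (idx \<iota>) - \<theta> (idx \<iota>) - ?S \<iota> \<omega>)\<bar>"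
      by (simp add: right_diff_distrib sum_subtractf)
    also have "\<dots> \<le> (\<Sum>\<iota>\<in>(UNIV :: 'k set). sqrt (f * real n) * err)"
      by (rule order.trans[OF sum_abs sum_mono])
        (unfold abs_mult, intro mult_mono cb loc[OF \<omega>] idx_in, use f0 in auto)
    finally show "\<bar>(\<Sum>\<iota>\<in>UNIV. c \<iota> * (\<theta>h \<omega> (idx \<iota>) - \<theta> (idx \<iota>))) - (\<Sum>\<iota>\<in>UNIV. c \<iota> * ?S \<iota> \<omega>)\<bar>
        \<le> real CARD('k) * (sqrt (f * real n) * err)" by simp
  qed
  have tau_le: "tau2 \<le> \<tau>"
  proof -
    have "(1 - a0)\<^sup>2 \<le> (1 - al)\<^sup>2" using a0 by (intro power_mono) auto
    then show ?thesis unfolding tau2_def \<tau> using al a0 by (intro frac_le) auto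
  qed
  have Cc0: "Cc \<ge> 0"
  proof -
    have "0 \<le> a0" using al a0 by linarith
    then show ?thesis unfolding Cc using summable_cube_power[of a0] a0 by (auto intro!: suminf_nonneg)
  qed
  have term_err: "sqrt (f * real n) * err \<le> sqrt f * (C3 * B)"
    using mult_left_mono[OF rb(2), of "sqrt f"] f0 by (simp add: real_sqrt_mult mult.assoc)
  have term_bad: "prob Bad \<le> 4 / real n + (real CARD('p) + real CARD('k) + 4) * (1 + 2 * \<tau>) / ln (real n)
      + real CARD('p) * (real CARD('p) * q / (e0 * real n))"
  proof -
    have "(real CARD('p) + real CARD('k) + 4) * (1 + 2 * tau2) / ln (real n)
        \<le> (real CARD('p) + real CARD('k) + 4) * (1 + 2 * \<tau>) / ln (real n)"
      using tau_le l1 by (intro divide_right_mono mult_left_mono) auto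
    moreover have "real CARD('p) * (real CARD('p) * q / (eps * real n)) \<le> real CARD('p) * (real CARD('p) * q / (e0 * real n))"
      using e0 q n1 by (intro mult_left_mono divide_left_mono mult_right_mono) auto
    ultimately show ?thesis using pBad by linarith
  qed
  \<comment> \<open>A common scale: \<open>\<beta>\<close>, and even the product
    \<open>E * \<beta>\<close> that arises from \<open>n * \<beta>^3\<close>, is at most a constant
    times \<open>g\<close>, while both \<open>g\<close> and \<open>g^2\<close> are at most
    \<open>B\<close>.\<close>
  define g where "g = E\<^sup>2 / sqrt (real n)"
  have g0: "g \<ge> 0" by (simp add: g_def)
  have gB: "g \<le> B"
  proof -
    have "1 * E\<^sup>2 * 1 \<le> (1 + lam) * E ^ 8 * ln (real n)"
      using lam0 l1 E power_increasing[of 2 8 E] by (intro mult_mono) auto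
    then show ?thesis unfolding g_def B using n1 by (intro divide_right_mono) auto
  qed
  have g2: "g\<^sup>2 = E ^ 4 / real n" by (simp add: g_def power_divide flip: power_mult)
  have gg: "g\<^sup>2 \<le> B" using g0 gB B1 mult_mono[of g B g 1] by (simp add: power2_eq_square)
  have \<beta>2: "\<beta>\<^sup>2 = 4 * E * f / (real n - 1)" and \<beta>0: "\<beta> \<ge> 0"
  proof -
    have "f / (m * real (n - 1)) = 4 * E * f / (real n - 1)" unfolding m_def nm1 using E0 N3 by (simp add: field_simps)
    moreover have "0 \<le> 4 * E * f / (real n - 1)" using E0 f0 N3 by simp
    ultimately show "\<beta>\<^sup>2 = 4 * E * f / (real n - 1)" "\<beta> \<ge> 0" unfolding \<beta>_def by simp_all
  qed
  have \<beta>2_le: "\<beta>\<^sup>2 \<le> 8 * f * (E / real n)"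
  proof -
    have "4 * E * f / (real n - 1) \<le> 4 * E * f / (real n / 2)"
      using E0 f0 N3 by (intro divide_left_mono) auto
    then show ?thesis unfolding \<beta>2 by (simp add: mult_ac)
  qed
  have En: "E / real n \<le> g\<^sup>2"
    unfolding g2 using power_increasing[of 1 4 E] E n1 by (intro divide_right_mono) auto
  have \<beta>2_g: "\<beta>\<^sup>2 \<le> 8 * f * g\<^sup>2" using \<beta>2_le mult_left_mono[OF En, of "8 * f"] f0 by linarith
  have \<beta>2_B: "\<beta>\<^sup>2 \<le> 8 * f * B" using \<beta>2_g mult_left_mono[OF gg, of "8 * f"] f0 by linarith
  have \<beta>2_1: "\<beta>\<^sup>2 \<le> 8 * f" using \<beta>2_B mult_left_mono[OF B1, of "8 * f"] f0 by linarith
  have sq_le: "x \<le> y" if "x\<^sup>2 \<le> y\<^sup>2" "0 \<le> y" for x y :: real using that by (rule power2_le_imp_le)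
  have \<beta>_g: "\<beta> \<le> sqrt (8 * f) * g"
    by (rule sq_le) (use \<beta>2_g f0 g0 in \<open>simp_all add: power_mult_distrib\<close>)
  have \<beta>_B: "\<beta> \<le> sqrt (8 * f) * B" using \<beta>_g mult_left_mono[OF gB, of "sqrt (8 * f)"] f0 by simp
  have E\<beta>: "E * \<beta> \<le> sqrt (8 * f) * g"
  proof (rule sq_le)
    have "(E * \<beta>)\<^sup>2 \<le> E\<^sup>2 * (8 * f * (E / real n))"
      unfolding power_mult_distrib using \<beta>2_le by (intro mult_left_mono) auto
    also have "\<dots> = 8 * f * (E ^ 3 / real n)" by (simp add: eval_nat_numeral)
    also have "\<dots> \<le> 8 * f * g\<^sup>2"
      unfolding g2 using power_increasing[of 3 4 E] E f0 by (intro mult_left_mono divide_right_mono) auto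
    finally show "(E * \<beta>)\<^sup>2 \<le> (sqrt (8 * f) * g)\<^sup>2" using f0 by (simp add: power_mult_distrib)
  qed (use f0 g0 in auto)
  have n\<beta>2: "real n * \<beta>\<^sup>2 \<le> 8 * f * E" using mult_left_mono[OF \<beta>2_le, of "real n"] n1 by simp
  let ?k = "real CARD('k)"
  have T1: "(2 * \<beta> + 4 * \<beta>\<^sup>2) * (f + ?k * \<beta>\<^sup>2) \<le> (2 * sqrt (8 * f) + 32 * f) * (f + 8 * ?k * f) * B"
  proof -
    have "2 * \<beta> + 4 * \<beta>\<^sup>2 \<le> (2 * sqrt (8 * f) + 32 * f) * B"
      using \<beta>_B \<beta>2_B by (simp add: distrib_right)
    moreover have "f + ?k * \<beta>\<^sup>2 \<le> f + 8 * ?k * f" using mult_left_mono[OF \<beta>2_1, of ?k] by simp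
    ultimately have "(2 * \<beta> + 4 * \<beta>\<^sup>2) * (f + ?k * \<beta>\<^sup>2) \<le> ((2 * sqrt (8 * f) + 32 * f) * B) * (f + 8 * ?k * f)"
      using \<beta>0 f0 g0 gB by (intro mult_mono) auto
    then show ?thesis by (simp add: mult_ac)
  qed
  have T2: "16 * real n * \<beta> ^ 3 * Cc \<le> 128 * f * sqrt (8 * f) * Cc * B"
  proof -
    have "real n * \<beta> ^ 3 = (real n * \<beta>\<^sup>2) * \<beta>" by (simp add: power3_eq_cube power2_eq_square)
    also have "\<dots> \<le> 8 * f * E * \<beta>" using n\<beta>2 \<beta>0 by (rule mult_right_mono)
    also have "\<dots> \<le> 8 * f * (sqrt (8 * f) * g)" using mult_left_mono[OF E\<beta>, of "8 * f"] f0 by (simp add: mult_ac)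
    also have "\<dots> \<le> 8 * f * (sqrt (8 * f) * B)" using gB f0 by (intro mult_left_mono) auto
    finally have "16 * Cc * (real n * \<beta> ^ 3) \<le> 16 * Cc * (8 * f * (sqrt (8 * f) * B))"
      using Cc0 by (intro mult_left_mono) auto
    then show ?thesis by (simp add: mult_ac)
  qed
  have T3: "32 * real n * \<beta> ^ 4 * tau2\<^sup>2 \<le> 2048 * f\<^sup>2 * \<tau>\<^sup>2 * B"
  proof -
    have "real n * \<beta> ^ 4 = (real n * \<beta>\<^sup>2) * \<beta>\<^sup>2" by (simp add: power4_eq_xxxx power2_eq_square)
    also have "\<dots> \<le> (8 * f * E) * (8 * f * (E / real n))"
      using n\<beta>2 \<beta>2_le E0 f0 by (intro mult_mono[OF n\<beta>2 \<beta>2_le]) auto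
    also have "\<dots> = 64 * f\<^sup>2 * (E\<^sup>2 / real n)" by (simp add: power2_eq_square)
    also have "\<dots> \<le> 64 * f\<^sup>2 * g\<^sup>2"
      unfolding g2 using power_increasing[of 2 4 E] E by (intro mult_left_mono divide_right_mono) auto
    also have "\<dots> \<le> 64 * f\<^sup>2 * B" using gg by (intro mult_left_mono) auto
    finally have a: "real n * \<beta> ^ 4 \<le> 64 * f\<^sup>2 * B" .
    have b: "tau2\<^sup>2 \<le> \<tau>\<^sup>2" using tau_le tau2_nonneg by (intro power_mono) auto
    have "(real n * \<beta> ^ 4) * tau2\<^sup>2 \<le> (64 * f\<^sup>2 * B) * \<tau>\<^sup>2"
      by (rule mult_mono[OF a b]) (use g0 gB in auto)
    then show ?thesis by (simp add: mult_ac)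
  qed
  have T4: "?k * \<beta>\<^sup>2 * (1 + 3 * tau2) \<le> 8 * ?k * f * (1 + 3 * \<tau>) * B"
  proof -
    have "?k * \<beta>\<^sup>2 * (1 + 3 * tau2) \<le> ?k * (8 * f * B) * (1 + 3 * \<tau>)"
      using tau_le tau2_nonneg f0 g0 gB
      by (intro mult_mono[OF mult_left_mono[OF \<beta>2_B]]) auto
    then show ?thesis by (simp add: mult_ac)
  qed
  let ?U = "expectation (\<lambda>\<omega>. iexp (\<Sum>\<iota>\<in>UNIV. c \<iota> * (\<theta>h \<omega> (idx \<iota>) - \<theta> (idx \<iota>))))"
  let ?V = "expectation (\<lambda>\<omega>. iexp (\<Sum>\<iota>\<in>UNIV. c \<iota> * ?S \<iota> \<omega>))"
  have tri: "cmod (?U - complex_of_real (exp (- f / 2))) \<le> cmod (?U - ?V) + cmod (?V - complex_of_real (exp (- f / 2)))"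
    using norm_triangle_ineq[of "?U - ?V" "?V - complex_of_real (exp (- f / 2))"] by simp
  have kerr: "?k * (sqrt (f * real n) * err) \<le> ?k * sqrt f * C3 * B"
    using mult_left_mono[OF term_err, of ?k] by (simp add: mult.assoc)
  have rhs: "(?k * sqrt f * C3 + (2 * sqrt (8 * f) + 32 * f) * (f + 8 * ?k * f)
        + 128 * f * sqrt (8 * f) * Cc + 2048 * f\<^sup>2 * \<tau>\<^sup>2 + 8 * ?k * f * (1 + 3 * \<tau>)) * B
      = ?k * sqrt f * C3 * B + (2 * sqrt (8 * f) + 32 * f) * (f + 8 * ?k * f) * B
        + 128 * f * sqrt (8 * f) * Cc * B + 2048 * f\<^sup>2 * \<tau>\<^sup>2 * B + 8 * ?k * f * (1 + 3 * \<tau>) * B"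
    unfolding distrib_right by (rule refl)
  have comb5: "u \<le> 2 * b + (e + t1 + t2 + t3 + t4) + r"
    if "u \<le> v + w" "v \<le> 2 * pb + e'" "w \<le> x1 + x2 + x3 + r + x4" "pb \<le> b" "e' \<le> e"
      "x1 \<le> t1" "x2 \<le> t2" "x3 \<le> t3" "x4 \<le> t4"
    for u v w b pb e e' t1 t2 t3 t4 x1 x2 x3 x4 r :: real using that by linarith
  show ?thesis unfolding rhs by (rule comb5[OF tri loc_err clt term_bad kerr T1 T2 T3 T4])
qed

text \<open>As \<open>w n\<close> is at least \<open>E n ^ 9\<close>, the rate condition dominates
  \<open>E^8 ln n / sqrt n\<close> by its first summand, and \<open>q\<close> times the square of
  \<open>lam E^8 ln n / sqrt n\<close> by its second. A square root and division by the fixed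
  \<open>q\<close> recover the latter.\<close>

lemma rate_null:
  fixes E et w lam :: "nat \<Rightarrow> real" and q :: real
  assumes q: "q > 0" and E: "\<And>n. n \<ge> 2 \<Longrightarrow> E n \<ge> 1" and et: "\<And>n. n \<ge> 2 \<Longrightarrow> et n \<ge> 1"
    and w: "\<And>n. n \<ge> 3 \<Longrightarrow> E n ^ 9 \<le> w n"
    and rate: "(\<lambda>n. (et n)\<^sup>2 * E n ^ 9 + (w n)\<^sup>2 * (lam n)\<^sup>2 * q * E n ^ 3 * ln (real n))
      \<in> o(\<lambda>n. sqrt (real n) / ln (real n))"
  shows "(\<lambda>n. (1 + lam n) * E n ^ 8 * ln (real n) / sqrt (real n)) \<longlonglongrightarrow> 0"
proof -
  define D where "D n = ((et n)\<^sup>2 * E n ^ 9 + (w n)\<^sup>2 * (lam n)\<^sup>2 * q * E n ^ 3 * ln (real n))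
      * ln (real n) / sqrt (real n)" for n
  have D: "D \<longlonglongrightarrow> 0" using smalloD_tendsto[OF rate] by (simp add: D_def[abs_def])
  have ln1: "ln (real n) \<ge> 1" if "n \<ge> 3" for n
  proof -
    have "exp 1 \<le> (3 :: real)" by (rule exp_le)
    moreover have "real n \<ge> 3" using that by simp
    ultimately have "exp 1 \<le> real n" by linarith
    then show ?thesis using that by (simp add: ln_ge_iff)
  qed
  have b1: "\<bar>E n ^ 8 * ln (real n) / sqrt (real n)\<bar> \<le> D n"
    and b2: "q * (lam n * E n ^ 8 * ln (real n) / sqrt (real n))\<^sup>2 \<le> D n" if n: "n \<ge> 3" for n
  proof -
    have E1: "E n \<ge> 1" and et1: "et n \<ge> 1" using E et n by auto
    have l: "ln (real n) \<ge> 1" by (rule ln1[OF n])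
    have S: "sqrt (real n) \<ge> 1" using n by simp
    let ?x = "(et n)\<^sup>2 * E n ^ 9" and ?y = "(w n)\<^sup>2 * (lam n)\<^sup>2 * q * E n ^ 3 * ln (real n)"
    have x0: "?x \<ge> 0" using E1 by simp
    have y0: "?y \<ge> 0" using E1 q l by simp
    have "1 * E n ^ 8 \<le> ?x"
      using power_increasing[of 8 9 "E n"] E1 et1 one_le_power[of "et n" 2] by (intro mult_mono) auto
    then have "E n ^ 8 \<le> ?x + ?y" using y0 by linarith
    then have "E n ^ 8 * ln (real n) / sqrt (real n) \<le> D n"
      unfolding D_def using l S by (intro divide_right_mono mult_right_mono) auto
    then show "\<bar>E n ^ 8 * ln (real n) / sqrt (real n)\<bar> \<le> D n" using E1 l S by simp
    have w8: "E n ^ 8 \<le> w n" using w[OF n] power_increasing[of 8 9 "E n"] E1 by linarith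
    have "q * (lam n * E n ^ 8 * ln (real n))\<^sup>2 = (E n ^ 8)\<^sup>2 * (lam n)\<^sup>2 * q * 1 * ln (real n) * ln (real n)"
      by (simp add: power_mult_distrib power2_eq_square)
    also have "\<dots> \<le> ?y * ln (real n)"
    proof (intro mult_right_mono)
      have "(E n ^ 8)\<^sup>2 \<le> (w n)\<^sup>2" using w8 E1 by (intro power_mono) auto
      then have "(E n ^ 8)\<^sup>2 * (lam n)\<^sup>2 * q \<le> (w n)\<^sup>2 * (lam n)\<^sup>2 * q" using q by (intro mult_right_mono) auto
      from this one_le_power[OF E1, of 3]
      show "(E n ^ 8)\<^sup>2 * (lam n)\<^sup>2 * q * 1 \<le> (w n)\<^sup>2 * (lam n)\<^sup>2 * q * E n ^ 3"
        by (rule mult_mono) (use q in auto)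
    qed (use l in auto)
    also have "\<dots> \<le> (?x + ?y) * ln (real n)" using x0 l by (intro mult_right_mono) auto
    finally have *: "q * (lam n * E n ^ 8 * ln (real n))\<^sup>2 \<le> (?x + ?y) * ln (real n)" .
    have "q * (lam n * E n ^ 8 * ln (real n) / sqrt (real n))\<^sup>2 = q * (lam n * E n ^ 8 * ln (real n))\<^sup>2 / real n"
      using n by (simp add: power_divide)
    also have "\<dots> \<le> (?x + ?y) * ln (real n) / real n" using * by (intro divide_right_mono) auto
    also have "\<dots> \<le> (?x + ?y) * ln (real n) / sqrt (real n)"
    proof (rule divide_left_mono)
      have "sqrt (real n) * 1 \<le> sqrt (real n) * sqrt (real n)" using S by (intro mult_left_mono) auto
      then show "sqrt (real n) \<le> real n" by simp
      show "0 \<le> (?x + ?y) * ln (real n)" using x0 y0 l by simp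
    qed (use n in auto)
    finally show "q * (lam n * E n ^ 8 * ln (real n) / sqrt (real n))\<^sup>2 \<le> D n" by (simp add: D_def)
  qed
  have l1: "(\<lambda>n. E n ^ 8 * ln (real n) / sqrt (real n)) \<longlonglongrightarrow> 0"
    by (rule Lim_null_comparison[OF _ D]) (use b1 in \<open>auto simp: eventually_sequentially intro!: exI[of _ 3]\<close>)
  have "(\<lambda>n. q * (lam n * E n ^ 8 * ln (real n) / sqrt (real n))\<^sup>2) \<longlonglongrightarrow> 0"
    by (rule Lim_null_comparison[OF _ D])
      (use b2 q in \<open>auto simp: eventually_sequentially abs_mult intro!: exI[of _ 3]\<close>)
  then have "(\<lambda>n. (1 / q) * (q * (lam n * E n ^ 8 * ln (real n) / sqrt (real n))\<^sup>2)) \<longlonglongrightarrow> (1 / q) * 0"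
    by (intro tendsto_intros)
  then have "(\<lambda>n. (lam n * E n ^ 8 * ln (real n) / sqrt (real n))\<^sup>2) \<longlonglongrightarrow> 0" using q by simp
  then have "(\<lambda>n. sqrt ((lam n * E n ^ 8 * ln (real n) / sqrt (real n))\<^sup>2)) \<longlonglongrightarrow> sqrt 0"
    by (intro tendsto_intros)
  then have l2: "(\<lambda>n. lam n * E n ^ 8 * ln (real n) / sqrt (real n)) \<longlonglongrightarrow> 0"
    by (simp add: tendsto_rabs_zero_iff del: abs_mult abs_divide)
  have "(\<lambda>n. E n ^ 8 * ln (real n) / sqrt (real n) + lam n * E n ^ 8 * ln (real n) / sqrt (real n)) \<longlonglongrightarrow> 0 + 0"
    by (rule tendsto_add[OF l1 l2])
  then show ?thesis by (simp add: distrib_right add_divide_distrib)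
qed

section \<open>Levy's continuity theorem in several dimensions\<close>

lemma prod_Basis_vec:
  fixes x :: "real^'k"
  shows "(\<Prod>b\<in>Basis. F (axis_index b) (x \<bullet> b)) = (\<Prod>i\<in>UNIV. F i (x $ i))"
proof -
  have eq: "(Basis :: (real^'k) set) = (\<lambda>i. axis i 1) ` UNIV" by (auto simp: Basis_vec_def)
  have "inj (\<lambda>i. axis i 1 :: real^'k)" by (auto simp: inj_on_def axis_eq_axis)
  then show ?thesis
    unfolding eq by (subst prod.reindex) (simp_all add: axis_index_axis inner_axis)
qed

text \<open>Lebesgue measure on vectors is an image of the product measure over
  \<open>Basis\<close>; \<open>axis_index\<close> translates the factors to coordinates.\<close>

lemma has_integral_prod_lborel_vec:
  fixes F :: "'k::finite \<Rightarrow> real \<Rightarrow> 'b::{real_normed_field, banach, second_countable_topology}"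
  assumes int: "\<And>i. integrable lborel (F i)"
  shows "integrable lborel (\<lambda>x::real^'k. \<Prod>i\<in>UNIV. F i (x $ i))"
    and "(\<integral>x. (\<Prod>i\<in>UNIV. F i ((x :: real^'k) $ i)) \<partial>lborel) = (\<Prod>i\<in>UNIV. \<integral>x. F i x \<partial>lborel)"
proof -
  interpret product_sigma_finite "\<lambda>_::real^'k. lborel :: real measure" ..
  let ?T = "\<lambda>f. \<Sum>b\<in>(Basis :: (real^'k) set). f b *\<^sub>R b"
  have Fm: "F i \<in> borel_measurable borel" for i
    using borel_measurable_integrable[OF int[of i]] by simp
  have comp: "(\<Prod>i\<in>UNIV. F i (?T f $ i)) = (\<Prod>b\<in>Basis. F (axis_index b) (f b))" for f
    unfolding prod_Basis_vec[symmetric]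
    by (intro prod.cong refl) (simp add: inner_sum_left inner_Basis if_distrib cong: if_cong)
  have T: "?T \<in> measurable (\<Pi>\<^sub>M b\<in>Basis. lborel) (borel :: (real^'k) measure)" by measurable
  have meas: "(\<lambda>x::real^'k. \<Prod>i\<in>UNIV. F i (x $ i)) \<in> borel_measurable borel"
    using Fm by (intro borel_measurable_prod measurable_compose[OF _ Fm]) measurable
  have I: "integrable (\<Pi>\<^sub>M b\<in>Basis. lborel) (\<lambda>f. \<Prod>b\<in>(Basis :: (real^'k) set). F (axis_index b) (f b))"
    by (rule product_integrable_prod) (auto intro: int)
  show "integrable lborel (\<lambda>x::real^'k. \<Prod>i\<in>UNIV. F i (x $ i))"
    unfolding lborel_eq[where 'a = "real^'k"]
    by (subst integrable_distr_eq[OF T meas]) (unfold comp, rule I)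
  have "(\<integral>x. (\<Prod>i\<in>UNIV. F i ((x :: real^'k) $ i)) \<partial>lborel)
      = (\<integral>f. (\<Prod>b\<in>(Basis :: (real^'k) set). F (axis_index b) (f b)) \<partial>(\<Pi>\<^sub>M b\<in>Basis. lborel))"
    unfolding lborel_eq[where 'a = "real^'k"]
    by (subst integral_distr[OF T meas]) (simp only: comp)
  also have "\<dots> = (\<Prod>b\<in>(Basis :: (real^'k) set). \<integral>x. F (axis_index b) x \<partial>lborel)"
    by (rule product_integral_prod) (auto intro: int)
  also have "\<dots> = (\<Prod>i\<in>UNIV. \<integral>x. F i x \<partial>lborel)"
    using prod_Basis_vec[of "\<lambda>i _. \<integral>x. F i x \<partial>lborel" "0 :: real^'k"] by simp
  finally show "(\<integral>x. (\<Prod>i\<in>UNIV. F i ((x :: real^'k) $ i)) \<partial>lborel) = (\<Prod>i\<in>UNIV. \<integral>x. F i x \<partial>lborel)" .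
qed

definition mvn_density :: "real^'k \<Rightarrow> real" where
  "mvn_density x = (\<Prod>i\<in>UNIV. std_normal_density (x $ i))"

lemma mvn_density_eq:
  "mvn_density (x :: real^'k) = (1 / sqrt (2 * pi)) ^ CARD('k) * exp (- (x \<bullet> x) / 2)"
proof -
  have "exp (- (x \<bullet> x) / 2) = exp (\<Sum>i\<in>UNIV. - (x $ i)\<^sup>2 / 2)"
    by (simp add: inner_vec_def power2_eq_square sum_divide_distrib sum_negf)
  also have "\<dots> = (\<Prod>i\<in>UNIV. exp (- (x $ i)\<^sup>2 / 2))" by (simp add: exp_sum)
  finally show ?thesis
    unfolding mvn_density_def std_normal_density_def prod.distrib prod_constant by simp
qed

lemma mvn_density_nonneg: "0 \<le> mvn_density x"
  unfolding mvn_density_def by (intro prod_nonneg) simp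

lemma mvn_density_le: "mvn_density (x :: real^'k) \<le> (1 / sqrt (2 * pi)) ^ CARD('k)"
  unfolding mvn_density_eq by (intro mult_left_le) auto

lemma continuous_mvn_density: "continuous_on UNIV mvn_density"
  unfolding mvn_density_eq[abs_def] by (intro continuous_intros) auto

lemma measurable_mvn_density [measurable]: "mvn_density \<in> borel_measurable borel"
  by (rule borel_measurable_continuous_onI[OF continuous_mvn_density])

lemma std_mvn_eq: "std_mvn = density lborel (\<lambda>x. ennreal (mvn_density x))"
  by (simp add: std_mvn_def mvn_density_def)

lemma sets_std_mvn [simp, measurable_cong]: "sets std_mvn = sets borel"
  and space_std_mvn [simp]: "space std_mvn = UNIV"
  by (simp_all add: std_mvn_eq)

lemma integral_std_mvn:
  fixes f :: "real^'k \<Rightarrow> 'b::{banach, second_countable_topology}"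
  assumes [measurable]: "f \<in> borel_measurable borel"
  shows "(\<integral>x. f x \<partial>std_mvn) = (\<integral>x. mvn_density x *\<^sub>R f x \<partial>lborel)"
  unfolding std_mvn_eq by (rule integral_density) (auto simp: mvn_density_nonneg)

lemma prob_space_std_mvn: "prob_space (std_mvn :: (real^'k) measure)"
proof
  interpret N: prob_space "density lborel std_normal_density" by (rule prob_space_normal_density) simp
  have one: "(\<integral>x. std_normal_density x \<partial>lborel) = 1" by (simp add: integral_normal_density)
  have i: "integrable lborel (mvn_density :: real^'k \<Rightarrow> real)"
    "(\<integral>x. mvn_density (x :: real^'k) \<partial>lborel) = 1"
    unfolding mvn_density_def[abs_def]
    using has_integral_prod_lborel_vec[where F = "\<lambda>_::'k. std_normal_density"]
    by (simp_all add: integrable_normal_density one)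
  have "emeasure std_mvn (space (std_mvn :: (real^'k) measure))
      = (\<integral>\<^sup>+x. ennreal (mvn_density (x :: real^'k)) \<partial>lborel)"
    unfolding std_mvn_eq by (subst emeasure_density) auto
  also have "\<dots> = ennreal 1"
    using i by (subst nn_integral_eq_integral) (auto simp: mvn_density_nonneg)
  finally show "emeasure std_mvn (space (std_mvn :: (real^'k) measure)) = 1" by simp
qed

definition mchar :: "(real^'k) measure \<Rightarrow> real^'k \<Rightarrow> complex" where
  "mchar \<mu> t = (\<integral>x. iexp (t \<bullet> x) \<partial>\<mu>)"

lemma mchar_std_mvn: "mchar std_mvn (t :: real^'k) = complex_of_real (exp (- (t \<bullet> t) / 2))"
proof -
  let ?F = "\<lambda>i x. complex_of_real (std_normal_density x) * iexp (t $ i * x)"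
  have F: "integrable lborel (?F i)" "(\<integral>x. ?F i x \<partial>lborel) = complex_of_real (exp (- (t $ i)\<^sup>2 / 2))" for i
  proof -
    have [measurable]: "(\<lambda>x. iexp (t $ i * x)) \<in> borel_measurable borel" by measurable
    show "integrable lborel (?F i)"
    proof (rule Bochner_Integration.integrable_bound[of lborel std_normal_density])
      show "integrable lborel std_normal_density" by (simp add: integrable_normal_density)
      show "AE x in lborel. norm (?F i x) \<le> norm (std_normal_density x)"
        by (auto simp: norm_mult)
    qed measurable
    have "char std_normal_distribution (t $ i) = (\<integral>x. std_normal_density x *\<^sub>R iexp (t $ i * x) \<partial>lborel)"
      unfolding char_def by (subst integral_density) auto
    then show "(\<integral>x. ?F i x \<partial>lborel) = complex_of_real (exp (- (t $ i)\<^sup>2 / 2))"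
      by (simp add: char_std_normal_distribution scaleR_conv_of_real)
  qed
  have "mchar std_mvn t = (\<integral>x. mvn_density x *\<^sub>R iexp (t \<bullet> x) \<partial>lborel)"
    unfolding mchar_def by (rule integral_std_mvn) measurable
  also have "\<dots> = (\<integral>x. (\<Prod>i\<in>UNIV. ?F i ((x :: real^'k) $ i)) \<partial>lborel)"
  proof (rule Bochner_Integration.integral_cong[OF refl])
    fix x :: "real^'k"
    have "iexp (t \<bullet> x) = (\<Prod>i\<in>UNIV. iexp (t $ i * x $ i))"
      by (simp add: inner_vec_def sum_distrib_left exp_sum)
    then show "mvn_density x *\<^sub>R iexp (t \<bullet> x) = (\<Prod>i\<in>UNIV. ?F i (x $ i))"
      by (simp add: mvn_density_def prod.distrib scaleR_conv_of_real)
  qed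
  also have "\<dots> = (\<Prod>i\<in>UNIV. complex_of_real (exp (- (t $ i)\<^sup>2 / 2)))"
    using has_integral_prod_lborel_vec(2)[where F = ?F, OF F(1)] F(2) by simp
  also have "\<dots> = complex_of_real (exp (- (t \<bullet> t) / 2))"
    by (simp add: inner_vec_def power2_eq_square flip: exp_sum of_real_prod)
      (simp add: sum_divide_distrib sum_negf)
  finally show ?thesis .
qed

text \<open>The Gaussian density is its own Fourier transform up to a constant. This takes the place
  of an inversion formula.\<close>

lemma mvn_density_fourier:
  "complex_of_real (mvn_density (u :: real^'k))
    = complex_of_real ((1 / sqrt (2 * pi)) ^ CARD('k)) * (\<integral>z. iexp (u \<bullet> z) \<partial>std_mvn)"
  using mchar_std_mvn[of u] by (simp add: mchar_def mvn_density_eq)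

text \<open>By Fubini, a Gaussian average of a measure is an integral of its characteristic function
  against a Gaussian weight. Pointwise convergence of characteristic functions thus passes to
  Gaussian averages.\<close>

lemma integral_mvn_density_fourier:
  fixes \<mu> :: "(real^'k) measure"
  assumes "prob_space \<mu>" and sets [measurable_cong]: "sets \<mu> = sets borel"
  shows "complex_of_real (\<integral>x. mvn_density ((y - x) /\<^sub>R \<sigma>) \<partial>\<mu>)
    = complex_of_real ((1 / sqrt (2 * pi)) ^ CARD('k))
      * (\<integral>z. iexp (y \<bullet> z / \<sigma>) * mchar \<mu> (- z /\<^sub>R \<sigma>) \<partial>std_mvn)"
proof -
  interpret M: prob_space \<mu> by fact
  interpret N: prob_space "std_mvn :: (real^'k) measure" by (rule prob_space_std_mvn)
  interpret MN: pair_prob_space \<mu> "std_mvn :: (real^'k) measure" ..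
  let ?c = "complex_of_real ((1 / sqrt (2 * pi)) ^ CARD('k))"
  have "complex_of_real (\<integral>x. mvn_density ((y - x) /\<^sub>R \<sigma>) \<partial>\<mu>)
      = (\<integral>x. complex_of_real (mvn_density ((y - x) /\<^sub>R \<sigma>)) \<partial>\<mu>)"
    by simp
  also have "\<dots> = ?c * (\<integral>x. (\<integral>z. iexp (((y - x) /\<^sub>R \<sigma>) \<bullet> z) \<partial>std_mvn) \<partial>\<mu>)"
    unfolding mvn_density_fourier by simp
  also have "(\<integral>x. (\<integral>z. iexp (((y - x) /\<^sub>R \<sigma>) \<bullet> z) \<partial>std_mvn) \<partial>\<mu>)
      = (\<integral>z. (\<integral>x. iexp (((y - x) /\<^sub>R \<sigma>) \<bullet> z) \<partial>\<mu>) \<partial>std_mvn)"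
  proof (rule MN.Fubini_integral[symmetric])
    show "integrable (\<mu> \<Otimes>\<^sub>M std_mvn) (\<lambda>(x, z). iexp (((y - x) /\<^sub>R \<sigma>) \<bullet> z))"
      by (rule MN.P.integrable_const_bound[where B = 1]) (auto simp: split_beta)
  qed
  also have "\<dots> = (\<integral>z. iexp (y \<bullet> z / \<sigma>) * mchar \<mu> (- z /\<^sub>R \<sigma>) \<partial>std_mvn)"
  proof (rule Bochner_Integration.integral_cong[OF refl])
    fix z :: "real^'k"
    have "iexp (((y - x) /\<^sub>R \<sigma>) \<bullet> z) = iexp (y \<bullet> z / \<sigma>) * iexp ((- z /\<^sub>R \<sigma>) \<bullet> x)" for x
      by (simp add: exp_add[symmetric] inner_diff_left algebra_simps inner_commute divide_inverse)
    then show "(\<integral>x. iexp (((y - x) /\<^sub>R \<sigma>) \<bullet> z) \<partial>\<mu>) = iexp (y \<bullet> z / \<sigma>) * mchar \<mu> (- z /\<^sub>R \<sigma>)"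
      by (simp add: mchar_def)
  qed
  finally show ?thesis .
qed

lemma gaussian_smoothing:
  fixes f :: "real^'k \<Rightarrow> real"
  assumes [measurable]: "f \<in> borel_measurable borel" and \<sigma>: "\<sigma> > 0"
  shows "(\<integral>z. f (x + \<sigma> *\<^sub>R z) \<partial>std_mvn)
    = (\<integral>y. f y * (mvn_density ((y - x) /\<^sub>R \<sigma>) / \<sigma> ^ CARD('k)) \<partial>lborel)"
proof -
  let ?T = "\<lambda>z. x + \<sigma> *\<^sub>R z"
  let ?g = "\<lambda>y. f y * (mvn_density ((y - x) /\<^sub>R \<sigma>) / \<sigma> ^ CARD('k))"
  have L: "(lborel :: (real^'k) measure)
      = density (distr lborel borel ?T) (\<lambda>_. ennreal (\<sigma> ^ CARD('k)))"
    using lborel_affine[of \<sigma> x] \<sigma> by simp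
  have "integral\<^sup>L lborel ?g
      = integral\<^sup>L (density (distr lborel borel ?T) (\<lambda>_. ennreal (\<sigma> ^ CARD('k)))) ?g"
    by (rule arg_cong[OF L])
  also have "\<dots> = (\<integral>y. \<sigma> ^ CARD('k) *\<^sub>R ?g y \<partial>distr lborel borel ?T)"
    using \<sigma> by (intro integral_density) auto
  also have "\<dots> = (\<integral>z. \<sigma> ^ CARD('k) *\<^sub>R ?g (?T z) \<partial>lborel)"
    by (rule integral_distr) auto
  also have "\<dots> = (\<integral>z. mvn_density z *\<^sub>R f (?T z) \<partial>lborel)"
    using \<sigma> by (intro Bochner_Integration.integral_cong) auto
  also have "\<dots> = (\<integral>z. f (?T z) \<partial>std_mvn)"
    by (rule integral_std_mvn[symmetric]) auto
  finally show ?thesis ..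
qed

lemma norm_mchar_le:
  assumes "prob_space \<mu>" and [measurable_cong]: "sets \<mu> = sets borel"
  shows "norm (mchar \<mu> t) \<le> 1"
proof -
  interpret M: prob_space \<mu> by fact
  have "norm (mchar \<mu> t) \<le> (\<integral>x. norm (iexp (t \<bullet> x)) \<partial>\<mu>)"
    unfolding mchar_def by (rule integral_norm_bound)
  then show ?thesis by (simp add: M.prob_space)
qed

lemma measurable_mchar [measurable]:
  assumes "prob_space \<mu>" and [measurable_cong]: "sets \<mu> = sets borel"
  shows "mchar \<mu> \<in> borel_measurable borel"
proof -
  interpret M: prob_space \<mu> by fact
  show ?thesis unfolding mchar_def by measurable
qed

text \<open>Characteristic functions have modulus at most 1, so dominated convergence under the
  finite Gaussian measure applies.\<close>

lemma gaussian_average_limit: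
  fixes \<mu> :: "nat \<Rightarrow> (real^'k) measure"
  assumes P: "\<And>n. prob_space (\<mu> n)" "\<And>n. sets (\<mu> n) = sets borel"
    and Q: "prob_space \<nu>" "sets \<nu> = sets borel"
    and lim: "\<And>t. (\<lambda>n. mchar (\<mu> n) t) \<longlonglongrightarrow> mchar \<nu> t"
  shows "(\<lambda>n. \<integral>x. mvn_density ((y - x) /\<^sub>R \<sigma>) \<partial>\<mu> n) \<longlonglongrightarrow> (\<integral>x. mvn_density ((y - x) /\<^sub>R \<sigma>) \<partial>\<nu>)"
proof -
  interpret N: prob_space "std_mvn :: (real^'k) measure" by (rule prob_space_std_mvn)
  note [measurable] = measurable_mchar[OF P] measurable_mchar[OF Q]
  have "(\<lambda>n. \<integral>z. iexp (y \<bullet> z / \<sigma>) * mchar (\<mu> n) (- z /\<^sub>R \<sigma>) \<partial>std_mvn)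
      \<longlonglongrightarrow> (\<integral>z. iexp (y \<bullet> z / \<sigma>) * mchar \<nu> (- z /\<^sub>R \<sigma>) \<partial>std_mvn)"
  proof (rule integral_dominated_convergence[where w = "\<lambda>_. 1"])
    show "AE z in std_mvn. (\<lambda>n. iexp (y \<bullet> z / \<sigma>) * mchar (\<mu> n) (- z /\<^sub>R \<sigma>))
        \<longlonglongrightarrow> iexp (y \<bullet> z / \<sigma>) * mchar \<nu> (- z /\<^sub>R \<sigma>)"
      by (auto intro!: tendsto_intros lim)
    show "AE z in std_mvn. norm (iexp (y \<bullet> z / \<sigma>) * mchar (\<mu> n) (- z /\<^sub>R \<sigma>)) \<le> 1" for n
      using norm_mchar_le[OF P] by (auto simp: norm_mult)
  qed auto
  then have "(\<lambda>n. complex_of_real (\<integral>x. mvn_density ((y - x) /\<^sub>R \<sigma>) \<partial>\<mu> n))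
      \<longlonglongrightarrow> complex_of_real (\<integral>x. mvn_density ((y - x) /\<^sub>R \<sigma>) \<partial>\<nu>)"
    unfolding integral_mvn_density_fourier[OF P] integral_mvn_density_fourier[OF Q]
    by (intro tendsto_intros)
  then show ?thesis by (simp only: tendsto_of_real_iff)
qed

text \<open>Smoothing is moved from the test function to the measure. Fubini requires
  \<open>f\<close> to be Lebesgue integrable, which is why compactly supported functions come
  first.\<close>

lemma smoothed_integral:
  fixes \<mu> :: "(real^'k) measure"
  assumes P: "prob_space \<mu>" and [measurable_cong]: "sets \<mu> = sets borel"
    and f [measurable]: "f \<in> borel_measurable borel" and fi: "integrable lborel f" and \<sigma>: "\<sigma> > 0"
  shows "(\<integral>x. (\<integral>z. f (x + \<sigma> *\<^sub>R z) \<partial>std_mvn) \<partial>\<mu>)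
    = (\<integral>y. f y / \<sigma> ^ CARD('k) * (\<integral>x. mvn_density ((y - x) /\<^sub>R \<sigma>) \<partial>\<mu>) \<partial>lborel)"
proof -
  interpret M: prob_space \<mu> by fact
  interpret LP: pair_sigma_finite \<mu> "lborel :: (real^'k) measure" ..
  let ?C = "(1 / sqrt (2 * pi)) ^ CARD('k)"
  let ?g = "\<lambda>x y. f y * (mvn_density ((y - x) /\<^sub>R \<sigma>) / \<sigma> ^ CARD('k))"
  have "(\<integral>x. (\<integral>z. f (x + \<sigma> *\<^sub>R z) \<partial>std_mvn) \<partial>\<mu>) = (\<integral>x. (\<integral>y. ?g x y \<partial>lborel) \<partial>\<mu>)"
    by (simp only: gaussian_smoothing[OF f \<sigma>])
  also have "\<dots> = (\<integral>y. (\<integral>x. ?g x y \<partial>\<mu>) \<partial>lborel)"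
  proof (rule LP.Fubini_integral[symmetric])
    have "integrable (\<mu> \<Otimes>\<^sub>M lborel) (\<lambda>(x, y). f y * (?C / \<sigma> ^ CARD('k)))"
    proof -
      have "integrable (\<mu> \<Otimes>\<^sub>M lborel) (\<lambda>p. (case p of (x, y) \<Rightarrow> f y) * (?C / \<sigma> ^ CARD('k)))"
      proof (rule integrable_mult_left, rule LP.Fubini_integrable)
        show "integrable \<mu> (\<lambda>x. \<integral>y. norm (case (x, y) of (x, y) \<Rightarrow> f y) \<partial>lborel)" by simp
        show "AE x in \<mu>. integrable lborel (\<lambda>y. case (x, y) of (x, y) \<Rightarrow> f y)" using fi by simp
      qed measurable
      then show ?thesis by (simp only: case_prod_unfold)
    qed
    then show "integrable (\<mu> \<Otimes>\<^sub>M lborel) (\<lambda>(x, y). ?g x y)"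
    proof (rule Bochner_Integration.integrable_bound)
      show "AE p in \<mu> \<Otimes>\<^sub>M lborel. norm (case p of (x, y) \<Rightarrow> ?g x y)
          \<le> norm (case p of (x, y) \<Rightarrow> f y * (?C / \<sigma> ^ CARD('k)))"
      proof (intro AE_I2)
        fix p :: "(real^'k) \<times> (real^'k)"
        have "\<bar>mvn_density (u :: real^'k)\<bar> \<le> ?C" for u
          by (simp add: mvn_density_nonneg mvn_density_le)
        then show "norm (case p of (x, y) \<Rightarrow> ?g x y)
            \<le> norm (case p of (x, y) \<Rightarrow> f y * (?C / \<sigma> ^ CARD('k)))"
          using \<sigma> by (auto simp: split_beta abs_mult intro!: mult_left_mono divide_right_mono)
      qed
    qed measurable
  qed
  also have "\<dots> = (\<integral>y. f y / \<sigma> ^ CARD('k) * (\<integral>x. mvn_density ((y - x) /\<^sub>R \<sigma>) \<partial>\<mu>) \<partial>lborel)"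
    by (intro Bochner_Integration.integral_cong) (auto simp: field_simps)
  finally show ?thesis .
qed

lemma smoothed_limit:
  fixes \<mu> :: "nat \<Rightarrow> (real^'k) measure" and f :: "real^'k \<Rightarrow> real"
  assumes P: "\<And>n. prob_space (\<mu> n)" "\<And>n. sets (\<mu> n) = sets borel"
    and Q: "prob_space \<nu>" "sets \<nu> = sets borel"
    and lim: "\<And>t. (\<lambda>n. mchar (\<mu> n) t) \<longlonglongrightarrow> mchar \<nu> t"
    and f [measurable]: "f \<in> borel_measurable borel" and fi: "integrable lborel f" and \<sigma>: "\<sigma> > 0"
  shows "(\<lambda>n. \<integral>x. (\<integral>z. f (x + \<sigma> *\<^sub>R z) \<partial>std_mvn) \<partial>\<mu> n)
    \<longlonglongrightarrow> (\<integral>x. (\<integral>z. f (x + \<sigma> *\<^sub>R z) \<partial>std_mvn) \<partial>\<nu>)"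
  unfolding smoothed_integral[OF P f fi \<sigma>] smoothed_integral[OF Q f fi \<sigma>]
proof (rule integral_dominated_convergence)
  let ?C = "(1 / sqrt (2 * pi)) ^ CARD('k)"
  have avg_meas: "(\<lambda>y. \<integral>x. mvn_density ((y - x) /\<^sub>R \<sigma>) \<partial>\<mu>') \<in> borel_measurable borel"
    if "prob_space \<mu>'" and [measurable_cong]: "sets \<mu>' = sets borel" for \<mu>' :: "(real^'k) measure"
  proof -
    interpret M: prob_space \<mu>' by fact
    show ?thesis by measurable
  qed
  note [measurable] = avg_meas[OF P] avg_meas[OF Q]
  show "integrable lborel (\<lambda>y. \<bar>f y\<bar> / \<sigma> ^ CARD('k) * ?C)" using fi by simp
  show "AE y in lborel. (\<lambda>n. f y / \<sigma> ^ CARD('k) * (\<integral>x. mvn_density ((y - x) /\<^sub>R \<sigma>) \<partial>\<mu> n))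
      \<longlonglongrightarrow> f y / \<sigma> ^ CARD('k) * (\<integral>x. mvn_density ((y - x) /\<^sub>R \<sigma>) \<partial>\<nu>)"
    by (intro AE_I2 tendsto_intros gaussian_average_limit P Q lim)
  show "AE y in lborel. norm (f y / \<sigma> ^ CARD('k) * (\<integral>x. mvn_density ((y - x) /\<^sub>R \<sigma>) \<partial>\<mu> n))
      \<le> \<bar>f y\<bar> / \<sigma> ^ CARD('k) * ?C" for n
  proof (intro AE_I2)
    fix y :: "real^'k"
    interpret M: prob_space "\<mu> n" by (rule P)
    note [measurable_cong] = P(2)
    have i: "integrable (\<mu> n) (\<lambda>x. mvn_density ((y - x) /\<^sub>R \<sigma>))"
      by (rule M.integrable_const_bound[where B = ?C])
        (auto simp: mvn_density_nonneg mvn_density_le)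
    have "(\<integral>x. mvn_density ((y - x) /\<^sub>R \<sigma>) \<partial>\<mu> n) \<le> (\<integral>x. ?C \<partial>\<mu> n)"
      by (rule integral_mono[OF i]) (auto simp: mvn_density_le)
    then have "(\<integral>x. mvn_density ((y - x) /\<^sub>R \<sigma>) \<partial>\<mu> n) \<le> ?C" by (simp add: M.prob_space)
    moreover have "0 \<le> (\<integral>x. mvn_density ((y - x) /\<^sub>R \<sigma>) \<partial>\<mu> n)"
      by (rule integral_nonneg_AE) (simp add: mvn_density_nonneg)
    ultimately show "norm (f y / \<sigma> ^ CARD('k) * (\<integral>x. mvn_density ((y - x) /\<^sub>R \<sigma>) \<partial>\<mu> n))
        \<le> \<bar>f y\<bar> / \<sigma> ^ CARD('k) * ?C"
      unfolding real_norm_def abs_mult abs_divide using \<sigma>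
      by (intro mult_mono) auto
  qed
  show "(\<lambda>y. f y / \<sigma> ^ CARD('k) * (\<integral>x. mvn_density ((y - x) /\<^sub>R \<sigma>) \<partial>\<nu>)) \<in> borel_measurable lborel"
    by measurable
  show "(\<lambda>y. f y / \<sigma> ^ CARD('k) * (\<integral>x. mvn_density ((y - x) /\<^sub>R \<sigma>) \<partial>\<mu> n)) \<in> borel_measurable lborel" for n
    by measurable
qed

lemma std_mvn_tail:
  assumes "\<epsilon> > 0"
  shows "\<exists>R>0. measure (std_mvn :: (real^'k) measure) {z. R \<le> norm z} < \<epsilon>"
proof -
  interpret N: prob_space "std_mvn :: (real^'k) measure" by (rule prob_space_std_mvn)
  have "(\<lambda>i. N.prob {z. real i \<le> norm z}) \<longlonglongrightarrow> N.prob (\<Inter>i. {z. real i \<le> norm z})"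
    by (rule N.finite_Lim_measure_decseq) (auto simp: decseq_def)
  moreover have "(\<Inter>i. {z :: real^'k. real i \<le> norm z}) = {}"
  proof -
    have "\<exists>i. \<not> real i \<le> norm z" for z :: "real^'k"
      using reals_Archimedean2[of "norm z"] by (auto simp: not_le)
    then show ?thesis by auto
  qed
  ultimately have "(\<lambda>i. N.prob {z. real i \<le> norm z}) \<longlonglongrightarrow> 0" by simp
  then have "\<forall>\<^sub>F i in sequentially. N.prob {z. real i \<le> norm z} < \<epsilon>"
    using assms by (rule order_tendstoD)
  then obtain i where i: "\<And>j. j \<ge> i \<Longrightarrow> N.prob {z. real j \<le> norm z} < \<epsilon>"
    by (auto simp: eventually_sequentially)
  show ?thesis by (rule exI[of _ "real (Suc i)"]) (use i[of "Suc i"] in auto)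
qed

lemma smoothing_error:
  fixes f :: "real^'k \<Rightarrow> real"
  assumes uc: "uniformly_continuous_on UNIV f" and B: "\<And>x. \<bar>f x\<bar> \<le> B" and \<epsilon>: "\<epsilon> > 0"
  shows "\<exists>\<sigma>>0. \<forall>x. \<bar>(\<integral>z. f (x + \<sigma> *\<^sub>R z) \<partial>std_mvn) - f x\<bar> \<le> \<epsilon>"
proof -
  interpret N: prob_space "std_mvn :: (real^'k) measure" by (rule prob_space_std_mvn)
  have B0: "B \<ge> 0" using B[of 0] by linarith
  obtain d where d: "d > 0" "\<And>x y. dist x y < d \<Longrightarrow> dist (f x) (f y) < \<epsilon> / 2"
    using uc \<epsilon> unfolding uniformly_continuous_on_def by (metis UNIV_I half_gt_zero)
  obtain R where R: "R > 0" "N.prob {z. R \<le> norm z} < \<epsilon> / (4 * (B + 1))"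
    using std_mvn_tail[of "\<epsilon> / (4 * (B + 1))"] \<epsilon> B0 by auto
  \<comment> \<open>With this scale, points \<open>z\<close> of norm below \<open>R\<close> move the
    argument by less than \<open>d\<close>.\<close>
  define \<sigma> where "\<sigma> = d / R"
  have \<sigma>: "\<sigma> > 0" using d R by (simp add: \<sigma>_def)
  have fm [measurable]: "f \<in> borel_measurable borel"
    using uc by (intro borel_measurable_continuous_onI uniformly_continuous_imp_continuous)
  have fi: "integrable std_mvn (\<lambda>z. f (x + \<sigma> *\<^sub>R z))" for x
    by (rule N.integrable_const_bound[where B = B]) (use B in auto)
  have "\<bar>(\<integral>z. f (x + \<sigma> *\<^sub>R z) \<partial>std_mvn) - f x\<bar> \<le> \<epsilon>" for x
  proof -
    let ?I = "indicator {z :: real^'k. R \<le> norm z} :: _ \<Rightarrow> real"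
    have "(\<integral>z. f (x + \<sigma> *\<^sub>R z) \<partial>std_mvn) - f x = (\<integral>z. f (x + \<sigma> *\<^sub>R z) - f x \<partial>std_mvn)"
      using fi N.prob_space by simp
    also have "\<bar>\<dots>\<bar> \<le> (\<integral>z. \<bar>f (x + \<sigma> *\<^sub>R z) - f x\<bar> \<partial>std_mvn)" by (rule integral_abs_bound)
    also have "\<dots> \<le> (\<integral>z. \<epsilon> / 2 + 2 * B * ?I z \<partial>std_mvn)"
    proof (rule integral_mono)
      show "integrable std_mvn (\<lambda>z. \<bar>f (x + \<sigma> *\<^sub>R z) - f x\<bar>)" using fi by simp
      show "integrable std_mvn (\<lambda>z. \<epsilon> / 2 + 2 * B * ?I z)"
        by (rule N.integrable_const_bound[where B = "\<epsilon> / 2 + 2 * B"])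
          (use \<epsilon> B0 in \<open>auto simp: indicator_def\<close>)
      fix z :: "real^'k"
      show "\<bar>f (x + \<sigma> *\<^sub>R z) - f x\<bar> \<le> \<epsilon> / 2 + 2 * B * ?I z"
      proof (cases "R \<le> norm z")
        case True
        then show ?thesis using B[of x] B[of "x + \<sigma> *\<^sub>R z"] \<epsilon> by simp
      next
        case False
        then have "\<sigma> * norm z < \<sigma> * R" using \<sigma> by simp
        then have "dist (x + \<sigma> *\<^sub>R z) x < d" using R d \<sigma> by (simp add: dist_norm \<sigma>_def)
        then show ?thesis using d(2)[of "x + \<sigma> *\<^sub>R z" x] False by (simp add: dist_real_def)
      qed
    qed
    also have "\<dots> = \<epsilon> / 2 + 2 * B * N.prob {z. R \<le> norm z}"
    proof -
      have "integrable std_mvn ?I"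
        by (rule N.integrable_const_bound[where B = 1]) (auto simp: indicator_def)
      then show ?thesis using N.prob_space by simp
    qed
    also have "\<dots> \<le> \<epsilon> / 2 + 2 * B * (\<epsilon> / (4 * (B + 1)))"
      using R B0 by (intro add_left_mono mult_left_mono) auto
    also have "2 * B * (\<epsilon> / (4 * (B + 1))) \<le> \<epsilon> / 2" using B0 \<epsilon> by (simp add: field_simps)
    finally show ?thesis by simp
  qed
  then show ?thesis using \<sigma> by blast
qed

text \<open>A continuous function of compact support is bounded, Lebesgue integrable and uniformly
  continuous. Hence smoothing changes its integral by little, uniformly over all probability
  measures, and the smoothed integrals converge.\<close>

lemma levy_compact_support:
  fixes \<mu> :: "nat \<Rightarrow> (real^'k) measure" and f :: "real^'k \<Rightarrow> real"
  assumes P: "\<And>n. prob_space (\<mu> n)" "\<And>n. sets (\<mu> n) = sets borel"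
    and Q: "prob_space \<nu>" "sets \<nu> = sets borel"
    and lim: "\<And>t. (\<lambda>n. mchar (\<mu> n) t) \<longlonglongrightarrow> mchar \<nu> t"
    and f: "continuous_on UNIV f" and supp: "\<And>x. norm x > R \<Longrightarrow> f x = 0"
  shows "(\<lambda>n. \<integral>x. f x \<partial>\<mu> n) \<longlonglongrightarrow> (\<integral>x. f x \<partial>\<nu>)"
proof (rule LIMSEQ_I)
  fix \<epsilon> :: real assume \<epsilon>: "\<epsilon> > 0"
  have fm [measurable]: "f \<in> borel_measurable borel" by (rule borel_measurable_continuous_onI[OF f])
  have "compact (f ` cball 0 R)" using f by (intro compact_continuous_image) (auto intro: continuous_on_subset)
  then obtain B0 where B0: "\<forall>x\<in>cball 0 R. \<bar>f x\<bar> \<le> B0"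
    by (auto dest!: compact_imp_bounded simp: bounded_iff)
  \<comment> \<open>For negative \<open>R\<close> the ball is empty and \<open>B0\<close> can be any
    number; hence the maximum with 0.\<close>
  define B where "B = max B0 0"
  have B: "\<bar>f x\<bar> \<le> B" for x
    using B0 supp[of x] by (cases "norm x > R") (auto simp: B_def max.coboundedI1)
  have fi: "integrable lborel f"
  proof (rule Bochner_Integration.integrable_bound)
    show "integrable lborel (\<lambda>x. B * indicator (cball (0 :: real^'k) R) x)"
      using emeasure_lborel_cball_finite[of "0 :: real^'k" R] by simp
    show "AE x in lborel. norm (f x) \<le> norm (B * indicator (cball (0 :: real^'k) R) x)"
      using B supp by (intro AE_I2) (auto simp: indicator_def B_def)
  qed measurable
  have uc: "uniformly_continuous_on UNIV f"
  proof -
    \<comment> \<open>One unit of margin: two points at distance below 1 lie either both in the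
      larger ball or both where \<open>f\<close> vanishes.\<close>
    have "uniformly_continuous_on (cball 0 (R + 1)) f"
      using f by (intro compact_uniformly_continuous) (auto intro: continuous_on_subset)
    then have *: "\<exists>d>0. \<forall>x\<in>cball 0 (R + 1). \<forall>y\<in>cball 0 (R + 1). dist y x < d \<longrightarrow> dist (f y) (f x) < e"
      if "e > 0" for e
      using that unfolding uniformly_continuous_on_def by blast
    show ?thesis unfolding uniformly_continuous_on_def
    proof (intro allI impI)
      fix e :: real assume e: "e > 0"
      from *[OF e] obtain d where d: "d > 0" "\<And>x y. norm x \<le> R + 1 \<Longrightarrow> norm y \<le> R + 1 \<Longrightarrow>
        dist y x < d \<Longrightarrow> dist (f y) (f x) < e" by auto
      have "dist (f y) (f x) < e" if "dist y x < min d 1" for x y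
      proof (cases "norm x \<le> R + 1 \<and> norm y \<le> R + 1")
        case True
        then show ?thesis using d(2)[of x y] that by simp
      next
        case False
        have "\<bar>norm y - norm x\<bar> \<le> norm (y - x)" by (rule norm_triangle_ineq3)
        then have "norm x > R" "norm y > R" using False that by (auto simp: dist_norm)
        then show ?thesis using e supp by simp
      qed
      then show "\<exists>d>0. \<forall>x\<in>UNIV. \<forall>x'\<in>UNIV. dist x' x < d \<longrightarrow> dist (f x') (f x) < e"
        using d(1) by (intro exI[of _ "min d 1"]) auto
    qed
  qed
  obtain \<sigma> where \<sigma>: "\<sigma> > 0" "\<And>x. \<bar>(\<integral>z. f (x + \<sigma> *\<^sub>R z) \<partial>std_mvn) - f x\<bar> \<le> \<epsilon> / 4"
    using smoothing_error[OF uc B, of "\<epsilon> / 4"] \<epsilon> by auto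
  let ?g = "\<lambda>x. \<integral>z. f (x + \<sigma> *\<^sub>R z) \<partial>std_mvn"
  interpret N: prob_space "std_mvn :: (real^'k) measure" by (rule prob_space_std_mvn)
  have gm [measurable]: "?g \<in> borel_measurable borel" by measurable
  have near: "\<bar>(\<integral>x. ?g x \<partial>\<mu>') - (\<integral>x. f x \<partial>\<mu>')\<bar> \<le> \<epsilon> / 4"
    if "prob_space \<mu>'" and [measurable_cong]: "sets \<mu>' = sets borel" for \<mu>' :: "(real^'k) measure"
  proof -
    interpret M: prob_space \<mu>' by fact
    have i1: "integrable \<mu>' f" by (rule M.integrable_const_bound[where B = B]) (use B in auto)
    have i2: "integrable \<mu>' ?g"
    proof (rule M.integrable_const_bound[where B = "B + \<epsilon> / 4"])
      have "\<bar>?g x\<bar> \<le> B + \<epsilon> / 4" for x using \<sigma>(2)[of x] B[of x] by linarith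
      then show "AE x in \<mu>'. norm (?g x) \<le> B + \<epsilon> / 4" by simp
    qed measurable
    have "(\<integral>x. ?g x \<partial>\<mu>') - (\<integral>x. f x \<partial>\<mu>') = (\<integral>x. ?g x - f x \<partial>\<mu>')"
      using i1 i2 by simp
    also have "\<bar>\<dots>\<bar> \<le> (\<integral>x. \<bar>?g x - f x\<bar> \<partial>\<mu>')" by (rule integral_abs_bound)
    also have "\<dots> \<le> (\<integral>x. \<epsilon> / 4 \<partial>\<mu>')"
      using i1 i2 \<sigma>(2) by (intro integral_mono) auto
    finally show ?thesis by (simp add: M.prob_space)
  qed
  have "(\<lambda>n. \<integral>x. ?g x \<partial>\<mu> n) \<longlonglongrightarrow> (\<integral>x. ?g x \<partial>\<nu>)"
    by (rule smoothed_limit[OF P Q lim fm fi \<sigma>(1)])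
  from LIMSEQ_D[OF this, of "\<epsilon> / 4"] \<epsilon> obtain n0 where
    n0: "\<And>n. n \<ge> n0 \<Longrightarrow> norm ((\<integral>x. ?g x \<partial>\<mu> n) - (\<integral>x. ?g x \<partial>\<nu>)) < \<epsilon> / 4" by auto
  have "norm ((\<integral>x. f x \<partial>\<mu> n) - (\<integral>x. f x \<partial>\<nu>)) < \<epsilon>" if "n \<ge> n0" for n
    using n0[OF that] near[OF P, of n] near[OF Q] \<epsilon> unfolding real_norm_def by linarith
  then show "\<exists>n0. \<forall>n\<ge>n0. norm ((\<integral>x. f x \<partial>\<mu> n) - (\<integral>x. f x \<partial>\<nu>)) < \<epsilon>" by blast
qed

text \<open>A cutoff \<open>c\<close> reduces the claim to compact support. Tightness comes from the
  same source: \<open>c\<close> is itself a compactly supported test function, so the mass it misses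
  under \<open>\<mu> n\<close> is eventually comparable to that under the limit.\<close>

theorem levy_continuity_vec:
  fixes \<mu> :: "nat \<Rightarrow> (real^'k) measure" and f :: "real^'k \<Rightarrow> real"
  assumes P: "\<And>n. prob_space (\<mu> n)" "\<And>n. sets (\<mu> n) = sets borel"
    and lim: "\<And>t. (\<lambda>n. mchar (\<mu> n) t) \<longlonglongrightarrow> mchar std_mvn t"
    and f: "continuous_on UNIV f" and B: "\<And>x. \<bar>f x\<bar> \<le> B"
  shows "(\<lambda>n. \<integral>x. f x \<partial>\<mu> n) \<longlonglongrightarrow> (\<integral>x. f x \<partial>std_mvn)"
proof (rule LIMSEQ_I)
  fix \<epsilon> :: real assume \<epsilon>: "\<epsilon> > 0"
  interpret N: prob_space "std_mvn :: (real^'k) measure" by (rule prob_space_std_mvn)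
  have B0: "B \<ge> 0" using B[of 0] by linarith
  have fm [measurable]: "f \<in> borel_measurable borel" by (rule borel_measurable_continuous_onI[OF f])
  define \<delta> where "\<delta> = \<epsilon> / (6 * (B + 1))"
  have \<delta>: "\<delta> > 0" using \<epsilon> B0 by (simp add: \<delta>_def)
  obtain R where R: "N.prob {z. R \<le> norm z} < \<delta>" using std_mvn_tail[OF \<delta>] by auto
  define c where "c x = max 0 (min 1 (R + 1 - norm x))" for x :: "real^'k"
  have c: "0 \<le> c x" "c x \<le> 1" for x by (auto simp: c_def)
  have c_supp: "c x = 0" if "norm x > R + 1" for x using that by (simp add: c_def)
  have c_cont: "continuous_on UNIV c" unfolding c_def[abs_def]
    by (intro continuous_on_max continuous_on_min continuous_intros)
  have cm [measurable]: "c \<in> borel_measurable borel" by (rule borel_measurable_continuous_onI[OF c_cont])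
  have l1: "(\<lambda>n. \<integral>x. f x * c x \<partial>\<mu> n) \<longlonglongrightarrow> (\<integral>x. f x * c x \<partial>std_mvn)"
    by (rule levy_compact_support[OF P prob_space_std_mvn sets_std_mvn lim, where R = "R + 1"])
      (auto intro!: continuous_intros f c_cont c_supp)
  have l2: "(\<lambda>n. \<integral>x. c x \<partial>\<mu> n) \<longlonglongrightarrow> (\<integral>x. c x \<partial>std_mvn)"
    by (rule levy_compact_support[OF P prob_space_std_mvn sets_std_mvn lim, where R = "R + 1"])
      (auto intro!: c_cont c_supp)
  have split: "\<bar>(\<integral>x. f x \<partial>\<mu>') - (\<integral>x. f x * c x \<partial>\<mu>')\<bar> \<le> B * (1 - (\<integral>x. c x \<partial>\<mu>'))"
    if "prob_space \<mu>'" and [measurable_cong]: "sets \<mu>' = sets borel" for \<mu>' :: "(real^'k) measure"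
  proof -
    interpret M: prob_space \<mu>' by fact
    have i1: "integrable \<mu>' f" by (rule M.integrable_const_bound[where B = B]) (use B in auto)
    have i2: "integrable \<mu>' c" by (rule M.integrable_const_bound[where B = 1]) (use c in auto)
    have i3: "integrable \<mu>' (\<lambda>x. f x * c x)"
      by (rule M.integrable_const_bound[where B = B])
        (use B B0 c in \<open>auto simp: abs_mult intro!: AE_I2 mult_mono[where b = B and d = 1, simplified]\<close>)
    have "(\<integral>x. f x \<partial>\<mu>') - (\<integral>x. f x * c x \<partial>\<mu>') = (\<integral>x. f x - f x * c x \<partial>\<mu>')"
      using i1 i3 by simp
    also have "\<bar>\<dots>\<bar> \<le> (\<integral>x. \<bar>f x - f x * c x\<bar> \<partial>\<mu>')" by (rule integral_abs_bound)
    also have "\<dots> \<le> (\<integral>x. B * (1 - c x) \<partial>\<mu>')"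
    proof (rule integral_mono)
      fix x
      have "\<bar>f x - f x * c x\<bar> = \<bar>f x\<bar> * (1 - c x)"
        using c[of x] by (simp add: right_diff_distrib[symmetric, of "f x" 1 "c x", simplified] abs_mult)
      then show "\<bar>f x - f x * c x\<bar> \<le> B * (1 - c x)"
        using B[of x] c[of x] by (simp add: mult_right_mono)
    qed (use i1 i2 i3 in auto)
    also have "\<dots> = B * (1 - (\<integral>x. c x \<partial>\<mu>'))" using i2 by (simp add: M.prob_space)
    finally show ?thesis .
  qed
  have cN: "1 - (\<integral>x. c x \<partial>std_mvn) < \<delta>"
  proof -
    have ci: "integrable std_mvn c" by (rule N.integrable_const_bound[where B = 1]) (use c in auto)
    have "1 - (\<integral>x. c x \<partial>std_mvn) = (\<integral>x. 1 - c x \<partial>std_mvn)" using ci N.prob_space by simp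
    also have "\<dots> \<le> (\<integral>x. indicator {z :: real^'k. R \<le> norm z} x \<partial>std_mvn)"
    proof (rule integral_mono)
      show "1 - c x \<le> indicator {z. R \<le> norm z} x" for x
        using c[of x] by (auto simp: indicator_def c_def)
      show "integrable std_mvn (indicator {z :: real^'k. R \<le> norm z} :: _ \<Rightarrow> real)"
        by (rule N.integrable_const_bound[where B = 1]) (auto simp: indicator_def)
    qed (use ci in auto)
    also have "\<dots> < \<delta>" using R by simp
    finally show ?thesis .
  qed
  from LIMSEQ_D[OF l1, of \<delta>] LIMSEQ_D[OF l2, of \<delta>] \<delta> obtain n1 n2 where
    n1: "\<And>n. n \<ge> n1 \<Longrightarrow> norm ((\<integral>x. f x * c x \<partial>\<mu> n) - (\<integral>x. f x * c x \<partial>std_mvn)) < \<delta>" and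
    n2: "\<And>n. n \<ge> n2 \<Longrightarrow> norm ((\<integral>x. c x \<partial>\<mu> n) - (\<integral>x. c x \<partial>std_mvn)) < \<delta>" by auto
  have "norm ((\<integral>x. f x \<partial>\<mu> n) - (\<integral>x. f x \<partial>std_mvn)) < \<epsilon>" if n: "n \<ge> max n1 n2" for n
  proof -
    have "1 - (\<integral>x. c x \<partial>\<mu> n) \<le> 2 * \<delta>" using n2[of n] n cN by (auto simp: abs_less_iff)
    then have "B * (1 - (\<integral>x. c x \<partial>\<mu> n)) \<le> B * (2 * \<delta>)" using B0 by (rule mult_left_mono)
    moreover have "B * (1 - (\<integral>x. c x \<partial>std_mvn)) \<le> B * \<delta>"
      using cN B0 by (intro mult_left_mono) auto
    ultimately have "\<bar>(\<integral>x. f x \<partial>\<mu> n) - (\<integral>x. f x \<partial>std_mvn)\<bar> \<le> B * (2 * \<delta>) + \<delta> + B * \<delta>"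
      using split[OF P, of n] split[OF prob_space_std_mvn sets_std_mvn] n1[of n] n
      unfolding real_norm_def by simp
    also have "\<dots> = (3 * B + 1) * \<delta>" by (simp add: algebra_simps)
    also have "\<dots> < (6 * (B + 1)) * \<delta>" using B0 \<delta> by (intro mult_strict_right_mono) auto
    also have "\<dots> = \<epsilon>" using B0 by (simp add: \<delta>_def)
    finally show ?thesis by simp
  qed
  then show "\<exists>n0. \<forall>n\<ge>n0. norm ((\<integral>x. f x \<partial>\<mu> n) - (\<integral>x. f x \<partial>std_mvn)) < \<epsilon>" by blast
qed

section \<open>Square roots of positive definite matrices\<close>

text \<open>The norm of a symmetric operator is bounded by its quadratic form: polarization of the
  form at \<open>x\<close> and at \<open>B x\<close> rescaled to the length of \<open>x\<close>
  recovers \<open>norm (B x)\<close>.\<close>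

lemma symmetric_form_bound:
  fixes B :: "'a::real_inner \<Rightarrow>\<^sub>L 'a"
  assumes sym: "\<And>x y. x \<bullet> B y = B x \<bullet> y" and r: "\<And>x. \<bar>x \<bullet> B x\<bar> \<le> r * (x \<bullet> x)"
    and r0: "0 \<le> r"
  shows "norm B \<le> r"
proof (rule norm_blinfun_bound[OF r0])
  show "norm (B x) \<le> r * norm x" for x
  proof (cases "B x = 0 \<or> x = 0")
    case True
    then show ?thesis using r0 by (auto simp: blinfun.zero_right)
  next
    case False
    define s where "s = norm x / norm (B x)"
    define y where "y = s *\<^sub>R B x"
    have ny: "norm y = norm x" using False by (simp add: y_def s_def)
    have "4 * (y \<bullet> B x) = (x + y) \<bullet> B (x + y) - (x - y) \<bullet> B (x - y)"
      using sym[of x y] by (simp add: blinfun.add_right blinfun.diff_right inner_add_left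
          inner_add_right inner_diff_left inner_diff_right inner_commute)
    also have "\<dots> \<le> r * ((x + y) \<bullet> (x + y)) + r * ((x - y) \<bullet> (x - y))"
      using r[of "x + y"] r[of "x - y"] by linarith
    also have "\<dots> = 2 * r * (x \<bullet> x + y \<bullet> y)"
      by (simp add: inner_add_left inner_add_right inner_diff_left inner_diff_right inner_commute
          algebra_simps)
    also have "\<dots> = 4 * r * (norm x)\<^sup>2" using ny by (simp add: power2_norm_eq_inner[symmetric])
    finally have "y \<bullet> B x \<le> r * (norm x)\<^sup>2" by simp
    moreover have "y \<bullet> B x = norm x * norm (B x)"
      using False by (simp add: y_def s_def power2_norm_eq_inner[symmetric] power2_eq_square)
    ultimately have "norm x * norm (B x) \<le> norm x * (r * norm x)"
      by (simp add: power2_eq_square mult_ac)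
    then show ?thesis using False by simp
  qed
qed

lemma pos_def_symmetric: "pos_def A \<Longrightarrow> x \<bullet> (A *v y) = (A *v x) \<bullet> y"
  unfolding pos_def_def by (metis dot_lmul_matrix vector_transpose_matrix)

lemma pos_def_lower_bound:
  fixes A :: "real^'k^'k"
  assumes A: "pos_def A"
  shows "\<exists>l>0. \<forall>x. l * (x \<bullet> x) \<le> x \<bullet> (A *v x)"
proof -
  let ?S = "sphere (0 :: real^'k) 1"
  have "continuous_on ?S (\<lambda>x. x \<bullet> (A *v x))"
    by (intro continuous_intros matrix_vector_mult_linear_continuous_on)
  moreover have "axis undefined 1 \<in> ?S" by (simp add: norm_axis_1)
  ultimately obtain e where e: "e \<in> ?S" "\<And>x. x \<in> ?S \<Longrightarrow> e \<bullet> (A *v e) \<le> x \<bullet> (A *v x)"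
    using continuous_attains_inf[of ?S "\<lambda>x. x \<bullet> (A *v x)"] by (metis compact_sphere empty_iff)
  define l where "l = e \<bullet> (A *v e)"
  have "e \<noteq> 0" using e(1) by auto
  then have "l > 0" using A by (auto simp: pos_def_def l_def)
  moreover have "l * (x \<bullet> x) \<le> x \<bullet> (A *v x)" for x
  proof (cases "x = 0")
    case False
    then have "l \<le> (x /\<^sub>R norm x) \<bullet> (A *v (x /\<^sub>R norm x))"
      unfolding l_def by (intro e(2)) simp
    also have "\<dots> = x \<bullet> (A *v x) / (norm x)\<^sup>2"
      by (simp add: matrix_vector_mult_scaleR power2_eq_square divide_inverse)
    finally show ?thesis using False by (simp add: pos_le_divide_eq power2_norm_eq_inner)
  qed simp
  ultimately show ?thesis by blast
qed

text \<open>With \<open>A = c (I - B)\<close> and \<open>\<parallel>B\<parallel> \<le> r < 1\<close>, the square root is \<open>\<surd>c (I - Y)\<close> for the fixed point \<open>Y\<close>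
  of the contraction \<open>Y \<mapsto> (B + Y\<^sup>2) / 2\<close>.\<close>

lemma pos_def_square_root:
  fixes A :: "real^'k^'k"
  assumes A: "pos_def A"
  shows "\<exists>R. pos_def R \<and> R ** R = A"
proof -
  obtain l where l: "l > 0" "\<And>x. l * (x \<bullet> x) \<le> x \<bullet> (A *v x)"
    using pos_def_lower_bound[OF A] by blast
  define T where "T = Blinfun (\<lambda>x. A *v x)"
  have T: "T x = A *v x" for x
    by (simp add: T_def bounded_linear_Blinfun_apply matrix_vector_mul_bounded_linear)
  \<comment> \<open>\<open>norm T\<close> bounds the form of \<open>A\<close> from above; adding
    \<open>l\<close> keeps \<open>c\<close> positive and \<open>r\<close> nonnegative. The form of
    \<open>B\<close> then lies between 0 and \<open>r\<close>.\<close>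
  define c where "c = norm T + l"
  have c: "c > 0" using l(1) norm_ge_zero[of T] unfolding c_def by linarith
  define B where "B = id_blinfun - T /\<^sub>R c"
  define r where "r = 1 - l / c"
  have r: "0 \<le> r" "r < 1" using c l(1) by (auto simp: r_def c_def field_simps)
  have B: "B x = x - (A *v x) /\<^sub>R c" for x
    by (simp add: B_def blinfun.diff_left blinfun.scaleR_left T)
  have B_sym: "x \<bullet> B y = B x \<bullet> y" for x y
    by (simp add: B inner_diff_left inner_diff_right pos_def_symmetric[OF A])
  have B_form: "\<bar>x \<bullet> B x\<bar> \<le> r * (x \<bullet> x)" for x
  proof -
    have "x \<bullet> (A *v x) \<le> norm x * norm (T x)" unfolding T by (rule norm_cauchy_schwarz)
    also have "\<dots> \<le> norm x * (norm T * norm x)" by (intro mult_left_mono norm_blinfun) auto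
    also have "\<dots> \<le> c * (x \<bullet> x)"
      using l(1) by (simp add: c_def power2_norm_eq_inner[symmetric] power2_eq_square algebra_simps)
    finally have "(x \<bullet> (A *v x)) / c \<le> x \<bullet> x" using c by (simp add: pos_divide_le_eq mult.commute)
    moreover have "l * (x \<bullet> x) / c \<le> (x \<bullet> (A *v x)) / c" using l(2) c by (intro divide_right_mono) auto
    ultimately show ?thesis
      by (simp add: B inner_diff_right r_def divide_inverse algebra_simps)
  qed
  have nB: "norm B \<le> r" by (rule symmetric_form_bound[OF B_sym B_form r(1)])
  \<comment> \<open>Symmetry is part of the set, which is closed, so that the fixed point inherits
    it. The radius is preserved as \<open>(r + r^2) / 2 \<le> r\<close>.\<close>
  define S where "S = {Y :: (real^'k) \<Rightarrow>\<^sub>L (real^'k). norm Y \<le> r \<and> (\<forall>x y. x \<bullet> blinfun_apply Y y = blinfun_apply Y x \<bullet> y)}"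
  define f where "f Y = (1/2) *\<^sub>R (B + (Y o\<^sub>L Y))" for Y
  have "closed S"
  proof -
    have eq: "S = {Y. norm Y \<le> r} \<inter> (\<Inter>x. \<Inter>y. {Y. x \<bullet> blinfun_apply Y y = blinfun_apply Y x \<bullet> y})" by (auto simp: S_def)
    show ?thesis unfolding eq
      by (intro closed_Int closed_INT ballI closed_Collect_le closed_Collect_eq continuous_intros)
  qed
  then have "\<exists>!Y. Y \<in> S \<and> f Y = Y"
  proof (rule Banach_fix[of S r f, OF complete_eq_closed[THEN iffD2]])
    show "S \<noteq> {}" using r(1) by (auto simp: S_def intro!: exI[of _ 0])
    show "f ` S \<subseteq> S"
    proof clarify
      fix Y assume Y: "Y \<in> S"
      have "norm (Y o\<^sub>L Y) \<le> r * r"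
        using Y r(1) by (intro order_trans[OF norm_blinfun_compose] mult_mono) (auto simp: S_def)
      also have "\<dots> \<le> r" using r by (simp add: mult_left_le)
      finally have "norm (B + (Y o\<^sub>L Y)) \<le> 2 * r" using nB norm_triangle_ineq[of B "Y o\<^sub>L Y"] by linarith
      moreover have "x \<bullet> f Y y = f Y x \<bullet> y" for x y
        using Y B_sym[of x y] by (simp add: f_def S_def blinfun.add_left blinfun.scaleR_left
            inner_add_left inner_add_right)
      ultimately show "f Y \<in> S" by (simp add: S_def f_def)
    qed
    show "dist (f Y) (f Y') \<le> r * dist Y Y'" if "Y \<in> S" "Y' \<in> S" for Y Y'
    proof -
      have "f Y - f Y' = (1/2) *\<^sub>R ((Y o\<^sub>L (Y - Y')) + ((Y - Y') o\<^sub>L Y'))"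
        by (rule blinfun_eqI) (simp add: f_def blinfun.bilinear_simps algebra_simps)
      then have "norm (f Y - f Y') \<le> (1/2) * (norm (Y o\<^sub>L (Y - Y')) + norm ((Y - Y') o\<^sub>L Y'))"
        using norm_triangle_ineq[of "Y o\<^sub>L (Y - Y')" "(Y - Y') o\<^sub>L Y'"] by simp
      also have "\<dots> \<le> (1/2) * (norm Y * norm (Y - Y') + norm (Y - Y') * norm Y')"
        by (intro mult_left_mono add_mono norm_blinfun_compose) auto
      also have "\<dots> \<le> (1/2) * (r * norm (Y - Y') + norm (Y - Y') * r)"
        using that by (intro mult_left_mono add_mono mult_right_mono mult_left_mono) (auto simp: S_def)
      finally show ?thesis by (simp add: dist_norm mult.commute)
    qed
  qed (use r in auto)
  then obtain Y where Y: "norm Y \<le> r" "\<And>x y. x \<bullet> blinfun_apply Y y = blinfun_apply Y x \<bullet> y"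
      "f Y = Y"
    by (auto simp: S_def)
  \<comment> \<open>The fixed point equation in the form \<open>(I - Y)^2 = I - B\<close>.\<close>
  have YY: "Y (Y x) = 2 *\<^sub>R Y x - B x" for x
  proof -
    have "Y x = (1/2) *\<^sub>R (B x + Y (Y x))"
      using arg_cong[OF Y(3), of "\<lambda>Y. blinfun_apply Y x"]
      by (simp add: f_def blinfun.add_left blinfun.scaleR_left)
    then have "2 *\<^sub>R Y x = 2 *\<^sub>R ((1/2) *\<^sub>R (B x + Y (Y x)))" by (rule arg_cong)
    also have "\<dots> = B x + Y (Y x)" by simp
    finally show ?thesis by simp
  qed
  define g where "g x = sqrt c *\<^sub>R (x - Y x)" for x
  have lin: "linear g" unfolding g_def
    by (intro linear_compose_scale_right linear_compose_sub linear_id[unfolded id_def]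
        bounded_linear.linear blinfun.bounded_linear_right)
  define R where "R = matrix g"
  have R: "R *v x = g x" for x unfolding R_def using fun_cong[OF matrix_vector_mul(2)[OF lin]] by simp
  have "R *v (R *v x) = A *v x" for x
  proof -
    have "R *v (R *v x) = (sqrt c * sqrt c) *\<^sub>R (x - 2 *\<^sub>R Y x + Y (Y x))"
      by (simp add: R g_def blinfun.bilinear_simps scaleR_diff_right scaleR_add_right scaleR_2)
    also have "\<dots> = c *\<^sub>R (x - B x)" using c by (simp add: YY)
    also have "\<dots> = A *v x" using c by (simp add: B)
    finally show ?thesis .
  qed
  then have "R ** R = A" by (simp add: matrix_eq matrix_vector_mul_assoc)
  moreover have "transpose R = R"
  proof -
    have "R $ i $ j = axis i 1 \<bullet> g (axis j 1)" for i j by (simp add: R_def matrix_def inner_axis')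
    moreover have "axis i 1 \<bullet> g (axis j 1) = axis j 1 \<bullet> g (axis i 1)" for i j
      using Y(2)[of "axis i 1" "axis j 1"]
      by (simp add: g_def inner_diff_right inner_commute)
    ultimately show ?thesis by (simp add: transpose_def vec_eq_iff)
  qed
  moreover have "x \<bullet> (R *v x) > 0" if "x \<noteq> 0" for x
  proof -
    have "x \<bullet> Y x \<le> norm x * norm (Y x)" by (rule norm_cauchy_schwarz)
    also have "\<dots> \<le> norm x * (norm Y * norm x)" by (intro mult_left_mono norm_blinfun) auto
    also have "\<dots> \<le> norm x * (r * norm x)" using Y(1) by (intro mult_left_mono mult_right_mono) auto
    also have "\<dots> < norm x * norm x" using r that by simp
    finally have "x \<bullet> Y x < x \<bullet> x" by (simp add: power2_norm_eq_inner[symmetric] power2_eq_square)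
    then show ?thesis using c by (simp add: R g_def inner_diff_right)
  qed
  ultimately show ?thesis unfolding pos_def_def by blast
qed

section \<open>Asymptotic normality\<close>

lemma pos_def_invertible:
  fixes A :: "real^'k^'k"
  assumes "pos_def A"
  shows "invertible A"
proof -
  have "x = 0" if "A *v x = 0" for x
  proof (rule ccontr)
    assume "x \<noteq> 0"
    then have "x \<bullet> (A *v x) > 0" using assms by (simp add: pos_def_def)
    then show False using that by simp
  qed
  then show ?thesis by (simp add: invertible_left_inverse matrix_left_invertible_ker)
qed

lemma diag_plus_const_form:
  fixes D :: "'k::finite \<Rightarrow> real" and x :: "real^'k"
  shows "x \<bullet> ((\<chi> i j. (if i = j then D i else 0) + t) *v x)
    = (\<Sum>i\<in>UNIV. (x $ i)\<^sup>2 * D i) + t * (\<Sum>i\<in>UNIV. x $ i)\<^sup>2"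
proof -
  have "((\<chi> i j. (if i = j then D i else 0) + t) *v x) $ i = D i * x $ i + t * (\<Sum>j\<in>UNIV. x $ j)" for i
    by (simp add: matrix_vector_mult_def distrib_right sum.distrib sum_distrib_left if_distrib[of "\<lambda>a. a * _"]
        cong: if_cong)
  then show ?thesis
    by (simp add: inner_vec_def distrib_left sum.distrib power2_eq_square sum_distrib_left sum_distrib_right ac_simps)
qed

lemma pos_def_diag_plus_const:
  fixes D :: "'k::finite \<Rightarrow> real"
  assumes D: "\<And>i. D i > 0" and t: "t \<ge> 0"
  shows "pos_def ((\<chi> i j. (if i = j then D i else 0) + t) :: real^'k^'k)"
  unfolding pos_def_def diag_plus_const_form
proof (intro conjI allI impI)
  show "transpose (\<chi> i j. (if i = j then D i else 0) + t) = ((\<chi> i j. (if i = j then D i else 0) + t) :: real^'k^'k)"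
    by (auto simp: transpose_def vec_eq_iff)
  fix x :: "real^'k" assume "x \<noteq> 0"
  then obtain i where i: "x $ i \<noteq> 0" by (auto simp: vec_eq_iff)
  have "0 < (\<Sum>i\<in>UNIV. (x $ i)\<^sup>2 * D i)"
    by (rule sum_pos2[of _ i]) (use i D in \<open>auto intro!: mult_nonneg_nonneg D[THEN less_imp_le]\<close>)
  then show "0 < (\<Sum>i\<in>UNIV. (x $ i)\<^sup>2 * D i) + t * (\<Sum>i\<in>UNIV. x $ i)\<^sup>2"
    using t by (intro add_pos_nonneg) auto
qed

text \<open>The vectors to be tested are \<open>c n = R\<^sub>n\<^sup>-\<^sup>1 t\<close>, on which the form of \<open>\<Sigma> n\<close> is constantly \<open>t \<bullet> t\<close>.\<close>

lemma asymp_normal_from_linear_forms: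
  fixes X :: "nat \<Rightarrow> 'w \<Rightarrow> real^'k" and \<Sigma> :: "nat \<Rightarrow> real^'k^'k"
  assumes prob: "\<forall>\<^sub>F n in sequentially. prob_space (M n)"
    and meas: "\<forall>\<^sub>F n in sequentially. X n \<in> borel_measurable (M n)"
    and pd: "\<forall>\<^sub>F n in sequentially. pos_def (\<Sigma> n)"
    and char: "\<And>c f. (\<forall>\<^sub>F n in sequentially. c n \<bullet> (\<Sigma> n *v c n) = f) \<Longrightarrow>
      (\<lambda>n. \<integral>\<omega>. iexp (c n \<bullet> X n \<omega>) \<partial>M n) \<longlonglongrightarrow> complex_of_real (exp (- f / 2))"
  shows "asymp_normal M X (\<lambda>_. 0) \<Sigma>"
proof -
  define R where "R n = (SOME R. pos_def R \<and> R ** R = \<Sigma> n)" for n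
  have R: "pos_def (R n)" "R n ** R n = \<Sigma> n" if "pos_def (\<Sigma> n)" for n
    using someI_ex[OF pos_def_square_root[OF that]] unfolding R_def by auto
  define good where "good n \<longleftrightarrow> prob_space (M n) \<and> X n \<in> borel_measurable (M n) \<and> pos_def (\<Sigma> n)" for n
  have good: "\<forall>\<^sub>F n in sequentially. good n"
    unfolding good_def by (intro eventually_conj prob meas pd)
  define Y where "Y n \<omega> = matrix_inv (R n) *v X n \<omega>" for n \<omega>
  have Y: "Y n \<in> borel_measurable (M n)" if "good n" for n
  proof -
    have "(\<lambda>x. matrix_inv (R n) *v x) \<in> borel_measurable borel"
      by (intro borel_measurable_continuous_onI linear_continuous_on matrix_vector_mul_bounded_linear)
    then show ?thesis unfolding Y_def[abs_def] using that good_def measurable_compose by blast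
  qed
  \<comment> \<open>The hypotheses hold only eventually, whereas the continuity theorem asks for a
    probability measure at every index; the limit law serves as default value.\<close>
  define \<mu> where "\<mu> n = (if good n then distr (M n) borel (Y n) else std_mvn)" for n
  have \<mu>: "prob_space (\<mu> n)" "sets (\<mu> n) = sets borel" for n
    using prob_space.prob_space_distr[OF _ Y[of n]] good_def[of n] prob_space_std_mvn by (auto simp: \<mu>_def)
  have lim: "(\<lambda>n. mchar (\<mu> n) t) \<longlonglongrightarrow> mchar std_mvn t" for t
  proof -
    define c where "c n = matrix_inv (R n) *v t" for n
    have Rc: "R n *v c n = t" if "good n" for n
      using matrix_inv_mult(2)[OF pos_def_invertible[OF R(1)]] that
      by (simp add: c_def matrix_vector_mul_assoc good_def)
    have form: "c n \<bullet> (\<Sigma> n *v c n) = t \<bullet> t" if g: "good n" for n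
    proof -
      have p: "pos_def (\<Sigma> n)" using g by (simp add: good_def)
      have "c n \<bullet> (\<Sigma> n *v c n) = c n \<bullet> (R n *v (R n *v c n))"
        by (simp add: R(2)[OF p] matrix_vector_mul_assoc)
      also have "\<dots> = t \<bullet> t" unfolding pos_def_symmetric[OF R(1)[OF p]] Rc[OF g] by simp
      finally show ?thesis .
    qed
    have dual: "t \<bullet> Y n \<omega> = c n \<bullet> X n \<omega>" if g: "good n" for n \<omega>
    proof -
      have p: "pos_def (\<Sigma> n)" using g by (simp add: good_def)
      have "t \<bullet> Y n \<omega> = (R n *v c n) \<bullet> Y n \<omega>" by (simp add: Rc[OF g])
      also have "\<dots> = c n \<bullet> (R n *v Y n \<omega>)" by (rule pos_def_symmetric[OF R(1)[OF p], symmetric])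
      also have "R n *v Y n \<omega> = X n \<omega>"
        using matrix_inv_mult(2)[OF pos_def_invertible[OF R(1)[OF p]]]
        by (simp add: Y_def matrix_vector_mul_assoc)
      finally show ?thesis .
    qed
    have "mchar (\<mu> n) t = (\<integral>\<omega>. iexp (c n \<bullet> X n \<omega>) \<partial>M n)" if g: "good n" for n
    proof -
      have m: "(\<lambda>x. iexp (t \<bullet> x)) \<in> borel_measurable borel"
        by (intro borel_measurable_continuous_onI continuous_intros)
      have "mchar (\<mu> n) t = (\<integral>\<omega>. iexp (t \<bullet> Y n \<omega>) \<partial>M n)"
        unfolding mchar_def \<mu>_def using g by (simp add: integral_distr[OF Y[OF g] m])
      then show ?thesis by (simp only: dual[OF g])
    qed
    then have "\<forall>\<^sub>F n in sequentially. mchar (\<mu> n) t = (\<integral>\<omega>. iexp (c n \<bullet> X n \<omega>) \<partial>M n)"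
      using good by (auto elim: eventually_mono)
    moreover have "(\<lambda>n. \<integral>\<omega>. iexp (c n \<bullet> X n \<omega>) \<partial>M n) \<longlonglongrightarrow> complex_of_real (exp (- (t \<bullet> t) / 2))"
      using good form by (intro char) (auto elim: eventually_mono)
    ultimately show ?thesis unfolding mchar_std_mvn by (simp add: tendsto_cong)
  qed
  show ?thesis unfolding asymp_normal_def conv_in_distr_def
  proof (intro exI[of _ R] conjI allI impI)
    show "\<forall>\<^sub>F n in sequentially. pos_def (R n) \<and> R n ** R n = \<Sigma> n"
      using pd R by (auto elim: eventually_mono)
    show "\<forall>\<^sub>F n in sequentially. (\<lambda>\<omega>. matrix_inv (R n) *v (X n \<omega> - 0)) \<in> borel_measurable (M n)"
      using good Y unfolding Y_def[abs_def] by (auto elim: eventually_mono)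
    fix f :: "real^'k \<Rightarrow> real" assume f: "continuous_on UNIV f \<and> bounded (range f)"
    then obtain B where B: "\<And>x. \<bar>f x\<bar> \<le> B" by (auto simp: bounded_iff)
    have "(\<lambda>n. \<integral>x. f x \<partial>\<mu> n) \<longlonglongrightarrow> (\<integral>x. f x \<partial>std_mvn)"
      by (rule levy_continuity_vec[OF \<mu> lim _ B]) (use f in blast)
    moreover have "(\<integral>x. f x \<partial>\<mu> n) = (\<integral>\<omega>. f (matrix_inv (R n) *v (X n \<omega> - 0)) \<partial>M n)" if g: "good n" for n
      using integral_distr[OF Y[OF g], of f] f borel_measurable_continuous_onI[of f] g
      by (simp add: \<mu>_def Y_def)
    then have "\<forall>\<^sub>F n in sequentially. (\<integral>x. f x \<partial>\<mu> n) = (\<integral>\<omega>. f (matrix_inv (R n) *v (X n \<omega> - 0)) \<partial>M n)"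
      using good by (auto elim: eventually_mono)
    ultimately show "(\<lambda>n. \<integral>\<omega>. f (matrix_inv (R n) *v (X n \<omega> - 0)) \<partial>M n) \<longlonglongrightarrow> (\<integral>x. f x \<partial>std_mvn)"
      by (simp add: tendsto_cong)
  qed
qed

section \<open>The sequence of networks and the two noise regimes\<close>

locale network_sequence =
  fixes M :: "nat \<Rightarrow> 'w measure"
    and Z :: "nat \<Rightarrow> nat \<Rightarrow> nat \<Rightarrow> real^'p"
    and q :: real
    and \<theta> :: "nat \<Rightarrow> nat \<Rightarrow> real" and \<gamma> :: "nat \<Rightarrow> real^'p"
    and eps :: "nat \<Rightarrow> real"
    and A :: "nat \<Rightarrow> nat \<Rightarrow> nat \<Rightarrow> 'w \<Rightarrow> real"
    and ep em :: "nat \<Rightarrow> nat \<Rightarrow> 'w \<Rightarrow> int"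
    and \<eta> :: "nat \<Rightarrow> 'p \<Rightarrow> 'w \<Rightarrow> real"
    and \<theta>h :: "nat \<Rightarrow> 'w \<Rightarrow> nat \<Rightarrow> real" and \<gamma>h :: "nat \<Rightarrow> 'w \<Rightarrow> real^'p"
    and r1 r2 lam :: "nat \<Rightarrow> real"
    and \<rho> :: "nat \<Rightarrow> real"
  assumes rho_eq: "\<And>n. \<rho> n = rho n (\<theta> n) (\<gamma> n) q (r1 n) (r2 n)"
    and model: "\<And>n. n \<ge> 2 \<Longrightarrow>
      private_network (M n) n (Z n) q (\<theta> n) (\<gamma> n) (eps n) (A n) (ep n) (em n) (\<eta> n)"
    and estimator: "\<And>n. n \<ge> 2 \<Longrightarrow> is_estimator (M n) n (Z n) (priv_out n (A n) (ep n))
      (priv_in n (A n) (em n)) (priv_cov n (Z n) (A n) (\<eta> n)) (\<theta>h n) (\<gamma>h n)"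
    and radii: "\<And>n. r1 n > 0" "\<And>n. r2 n > 0"
    and H_pos_def: "\<forall>\<^sub>F n in sequentially. \<forall>\<omega>\<in>space (M n). \<forall>\<theta>' \<gamma>'. pos_def (H_mat n (Z n)
      (priv_out n (A n) (ep n) \<omega>) (priv_in n (A n) (em n) \<omega>) (priv_cov n (Z n) (A n) (\<eta> n) \<omega>) \<theta>' \<gamma>')"
    and lambda: "\<forall>\<^sub>F n in sequentially. \<forall>\<omega>\<in>space (M n). \<forall>\<theta>' \<in> theta_ball n (\<theta> n) (r1 n).
      mat_norm_inf (matrix_inv (H_mat n (Z n) (priv_out n (A n) (ep n) \<omega>) (priv_in n (A n) (em n) \<omega>)
        (priv_cov n (Z n) (A n) (\<eta> n) \<omega>) \<theta>' (\<gamma> n))) \<le> lam n / (real n)\<^sup>2"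
    and rate: "(\<lambda>n. (eps_tilde (eps n))\<^sup>2 * exp (9 * \<rho> n)
        + (varpi n CARD('p) q (eps n) (\<rho> n))\<^sup>2 * (lam n)\<^sup>2 * q * exp (3 * \<rho> n) * ln (real n))
      \<in> o(\<lambda>n. sqrt (real n) / ln (real n))"
begin

abbreviation Vd :: "nat \<Rightarrow> nat \<Rightarrow> real" where
  "Vd n i \<equiv> V_mat n (Z n) (\<theta> n) (\<gamma> n) i i"

abbreviation Vc :: "nat \<Rightarrow> real" where
  "Vc n \<equiv> V_corner n (Z n) (\<theta> n) (\<gamma> n)"

definition noise_var :: "nat \<Rightarrow> real" where
  "noise_var n = 2 * exp (- eps n / 2) / (1 - exp (- eps n / 2))\<^sup>2"

lemma noise_sd_eq:
  assumes "n \<ge> 2"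
  shows "(noise_sd (M n) n (ep n) (em n))\<^sup>2 = (2 * real n - 1) * noise_var n"
proof -
  interpret N: private_network "M n" n "Z n" q "\<theta> n" "\<gamma> n" "eps n" "A n" "ep n" "em n" "\<eta> n"
    by (rule model[OF assms])
  show ?thesis using N.noise_sd_square assms unfolding noise_var_def N.tau2_def N.al_def by simp
qed

lemma q_pos: "q > 0"
proof -
  interpret N: private_network "M 2" 2 "Z 2" q "\<theta> 2" "\<gamma> 2" "eps 2" "A 2" "ep 2" "em 2" "\<eta> 2"
    by (rule model) simp
  show ?thesis by (rule N.q_pos) simp
qed

lemma eps_pos: "n \<ge> 2 \<Longrightarrow> eps n > 0"
  using private_network.eps_pos[OF model] .

lemma noise_var_nonneg: "noise_var n \<ge> 0"
  by (simp add: noise_var_def)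

lemma lin_pred_le_rho:
  assumes n: "n \<ge> 2" and ij: "i \<in> {1..n}" "j \<in> {1..n}" "i \<noteq> j"
  shows "\<bar>lin_pred n (Z n) (\<theta> n) (\<gamma> n) i j\<bar> \<le> \<rho> n"
  unfolding rho_eq
  by (rule abs_lin_pred_le_rho[OF private_network.q_eq[OF model[OF n]] _ _ ij])
    (use radii[of n] in \<open>auto simp: theta_ball_def infnorm_0 less_imp_le\<close>)

lemma rho_nonneg: "n \<ge> 2 \<Longrightarrow> \<rho> n \<ge> 0"
  using lin_pred_le_rho[of n 1 2] by simp

lemma weight_ge:
  assumes n: "n \<ge> 2" and ij: "i \<in> {1..n}" "j \<in> {1..n}" "i \<noteq> j"
  shows "1 / (4 * exp (\<rho> n)) \<le> logistic' (lin_pred n (Z n) (\<theta> n) (\<gamma> n) i j)"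
proof -
  let ?x = "lin_pred n (Z n) (\<theta> n) (\<gamma> n) i j"
  have "1 / (4 * exp (\<rho> n)) = exp (- \<rho> n) / 4" by (simp add: exp_minus field_simps)
  also have "\<dots> \<le> exp (- \<bar>?x\<bar>) / 4" using lin_pred_le_rho[OF assms] by simp
  also have "\<dots> \<le> logistic' ?x" by (rule logistic'_ge)
  finally show ?thesis .
qed

lemma weighted_network:
  assumes n: "n \<ge> 3"
  shows "weighted_network n (Z n) (\<theta> n) (\<gamma> n) q (1 / (4 * exp (\<rho> n)))"
proof -
  have n2: "n \<ge> 2" using n by simp
  show ?thesis
    by unfold_locales
      (use n weight_ge[OF n2] logistic'_le private_network.Z_component_bound[OF model[OF n2]] in auto)
qed

lemma V_bounds:
  assumes n: "n \<ge> 3"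
  shows "i \<in> {1..n} \<Longrightarrow> Vd n i > 0" "Vc n > 0" "(real n - 1) / (4 * exp (\<rho> n)) \<le> Vc n"
    "Vc n \<le> (real n - 1) / 4"
proof -
  interpret W: weighted_network n "Z n" "\<theta> n" "\<gamma> n" q "1 / (4 * exp (\<rho> n))"
    by (rule weighted_network[OF n])
  have "real (n - 1) = real n - 1" using n by (simp add: of_nat_diff)
  note * = W.vc_bounds[unfolded this]
  show "i \<in> {1..n} \<Longrightarrow> Vd n i > 0" using W.vd_bounds(3) by (simp add: W.vd_def)
  show "Vc n > 0" "(real n - 1) / (4 * exp (\<rho> n)) \<le> Vc n" "Vc n \<le> (real n - 1) / 4"
    using * by (simp_all add: W.vc_def)
qed

lemma ln_ge_1: "n \<ge> 3 \<Longrightarrow> ln (real n) \<ge> 1"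
proof -
  assume n: "n \<ge> 3"
  have "exp 1 \<le> (3 :: real)" by (rule exp_le)
  moreover have "real n \<ge> 3" using n by simp
  ultimately have "exp 1 \<le> real n" by linarith
  then show ?thesis using n by (simp add: ln_ge_iff)
qed

lemma rate_tendsto:
  "(\<lambda>n. (1 + lam n) * exp (\<rho> n) ^ 8 * ln (real n) / sqrt (real n)) \<longlonglongrightarrow> 0"
proof (rule rate_null[OF q_pos])
  have e: "exp (9 * x) = exp x ^ 9" "exp (3 * x) = exp x ^ 3" for x :: real
    by (simp_all flip: exp_of_nat_mult)
  show "(\<lambda>n. (eps_tilde (eps n))\<^sup>2 * exp (\<rho> n) ^ 9
        + (varpi n CARD('p) q (eps n) (\<rho> n))\<^sup>2 * (lam n)\<^sup>2 * q * exp (\<rho> n) ^ 3 * ln (real n))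
      \<in> o(\<lambda>n. sqrt (real n) / ln (real n))" using rate unfolding e .
  show "exp (\<rho> n) \<ge> 1" if "n \<ge> 2" for n using rho_nonneg[OF that] by simp
  show "eps_tilde (eps n) \<ge> 1" if "n \<ge> 2" for n using eps_pos[OF that] by (simp add: eps_tilde_def)
  show "exp (\<rho> n) ^ 9 \<le> varpi n CARD('p) q (eps n) (\<rho> n)" if n: "n \<ge> 3" for n
  proof -
    have eps: "eps n > 0" using n by (intro eps_pos) simp
    have "exp (\<rho> n) ^ 9 * 1 \<le> exp (9 * \<rho> n) * (1 + 8 / eps n)\<^sup>2"
      unfolding e using eps by (intro mult_left_mono one_le_power) auto
    moreover have "0 \<le> q / sqrt (ln (real n))" "0 \<le> real CARD('p) * q / (real n * eps n)"
      using q_pos eps ln_ge_1[OF n] by auto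
    ultimately show ?thesis unfolding varpi_def by linarith
  qed
qed

text \<open>Common core of both regimes. \<open>t\<close>, the constant added to all entries of the
  covariance matrix, has to agree with the variance of the common part, noise included, only up to a
  factor tending to 1; so it may be \<open>1 / Vc\<close> when the noise is negligible. The bound
  \<open>a0\<close> keeps the variances and third moments of the noise bounded.\<close>

lemma estimator_asymp_normal:
  fixes idx :: "'k::finite \<Rightarrow> nat" and t :: "nat \<Rightarrow> real"
  assumes idx: "bij_betw idx UNIV {1..CARD('k)}"
    and a0: "0 < a0" "a0 < 1" "\<forall>\<^sub>F n in sequentially. exp (- eps n / 2) \<le> a0"
    and t: "\<forall>\<^sub>F n in sequentially. 1 / Vc n \<le> t n"
    and ratio: "(\<lambda>n. (1 / Vc n + (2 * real n - 1) * noise_var n / (Vc n)\<^sup>2) / t n) \<longlonglongrightarrow> 1"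
    and \<Sigma>: "\<forall>\<^sub>F n in sequentially. \<Sigma> n = (\<chi> i j. (if i = j then 1 / Vd n (idx i) else 0) + t n)"
  shows "asymp_normal M (\<lambda>n \<omega>. \<chi> i. \<theta>h n \<omega> (idx i) - \<theta> n (idx i)) (\<lambda>_. 0) \<Sigma>"
proof (rule asymp_normal_from_linear_forms)
  have idx_in: "idx \<iota> \<in> {1..CARD('k)}" for \<iota> using idx by (auto simp: bij_betw_def)
  have idx_n: "idx \<iota> \<in> {1..n}" if "n \<ge> CARD('k)" for \<iota> n using idx_in[of \<iota>] that by auto
  have large: "\<forall>\<^sub>F n in sequentially. n \<ge> 3 \<and> n \<ge> CARD('k)"
    by (intro eventually_conj eventually_ge_at_top)
  show "\<forall>\<^sub>F n in sequentially. prob_space (M n)"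
    using large by eventually_elim (use model in \<open>auto simp: private_network_def\<close>)
  show "\<forall>\<^sub>F n in sequentially. (\<lambda>\<omega>. \<chi> i. \<theta>h n \<omega> (idx i) - \<theta> n (idx i)) \<in> borel_measurable (M n)"
    using large
  proof eventually_elim
    case (elim n)
    have "(\<lambda>\<omega>. \<theta>h n \<omega> (idx i)) \<in> borel_measurable (M n)" for i
      using estimator[of n] elim idx_n[of n i] by (auto simp: is_estimator_def)
    then show ?case
      by (subst borel_measurable_euclidean_space) (auto simp: Basis_vec_def inner_axis)
  qed
  show "\<forall>\<^sub>F n in sequentially. pos_def (\<Sigma> n)"
    using large t \<Sigma>
  proof eventually_elim
    case (elim n)
    have "Vc n > 0" using V_bounds(2)[of n] elim by simp
    then have "0 < 1 / Vc n" by simp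
    then have "t n \<ge> 0" using elim(2) by linarith
    moreover have "0 < 1 / Vd n (idx i)" for i using V_bounds(1)[of n "idx i"] idx_n[of n i] elim by simp
    ultimately show ?case unfolding elim(3) by (intro pos_def_diag_plus_const)
  qed
  fix c :: "nat \<Rightarrow> real^'k" and f :: real
  assume form: "\<forall>\<^sub>F n in sequentially. c n \<bullet> (\<Sigma> n *v c n) = f"
  \<comment> \<open>\<open>exp (- eps n / 2) \<le> a0\<close> is the same as
    \<open>e0 \<le> eps n\<close>.\<close>
  define e0 where "e0 = - 2 * ln a0"
  have e0: "e0 > 0" using a0 by (simp add: e0_def)
  define B where "B n = (1 + lam n) * exp (\<rho> n) ^ 8 * ln (real n) / sqrt (real n)" for n
  have B: "B \<longlonglongrightarrow> 0" using rate_tendsto by (simp add: B_def[abs_def])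
  define C1 where "C1 = 192 + 2401 * real CARD('p) * q\<^sup>2"
  define C2 where "C2 = 768 + 98 * real CARD('p) * q * (49 * q + 1)"
  define C3 where "C3 = 288 * C2\<^sup>2 + 24 * real CARD('p) * q * (49 * q + 1 + 49 * q * C2\<^sup>2) + 192"
  define \<tau> where "\<tau> = 2 / (1 - a0)\<^sup>2"
  define Cc where "Cc = 2 * (\<Sum>k. real k ^ 3 * a0 ^ k)"
  define G where "G = real CARD('k) * sqrt f * C3 + (2 * sqrt (8 * f) + 32 * f) * (f + 8 * real CARD('k) * f)
        + 128 * f * sqrt (8 * f) * Cc + 2048 * f\<^sup>2 * \<tau>\<^sup>2 + 8 * real CARD('k) * f * (1 + 3 * \<tau>)"
  define L where "L = (real CARD('p) + real CARD('k) + 4) * (1 + 2 * \<tau>)"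
  let ?r = "\<lambda>n. (1 / Vc n + (2 * real n - 1) * noise_var n / (Vc n)\<^sup>2) / t n"
  let ?b = "\<lambda>n. 2 * (4 / real n + L / ln (real n) + real CARD('p) * (real CARD('p) * q / (e0 * real n)))
    + G * B n + f * \<bar>?r n - 1\<bar>"
  have Bsmall: "\<forall>\<^sub>F n in sequentially. B n < 1"
    using order_tendstoD(2)[OF B] by simp
  have "(\<lambda>n. C1 * C2 * B n) \<longlonglongrightarrow> C1 * C2 * 0" by (intro tendsto_intros B)
  then have B2: "\<forall>\<^sub>F n in sequentially. C1 * C2 * B n < 1 / 2"
    by (intro order_tendstoD(2)) auto
  have bound: "\<forall>\<^sub>F n in sequentially.
      norm ((\<integral>\<omega>. iexp (c n \<bullet> (\<chi> i. \<theta>h n \<omega> (idx i) - \<theta> n (idx i))) \<partial>M n) - complex_of_real (exp (- f / 2))) \<le> ?b n"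
    using large form H_pos_def lambda a0(3) t \<Sigma> Bsmall B2
  proof eventually_elim
    case (elim n)
    have n2: "n \<ge> 2" and n3: "n \<ge> 3" and nk: "CARD('k) \<le> n" using elim(1) by auto
    interpret N: private_network "M n" n "Z n" q "\<theta> n" "\<gamma> n" "eps n" "A n" "ep n" "em n" "\<eta> n"
      by (rule model[OF n2])
    \<comment> \<open>\<open>H\<close> does not depend on the sample, so its properties at a single
      sample point suffice.\<close>
    obtain \<omega> where \<omega>: "\<omega> \<in> space (M n)" using N.not_empty by blast
    have "\<theta> n \<in> theta_ball n (\<theta> n) (r1 n)" using radii(1)[of n] by (simp add: theta_ball_def less_imp_le)
    note Hinv = elim(4)[rule_format, OF \<omega> this] and Hpos = elim(3)[rule_format, OF \<omega>]
    have al: "N.al \<le> a0" using elim(5) by (simp add: N.al_def)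
    have "ln (exp (- eps n / 2)) \<le> ln a0" using elim(5) a0(1) by (subst ln_le_cancel_iff) auto
    then have eps: "e0 \<le> eps n" by (simp add: e0_def)
    have f: "(\<Sum>\<iota>\<in>UNIV. (c n $ \<iota>)\<^sup>2 / Vd n (idx \<iota>)) + t n * (\<Sum>\<iota>\<in>UNIV. c n $ \<iota>)\<^sup>2 = f"
      using elim(2) unfolding elim(7) diag_plus_const_form by simp
    have E: "exp (\<rho> n) \<ge> 1" using rho_nonneg[OF n2] by simp
    have nv: "N.tau2 = noise_var n" by (simp add: N.tau2_def N.al_def noise_var_def)
    have ip: "(\<Sum>\<iota>\<in>UNIV. c n $ \<iota> * (\<theta>h n \<omega> (idx \<iota>) - \<theta> n (idx \<iota>)))
        = c n \<bullet> (\<chi> i. \<theta>h n \<omega> (idx i) - \<theta> n (idx i))" for \<omega>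
      by (simp add: inner_vec_def)
    have "norm ((\<integral>\<omega>. iexp (\<Sum>\<iota>\<in>UNIV. c n $ \<iota> * (\<theta>h n \<omega> (idx \<iota>) - \<theta> n (idx \<iota>))) \<partial>M n)
        - complex_of_real (exp (- f / 2))) \<le> ?b n"
      unfolding G_def L_def nv[symmetric]
      by (rule N.char_rate[OF n3 E weight_ge[OF n2, folded N.wt_def] Hpos Hinv estimator[OF n2] idx nk al a0(2) e0 eps
          elim(6) f B_def less_imp_le[OF elim(8)] C1_def C2_def C3_def less_imp_le[OF elim(9)] \<tau>_def Cc_def])
    then show ?case unfolding ip .
  qed
  have l1: "(\<lambda>n. 4 / real n) \<longlonglongrightarrow> 0"
    using tendsto_mult[OF tendsto_const[of 4] lim_1_over_n] by simp
  have l2: "(\<lambda>n. L / ln (real n)) \<longlonglongrightarrow> 0"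
    by (intro tendsto_divide_0[OF tendsto_const] filterlim_at_top_imp_at_infinity
        filterlim_compose[OF ln_at_top filterlim_real_sequentially])
  have l3: "(\<lambda>n. real CARD('p) * q / (e0 * real n)) \<longlonglongrightarrow> 0"
    using tendsto_mult[OF tendsto_const[of "real CARD('p) * q / e0"] lim_1_over_n] by simp
  have "?b \<longlonglongrightarrow> 2 * (0 + 0 + real CARD('p) * 0) + G * 0 + f * \<bar>1 - 1\<bar>"
    by (rule tendsto_add[OF tendsto_add[OF tendsto_mult_left[OF tendsto_add[OF tendsto_add[OF l1 l2] tendsto_mult_left[OF l3]]]
        tendsto_mult_left[OF B]] tendsto_mult_left[OF tendsto_rabs[OF tendsto_diff[OF ratio tendsto_const]]]])
  then have "?b \<longlonglongrightarrow> 0" by simp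
  from Lim_null_comparison[OF bound this]
  show "(\<lambda>n. \<integral>\<omega>. iexp (c n \<bullet> (\<chi> i. \<theta>h n \<omega> (idx i) - \<theta> n (idx i))) \<partial>M n) \<longlonglongrightarrow> complex_of_real (exp (- f / 2))"
    by (rule LIM_zero_cancel)
qed

text \<open>Relative to \<open>1 / Vc\<close> the noise contributes
  \<open>(2 n - 1) * noise_var n / Vc n\<close>. The corner entry is at least
  \<open>(n - 1) / (4 e^\<rho>)\<close> and \<open>noise_var n\<close> is of order at most
  \<open>1 / eps n\<close>, so this is of order at most e^\<rho> / eps, which vanishes by
  hypothesis.\<close>

lemma asymp_normal_vanishing_noise:
  fixes idx :: "'k::finite \<Rightarrow> nat"
  assumes idx: "bij_betw idx UNIV {1..CARD('k)}"
    and small: "(\<lambda>n. exp (\<rho> n) * sqrt (ln (real n)) / eps n) \<longlonglongrightarrow> 0"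
  shows "asymp_normal M (\<lambda>n \<omega>. \<chi> i. \<theta>h n \<omega> (idx i) - \<theta> n (idx i)) (\<lambda>_. 0)
    (\<lambda>n. \<chi> i j. S_mat n (Z n) (\<theta> n) (\<gamma> n) (idx i) (idx j))"
proof -
  define x where "x n = exp (\<rho> n) * sqrt (ln (real n)) / eps n" for n
  have x: "x \<longlonglongrightarrow> 0" using small by (simp add: x_def[abs_def])
  \<comment> \<open>The value of \<open>exp (- eps n / 2)\<close> at \<open>eps n = 1\<close>;
    eventually \<open>eps n \<ge> 1\<close>.\<close>
  define a0 where "a0 = exp (- 1 / 2 :: real)"
  have a0: "0 < a0" "a0 < 1" by (auto simp: a0_def)
  have x_ge: "exp (\<rho> n) / eps n \<le> x n" "1 / eps n \<le> x n" if n: "n \<ge> 3" for n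
  proof -
    have eps: "eps n > 0" using n by (intro eps_pos) simp
    have E: "1 \<le> exp (\<rho> n)" using rho_nonneg[of n] n by simp
    have "sqrt (ln (real n)) \<ge> 1" using ln_ge_1[OF n] by simp
    then have "exp (\<rho> n) * 1 \<le> exp (\<rho> n) * sqrt (ln (real n))" by (intro mult_left_mono) auto
    then show 1: "exp (\<rho> n) / eps n \<le> x n" unfolding x_def using eps by (intro divide_right_mono) auto
    have "1 / eps n \<le> exp (\<rho> n) / eps n" using E eps by (intro divide_right_mono) auto
    then show "1 / eps n \<le> x n" using 1 by linarith
  qed
  have al: "\<forall>\<^sub>F n in sequentially. exp (- eps n / 2) \<le> a0"
    using order_tendstoD(2)[OF x zero_less_one] eventually_ge_at_top[of 3]
  proof eventually_elim
    case (elim n)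
    have eps: "eps n > 0" using elim by (intro eps_pos) simp
    have "1 / eps n \<le> 1" using x_ge(2)[of n] elim by linarith
    then have "eps n \<ge> 1" using eps by (simp add: field_simps)
    then show ?case by (simp add: a0_def)
  qed
  have noise: "\<forall>\<^sub>F n in sequentially.
      norm ((2 * real n - 1) * noise_var n / Vc n) \<le> 64 / (1 - a0)\<^sup>2 * x n"
    using al eventually_ge_at_top[of 3]
  proof eventually_elim
    case (elim n)
    have n: "n \<ge> 3" and n3: "real n \<ge> 3" using elim by auto
    have eps: "eps n > 0" using n by (intro eps_pos) simp
    have V: "Vc n > 0" "(real n - 1) / (4 * exp (\<rho> n)) \<le> Vc n" using V_bounds[OF n] by auto
    have "1 + eps n / 2 \<le> exp (eps n / 2)" by (rule exp_ge_add_one_self)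
    then have "eps n / 2 \<le> exp (eps n / 2)" by linarith
    then have "inverse (exp (eps n / 2)) \<le> inverse (eps n / 2)" using eps by (intro le_imp_inverse_le) auto
    then have al2: "exp (- eps n / 2) \<le> 2 / eps n" by (simp add: exp_minus)
    have "(1 - a0)\<^sup>2 \<le> (1 - exp (- eps n / 2))\<^sup>2" using elim(1) a0 by (intro power_mono) auto
    then have "noise_var n \<le> 2 * (2 / eps n) / (1 - a0)\<^sup>2"
      unfolding noise_var_def using a0 al2 eps by (intro frac_le mult_left_mono) auto
    also have "\<dots> = 4 / (1 - a0)\<^sup>2 * (1 / eps n)" by simp
    finally have nv: "noise_var n \<le> 4 / (1 - a0)\<^sup>2 * (1 / eps n)" .
    have "(2 * real n - 1) / Vc n \<le> (4 * (real n - 1)) / ((real n - 1) / (4 * exp (\<rho> n)))"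
      using V n3 by (intro frac_le) auto
    also have "\<dots> = 16 * exp (\<rho> n)" using n3 by (simp add: field_simps)
    finally have "(2 * real n - 1) / Vc n \<le> 16 * exp (\<rho> n)" .
    then have "(2 * real n - 1) / Vc n * noise_var n \<le> 16 * exp (\<rho> n) * (4 / (1 - a0)\<^sup>2 * (1 / eps n))"
      by (rule mult_mono[OF _ nv]) (use noise_var_nonneg in auto)
    also have "\<dots> = 64 / (1 - a0)\<^sup>2 * (exp (\<rho> n) / eps n)" by simp
    also have "\<dots> \<le> 64 / (1 - a0)\<^sup>2 * x n" using x_ge(1)[OF n] by (intro mult_left_mono) auto
    finally have "(2 * real n - 1) * noise_var n / Vc n \<le> 64 / (1 - a0)\<^sup>2 * x n" by simp
    moreover have "0 \<le> (2 * real n - 1) * noise_var n / Vc n"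
      using V(1) noise_var_nonneg[of n] n3 by (intro divide_nonneg_nonneg mult_nonneg_nonneg) auto
    ultimately show ?case by simp
  qed
  have "(\<lambda>n. 64 / (1 - a0)\<^sup>2 * x n) \<longlonglongrightarrow> 0" using tendsto_mult_left[OF x, of "64 / (1 - a0)\<^sup>2"] by simp
  from Lim_null_comparison[OF noise this]
  have "(\<lambda>n. 1 + (2 * real n - 1) * noise_var n / Vc n) \<longlonglongrightarrow> 1 + 0" by (rule tendsto_add[OF tendsto_const])
  moreover have "\<forall>\<^sub>F n in sequentially. 1 + (2 * real n - 1) * noise_var n / Vc n
      = (1 / Vc n + (2 * real n - 1) * noise_var n / (Vc n)\<^sup>2) / (1 / Vc n)"
    using eventually_ge_at_top[of 3]
  proof eventually_elim
    case (elim n)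
    then have "Vc n \<noteq> 0" using V_bounds(2)[of n] by simp
    then show ?case by (simp add: power2_eq_square field_simps)
  qed
  ultimately have ratio: "(\<lambda>n. (1 / Vc n + (2 * real n - 1) * noise_var n / (Vc n)\<^sup>2) / (1 / Vc n)) \<longlonglongrightarrow> 1"
    by (simp only: tendsto_cong add_0_right)
  have \<Sigma>: "\<forall>\<^sub>F n in sequentially. (\<chi> i j. S_mat n (Z n) (\<theta> n) (\<gamma> n) (idx i) (idx j))
      = (\<chi> i j. (if i = j then 1 / Vd n (idx i) else 0) + 1 / Vc n)"
    using eventually_ge_at_top[of "CARD('k)"]
  proof eventually_elim
    case (elim n)
    have "idx i \<in> {1..CARD('k)}" for i using bij_betwE[OF idx] by simp
    then have "idx i \<le> n" for i using elim by (meson atLeastAtMost_iff order_trans)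
    moreover have "idx i = idx j \<longleftrightarrow> i = j" for i j using idx by (auto simp: bij_betw_def inj_on_def)
    ultimately show ?case by (simp add: S_mat_def vec_eq_iff)
  qed
  show ?thesis by (rule estimator_asymp_normal[OF idx a0 al _ ratio \<Sigma>]) simp
qed

text \<open>Here \<open>t\<close> is the exact variance of the common part, so the ratio is
  eventually 1. The limit \<open>c\<close> serves to keep \<open>exp (- eps n / 2)\<close> away from
  1: it bounds \<open>(2 n - 1) * noise_var n / Vc n\<close>, and with
  \<open>Vc n \<le> (n - 1) / 4\<close> this bounds \<open>noise_var n\<close>.\<close>

lemma asymp_normal_bounded_noise:
  fixes idx :: "'k::finite \<Rightarrow> nat"
  assumes idx: "bij_betw idx UNIV {1..CARD('k)}"
    and lim: "(\<lambda>n. noise_sd (M n) n (ep n) (em n) / sqrt (Vc n)) \<longlonglongrightarrow> c"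
  shows "asymp_normal M (\<lambda>n \<omega>. \<chi> i. \<theta>h n \<omega> (idx i) - \<theta> n (idx i)) (\<lambda>_. 0)
    (\<lambda>n. \<chi> i j. (if i = j then 1 / Vd n (idx i) else 0)
      + (1 / Vc n + (noise_sd (M n) n (ep n) (em n))\<^sup>2 / (Vc n)\<^sup>2))"
proof -
  define L where "L = c\<^sup>2 + 1"
  \<comment> \<open>Either \<open>exp (- eps n / 2)\<close> is at most \<open>1 / 2\<close>, or
    \<open>noise_var n\<close> is at least \<open>1 / (1 - exp (- eps n / 2))\<close> and its bound
    \<open>L\<close> gives the second entry.\<close>
  define a0 where "a0 = max (1 / 2) (1 - 1 / L)"
  have L: "L \<ge> 1" by (simp add: L_def)
  have a0: "0 < a0" "a0 < 1" using L by (auto simp: a0_def)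
  have "(\<lambda>n. (noise_sd (M n) n (ep n) (em n) / sqrt (Vc n))\<^sup>2) \<longlonglongrightarrow> c\<^sup>2" by (intro tendsto_power lim)
  then have "\<forall>\<^sub>F n in sequentially. (noise_sd (M n) n (ep n) (em n) / sqrt (Vc n))\<^sup>2 < L"
    by (rule order_tendstoD) (simp add: L_def)
  then have al: "\<forall>\<^sub>F n in sequentially. exp (- eps n / 2) \<le> a0"
    using eventually_ge_at_top[of 3]
  proof eventually_elim
    case (elim n)
    let ?a = "exp (- eps n / 2)"
    have n: "n \<ge> 3" and n2: "n \<ge> 2" and n3: "real n \<ge> 3" using elim by auto
    have V: "Vc n > 0" "Vc n \<le> (real n - 1) / 4" using V_bounds[OF n] by auto
    have a1: "?a < 1" using eps_pos[OF n2] by simp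
    have "(2 * real n - 1) * noise_var n / Vc n < L"
      using elim(1) V(1) by (simp add: power_divide noise_sd_eq[OF n2])
    then have "(2 * real n - 1) * noise_var n < L * Vc n" using V(1) by (simp add: divide_less_eq)
    also have "\<dots> \<le> L * (2 * real n - 1)" using V(2) L n3 by (intro mult_left_mono) auto
    finally have nv: "noise_var n < L" using n3 by (simp add: mult.commute)
    show ?case
    proof (cases "?a \<le> 1 / 2")
      case False
      have "1 / (1 - ?a) \<le> 1 / (1 - ?a)\<^sup>2"
        using a1 False by (intro divide_left_mono) (auto simp: power2_eq_square mult_le_one)
      also have "\<dots> \<le> noise_var n" unfolding noise_var_def using False by (intro divide_right_mono) auto
      finally have "1 / (1 - ?a) < L" using nv by linarith
      then have "1 / L < 1 - ?a" using a1 L by (simp add: field_simps)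
      then show ?thesis by (simp add: a0_def)
    qed (simp add: a0_def)
  qed
  have s: "\<forall>\<^sub>F n in sequentially. 1 / Vc n + (2 * real n - 1) * noise_var n / (Vc n)\<^sup>2
      = 1 / Vc n + (noise_sd (M n) n (ep n) (em n))\<^sup>2 / (Vc n)\<^sup>2"
    using eventually_ge_at_top[of 2] by eventually_elim (simp add: noise_sd_eq)
  have pos: "\<forall>\<^sub>F n in sequentially. 1 / Vc n + (noise_sd (M n) n (ep n) (em n))\<^sup>2 / (Vc n)\<^sup>2 > 0"
    using eventually_ge_at_top[of 3] by eventually_elim (simp add: V_bounds add_pos_nonneg)
  have "\<forall>\<^sub>F n in sequentially. (1 / Vc n + (2 * real n - 1) * noise_var n / (Vc n)\<^sup>2)
      / (1 / Vc n + (noise_sd (M n) n (ep n) (em n))\<^sup>2 / (Vc n)\<^sup>2) = 1"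
    using s pos
  proof eventually_elim
    case (elim n)
    then show ?case unfolding elim(1) by (intro divide_self) linarith
  qed
  then have ratio: "(\<lambda>n. (1 / Vc n + (2 * real n - 1) * noise_var n / (Vc n)\<^sup>2)
      / (1 / Vc n + (noise_sd (M n) n (ep n) (em n))\<^sup>2 / (Vc n)\<^sup>2)) \<longlonglongrightarrow> 1"
    by (rule tendsto_eventually)
  show ?thesis by (rule estimator_asymp_normal[OF idx a0 al _ ratio]) simp_all
qed

end

theorem theorem2:
  fixes M :: "nat \<Rightarrow> 'w measure"
    and Z :: "nat \<Rightarrow> nat \<Rightarrow> nat \<Rightarrow> real^'p"
    and q :: real
    and \<theta> :: "nat \<Rightarrow> nat \<Rightarrow> real" and \<gamma> :: "nat \<Rightarrow> real^'p"
    and eps :: "nat \<Rightarrow> real"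
    and A :: "nat \<Rightarrow> nat \<Rightarrow> nat \<Rightarrow> 'w \<Rightarrow> real"
    and ep em :: "nat \<Rightarrow> nat \<Rightarrow> 'w \<Rightarrow> int"
    and \<eta> :: "nat \<Rightarrow> 'p \<Rightarrow> 'w \<Rightarrow> real"
    and \<theta>h :: "nat \<Rightarrow> 'w \<Rightarrow> nat \<Rightarrow> real" and \<gamma>h :: "nat \<Rightarrow> 'w \<Rightarrow> real^'p"
    and r1 r2 lam :: "nat \<Rightarrow> real"
    and d b :: "nat \<Rightarrow> 'w \<Rightarrow> nat \<Rightarrow> real" and y :: "nat \<Rightarrow> 'w \<Rightarrow> real^'p"
    and H :: "nat \<Rightarrow> 'w \<Rightarrow> (nat \<Rightarrow> real) \<Rightarrow> real^'p \<Rightarrow> real^'p^'p"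
    and V S :: "nat \<Rightarrow> nat \<Rightarrow> nat \<Rightarrow> real"
    and \<rho> w v2n s :: "nat \<Rightarrow> real"
    and X :: "nat \<Rightarrow> 'w \<Rightarrow> real^'k"
    and idx :: "'k::finite \<Rightarrow> nat"
  assumes d_eq: "d = (\<lambda>n. priv_out n (A n) (ep n))"
    and b_eq: "b = (\<lambda>n. priv_in n (A n) (em n))"
    and y_eq: "y = (\<lambda>n. priv_cov n (Z n) (A n) (\<eta> n))"
    and H_eq: "H = (\<lambda>n \<omega>. H_mat n (Z n) (d n \<omega>) (b n \<omega>) (y n \<omega>))"
    and rho_eq: "\<rho> = (\<lambda>n. rho n (\<theta> n) (\<gamma> n) q (r1 n) (r2 n))"
    and w_eq: "w = (\<lambda>n. varpi n CARD('p) q (eps n) (\<rho> n))"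
    and V_eq: "V = (\<lambda>n. V_mat n (Z n) (\<theta> n) (\<gamma> n))"
    and v2n_eq: "v2n = (\<lambda>n. V_corner n (Z n) (\<theta> n) (\<gamma> n))"
    and S_eq: "S = (\<lambda>n. S_mat n (Z n) (\<theta> n) (\<gamma> n))"
    and s_eq: "s = (\<lambda>n. noise_sd (M n) n (ep n) (em n))"
    and X_eq: "X = (\<lambda>n \<omega>. \<chi> i. \<theta>h n \<omega> (idx i) - \<theta> n (idx i))"
    and model: "\<And>n. n \<ge> 2 \<Longrightarrow>
      private_network (M n) n (Z n) q (\<theta> n) (\<gamma> n) (eps n) (A n) (ep n) (em n) (\<eta> n)"
    and estimator: "\<And>n. n \<ge> 2 \<Longrightarrow>
      is_estimator (M n) n (Z n) (d n) (b n) (y n) (\<theta>h n) (\<gamma>h n)"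
    and radii: "\<And>n. r1 n > 0" "\<And>n. r2 n > 0"
    and H_pos_def: "\<forall>\<^sub>F n in sequentially. \<forall>\<omega>\<in>space (M n). \<forall>\<theta>' \<gamma>'. pos_def (H n \<omega> \<theta>' \<gamma>')"
    and lambda: "\<forall>\<^sub>F n in sequentially. \<forall>\<omega>\<in>space (M n). \<forall>\<theta>' \<in> theta_ball n (\<theta> n) (r1 n).
      mat_norm_inf (matrix_inv (H n \<omega> \<theta>' (\<gamma> n))) \<le> lam n / (real n)\<^sup>2"
    and rate1: "(\<lambda>n. eps_tilde (eps n) * exp (6 * \<rho> n)) \<in> o(\<lambda>n. sqrt (real n / ln (real n)))"
    and rate2: "(\<lambda>n. w n * (lam n)\<^sup>2 * exp (9 * \<rho> n)) \<in> o(\<lambda>n. real n / ln (real n))"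
    and rate3: "(\<lambda>n. (eps_tilde (eps n))\<^sup>2 * exp (9 * \<rho> n)
        + (w n)\<^sup>2 * (lam n)\<^sup>2 * q * exp (3 * \<rho> n) * ln (real n))
      \<in> o(\<lambda>n. sqrt (real n) / ln (real n))"
    and idx: "bij_betw idx UNIV {1..CARD('k)}"
  shows "((\<lambda>n. exp (\<rho> n) * sqrt (ln (real n)) / eps n) \<in> o(\<lambda>_. 1) \<longrightarrow>
        asymp_normal M X (\<lambda>_. 0) (\<lambda>n. \<chi> i j. S n (idx i) (idx j)))
    \<and> (\<forall>n\<ge>2. (s n)\<^sup>2
        = 2 * (2 * real n - 1) * exp (- eps n / 2) / (1 - exp (- eps n / 2))\<^sup>2)
    \<and> (\<forall>c. (\<lambda>n. s n / sqrt (v2n n)) \<longlonglongrightarrow> c \<longrightarrow>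
        asymp_normal M X (\<lambda>_. 0)
          (\<lambda>n. \<chi> i j. (if i = j then 1 / V n (idx i) (idx i) else 0)
            + (1 / v2n n + (s n)\<^sup>2 / (v2n n)\<^sup>2)))"
proof -
  interpret N: network_sequence M Z q \<theta> \<gamma> eps A ep em \<eta> \<theta>h \<gamma>h r1 r2 lam \<rho>
  proof (rule network_sequence.intro)
    show "\<rho> n = rho n (\<theta> n) (\<gamma> n) q (r1 n) (r2 n)" for n by (simp add: rho_eq)
  qed (fact model estimator[unfolded d_eq b_eq y_eq] radii H_pos_def[unfolded H_eq d_eq b_eq y_eq]
      lambda[unfolded H_eq d_eq b_eq y_eq] rate3[unfolded w_eq])+
  show ?thesis unfolding V_eq v2n_eq S_eq s_eq X_eq
  proof (intro conjI allI impI)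
    assume "(\<lambda>n. exp (\<rho> n) * sqrt (ln (real n)) / eps n) \<in> o(\<lambda>_. 1)"
    from smalloD_tendsto[OF this]
    show "asymp_normal M (\<lambda>n \<omega>. \<chi> i. \<theta>h n \<omega> (idx i) - \<theta> n (idx i)) (\<lambda>_. 0)
        (\<lambda>n. \<chi> i j. S_mat n (Z n) (\<theta> n) (\<gamma> n) (idx i) (idx j))"
      by (intro N.asymp_normal_vanishing_noise idx) simp
  next
    fix n :: nat assume "2 \<le> n"
    then show "(noise_sd (M n) n (ep n) (em n))\<^sup>2
        = 2 * (2 * real n - 1) * exp (- eps n / 2) / (1 - exp (- eps n / 2))\<^sup>2"
      by (simp add: N.noise_sd_eq N.noise_var_def)
  next
    fix c assume "(\<lambda>n. noise_sd (M n) n (ep n) (em n) / sqrt (V_corner n (Z n) (\<theta> n) (\<gamma> n))) \<longlonglongrightarrow> c"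
    then show "asymp_normal M (\<lambda>n \<omega>. \<chi> i. \<theta>h n \<omega> (idx i) - \<theta> n (idx i)) (\<lambda>_. 0)
        (\<lambda>n. \<chi> i j. (if i = j then 1 / V_mat n (Z n) (\<theta> n) (\<gamma> n) (idx i) (idx i) else 0)
          + (1 / V_corner n (Z n) (\<theta> n) (\<gamma> n)
            + (noise_sd (M n) n (ep n) (em n))\<^sup>2 / (V_corner n (Z n) (\<theta> n) (\<gamma> n))\<^sup>2))"
      by (rule N.asymp_normal_bounded_noise[OF idx])
  qed
qed

end
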